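(* Let $\alpha,\epsilon>0$, $\beta=\alpha\epsilon$, $T>0$, $\Omega=(0,1)^3$, and let $\boldsymbol f:\Omega\to\mathbb{R}^3$ be a given time-independent bounded field. Let $\Phi:\bar\Omega\times[0,T]\to\mathbb{S}^2$ (so $|\Phi|\equiv 1$) be an exact solution of $$\partial_t\Phi=-\alpha\,\Phi\times\big(\Phi\times(\epsilon\Delta\Phi+\boldsymbol f)\big)\ \text{ in }\Omega\times(0,T],\qquad \frac{\partial\Phi}{\partial\nu}\Big|_{\partial\Omega}=0,$$ with the regularity $$\Phi\in C^3([0,T];[C^0(\bar\Omega)]^3)\cap C^2([0,T];[C^2(\bar\Omega)]^3)\cap L^\infty([0,T];[C^4(\bar\Omega)]^3).$$ Let $h=1/N$ be the spatial mesh size, $k>0$ the time step, $t_n=nk$. Given an initial grid function $\boldsymbol m_0$, let $\boldsymbol m_n$ ($n\ge 0$) be the numerical solution generated by the following scheme: for each $n\ge0$, $\tilde{\boldsymbol m}_1=\boldsymbol m_n$ and $$\begin{aligned} \tilde{\boldsymbol m}_2&=\tilde{\boldsymbol m}_1+\tfrac{k}{4}L_h(\tilde{\boldsymbol m}_2),\\ \tilde{\boldsymbol m}_3&=\tilde{\boldsymbol m}_1+\tfrac{k}{2}N_h(\tilde{\boldsymbol m}_2)+\tfrac{k}{4}L_h(\tilde{\boldsymbol m}_3),\\ \tilde{\boldsymbol m}_4&=\tilde{\boldsymbol m}_1+\tfrac{k}{2}\big(N_h(\tilde{\boldsymbol m}_2)+N_h(\tilde{\boldsymbol m}_3)\big)+\tfrac{k}{3}\big(L_h(\tilde{\boldsymbol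 m}_2)+L_h(\tilde{\boldsymbol m}_3)+L_h(\tilde{\boldsymbol m}_4)\big),\\ \boldsymbol m_{n+1}&=\tilde{\boldsymbol m}_1+\tfrac{k}{3}\big(N_h(\tilde{\boldsymbol m}_2)+N_h(\tilde{\boldsymbol m}_3)+N_h(\tilde{\boldsymbol m}_4)\big)+\tfrac{k}{3}\big(L_h(\tilde{\boldsymbol m}_2)+L_h(\tilde{\boldsymbol m}_3)+L_h(\tilde{\boldsymbol m}_4)\big), \end{aligned}$$ where $$L_h(\boldsymbol m)=\beta\Delta_h\boldsymbol m,\qquad N_h(\boldsymbol m)=\beta|\mathcal A_h\nabla_h\boldsymbol m|^2\boldsymbol m-\alpha\,\boldsymbol m\times(\boldsymbol m\times\boldsymbol f).$$ Assume that the initial error satisfies $\|\mathcal P_h\Phi(\cdot,t_0)-\boldsymbol m_0\|_2+\|\nabla_h(\mathcal P_h\Phi(\cdot,t_0)-\boldsymbol m_0)\|_2=\mathcal O(h^2)$, and that $C_1h\le k\le C_2h$ for fixed constants $C_1,C_2>0$. Then there is a constant $\mathcal C>0$, independent of $k$ and $h$, such that, as $k,h\to0^+$ (i.e. for all sufficiently small $k,h$ satisfying $C_1h\le k\le C_2h$), $$\|\mathcal P_h\Phi(\cdot,t_n)-\boldsymbol m_n\|_2\le\mathcal C(k^2+h^2)\qquad\text{for all }1\le n\le\lfloor T/k\rfloor.$$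
   Context: Grid: the grid points are $((i-\tfrac12)h,(j-\tfrac12)h,(\ell-\tfrac12)h)$, $1\le i,j,\ell\le N$, $h=1/N$; grid functions are $\mathbb{R}^3$-valued and are extended to ghost points (index $0$ or $N+1$ in a direction) by the discrete homogeneous Neumann condition $\boldsymbol m_{0,j,\ell}=\boldsymbol m_{1,j,\ell}$, $\boldsymbol m_{N+1,j,\ell}=\boldsymbol m_{N,j,\ell}$, and similarly in the other two directions. All stages $\tilde{\boldsymbol m}_j$ and all $\boldsymbol m_n$ satisfy this condition. $\mathcal P_h$ denotes pointwise restriction to the grid points (extended to ghost points by the same rule). $\Delta_h$ is the standard seven-point second-order centered discrete Laplacian, applied componentwise. $\nabla_h$ is the discrete gradient with one-sided differences, e.g. in the $x$-direction $(\boldsymbol m_{i+1,j,\ell}-\boldsymbol m_{i,j,\ell})/h$, and similarly in $y,z$. $\mathcal A_h\nabla_h$ is the averaged gradient, a second-order approximation of the gradient: each directional difference is averaged with its neighbour in the same direction, so that its $x$-component at $(i,j,\ell)$ is $(\boldsymbol m_{i+1,j,\ell}-\boldsymbol m_{i-1,j,\ell})/(2h)$, and similarly in $y,z$; $|\mathcal A_h\nabla_h\boldsymbol m|^2$ is the sum of squares of all nine entries at each grid point. In $N_h$, $\boldsymbol f$ is evaluated at the grid points. Norm: $\|\boldsymbol g\|_2=\big(h^3\sum|\boldsymbol g_{i,j,\ell}|^2\big)^{1/2}$, the sum being over all grid points $1\le i,j,\ell\le N$ (for $\nabla_h\boldsymbol g$, $|\cdot|$ is the Euclidean norm of all entries).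 *)

theory Defs
  imports "HOL-Analysis.Analysis" "HOL-Library.Landau_Symbols"
begin

section \<open>Function spaces on the unit cube\<close>

definition cube :: "(real^3) set"
  where "cube = box 0 1"

definition partial :: "3 \<Rightarrow> (real^3 \<Rightarrow> real^3) \<Rightarrow> real^3 \<Rightarrow> real^3"
  where "partial d v x = vector_derivative (\<lambda>s. v (x + s *\<^sub>R axis d 1)) (at 0)"

primrec partials :: "3 list \<Rightarrow> (real^3 \<Rightarrow> real^3) \<Rightarrow> real^3 \<Rightarrow> real^3"
  where
    "partials [] v = v"
  | "partials (d # ds) v = partial d (partials ds v)"

text \<open>
  The space \<open>[C\<^sup>r(closure cube)]\<^sup>3\<close>: all iterated partial derivatives of order at most \<open>r\<close>
  exist in the open cube and extend continuously to its closure. Its norm is the maximum of the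
  suprema of these derivatives; taking the suprema over the open cube changes nothing, by
  continuity.
\<close>
definition Cr_closure :: "nat \<Rightarrow> (real^3 \<Rightarrow> real^3) set"
  where "Cr_closure r = {v.
    continuous_on (closure cube) v \<and>
    (\<forall>ds d. length ds < r \<longrightarrow>
      (\<forall>x\<in>cube. (\<lambda>s. partials ds v (x + s *\<^sub>R axis d 1)) differentiable (at 0))) \<and>
    (\<forall>ds. length ds \<le> r \<longrightarrow>
      (\<exists>w. continuous_on (closure cube) w \<and> (\<forall>x\<in>cube. w x = partials ds v x)))}"

definition Cr_norm :: "nat \<Rightarrow> (real^3 \<Rightarrow> real^3) \<Rightarrow> real"
  where "Cr_norm r v = Sup {norm (partials ds v x) |ds x. length ds \<le> r \<and> x \<in> cube}"

text \<open>
  \<open>C\<^sup>q([0,T]; [C\<^sup>r(closure cube)]\<^sup>3)\<close>, with time derivatives taken in the norm of the target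
  space, one-sided at \<open>0\<close> and \<open>T\<close>.
\<close>
primrec Cq_time :: "nat \<Rightarrow> nat \<Rightarrow> real \<Rightarrow> (real \<Rightarrow> real^3 \<Rightarrow> real^3) \<Rightarrow> bool"
  where
    "Cq_time 0 r T u \<longleftrightarrow>
      (\<forall>t\<in>{0..T}. u t \<in> Cr_closure r \<and>
        ((\<lambda>s. Cr_norm r (\<lambda>x. u s x - u t x)) \<longlongrightarrow> 0) (at t within {0..T}))"
  | "Cq_time (Suc q) r T u \<longleftrightarrow>
      (\<forall>t\<in>{0..T}. u t \<in> Cr_closure r) \<and>
      (\<exists>u'. Cq_time q r T u' \<and>
        (\<forall>t\<in>{0..T}.
          ((\<lambda>s. Cr_norm r (\<lambda>x. (u s x - u t x) /\<^sub>R (s - t) - u' t x)) \<longlongrightarrow> 0)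
            (at t within {0..T})))"

text \<open>
  \<open>L\<^sup>\<infinity>([0,T]; [C\<^sup>r(closure cube)]\<^sup>3)\<close>: strongly (Bochner) measurable and essentially bounded.
\<close>
definition Linf_time :: "nat \<Rightarrow> real \<Rightarrow> (real \<Rightarrow> real^3 \<Rightarrow> real^3) \<Rightarrow> bool"
  where "Linf_time r T u \<longleftrightarrow>
    (AE t in lebesgue_on {0..T}. u t \<in> Cr_closure r) \<and>
    (\<exists>S :: nat \<Rightarrow> real \<Rightarrow> real^3 \<Rightarrow> real^3.
      (\<forall>i. simple_function (lebesgue_on {0..T}) (S i) \<and> (\<forall>t\<in>{0..T}. S i t \<in> Cr_closure r)) \<and>
      (AE t in lebesgue_on {0..T}.
        (\<lambda>i. Cr_norm r (\<lambda>x. S i t x - u t x)) \<longlonglongrightarrow> 0)) \<and>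
    (\<exists>K. AE t in lebesgue_on {0..T}. Cr_norm r (u t) \<le> K)"


section \<open>The continuous problem\<close>

definition laplacian :: "(real^3 \<Rightarrow> real^3) \<Rightarrow> real^3 \<Rightarrow> real^3"
  where "laplacian v x = (\<Sum>d\<in>UNIV. partials [d, d] v x)"

text \<open>The outward unit normal exists only in the relative interior of a face.\<close>
definition outward_normal :: "real^3 \<Rightarrow> real^3 \<Rightarrow> bool"
  where "outward_normal x \<nu> \<longleftrightarrow>
    (\<exists>d. (\<forall>e. e \<noteq> d \<longrightarrow> 0 < x $ e \<and> x $ e < 1) \<and>
         (x $ d = 0 \<and> \<nu> = - axis d 1 \<or> x $ d = 1 \<and> \<nu> = axis d 1))"

definition neumann_bc :: "(real^3 \<Rightarrow> real^3) \<Rightarrow> bool"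
  where "neumann_bc v \<longleftrightarrow>
    (\<forall>x \<nu>. outward_normal x \<nu> \<longrightarrow>
      ((\<lambda>s. (v x - v (x - s *\<^sub>R \<nu>)) /\<^sub>R s) \<longlongrightarrow> 0) (at_right 0))"

definition exact_solution ::
  "real \<Rightarrow> real \<Rightarrow> (real^3 \<Rightarrow> real^3) \<Rightarrow> real \<Rightarrow> (real \<Rightarrow> real^3 \<Rightarrow> real^3) \<Rightarrow> bool"
  where "exact_solution \<alpha> \<epsilon> f T \<Phi> \<longleftrightarrow>
    (\<forall>t\<in>{0..T}. \<forall>x\<in>closure cube. norm (\<Phi> t x) = 1) \<and>
    (\<forall>t\<in>{0<..T}. \<forall>x\<in>cube.
      ((\<lambda>s. \<Phi> s x) has_vector_derivative
        - \<alpha> *\<^sub>R cross3 (\<Phi> t x) (cross3 (\<Phi> t x) (\<epsilon> *\<^sub>R laplacian (\<Phi> t) x + f x)))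
        (at t within {0..T})) \<and>
    (\<forall>t\<in>{0<..T}. neumann_bc (\<Phi> t))"


section \<open>Grid functions\<close>

text \<open>
  A grid function is indexed by multi-indices with components in \<open>{0..N+1}\<close>; the components
  \<open>0\<close> and \<open>N+1\<close> are the ghost layers, and values at other indices are never used.
\<close>
type_synonym gridfun = "nat^3 \<Rightarrow> real^3"

definition mesh :: "nat \<Rightarrow> real"
  where "mesh N = 1 / real N"

definition grid :: "nat \<Rightarrow> (nat^3) set"
  where "grid N = {p. \<forall>d. 1 \<le> p $ d \<and> p $ d \<le> N}"

definition grid_point :: "nat \<Rightarrow> nat^3 \<Rightarrow> real^3"
  where "grid_point N p = (\<chi> d. (real (p $ d) - 1/2) * mesh N)"

definition discrete_neumann :: "nat \<Rightarrow> gridfun \<Rightarrow> bool"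
  where "discrete_neumann N g \<longleftrightarrow>
    (\<forall>d p. (\<forall>e. e \<noteq> d \<longrightarrow> 1 \<le> p $ e \<and> p $ e \<le> N) \<longrightarrow>
      (p $ d = 0 \<longrightarrow> g p = g (p + axis d 1)) \<and>
      (p $ d = N + 1 \<longrightarrow> g p = g (p - axis d 1)))"

text \<open>Clamping an index to \<open>{1..N}\<close> realizes the discrete Neumann extension to ghost points.\<close>
definition grid_restrict :: "nat \<Rightarrow> (real^3 \<Rightarrow> real^3) \<Rightarrow> gridfun"
  where "grid_restrict N v p = v (grid_point N (\<chi> d. max 1 (min N (p $ d))))"

definition forward_diff :: "nat \<Rightarrow> 3 \<Rightarrow> gridfun \<Rightarrow> gridfun"
  where "forward_diff N d g p = (g (p + axis d 1) - g p) /\<^sub>R mesh N"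

definition averaged_diff :: "nat \<Rightarrow> 3 \<Rightarrow> gridfun \<Rightarrow> gridfun"
  where "averaged_diff N d g p = (g (p + axis d 1) - g (p - axis d 1)) /\<^sub>R (2 * mesh N)"

definition discrete_laplacian :: "nat \<Rightarrow> gridfun \<Rightarrow> gridfun"
  where "discrete_laplacian N g p =
    (\<Sum>d\<in>UNIV. (g (p + axis d 1) - 2 *\<^sub>R g p + g (p - axis d 1)) /\<^sub>R (mesh N)\<^sup>2)"

definition grid_norm :: "nat \<Rightarrow> gridfun \<Rightarrow> real"
  where "grid_norm N g = sqrt (mesh N ^ 3 * (\<Sum>p\<in>grid N. (norm (g p))\<^sup>2))"

definition grid_grad_norm :: "nat \<Rightarrow> gridfun \<Rightarrow> real"
  where "grid_grad_norm N g =
    sqrt (mesh N ^ 3 * (\<Sum>p\<in>grid N. \<Sum>d\<in>UNIV. (norm (forward_diff N d g p))\<^sup>2))"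


section \<open>The scheme\<close>

definition Lh :: "real \<Rightarrow> nat \<Rightarrow> gridfun \<Rightarrow> gridfun"
  where "Lh \<beta> N g p = \<beta> *\<^sub>R discrete_laplacian N g p"

definition Nh :: "real \<Rightarrow> real \<Rightarrow> (real^3 \<Rightarrow> real^3) \<Rightarrow> nat \<Rightarrow> gridfun \<Rightarrow> gridfun"
  where "Nh \<alpha> \<beta> f N g p =
    (\<beta> * (\<Sum>d\<in>UNIV. (norm (averaged_diff N d g p))\<^sup>2)) *\<^sub>R g p
    - \<alpha> *\<^sub>R cross3 (g p) (cross3 (g p) (f (grid_point N p)))"

definition scheme_step ::
  "real \<Rightarrow> real \<Rightarrow> (real^3 \<Rightarrow> real^3) \<Rightarrow> nat \<Rightarrow> real \<Rightarrow> gridfun \<Rightarrow> gridfun \<Rightarrow> bool"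
  where "scheme_step \<alpha> \<beta> f N k m1 m' \<longleftrightarrow>
    (let L = Lh \<beta> N; R = Nh \<alpha> \<beta> f N in
     \<exists>m2 m3 m4.
      discrete_neumann N m2 \<and> discrete_neumann N m3 \<and> discrete_neumann N m4 \<and>
      (\<forall>p\<in>grid N.
        m2 p = m1 p + (k/4) *\<^sub>R L m2 p \<and>
        m3 p = m1 p + (k/2) *\<^sub>R R m2 p + (k/4) *\<^sub>R L m3 p \<and>
        m4 p = m1 p + (k/2) *\<^sub>R (R m2 p + R m3 p) + (k/3) *\<^sub>R (L m2 p + L m3 p + L m4 p) \<and>
        m' p = m1 p + (k/3) *\<^sub>R (R m2 p + R m3 p + R m4 p)
                    + (k/3) *\<^sub>R (L m2 p + L m3 p + L m4 p)))"

definition numerical_solution ::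
  "real \<Rightarrow> real \<Rightarrow> (real^3 \<Rightarrow> real^3) \<Rightarrow> nat \<Rightarrow> real \<Rightarrow> (nat \<Rightarrow> gridfun) \<Rightarrow> bool"
  where "numerical_solution \<alpha> \<beta> f N k m \<longleftrightarrow>
    (\<forall>n. discrete_neumann N (m n) \<and> scheme_step \<alpha> \<beta> f N k (m n) (m (Suc n)))"

text \<open>
  The limit \<open>h = 1/N \<rightarrow> 0\<^sup>+\<close>, \<open>k \<rightarrow> 0\<^sup>+\<close> subject to \<open>C\<^sub>1 h \<le> k \<le> C\<^sub>2 h\<close>, as a filter on pairs \<open>(N, k)\<close>.
\<close>
definition refinement :: "real \<Rightarrow> real \<Rightarrow> (nat \<times> real) filter"
  where "refinement C1 C2 =
    inf (at_top \<times>\<^sub>F at_right 0) (principal {(N, k). C1 * mesh N \<le> k \<and> k \<le> C2 * mesh N})"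

end

(*
  Even reflection turns the Neumann grid into a discrete torus, on which the scheme becomes an
  implicit-explicit Runge-Kutta method whose linear part Z commutes with the difference operators.

  Inserting the exact solution F itself into the stages gives residuals that are only of second
  order in k. Instead the numerical solution is compared with a modified reference
  Y = F + (k/4) (N(F1) - N(F)) + W, where F1 is F at the next time level and W is a resolvent applied
  to small increments. It differs from F by O(k^2), its stages 2 and 3 are defined by the scheme, and
  the residuals of the remaining two equations are O(k^3) in the discrete H^-1 norm.

  The stage errors satisfy an energy estimate in which the implicit part dissipates the H^1 norm.
  The nonlinearity loses one derivative; the loss is absorbed by that dissipation as long as
  h^(-3/2) (|e| + k^(5/2)) is small, since the inverse inequality then controls the quadratic terms.
  This smallness follows by induction from |e| = O(k^2) because h and k are comparable, and the
  discrete Gronwall inequality closes the induction.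

  Consistency in space is needed only in H^-1, so four derivatives in space suffice: at the
  boundary the second difference is first-order accurate, but its error is a divergence of a
  second-order flux error. The L^infinity regularity gives these bounds for almost every time;
  they extend to all times because both sides are continuous in time for a fixed grid.
*)
theory Submission
  imports Defs
begin

section \<open>Finite difference calculus on a periodic lattice\<close>

text \<open>The obstacle is stiffness: k is comparable to h, so \<open>Z\<close> has norm of order
  1/k and the stage equations cannot be expanded in powers of it. Only resolvents are used, through
  Z J = (J - 1)/a; this is why W contains one. Its shape follows from requiring that the
  second-order part of the fourth-stage residual vanish once the Crank-Nicolson identity for F is
  inserted; the operator found there is 3 - Z/4 = 3 (1 - Z/12). The weight k/4 in Y is what the last
  update produces: stages 2 and 3 have mean time t + k/4, and 1/3 - 1/12 = 1/4. Each of these two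
  stages is wrong by O(k) and only their sum is accurate, so the nonlinearity is linearised at F
  before the stages are added. Residuals are paired with the error in H^-1, since the derivative of
  the nonlinearity maps L2 only to H^-1. The last update has no implicit solve, so the square of its
  L2 norm enters too; a loss of sqrt k is affordable there, because k^6/k = k^5 is what one step may
  add.\<close>

lemma norm_cross3_le: "norm (cross3 x y) \<le> norm x * norm (y :: real^3)"
proof -
  have "(norm (cross3 x y))\<^sup>2 \<le> (norm x * norm y)\<^sup>2"
    unfolding norm_cross_dot[of x y, symmetric] by simp
  then show ?thesis
    by (rule power2_le_imp_le) simp
qed

lemma sum_UNIV_3_double: "(\<Sum>d\<in>(UNIV::3 set). x + x) = 6 *\<^sub>R (x :: real^3)"
  by (simp add: sum_3 vec_eq_iff)

text \<open>An abstract discrete torus: in each direction \<open>sh\<close> and \<open>sb\<close>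
  are mutually inverse shifts, the shifts of different directions commute, and points outside
  \<open>B\<close> are fixed. Every difference therefore vanishes off \<open>B\<close>, and
  functions on the whole type need no side conditions. The 8 in \<open>vol\<close> is the volume of
  the torus of side 2 that arises from the unit cube by reflection.\<close>

locale lattice =
  fixes B :: "'a set" and sh sb :: "3 \<Rightarrow> 'a \<Rightarrow> 'a"
    and h k \<alpha> \<beta> :: real and f :: "'a \<Rightarrow> real^3"
  assumes finB: "finite B"
    and sh_sb [simp]: "sh d (sb d p) = p" and sb_sh [simp]: "sb d (sh d p) = p"
    and sh_comm: "sh d (sh e p) = sh e (sh d p)"
    and sh_B [simp]: "sh d p \<in> B \<longleftrightarrow> p \<in> B"
    and sh_out: "p \<notin> B \<Longrightarrow> sh d p = p"
    and vol: "h ^ 3 * real (card B) \<le> 8"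
    and h_pos: "h > 0" and k_pos: "k > 0" and \<alpha>_pos: "\<alpha> > 0" and \<beta>_pos: "\<beta> > 0"
begin

lemma sb_B [simp]: "sb d p \<in> B \<longleftrightarrow> p \<in> B"
  by (metis sh_B sh_sb)

lemma sb_out: "p \<notin> B \<Longrightarrow> sb d p = p"
  by (metis sb_sh sh_out)

lemma sb_sh_comm: "sb d (sh e p) = sh e (sb d p)"
  by (metis sb_sh sh_comm sh_sb)

section \<open>Difference operators, nonlinearity and inner products\<close>

definition Dp :: "3 \<Rightarrow> ('a \<Rightarrow> real^3) \<Rightarrow> 'a \<Rightarrow> real^3"
  where "Dp d u p = (u (sh d p) - u p) /\<^sub>R h"

definition Ac :: "3 \<Rightarrow> ('a \<Rightarrow> real^3) \<Rightarrow> 'a \<Rightarrow> real^3"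
  where "Ac d u p = (u (sh d p) - u (sb d p)) /\<^sub>R (2 * h)"

definition Sd :: "3 \<Rightarrow> ('a \<Rightarrow> real^3) \<Rightarrow> 'a \<Rightarrow> real^3"
  where "Sd d u p = (u (sh d p) - 2 *\<^sub>R u p + u (sb d p)) /\<^sub>R h\<^sup>2"

text \<open>The time step is included, so that this is k \<beta> times the discrete Laplacian and
  resolvents carry plain numerical parameters such as 1/4.\<close>

definition Z :: "('a \<Rightarrow> real^3) \<Rightarrow> 'a \<Rightarrow> real^3"
  where "Z u p = (k * \<beta>) *\<^sub>R (\<Sum>d\<in>UNIV. Sd d u p)"

definition NL :: "('a \<Rightarrow> real^3) \<Rightarrow> 'a \<Rightarrow> real^3"
  where "NL u p = (\<beta> * (\<Sum>d\<in>UNIV. (norm (Ac d u p))\<^sup>2)) *\<^sub>R u p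
    - \<alpha> *\<^sub>R cross3 (u p) (cross3 (u p) (f p))"

definition ip :: "('a \<Rightarrow> real^3) \<Rightarrow> ('a \<Rightarrow> real^3) \<Rightarrow> real"
  where "ip u v = h ^ 3 * (\<Sum>p\<in>B. u p \<bullet> v p)"

definition nrm :: "('a \<Rightarrow> real^3) \<Rightarrow> real"
  where "nrm u = sqrt (ip u u)"

definition dip :: "('a \<Rightarrow> real^3) \<Rightarrow> ('a \<Rightarrow> real^3) \<Rightarrow> real"
  where "dip u v = (\<Sum>d\<in>UNIV. ip (Dp d u) (Dp d v))"

definition gn :: "('a \<Rightarrow> real^3) \<Rightarrow> real"
  where "gn u = sqrt (dip u u)"

text \<open>The resolvent (1 - a Z)^(-1). That it exists and is unique for a \<ge> 0 is shown by
  \<open>resolvent_exists\<close> and \<open>J_unique\<close>.\<close>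

definition J :: "real \<Rightarrow> ('a \<Rightarrow> real^3) \<Rightarrow> 'a \<Rightarrow> real^3"
  where "J a u = (SOME v. \<forall>p. v p = u p + a *\<^sub>R Z v p)"

lemma Dp_add: "Dp d (\<lambda>p. u p + v p) p = Dp d u p + Dp d v p"
  and Dp_diff: "Dp d (\<lambda>p. u p - v p) p = Dp d u p - Dp d v p"
  and Dp_scale: "Dp d (\<lambda>p. a *\<^sub>R u p) p = a *\<^sub>R Dp d u p"
  by (simp_all add: Dp_def algebra_simps)

lemma Ac_add: "Ac d (\<lambda>p. u p + v p) p = Ac d u p + Ac d v p"
  and Ac_diff: "Ac d (\<lambda>p. u p - v p) p = Ac d u p - Ac d v p"
  and Ac_scale: "Ac d (\<lambda>p. a *\<^sub>R u p) p = a *\<^sub>R Ac d u p"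
  by (simp_all add: Ac_def algebra_simps)

lemma Ac_Dp: "Ac d u p = (1/2) *\<^sub>R (Dp d u p + Dp d u (sb d p))"
  using h_pos by (simp add: Ac_def Dp_def algebra_simps)

lemma Sd_Dp: "Sd d u p = (Dp d u p - Dp d u (sb d p)) /\<^sub>R h"
  by (simp add: Sd_def Dp_def algebra_simps power2_eq_square scaleR_2)

lemma Z_add: "Z (\<lambda>p. u p + v p) p = Z u p + Z v p"
  by (simp add: Z_def Sd_def algebra_simps scaleR_2 sum.distrib sum_subtractf)

lemma Z_scale: "Z (\<lambda>p. a *\<^sub>R u p) p = a *\<^sub>R Z u p"
proof -
  have "Sd d (\<lambda>p. a *\<^sub>R u p) p = a *\<^sub>R Sd d u p" for d
    by (simp add: Sd_def algebra_simps)
  then show ?thesis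
    by (simp add: Z_def scaleR_sum_right mult.commute mult.left_commute)
qed

lemma Z_diff: "Z (\<lambda>p. u p - v p) p = Z u p - Z v p"
  using Z_add[of u "\<lambda>p. (-1) *\<^sub>R v p" p] Z_scale[of "-1" v p] by simp

lemmas Z_lin = Z_add Z_diff Z_scale

section \<open>Existence, uniqueness and contraction of the resolvent\<close>

lemma Z_expand:
  "a *\<^sub>R Z v p = (a * k * \<beta> / h\<^sup>2) *\<^sub>R (\<Sum>d\<in>UNIV. v (sh d p) + v (sb d p))
    - (6 * (a * k * \<beta> / h\<^sup>2)) *\<^sub>R v p"
proof -
  have "(\<Sum>d\<in>UNIV. Sd d v p) = (1/h\<^sup>2) *\<^sub>R (\<Sum>d\<in>(UNIV::3 set). (v (sh d p) + v (sb d p)) - 2 *\<^sub>R v p)"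
    unfolding scaleR_sum_right Sd_def by (intro sum.cong refl) (simp add: algebra_simps divide_inverse)
  also have "\<dots> = (1/h\<^sup>2) *\<^sub>R ((\<Sum>d\<in>UNIV. v (sh d p) + v (sb d p)) - 6 *\<^sub>R v p)"
    by (subst sum_subtractf) (simp add: sum_constant_scaleR)
  finally have "a *\<^sub>R Z v p = (a * k * \<beta>) *\<^sub>R ((1/h\<^sup>2) *\<^sub>R ((\<Sum>d\<in>UNIV. v (sh d p) + v (sb d p)) - 6 *\<^sub>R v p))"
    by (simp only: Z_def scaleR_scaleR mult.assoc)
  then show ?thesis
    by (simp add: scaleR_diff_right)
qed

text \<open>At a point of \<open>B\<close> where |v| is maximal, (1 + 6s) v is u plus s times six
  neighbour values of no larger norm, so the neighbours cancel against 6s |v|. Off \<open>B\<close>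
  the operator \<open>Z\<close> vanishes and v = u.\<close>

lemma max_principle:
  assumes a: "a \<ge> 0" and eq: "\<And>p. v p = u p + a *\<^sub>R Z v p" and u: "\<And>p. norm (u p) \<le> K"
  shows "norm (v p) \<le> K"
proof (cases "p \<in> B")
  case False
  then have "a *\<^sub>R Z v p = 0"
    unfolding Z_expand sh_out[OF False] sb_out[OF False] sum_UNIV_3_double by simp
  then have "v p = u p"
    using eq[of p] by (metis add.right_neutral)
  then show ?thesis using u[of p] by simp
next
  case True
  define s where "s = a * k * \<beta> / h\<^sup>2"
  have s: "s \<ge> 0" using a k_pos \<beta>_pos by (simp add: s_def)
  obtain q where q: "q \<in> B" "\<And>p. p \<in> B \<Longrightarrow> norm (v p) \<le> norm (v q)"
  proof -
    let ?m = "Max ((\<lambda>p. norm (v p)) ` B)"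
    have "?m \<in> (\<lambda>p. norm (v p)) ` B"
      using True finB by (intro Max_in) auto
    then obtain q where "q \<in> B" "?m = norm (v q)" by auto
    then show ?thesis
      using that finB by (metis Max_ge finite_imageI imageI)
  qed
  have "(1 + 6 * s) *\<^sub>R v q = u q + s *\<^sub>R (\<Sum>d\<in>UNIV. v (sh d q) + v (sb d q))"
  proof -
    have *: "(1 + c) *\<^sub>R x = y + w" if "x = y + (w - c *\<^sub>R x)" for x y w :: "real^3" and c
      using arg_cong[OF that, of "\<lambda>z. z + c *\<^sub>R x"] by (simp add: scaleR_left_distrib)
    show ?thesis
      using eq[of q] unfolding Z_expand s_def[symmetric] by (rule *)
  qed
  then have "norm ((1 + 6 * s) *\<^sub>R v q) \<le> norm (u q) + s * norm (\<Sum>d\<in>UNIV. v (sh d q) + v (sb d q))"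
    using norm_triangle_ineq[of "u q" "s *\<^sub>R (\<Sum>d\<in>UNIV. v (sh d q) + v (sb d q))"] s by simp
  also have "norm (\<Sum>d\<in>UNIV. v (sh d q) + v (sb d q)) \<le> (\<Sum>d\<in>(UNIV::3 set). 2 * norm (v q))"
  proof (intro sum_norm_le)
    show "norm (v (sh d q) + v (sb d q)) \<le> 2 * norm (v q)" for d
      using norm_triangle_ineq[of "v (sh d q)" "v (sb d q)"] q(2)[of "sh d q"] q(2)[of "sb d q"] q(1)
      by simp
  qed
  finally have "(1 + 6 * s) * norm (v q) \<le> norm (u q) + s * (6 * norm (v q))"
    using s by (simp add: mult_left_mono)
  then have "norm (v q) \<le> norm (u q)"
    by (simp add: algebra_simps)
  then show ?thesis using q(2)[OF True] u[of q] by simp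
qed

text \<open>Jacobi iteration: \<open>S\<close> contracts the sup norm by 6s/(1 + 6s) < 1. Although
  functions live on the whole type, the first increment is bounded, because it vanishes off the
  finite set \<open>B\<close>; the iterates then converge pointwise by comparison with a geometric
  series.\<close>

lemma resolvent_exists:
  assumes a: "a \<ge> 0"
  shows "\<exists>v. \<forall>p. v p = u p + a *\<^sub>R Z v p"
proof -
  define s where "s = a * k * \<beta> / h\<^sup>2"
  have s: "s \<ge> 0" using a k_pos \<beta>_pos by (simp add: s_def)
  define S where "S v p = (u p + s *\<^sub>R (\<Sum>d\<in>UNIV. v (sh d p) + v (sb d p))) /\<^sub>R (1 + 6 * s)" for v p
  define \<theta> where "\<theta> = 6 * s / (1 + 6 * s)"
  have \<theta>: "0 \<le> \<theta>" "\<theta> < 1" using s by (auto simp: \<theta>_def)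
  define w where "w n = (S ^^ n) u" for n
  have contr: "norm (S v p - S v' p) \<le> \<theta> * C" if "\<And>p. norm (v p - v' p) \<le> C" for v v' p C
  proof -
    have *: "(x + s *\<^sub>R y) /\<^sub>R c - (x + s *\<^sub>R y') /\<^sub>R c = (s / c) *\<^sub>R (y - y')" for x y y' :: "real^3" and c
      by (simp add: scaleR_right_distrib scaleR_right_diff_distrib divide_inverse mult.commute)
    have "S v p - S v' p = (s / (1 + 6 * s)) *\<^sub>R ((\<Sum>d\<in>UNIV. v (sh d p) + v (sb d p)) - (\<Sum>d\<in>UNIV. v' (sh d p) + v' (sb d p)))"
      unfolding S_def by (rule *)
    also have "(\<Sum>d\<in>UNIV. v (sh d p) + v (sb d p)) - (\<Sum>d\<in>UNIV. v' (sh d p) + v' (sb d p))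
        = (\<Sum>d\<in>UNIV. (v (sh d p) - v' (sh d p)) + (v (sb d p) - v' (sb d p)))"
      unfolding sum_subtractf[symmetric] by (intro sum.cong refl) simp
    finally have "S v p - S v' p = (s / (1 + 6 * s)) *\<^sub>R (\<Sum>d\<in>UNIV. (v (sh d p) - v' (sh d p)) + (v (sb d p) - v' (sb d p)))" .
    then have "norm (S v p - S v' p) = (s / (1 + 6 * s)) * norm (\<Sum>d\<in>UNIV. (v (sh d p) - v' (sh d p)) + (v (sb d p) - v' (sb d p)))"
      using s by simp
    also have "\<dots> \<le> (s / (1 + 6 * s)) * (\<Sum>d\<in>(UNIV::3 set). 2 * C)"
    proof (intro mult_left_mono sum_norm_le)
      show "norm (v (sh d p) - v' (sh d p) + (v (sb d p) - v' (sb d p))) \<le> 2 * C" for d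
        using norm_triangle_ineq[of "v (sh d p) - v' (sh d p)" "v (sb d p) - v' (sb d p)"]
          that[of "sh d p"] that[of "sb d p"] by linarith
    qed (use s in simp)
    also have "\<dots> = \<theta> * C" by (simp add: \<theta>_def)
    finally show ?thesis .
  qed
  define C where "C = (\<Sum>p\<in>B. norm (S u p - u p))"
  have C0: "norm (S u p - u p) \<le> C" for p
  proof (cases "p \<in> B")
    case True
    then show ?thesis unfolding C_def using finB by (intro member_le_sum) auto
  next
    case False
    have "S u p = (u p + s *\<^sub>R (6 *\<^sub>R u p)) /\<^sub>R (1 + 6 * s)"
      unfolding S_def sh_out[OF False] sb_out[OF False] sum_UNIV_3_double ..
    also have "u p + s *\<^sub>R (6 *\<^sub>R u p) = (1 + 6 * s) *\<^sub>R u p"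
      by (simp add: scaleR_left_distrib mult.commute)
    finally have "S u p = ((1 + 6 * s) *\<^sub>R u p) /\<^sub>R (1 + 6 * s)" .
    also have "\<dots> = u p" using s by simp
    finally show ?thesis unfolding C_def by (simp add: sum_nonneg)
  qed
  have step: "norm (w (Suc n) p - w n p) \<le> \<theta> ^ n * C" for n p
  proof (induction n arbitrary: p)
    case 0
    then show ?case using C0 by (simp add: w_def)
  next
    case (Suc n)
    then show ?case
      using contr[of "w (Suc n)" "w n" "\<theta> ^ n * C" p] by (simp add: w_def mult.assoc)
  qed
  have "\<exists>l. (\<lambda>n. w n p) \<longlonglongrightarrow> l" for p
  proof -
    have "summable (\<lambda>n. w (Suc n) p - w n p)"
    proof (rule summable_norm_cancel, rule summable_comparison_test'[of _ 0])
      show "summable (\<lambda>n. \<theta> ^ n * C)"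
        using \<theta> by (intro summable_mult2 summable_geometric) simp
      show "norm (norm (w (Suc n) p - w n p)) \<le> \<theta> ^ n * C" for n
        using step by simp
    qed
    then have "convergent (\<lambda>n. \<Sum>i<n. w (Suc i) p - w i p)"
      by (simp only: summable_iff_convergent)
    moreover have "(\<lambda>n. \<Sum>i<n. w (Suc i) p - w i p) = (\<lambda>n. w n p - w 0 p)"
      using sum_lessThan_telescope[of "\<lambda>n. w n p"] by auto
    ultimately obtain l where "(\<lambda>n. w n p - w 0 p) \<longlonglongrightarrow> l"
      unfolding convergent_def by auto
    from tendsto_add[OF this tendsto_const[of "w 0 p"]] show ?thesis
      by auto
  qed
  then obtain v where v: "\<And>p. (\<lambda>n. w n p) \<longlonglongrightarrow> v p"
    using choice[of "\<lambda>p l. (\<lambda>n. w n p) \<longlonglongrightarrow> l"] by blast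
  have "v p = S v p" for p
  proof (rule LIMSEQ_unique)
    show "(\<lambda>n. w (Suc n) p) \<longlonglongrightarrow> v p" by (rule LIMSEQ_Suc[OF v])
    show "(\<lambda>n. w (Suc n) p) \<longlonglongrightarrow> S v p"
    proof -
      have "w (Suc n) p = (u p + s *\<^sub>R (\<Sum>d\<in>UNIV. w n (sh d p) + w n (sb d p))) /\<^sub>R (1 + 6 * s)" for n
        unfolding S_def[symmetric] by (simp add: w_def)
      moreover have "(\<lambda>n. (u p + s *\<^sub>R (\<Sum>d\<in>UNIV. w n (sh d p) + w n (sb d p))) /\<^sub>R (1 + 6 * s)) \<longlonglongrightarrow> S v p"
        unfolding S_def by (intro tendsto_intros v)
      ultimately show ?thesis by simp
    qed
  qed
  then have "(1 + 6 * s) *\<^sub>R v p = u p + s *\<^sub>R (\<Sum>d\<in>UNIV. v (sh d p) + v (sb d p))" for p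
  proof -
    have *: "c *\<^sub>R x = y" if "x = y /\<^sub>R c" "c \<noteq> 0" for x y :: "real^3" and c
      using that by simp
    show ?thesis
      using \<open>v p = S v p\<close>[unfolded S_def] s by (intro *) auto
  qed
  then have "v p = u p + a *\<^sub>R Z v p" for p
  proof -
    have *: "x = y + (w - c *\<^sub>R x)" if "(1 + c) *\<^sub>R x = y + w" for x y w :: "real^3" and c
      using that by (simp add: scaleR_left_distrib eq_diff_eq add_diff_eq)
    assume "\<And>p. (1 + 6 * s) *\<^sub>R v p = u p + s *\<^sub>R (\<Sum>d\<in>UNIV. v (sh d p) + v (sb d p))"
    then show ?thesis
      unfolding Z_expand s_def[symmetric] by (rule *)
  qed
  then show ?thesis by blast
qed

lemma J_eq: "a \<ge> 0 \<Longrightarrow> J a u p = u p + a *\<^sub>R Z (J a u) p"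
  using someI_ex[OF resolvent_exists[of a u]] unfolding J_def by blast

lemma J_unique:
  assumes "a \<ge> 0" and eq: "\<And>p. v p = u p + a *\<^sub>R Z v p"
  shows "J a u = v"
proof
  fix p
  have "norm (J a u p - v p) \<le> 0"
  proof (rule max_principle[of a "\<lambda>p. J a u p - v p" "\<lambda>p. 0"])
    show "J a u p - v p = 0 + a *\<^sub>R Z (\<lambda>p. J a u p - v p) p" for p
      using eq[of p] J_eq[of a u p] assms(1) by (simp add: Z_diff algebra_simps)
  qed (use assms in auto)
  then show "J a u p = v p" by simp
qed

lemma norm_J_le: "a \<ge> 0 \<Longrightarrow> (\<And>p. norm (u p) \<le> K) \<Longrightarrow> norm (J a u p) \<le> K"
  using max_principle[of a "J a u" u K] J_eq[of a u] by blast

lemma J_add: "a \<ge> 0 \<Longrightarrow> J a (\<lambda>p. u p + v p) = (\<lambda>p. J a u p + J a v p)"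
proof (rule J_unique)
  show "a \<ge> 0 \<Longrightarrow> J a u p + J a v p = u p + v p + a *\<^sub>R Z (\<lambda>p. J a u p + J a v p) p" for p
    using J_eq[of a u p] J_eq[of a v p] by (simp add: Z_add algebra_simps)
qed

lemma J_diff: "a \<ge> 0 \<Longrightarrow> J a (\<lambda>p. u p - v p) = (\<lambda>p. J a u p - J a v p)"
proof (rule J_unique)
  show "a \<ge> 0 \<Longrightarrow> J a u p - J a v p = u p - v p + a *\<^sub>R Z (\<lambda>p. J a u p - J a v p) p" for p
    using J_eq[of a u p] J_eq[of a v p] by (simp add: Z_diff algebra_simps)
qed

lemma J_scale: "a \<ge> 0 \<Longrightarrow> J a (\<lambda>p. b *\<^sub>R u p) = (\<lambda>p. b *\<^sub>R J a u p)"
proof (rule J_unique)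
  show "a \<ge> 0 \<Longrightarrow> b *\<^sub>R J a u p = b *\<^sub>R u p + a *\<^sub>R Z (\<lambda>p. b *\<^sub>R J a u p) p" for p
    using J_eq[of a u p] by (simp add: Z_scale algebra_simps)
qed

lemmas J_lin = J_add J_diff J_scale

lemma Z_sh: "Z (\<lambda>p. u (sh d p)) p = Z u (sh d p)"
  unfolding Z_def Sd_def by (simp add: sb_sh_comm sh_comm[of _ d])

lemma J_sh: "a \<ge> 0 \<Longrightarrow> J a (\<lambda>p. u (sh d p)) = (\<lambda>p. J a u (sh d p))"
proof (rule J_unique)
  show "a \<ge> 0 \<Longrightarrow> J a u (sh d p) = u (sh d p) + a *\<^sub>R Z (\<lambda>p. J a u (sh d p)) p" for p
    using J_eq[of a u "sh d p"] by (simp add: Z_sh)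
qed

lemma Dp_J: "a \<ge> 0 \<Longrightarrow> Dp d (J a u) = J a (Dp d u)"
proof -
  assume a: "a \<ge> 0"
  have "Dp d u = (\<lambda>p. (1/h) *\<^sub>R (u (sh d p) - u p))" for u
    by (auto simp: Dp_def divide_inverse)
  then show ?thesis by (simp add: J_lin a J_sh)
qed

lemma Z_J: "a \<ge> 0 \<Longrightarrow> Z (J a u) = J a (Z u)"
proof (rule J_unique[symmetric])
  fix p assume a: "a \<ge> 0"
  have "J a u = (\<lambda>p. u p + a *\<^sub>R Z (J a u) p)" using J_eq[OF a] by blast
  then have "Z (J a u) p = Z (\<lambda>p. u p + a *\<^sub>R Z (J a u) p) p" by simp
  then show "Z (J a u) p = Z u p + a *\<^sub>R Z (Z (J a u)) p" by (simp add: Z_lin)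
qed

lemma J_cancel: "a \<ge> 0 \<Longrightarrow> J a (\<lambda>p. u p - a *\<^sub>R Z u p) = u"
  by (rule J_unique) auto

text \<open>The inverse inequality in the sup norm: a difference quotient costs 1/h.\<close>

lemma norm_Dp_le: "(\<And>p. norm (u p) \<le> K) \<Longrightarrow> norm (Dp d u p) \<le> 2 * K / h"
proof -
  assume u: "\<And>p. norm (u p) \<le> K"
  have "norm (u (sh d p) - u p) \<le> 2 * K"
    using norm_triangle_ineq4[of "u (sh d p)" "u p"] u[of p] u[of "sh d p"] by linarith
  then show ?thesis using h_pos by (simp add: Dp_def divide_inverse mult.commute)
qed

lemma norm_Ac_le: "(\<And>p. norm (Dp d u p) \<le> K) \<Longrightarrow> norm (Ac d u p) \<le> K"
proof -
  assume u: "\<And>p. norm (Dp d u p) \<le> K"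
  have "norm (Dp d u p + Dp d u (sb d p)) \<le> 2 * K"
    using norm_triangle_ineq[of "Dp d u p" "Dp d u (sb d p)"] u[of p] u[of "sb d p"] by linarith
  then show ?thesis by (simp add: Ac_Dp)
qed

section \<open>Summation by parts, Cauchy-Schwarz and energy identities\<close>

lemma sum_sh: "(\<Sum>p\<in>B. g (sh d p)) = (\<Sum>p\<in>B. g p)"
proof -
  have "bij_betw (sh d) B B"
    by (rule bij_betwI[where g = "sb d"]) auto
  then show ?thesis by (rule sum.reindex_bij_betw)
qed

lemma sum_sb: "(\<Sum>p\<in>B. g (sb d p)) = (\<Sum>p\<in>B. g p)"
  using sum_sh[of "\<lambda>p. g (sb d p)" d] by simp

lemma ip_commute: "ip u v = ip v u"
  by (simp add: ip_def inner_commute)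

lemma ip_add_left: "ip (\<lambda>p. u p + v p) w = ip u w + ip v w"
  and ip_diff_left: "ip (\<lambda>p. u p - v p) w = ip u w - ip v w"
  and ip_scale_left: "ip (\<lambda>p. a *\<^sub>R u p) w = a * ip u w"
  and ip_add_right: "ip w (\<lambda>p. u p + v p) = ip w u + ip w v"
  and ip_diff_right: "ip w (\<lambda>p. u p - v p) = ip w u - ip w v"
  and ip_scale_right: "ip w (\<lambda>p. a *\<^sub>R u p) = a * ip w u"
  by (simp_all add: ip_def inner_simps sum.distrib sum_subtractf sum_distrib_left algebra_simps)

lemmas ip_lin = ip_add_left ip_diff_left ip_scale_left ip_add_right ip_diff_right ip_scale_right

lemma ip_nonneg: "ip u u \<ge> 0"
  using h_pos by (auto simp: ip_def intro!: mult_nonneg_nonneg sum_nonneg)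

lemma nrm_nonneg [simp]: "nrm u \<ge> 0"
  by (simp add: nrm_def ip_nonneg)

lemma nrm_sq: "(nrm u)\<^sup>2 = ip u u"
  by (simp add: nrm_def ip_nonneg)

lemma nrm_sq_sum: "(nrm u)\<^sup>2 = h ^ 3 * (\<Sum>p\<in>B. (norm (u p))\<^sup>2)"
  by (simp add: nrm_sq ip_def power2_norm_eq_inner)

lemma dip_nonneg: "dip u u \<ge> 0"
  by (auto simp: dip_def intro!: sum_nonneg ip_nonneg)

lemma gn_nonneg [simp]: "gn u \<ge> 0"
  by (simp add: gn_def dip_nonneg)

lemma gn_sq: "(gn u)\<^sup>2 = dip u u"
  by (simp add: gn_def dip_nonneg)

lemma dip_commute: "dip u v = dip v u"
  by (simp add: dip_def ip_commute)

lemma Dp_fun: "Dp d (\<lambda>p. u p + v p) = (\<lambda>p. Dp d u p + Dp d v p)"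
   "Dp d (\<lambda>p. u p - v p) = (\<lambda>p. Dp d u p - Dp d v p)"
   "Dp d (\<lambda>p. a *\<^sub>R u p) = (\<lambda>p. a *\<^sub>R Dp d u p)"
  by (auto simp: Dp_add Dp_diff Dp_scale)

lemma dip_lin: "dip (\<lambda>p. u p + v p) w = dip u w + dip v w"
  "dip (\<lambda>p. u p - v p) w = dip u w - dip v w"
  "dip (\<lambda>p. a *\<^sub>R u p) w = a * dip u w"
  "dip w (\<lambda>p. u p + v p) = dip w u + dip w v"
  "dip w (\<lambda>p. u p - v p) = dip w u - dip w v"
  "dip w (\<lambda>p. a *\<^sub>R u p) = a * dip w u"
  by (simp_all add: dip_def Dp_fun ip_lin sum.distrib sum_subtractf sum_distrib_left)

text \<open>The case c = 0 needs its own argument because \<open>ip\<close> and \<open>dip\<close>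
  are only semidefinite: functions vanishing on \<open>B\<close>, and constants in the case of
  \<open>dip\<close>, are null vectors.\<close>

lemma quadratic_nonneg_CS:
  fixes a b c :: real
  assumes "\<And>t. a + 2 * t * b + t\<^sup>2 * c \<ge> 0" "a \<ge> 0" "c \<ge> 0"
  shows "\<bar>b\<bar> \<le> sqrt a * sqrt c"
proof (cases "c = 0")
  case True
  have "b = 0"
  proof (rule ccontr)
    assume "b \<noteq> 0"
    then show False using assms(1)[of "-(a + 1) / (2 * b)"] True by (simp add: field_simps)
  qed
  then show ?thesis using True by simp
next
  case False
  have "a + 2 * (-b / c) * b + (-b / c)\<^sup>2 * c \<ge> 0" by (rule assms)
  then have "b\<^sup>2 \<le> a * c" using False assms(3) by (simp add: field_simps power2_eq_square)
  then show ?thesis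
    by (metis abs_le_square_iff abs_of_nonneg assms(2,3) mult_nonneg_nonneg real_sqrt_ge_0_iff real_sqrt_le_mono real_sqrt_mult real_sqrt_abs)
qed

lemma ip_CS: "\<bar>ip u v\<bar> \<le> nrm u * nrm v"
proof -
  have "ip u u + 2 * t * ip u v + t\<^sup>2 * ip v v \<ge> 0" for t
    using ip_nonneg[of "\<lambda>p. u p + t *\<^sub>R v p"]
    by (simp add: ip_lin ip_commute[of v u] power2_eq_square algebra_simps)
  then show ?thesis unfolding nrm_def by (intro quadratic_nonneg_CS ip_nonneg) auto
qed

lemma dip_CS: "\<bar>dip u v\<bar> \<le> gn u * gn v"
proof -
  have "dip u u + 2 * t * dip u v + t\<^sup>2 * dip v v \<ge> 0" for t
    using dip_nonneg[of "\<lambda>p. u p + t *\<^sub>R v p"]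
    by (simp add: dip_lin dip_commute[of v u] power2_eq_square algebra_simps)
  then show ?thesis unfolding gn_def by (intro quadratic_nonneg_CS dip_nonneg) auto
qed

lemma nrm_add: "nrm (\<lambda>p. u p + v p) \<le> nrm u + nrm v"
proof -
  have "(nrm (\<lambda>p. u p + v p))\<^sup>2 = (nrm u)\<^sup>2 + 2 * ip u v + (nrm v)\<^sup>2"
    by (simp add: nrm_sq ip_lin ip_commute[of v u])
  also have "\<dots> \<le> (nrm u + nrm v)\<^sup>2"
    using ip_CS[of u v] by (simp add: power2_sum)
  finally show ?thesis by (rule power2_le_imp_le) simp
qed

lemma nrm_scale: "nrm (\<lambda>p. a *\<^sub>R u p) = \<bar>a\<bar> * nrm u"
  by (simp add: nrm_def ip_lin real_sqrt_mult flip: mult.assoc power2_eq_square)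

lemma nrm_diff: "nrm (\<lambda>p. u p - v p) \<le> nrm u + nrm v"
  using nrm_add[of u "\<lambda>p. (-1) *\<^sub>R v p"] nrm_scale[of "-1" v] by simp

lemma gn_add: "gn (\<lambda>p. u p + v p) \<le> gn u + gn v"
proof -
  have "(gn (\<lambda>p. u p + v p))\<^sup>2 = (gn u)\<^sup>2 + 2 * dip u v + (gn v)\<^sup>2"
    by (simp add: gn_sq dip_lin dip_commute[of v u])
  also have "\<dots> \<le> (gn u + gn v)\<^sup>2"
    using dip_CS[of u v] by (simp add: power2_sum)
  finally show ?thesis by (rule power2_le_imp_le) simp
qed

lemma gn_scale: "gn (\<lambda>p. a *\<^sub>R u p) = \<bar>a\<bar> * gn u"
  by (simp add: gn_def dip_lin real_sqrt_mult flip: mult.assoc power2_eq_square)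

lemma gn_diff: "gn (\<lambda>p. u p - v p) \<le> gn u + gn v"
  using gn_add[of u "\<lambda>p. (-1) *\<^sub>R v p"] gn_scale[of "-1" v] by simp

lemma nrm_sh: "nrm (\<lambda>p. u (sh d p)) = nrm u" "nrm (\<lambda>p. u (sb d p)) = nrm u"
  unfolding nrm_def ip_def
  using sum_sh[of "\<lambda>p. u p \<bullet> u p" d] sum_sb[of "\<lambda>p. u p \<bullet> u p" d] by simp_all

lemma nrm_Dp_le: "nrm (Dp d u) \<le> gn u"
proof -
  have "ip (Dp d u) (Dp d u) \<le> dip u u"
    unfolding dip_def by (intro member_le_sum ip_nonneg) auto
  then show ?thesis by (simp add: nrm_def gn_def)
qed

lemma nrm_Ac_le: "nrm (Ac d u) \<le> gn u"
proof -
  have "nrm (Ac d u) = nrm (\<lambda>p. (1/2) *\<^sub>R (Dp d u p + Dp d u (sb d p)))"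
    by (simp add: Ac_Dp[abs_def])
  also have "\<dots> \<le> (1/2) * (nrm (Dp d u) + nrm (\<lambda>p. Dp d u (sb d p)))"
    unfolding nrm_scale using nrm_add[of "Dp d u" "\<lambda>p. Dp d u (sb d p)"] by simp
  finally show ?thesis using nrm_Dp_le[of d u] by (simp add: nrm_sh)
qed

lemma ip_div:
  "ip (\<lambda>p. (w p - w (sb d p)) /\<^sub>R h) v = - ip w (Dp d v)"
proof -
  have "(\<Sum>p\<in>B. w (sb d p) \<bullet> v p) = (\<Sum>p\<in>B. w p \<bullet> v (sh d p))"
    using sum_sb[of "\<lambda>p. w p \<bullet> v (sh d p)" d] by simp
  then show ?thesis
    unfolding ip_def Dp_def
    by (simp add: inner_simps sum_subtractf flip: sum_distrib_left) (simp add: algebra_simps)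
qed

lemma ip_Z: "ip (Z u) v = - (k * \<beta>) * dip u v"
proof -
  have "ip (Z u) v = (k * \<beta>) * (\<Sum>d\<in>UNIV. ip (\<lambda>p. (Dp d u p - Dp d u (sb d p)) /\<^sub>R h) v)"
    unfolding ip_def Z_def Sd_Dp
    by (simp add: inner_sum_left sum_distrib_left sum.swap[of _ B] algebra_simps)
  then show ?thesis by (simp add: ip_div dip_def sum_negf)
qed

lemma Ac_skew: "(\<Sum>p\<in>B. Ac d u p \<bullet> v p) = - (\<Sum>p\<in>B. u p \<bullet> Ac d v p)"
proof -
  have "(\<Sum>p\<in>B. u (sb d p) \<bullet> v p) = (\<Sum>p\<in>B. u p \<bullet> v (sh d p))"
    using sum_sb[of "\<lambda>p. u p \<bullet> v (sh d p)" d] by simp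
  moreover have "(\<Sum>p\<in>B. u (sh d p) \<bullet> v p) = (\<Sum>p\<in>B. u p \<bullet> v (sb d p))"
    using sum_sh[of "\<lambda>p. u p \<bullet> v (sb d p)" d] by simp
  ultimately show ?thesis
    unfolding Ac_def
    by (simp add: inner_simps sum_subtractf minus_mult_right flip: sum_distrib_left sum_divide_distrib)
qed

lemma ip_J: "a \<ge> 0 \<Longrightarrow> ip (J a u) v = ip u (J a v)"
proof -
  assume a: "a \<ge> 0"
  have u: "u = (\<lambda>p. J a u p - a *\<^sub>R Z (J a u) p)" and v: "v = (\<lambda>p. J a v p - a *\<^sub>R Z (J a v) p)"
    using J_eq[OF a, of u] J_eq[OF a, of v] by auto
  have "ip (J a u) v = ip (J a u) (J a v) + a * (k * \<beta>) * dip (J a u) (J a v)"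
    by (subst v) (simp add: ip_lin ip_commute[of _ "Z _"] ip_Z dip_commute)
  moreover have "ip u (J a v) = ip (J a u) (J a v) + a * (k * \<beta>) * dip (J a u) (J a v)"
    by (subst u) (simp add: ip_lin ip_Z)
  ultimately show ?thesis by simp
qed

text \<open>The equation u = J u - a Z (J u) is tested with J u. The gradient term is the
  dissipation that later pays for the derivative lost in the nonlinearity.\<close>

lemma J_energy:
  assumes "a \<ge> 0"
  shows "(nrm (J a u))\<^sup>2 + a * (k * \<beta>) * (gn (J a u))\<^sup>2 = ip u (J a u)"
proof -
  have u: "u = (\<lambda>p. J a u p - a *\<^sub>R Z (J a u) p)"
    using J_eq[OF assms, of u] by auto
  show ?thesis
    by (subst (3) u) (simp add: ip_lin ip_Z nrm_sq gn_sq)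
qed

lemma nrm_J_le: "a \<ge> 0 \<Longrightarrow> nrm (J a u) \<le> nrm u"
proof -
  assume a: "a \<ge> 0"
  have "(nrm (J a u))\<^sup>2 \<le> ip u (J a u)"
    using J_energy[OF a, of u] k_pos \<beta>_pos a by (smt (verit) mult_nonneg_nonneg zero_le_power2)
  also have "\<dots> \<le> nrm u * nrm (J a u)" using ip_CS[of u "J a u"] by simp
  finally have "nrm (J a u) * nrm (J a u) \<le> nrm u * nrm (J a u)" by (simp add: power2_eq_square)
  then show ?thesis
    by (metis mult_right_le_imp_le nrm_nonneg order_le_less)
qed

lemma gn_J_le: "a \<ge> 0 \<Longrightarrow> gn (J a u) \<le> gn u"
proof -
  assume a: "a \<ge> 0"
  have "dip (J a u) (J a u) \<le> dip u u"
    unfolding dip_def Dp_J[OF a]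
    by (intro sum_mono) (metis a nrm_J_le nrm_nonneg nrm_sq power_mono)
  then show ?thesis by (simp add: gn_def)
qed

end

lemma norm_scaled_diff_le:
  "norm x \<le> X \<Longrightarrow> norm y \<le> Y \<Longrightarrow> a \<ge> 0 \<Longrightarrow> b \<ge> 0 \<Longrightarrow> norm (a *\<^sub>R x - b *\<^sub>R y) \<le> a * X + b * Y"
  by (intro order.trans[OF norm_triangle_ineq4] add_mono) (simp_all add: mult_left_mono)

lemma cross_diff_left: "cross3 (x - y) z = cross3 x z - cross3 y z"
  and cross_diff_right: "cross3 z (x - y) = cross3 z x - cross3 z y" for x :: "real^3"
  using cross_add_left[of "x - y" y z] cross_add_right[of z "x - y" y] by simp_all

context lattice
begin

section \<open>Norm comparisons and linearisation of the nonlinearity\<close>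

lemma nrm_mono:
  assumes "\<And>p. p \<in> B \<Longrightarrow> norm (u p) \<le> C * norm (v p)" "C \<ge> 0"
  shows "nrm u \<le> C * nrm v"
proof -
  have "(nrm u)\<^sup>2 \<le> h ^ 3 * (\<Sum>p\<in>B. C\<^sup>2 * (norm (v p))\<^sup>2)"
    unfolding nrm_sq_sum using h_pos
    by (intro mult_left_mono sum_mono) (auto simp: power_mult_distrib[symmetric] intro!: power_mono assms)
  also have "\<dots> = (C * nrm v)\<^sup>2"
    by (simp add: nrm_sq_sum power_mult_distrib sum_distrib_left algebra_simps)
  finally show ?thesis using assms(2) by (auto intro: power2_le_imp_le)
qed

lemma nrm_le:
  assumes "\<And>p. norm (u p) \<le> K" "K \<ge> 0"
  shows "nrm u \<le> 3 * K"
proof -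
  have "(nrm u)\<^sup>2 \<le> h ^ 3 * (\<Sum>p\<in>B. K\<^sup>2)"
    unfolding nrm_sq_sum using h_pos
    by (intro mult_left_mono sum_mono) (auto intro!: power_mono assms)
  also have "\<dots> = (h ^ 3 * real (card B)) * K\<^sup>2" by simp
  also have "\<dots> \<le> 8 * K\<^sup>2" using vol by (intro mult_right_mono) auto
  \<comment> \<open>The volume factor sqrt 8 is rounded up to 3; this is the origin of the many
    factors 3 below.\<close>
  also have "\<dots> \<le> (3 * K)\<^sup>2" by (simp add: power2_eq_square)
  finally show ?thesis using assms(2) by (auto intro: power2_le_imp_le)
qed

text \<open>A single point carries weight h^3 in the squared norm, which gives the inverse
  inequality of three dimensions.\<close>

lemma norm_le_nrm:
  assumes "p \<in> B"
  shows "norm (u p) \<le> h powr (-3/2) * nrm u"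
proof -
  have "h ^ 3 * (norm (u p))\<^sup>2 \<le> (nrm u)\<^sup>2"
    unfolding nrm_sq_sum using h_pos assms finB
    by (intro mult_left_mono member_le_sum) auto
  then have "(h powr (-3/2))\<^sup>2 * (h ^ 3 * (norm (u p))\<^sup>2) \<le> (h powr (-3/2))\<^sup>2 * (nrm u)\<^sup>2"
    by (intro mult_left_mono) auto
  moreover have "(h powr (-3/2))\<^sup>2 * h ^ 3 = 1"
  proof -
    have "(h powr (-3/2))\<^sup>2 = h powr (-3)"
      by (simp add: power2_eq_square powr_add[symmetric])
    then show ?thesis using h_pos by (simp add: powr_minus powr_realpow[of h 3, simplified])
  qed
  ultimately have "(norm (u p))\<^sup>2 \<le> (h powr (-3/2) * nrm u)\<^sup>2"
    unfolding power_mult_distrib mult.assoc[symmetric] by simp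
  then show ?thesis by (rule power2_le_imp_le) simp
qed

text \<open>The Frechet derivative of \<open>NL\<close> at u in direction v.\<close>

definition DN :: "('a \<Rightarrow> real^3) \<Rightarrow> ('a \<Rightarrow> real^3) \<Rightarrow> 'a \<Rightarrow> real^3"
  where "DN u v p = \<beta> *\<^sub>R ((\<Sum>d\<in>UNIV. (norm (Ac d u p))\<^sup>2) *\<^sub>R v p
      + (2 * (\<Sum>d\<in>UNIV. Ac d u p \<bullet> Ac d v p)) *\<^sub>R u p)
    - \<alpha> *\<^sub>R (cross3 (v p) (cross3 (u p) (f p)) + cross3 (u p) (cross3 (v p) (f p)))"

lemma DN_add: "DN u (\<lambda>p. v p + w p) p = DN u v p + DN u w p"
  and DN_diff: "DN u (\<lambda>p. v p - w p) p = DN u v p - DN u w p"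
  and DN_scale: "DN u (\<lambda>p. a *\<^sub>R v p) p = a *\<^sub>R DN u v p"
  by (simp_all add: DN_def Ac_add Ac_diff Ac_scale inner_simps sum.distrib sum_subtractf
    cross_add_left cross_add_right cross_diff_left cross_diff_right cross_mult_left cross_mult_right
    algebra_simps flip: sum_distrib_left)

text \<open>\<open>NL\<close> is a cubic polynomial in u and its differences, so its Taylor
  remainder is explicit; every term is at least quadratic in v.\<close>

lemma NL_expand:
  "NL (\<lambda>p. u p + v p) p - NL u p - DN u v p =
    \<beta> *\<^sub>R ((2 * (\<Sum>d\<in>UNIV. Ac d u p \<bullet> Ac d v p)) *\<^sub>R v p
      + (\<Sum>d\<in>UNIV. (norm (Ac d v p))\<^sup>2) *\<^sub>R (u p + v p))
    - \<alpha> *\<^sub>R cross3 (v p) (cross3 (v p) (f p))"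
proof -
  have "(\<Sum>d\<in>UNIV. (norm (Ac d (\<lambda>p. u p + v p) p))\<^sup>2)
    = (\<Sum>d\<in>UNIV. (norm (Ac d u p))\<^sup>2) + 2 * (\<Sum>d\<in>UNIV. Ac d u p \<bullet> Ac d v p)
      + (\<Sum>d\<in>UNIV. (norm (Ac d v p))\<^sup>2)"
    unfolding sum_distrib_left sum.distrib[symmetric]
    by (intro sum.cong refl)
      (simp add: Ac_add power2_norm_eq_inner inner_simps inner_commute)
  then show ?thesis
    by (simp add: NL_def DN_def cross_add_left cross_add_right algebra_simps)
qed

lemma sum_norm_sq_le:
  assumes "\<And>d. norm (a d) \<le> K"
  shows "(\<Sum>d\<in>(UNIV::3 set). (norm (a d :: real^3))\<^sup>2) \<le> 3 * K\<^sup>2"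
proof -
  have "(\<Sum>d\<in>(UNIV::3 set). (norm (a d))\<^sup>2) \<le> (\<Sum>d\<in>(UNIV::3 set). K\<^sup>2)"
    by (intro sum_mono power_mono assms) auto
  then show ?thesis by simp
qed

lemma sum_inner_le:
  assumes "\<And>d. norm (a d) \<le> K" "\<And>d. norm (b d) \<le> L" "K \<ge> 0"
  shows "\<bar>\<Sum>d\<in>(UNIV::3 set). (a d :: real^3) \<bullet> b d\<bar> \<le> 3 * (K * L)"
proof -
  have "\<bar>\<Sum>d\<in>(UNIV::3 set). a d \<bullet> b d\<bar> \<le> (\<Sum>d\<in>(UNIV::3 set). K * L)"
    by (intro order.trans[OF sum_abs] sum_mono order.trans[OF Cauchy_Schwarz_ineq2] mult_mono assms) auto
  then show ?thesis by simp
qed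

lemma norm_cross2_le:
  assumes "norm a \<le> A" "norm b \<le> B'" "norm c \<le> C"
  shows "norm (cross3 a (cross3 b c)) \<le> A * (B' * (C::real))"
proof -
  have "A \<ge> 0" "B' \<ge> 0" using assms norm_ge_zero order.trans by blast+
  then show ?thesis
    by (intro order.trans[OF norm_cross3_le] mult_mono assms order.trans[OF norm_cross3_le]) auto
qed

lemma norm_DN_le:
  assumes u: "norm (u p) \<le> K" "\<And>d. norm (Ac d u p) \<le> K" and v: "norm (v p) \<le> \<epsilon>"
    "\<And>d. norm (Ac d v p) \<le> \<epsilon>" and f: "norm (f p) \<le> K"
  shows "norm (DN u v p) \<le> (9 * \<beta> + 2 * \<alpha>) * K\<^sup>2 * \<epsilon>"
proof -
  have K: "K \<ge> 0" "\<epsilon> \<ge> 0" using u(1) v(1) norm_ge_zero order.trans by blast+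
  have 1: "norm ((\<Sum>d\<in>UNIV. (norm (Ac d u p))\<^sup>2) *\<^sub>R v p) \<le> 3 * K\<^sup>2 * \<epsilon>"
    unfolding norm_scaleR using K
    by (intro mult_mono v) (auto simp: sum_nonneg intro!: sum_norm_sq_le u)
  have 2: "norm ((2 * (\<Sum>d\<in>UNIV. Ac d u p \<bullet> Ac d v p)) *\<^sub>R u p) \<le> (2 * (3 * (K * \<epsilon>))) * K"
    unfolding norm_scaleR abs_mult using K
    by (intro mult_mono u) (auto simp: sum_nonneg intro!: sum_inner_le u v)
  have 3: "norm (cross3 (v p) (cross3 (u p) (f p)) + cross3 (u p) (cross3 (v p) (f p)))
     \<le> \<epsilon> * (K * K) + K * (\<epsilon> * K)"
    by (intro norm_triangle_le add_mono norm_cross2_le u v f)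
  have "norm (DN u v p) \<le> \<beta> * (3 * K\<^sup>2 * \<epsilon> + (2 * (3 * (K * \<epsilon>))) * K) + \<alpha> * (\<epsilon> * (K * K) + K * (\<epsilon> * K))"
    unfolding DN_def
    using \<alpha>_pos \<beta>_pos by (intro norm_scaled_diff_le norm_triangle_mono 1 2 3) auto
  also have "\<dots> = (9 * \<beta> + 2 * \<alpha>) * K\<^sup>2 * \<epsilon>"
    by (simp add: power2_eq_square algebra_simps)
  finally show ?thesis .
qed

lemma norm_NL_expand_le:
  assumes u: "norm (u p) \<le> K" "\<And>d. norm (Ac d u p) \<le> K" and v: "norm (v p) \<le> \<epsilon>"
    "\<And>d. norm (Ac d v p) \<le> \<epsilon>" and f: "norm (f p) \<le> K" and \<epsilon>: "\<epsilon> \<le> K"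
  shows "norm (NL (\<lambda>p. u p + v p) p - NL u p - DN u v p) \<le> (12 * \<beta> + \<alpha>) * K * \<epsilon>\<^sup>2"
proof -
  have K: "K \<ge> 0" "\<epsilon> \<ge> 0" using u(1) v(1) norm_ge_zero order.trans by blast+
  have 1: "norm ((2 * (\<Sum>d\<in>UNIV. Ac d u p \<bullet> Ac d v p)) *\<^sub>R v p) \<le> (2 * (3 * (K * \<epsilon>))) * \<epsilon>"
    unfolding norm_scaleR abs_mult using K
    by (intro mult_mono v) (auto simp: sum_nonneg intro!: sum_inner_le u v)
  have "norm (u p + v p) \<le> 2 * K"
    using norm_triangle_ineq[of "u p" "v p"] u v \<epsilon> by linarith
  then have 2: "norm ((\<Sum>d\<in>UNIV. (norm (Ac d v p))\<^sup>2) *\<^sub>R (u p + v p)) \<le> 3 * \<epsilon>\<^sup>2 * (2 * K)"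
    unfolding norm_scaleR using K
    by (intro mult_mono) (auto simp: sum_nonneg intro!: sum_norm_sq_le v)
  have 3: "norm (cross3 (v p) (cross3 (v p) (f p))) \<le> \<epsilon> * (\<epsilon> * K)"
    by (intro norm_cross2_le v f)
  have "norm (NL (\<lambda>p. u p + v p) p - NL u p - DN u v p)
    \<le> \<beta> * ((2 * (3 * (K * \<epsilon>))) * \<epsilon> + 3 * \<epsilon>\<^sup>2 * (2 * K)) + \<alpha> * (\<epsilon> * (\<epsilon> * K))"
    unfolding NL_expand
    using \<alpha>_pos \<beta>_pos by (intro norm_scaled_diff_le norm_triangle_mono 1 2 3) auto
  also have "\<dots> = (12 * \<beta> + \<alpha>) * K * \<epsilon>\<^sup>2"
    by (simp add: power2_eq_square algebra_simps)
  finally show ?thesis .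
qed

lemma norm_DN_diff_le:
  assumes u: "norm (u p) \<le> K" "\<And>d. norm (Ac d u p) \<le> K" and v: "norm (v p) \<le> \<epsilon>"
    "\<And>d. norm (Ac d v p) \<le> \<epsilon>" and f: "norm (f p) \<le> K"
    and w: "norm (w p) \<le> \<eta>" "\<And>d. norm (Ac d w p) \<le> \<eta>" and \<eta>: "\<eta> \<le> K"
  shows "norm (DN (\<lambda>p. u p + w p) v p - DN u v p) \<le> (27 * \<beta> + 2 * \<alpha>) * K * \<eta> * \<epsilon>"
proof -
  have K: "K \<ge> 0" "\<epsilon> \<ge> 0" "\<eta> \<ge> 0"
    using u(1) v(1) w(1) norm_ge_zero order.trans by blast+
  have sq: "(\<Sum>d\<in>UNIV. (norm (Ac d (\<lambda>p. u p + w p) p))\<^sup>2)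
    = (\<Sum>d\<in>UNIV. (norm (Ac d u p))\<^sup>2) + 2 * (\<Sum>d\<in>UNIV. Ac d u p \<bullet> Ac d w p)
      + (\<Sum>d\<in>UNIV. (norm (Ac d w p))\<^sup>2)"
    unfolding sum_distrib_left sum.distrib[symmetric]
    by (intro sum.cong refl)
      (simp add: Ac_add power2_norm_eq_inner inner_simps inner_commute)
  have lin: "(\<Sum>d\<in>UNIV. Ac d (\<lambda>p. u p + w p) p \<bullet> Ac d v p)
    = (\<Sum>d\<in>UNIV. Ac d u p \<bullet> Ac d v p) + (\<Sum>d\<in>UNIV. Ac d w p \<bullet> Ac d v p)"
    by (simp add: Ac_add inner_simps sum.distrib)
  have eq: "DN (\<lambda>p. u p + w p) v p - DN u v p
    = \<beta> *\<^sub>R ((2 * (\<Sum>d\<in>UNIV. Ac d u p \<bullet> Ac d w p)) *\<^sub>R v p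
      + (\<Sum>d\<in>UNIV. (norm (Ac d w p))\<^sup>2) *\<^sub>R v p
      + (2 * (\<Sum>d\<in>UNIV. Ac d w p \<bullet> Ac d v p)) *\<^sub>R (u p + w p)
      + (2 * (\<Sum>d\<in>UNIV. Ac d u p \<bullet> Ac d v p)) *\<^sub>R w p)
    - \<alpha> *\<^sub>R (cross3 (v p) (cross3 (w p) (f p)) + cross3 (w p) (cross3 (v p) (f p)))"
    by (simp add: DN_def sq lin cross_add_left cross_add_right algebra_simps)
  have 1: "norm ((2 * (\<Sum>d\<in>UNIV. Ac d u p \<bullet> Ac d w p)) *\<^sub>R v p) \<le> (2 * (3 * (K * \<eta>))) * \<epsilon>"
    unfolding norm_scaleR abs_mult using K
    by (intro mult_mono v) (auto simp: sum_nonneg intro!: sum_inner_le u w)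
  \<comment> \<open>One of the two factors \<eta> is traded for K, so that the final bound is linear
    in \<eta> and in \<epsilon>.\<close>
  have 2: "norm ((\<Sum>d\<in>UNIV. (norm (Ac d w p))\<^sup>2) *\<^sub>R v p) \<le> 3 * (K * \<eta>) * \<epsilon>"
  proof -
    have "(\<Sum>d\<in>UNIV. (norm (Ac d w p))\<^sup>2) \<le> 3 * \<eta>\<^sup>2" by (intro sum_norm_sq_le w)
    also have "\<dots> \<le> 3 * (K * \<eta>)" using K \<eta> by (simp add: power2_eq_square mult_right_mono)
    finally show ?thesis
      unfolding norm_scaleR using K by (intro mult_mono v) (auto simp: sum_nonneg)
  qed
  have "norm (u p + w p) \<le> 2 * K"
    using norm_triangle_ineq[of "u p" "w p"] u w \<eta> by linarith
  then have 3: "norm ((2 * (\<Sum>d\<in>UNIV. Ac d w p \<bullet> Ac d v p)) *\<^sub>R (u p + w p)) \<le> (2 * (3 * (\<eta> * \<epsilon>))) * (2 * K)"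
    unfolding norm_scaleR abs_mult using K
    by (intro mult_mono) (auto simp: sum_nonneg intro!: sum_inner_le w v)
  have 4: "norm ((2 * (\<Sum>d\<in>UNIV. Ac d u p \<bullet> Ac d v p)) *\<^sub>R w p) \<le> (2 * (3 * (K * \<epsilon>))) * \<eta>"
    unfolding norm_scaleR abs_mult using K
    by (intro mult_mono w) (auto simp: sum_nonneg intro!: sum_inner_le u v)
  have 5: "norm (cross3 (v p) (cross3 (w p) (f p)) + cross3 (w p) (cross3 (v p) (f p)))
    \<le> \<epsilon> * (\<eta> * K) + \<eta> * (\<epsilon> * K)"
    by (intro norm_triangle_le add_mono norm_cross2_le w v f)
  have "norm (DN (\<lambda>p. u p + w p) v p - DN u v p)
    \<le> \<beta> * ((2 * (3 * (K * \<eta>))) * \<epsilon> + 3 * (K * \<eta>) * \<epsilon> + (2 * (3 * (\<eta> * \<epsilon>))) * (2 * K)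
        + (2 * (3 * (K * \<epsilon>))) * \<eta>) + \<alpha> * (\<epsilon> * (\<eta> * K) + \<eta> * (\<epsilon> * K))"
    unfolding eq
    using \<alpha>_pos \<beta>_pos by (intro norm_scaled_diff_le norm_triangle_mono 1 2 3 4 5) auto
  also have "\<dots> = (27 * \<beta> + 2 * \<alpha>) * K * \<eta> * \<epsilon>"
    by (simp add: algebra_simps)
  finally show ?thesis .
qed

text \<open>The iterated centred difference is the second difference with step 2h, an average of
  three ordinary ones with weights 1/4, 1/2, 1/4.\<close>

lemma Ac_Ac_le:
  assumes "\<And>p. norm (Sd d u p) \<le> K"
  shows "norm (Ac d (Ac d u) p) \<le> K"
proof -
  have "Ac d (Ac d u) p = (1/4) *\<^sub>R (Sd d u (sh d p) + 2 *\<^sub>R Sd d u p + Sd d u (sb d p))"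
    using h_pos by (simp add: vec_eq_iff Ac_def Sd_def power2_eq_square field_simps)
  also have "norm \<dots> \<le> (1/4) * (K + 2 * K + K)"
    unfolding norm_scaleR using assms
    by (intro mult_mono norm_triangle_le add_mono) auto
  finally show ?thesis by simp
qed

lemma J_sb: "a \<ge> 0 \<Longrightarrow> J a (\<lambda>p. u (sb d p)) = (\<lambda>p. J a u (sb d p))"
  using J_sh[of a "\<lambda>p. u (sb d p)" d] by (auto simp: fun_eq_iff)

lemma Sd_J: "a \<ge> 0 \<Longrightarrow> Sd d (J a u) = J a (Sd d u)"
proof -
  assume a: "a \<ge> 0"
  have "Sd d u = (\<lambda>p. (1/h\<^sup>2) *\<^sub>R (u (sh d p) - 2 *\<^sub>R u p + u (sb d p)))" for u
    by (auto simp: Sd_def divide_inverse)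
  then show ?thesis by (simp add: J_lin a J_sh J_sb)
qed

text \<open>By the energy identity |J u|^2 + a \<beta> k |grad J u|^2 is at most C (|J u| + |grad J
  u|). The gradient is controlled only with weight sqrt k, so the passage from the dual norm to L2
  costs a factor k^(-1/2).\<close>

lemma nrm_J_dual_le:
  assumes a: "a > 0" and k: "k \<le> 1" and dual: "\<And>e. \<bar>ip u e\<bar> \<le> C * (nrm e + gn e)" and C: "C \<ge> 0"
  shows "sqrt k * nrm (J a u) \<le> (1 + 1 / sqrt (a * \<beta>)) * C"
proof -
  define x y where "x = nrm (J a u)" and "y = gn (J a u)"
  have en: "x\<^sup>2 + a * \<beta> * (sqrt k * y)\<^sup>2 \<le> C * (x + y)"
    using J_energy[of a u] dual[of "J a u"] a k_pos by (auto simp: x_def y_def power_mult_distrib algebra_simps)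
  define s g where "s = sqrt k" and "g = sqrt (a * \<beta>)"
  have sg: "s > 0" "g > 0" "s \<le> 1" using k k_pos a \<beta>_pos by (auto simp: s_def g_def)
  have xy: "x \<ge> 0" "y \<ge> 0" by (auto simp: x_def y_def)
  have "s * (x\<^sup>2 + (g * s * y)\<^sup>2) \<le> s * (C * (x + y))"
    using en sg a \<beta>_pos by (intro mult_left_mono) (auto simp: s_def g_def power_mult_distrib)
  also have "\<dots> \<le> C * (x + s * y)"
    using sg xy C mult_right_mono[of s 1 x] by (simp add: algebra_simps mult_left_mono)
  finally have *: "s * (x\<^sup>2 + (g * s * y)\<^sup>2) \<le> C * (x + (g * s * y) / g)" using sg by simp
  define z where "z = g * s * y"
  have z: "z \<ge> 0" "s * (x\<^sup>2 + z\<^sup>2) \<le> C * (x + z / g)" using * xy sg by (auto simp: z_def)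
  show ?thesis
  proof (rule ccontr)
    assume "\<not> ?thesis"
    then have gt: "s * x > (1 + 1 / g) * C" by (simp add: s_def g_def x_def)
    have "x > 0" using gt sg C xy by (metis add_nonneg_nonneg divide_nonneg_pos less_eq_real_def mult_nonneg_nonneg mult_zero_right not_less zero_le_one)
    \<comment> \<open>Comparing both unknowns with the larger one turns the quadratic inequality
      into the linear bound s m \<le> (1 + 1/g) C.\<close>
    define m where "m = max x z"
    have m: "m \<ge> x" "m \<ge> z" "m > 0" using \<open>x > 0\<close> by (auto simp: m_def)
    have "s * m\<^sup>2 \<le> s * (x\<^sup>2 + z\<^sup>2)"
      using sg by (intro mult_left_mono) (auto simp: m_def max_def)
    also have "\<dots> \<le> C * (m + m / g)"
      using z m C sg by (intro order.trans[OF z(2)] mult_left_mono add_mono divide_right_mono) auto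
    finally have "(s * m) * m \<le> ((1 + 1 / g) * C) * m" by (simp add: power2_eq_square algebra_simps)
    then have "s * m \<le> (1 + 1 / g) * C" using m by simp
    moreover have "s * x \<le> s * m" using m sg by simp
    ultimately show False using gt by linarith
  qed
qed

lemma ip_sum_left: "ip (\<lambda>p. \<Sum>d\<in>S. u d p) v = (\<Sum>d\<in>S. ip (u d) v)"
  by (simp add: ip_def inner_sum_left sum_distrib_left sum.swap[of _ B])

text \<open>
  The derivative of the nonlinearity loses one difference, which summation by parts moves to the
  test function.
\<close>
lemma ip_DN_le:
  assumes u: "\<And>p. norm (u p) \<le> K" "\<And>d p. norm (Ac d u p) \<le> K" "\<And>d p. norm (Sd d u p) \<le> K"
    and f: "\<And>p. norm (f p) \<le> K"
  shows "\<bar>ip (DN u b) e\<bar> \<le> ((21 * \<beta> + 2 * \<alpha>) * K\<^sup>2) * nrm b * (nrm e + gn e)"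
proof -
  have K: "K \<ge> 0" using u(1) norm_ge_zero order.trans by blast
  define P where "P p = \<beta> *\<^sub>R ((\<Sum>d\<in>UNIV. (norm (Ac d u p))\<^sup>2) *\<^sub>R b p)
    - \<alpha> *\<^sub>R (cross3 (b p) (cross3 (u p) (f p)) + cross3 (u p) (cross3 (b p) (f p)))" for p
  have "norm (P p) \<le> (3 * \<beta> * K\<^sup>2 + 2 * \<alpha> * K\<^sup>2) * norm (b p)" for p
  proof -
    have 1: "norm ((\<Sum>d\<in>UNIV. (norm (Ac d u p))\<^sup>2) *\<^sub>R b p) \<le> 3 * K\<^sup>2 * norm (b p)"
      unfolding norm_scaleR using K
      by (intro mult_mono) (auto simp: sum_nonneg intro!: sum_norm_sq_le u)
    have 3: "norm (cross3 (b p) (cross3 (u p) (f p)) + cross3 (u p) (cross3 (b p) (f p)))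
       \<le> norm (b p) * (K * K) + K * (norm (b p) * K)"
      by (intro norm_triangle_le add_mono norm_cross2_le u f) auto
    have "norm (P p) \<le> \<beta> * (3 * K\<^sup>2 * norm (b p)) + \<alpha> * (norm (b p) * (K * K) + K * (norm (b p) * K))"
      unfolding P_def using \<alpha>_pos \<beta>_pos
      by (intro norm_scaled_diff_le 3 1) auto
    then show ?thesis by (simp add: power2_eq_square algebra_simps)
  qed
  then have P: "nrm P \<le> (3 * \<beta> * K\<^sup>2 + 2 * \<alpha> * K\<^sup>2) * nrm b"
    using \<alpha>_pos \<beta>_pos by (intro nrm_mono) auto
  \<comment> \<open>\<open>c\<close> collects the smooth factors that multiply
    \<open>Ac d b\<close>. Since \<open>Ac\<close> is skew-symmetric, the critical term becomes -
    <b, Ac c>, and the discrete product rule splits Ac c into one term with a difference of e and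
    two terms in which only u is differenced again.\<close>
  define c where "c d p = (u p \<bullet> e p) *\<^sub>R Ac d u p" for d p
  have c: "nrm (Ac d (c d)) \<le> 3 * K\<^sup>2 * (nrm e + gn e)" for d
  proof -
    have eq: "Ac d (c d) = (\<lambda>p. (u (sh d p) \<bullet> Ac d e p) *\<^sub>R Ac d u (sh d p)
      + ((Ac d u p \<bullet> e (sb d p)) *\<^sub>R Ac d u (sh d p) + (u (sb d p) \<bullet> e (sb d p)) *\<^sub>R Ac d (Ac d u) p))"
    proof
      fix p
      have "Ac d (c d) p = ((u (sh d p) \<bullet> ((e (sh d p) - e (sb d p)) /\<^sub>R (2*h))) *\<^sub>R Ac d u (sh d p)
      + ((((u (sh d p) - u (sb d p)) /\<^sub>R (2*h)) \<bullet> e (sb d p)) *\<^sub>R Ac d u (sh d p)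
      + (u (sb d p) \<bullet> e (sb d p)) *\<^sub>R ((Ac d u (sh d p) - Ac d u (sb d p)) /\<^sub>R (2*h))))"
        unfolding Ac_def[of d "c d"] c_def by (simp add: inner_simps algebra_simps)
      then show "Ac d (c d) p = (u (sh d p) \<bullet> Ac d e p) *\<^sub>R Ac d u (sh d p)
      + ((Ac d u p \<bullet> e (sb d p)) *\<^sub>R Ac d u (sh d p) + (u (sb d p) \<bullet> e (sb d p)) *\<^sub>R Ac d (Ac d u) p)"
        by (simp only: Ac_def[of d e] Ac_def[of d "Ac d u"] Ac_def[of d u p])
    qed
    have *: "norm ((x \<bullet> y) *\<^sub>R z) \<le> K\<^sup>2 * norm y" if "norm x \<le> K" "norm z \<le> K" for x y z :: "real^3"
    proof -
      have "\<bar>x \<bullet> y\<bar> * norm z \<le> (K * norm y) * K"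
        using that K by (intro mult_mono order.trans[OF Cauchy_Schwarz_ineq2]) auto
      then show ?thesis by (simp add: power2_eq_square algebra_simps)
    qed
    have "nrm (Ac d (c d)) \<le> K\<^sup>2 * nrm (Ac d e) + (K\<^sup>2 * nrm (\<lambda>p. e (sb d p)) + K\<^sup>2 * nrm (\<lambda>p. e (sb d p)))"
      unfolding eq
      by (intro order.trans[OF nrm_add] add_mono) (auto intro!: nrm_mono * u Ac_Ac_le)
    also have "\<dots> \<le> 3 * K\<^sup>2 * (nrm e + gn e)"
      using mult_left_mono[OF nrm_Ac_le[of d e], of "K\<^sup>2"]
      by (simp add: nrm_sh algebra_simps) (smt (verit) gn_nonneg nrm_nonneg mult_nonneg_nonneg zero_le_power2)
    finally show ?thesis .
  qed
  have "DN u b = (\<lambda>p. P p + (2 * \<beta>) *\<^sub>R (\<Sum>d\<in>UNIV. (Ac d u p \<bullet> Ac d b p) *\<^sub>R u p))"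
    by (auto simp: DN_def P_def algebra_simps scaleR_sum_left sum_distrib_left simp flip: scaleR_sum_left)
  then have eq0: "ip (DN u b) e = ip P e + 2 * \<beta> * (\<Sum>d\<in>UNIV. ip (\<lambda>p. (Ac d u p \<bullet> Ac d b p) *\<^sub>R u p) e)"
    by (simp add: ip_lin ip_sum_left)
  have "ip (\<lambda>p. (Ac d u p \<bullet> Ac d b p) *\<^sub>R u p) e = - ip b (Ac d (c d))" for d
  proof -
    have "ip (\<lambda>p. (Ac d u p \<bullet> Ac d b p) *\<^sub>R u p) e = h ^ 3 * (\<Sum>p\<in>B. Ac d b p \<bullet> c d p)"
      unfolding ip_def c_def by (intro arg_cong2[where f = "(*)"] sum.cong) (auto simp: inner_commute)
    then show ?thesis unfolding Ac_skew by (simp add: ip_def)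
  qed
  then have eq: "ip (DN u b) e = ip P e - 2 * \<beta> * (\<Sum>d\<in>UNIV. ip b (Ac d (c d)))"
    unfolding eq0 by (simp add: sum_negf)
  have "\<bar>ip P e\<bar> \<le> ((3 * \<beta> * K\<^sup>2 + 2 * \<alpha> * K\<^sup>2) * nrm b) * (nrm e + gn e)"
    using P by (intro order.trans[OF ip_CS] mult_mono) (auto intro: order.trans[OF nrm_nonneg])
  moreover have "\<bar>\<Sum>d\<in>UNIV. ip b (Ac d (c d))\<bar> \<le> (\<Sum>d\<in>(UNIV::3 set). nrm b * (3 * K\<^sup>2 * (nrm e + gn e)))"
    by (intro order.trans[OF sum_abs] sum_mono order.trans[OF ip_CS] mult_left_mono c) auto
  then have "\<bar>2 * \<beta> * (\<Sum>d\<in>UNIV. ip b (Ac d (c d)))\<bar> \<le> 2 * \<beta> * (9 * K\<^sup>2 * nrm b * (nrm e + gn e))"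
    unfolding abs_mult using \<beta>_pos by (intro mult_mono) (auto simp: mult_ac)
  ultimately have "\<bar>ip (DN u b) e\<bar> \<le> ((3 * \<beta> * K\<^sup>2 + 2 * \<alpha> * K\<^sup>2) * nrm b) * (nrm e + gn e)
     + 2 * \<beta> * (9 * K\<^sup>2 * nrm b * (nrm e + gn e))"
    unfolding eq by linarith
  also have "\<dots> = ((21 * \<beta> + 2 * \<alpha>) * K\<^sup>2) * nrm b * (nrm e + gn e)"
    by (simp add: algebra_simps)
  finally show ?thesis .
qed

lemma nrm_DN_le:
  assumes u: "\<And>p. norm (u p) \<le> K" "\<And>d p. norm (Ac d u p) \<le> K" and f: "\<And>p. norm (f p) \<le> K"
  shows "nrm (DN u v) \<le> ((9 * \<beta> + 2 * \<alpha>) * K\<^sup>2) * (nrm v + 3 * gn v)"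
proof -
  \<comment> \<open>A vector field whose length is the scalar majorant, so that
    \<open>nrm_mono\<close> and the triangle inequality for \<open>nrm\<close> apply to it.\<close>
  define w where "w p = (norm (v p) + (\<Sum>d\<in>UNIV. norm (Ac d v p))) *\<^sub>R (axis 1 1 :: real^3)" for p
  have "nrm (DN u v) \<le> ((9 * \<beta> + 2 * \<alpha>) * K\<^sup>2) * nrm w"
  proof (intro nrm_mono)
    fix p
    have "norm (Ac d v p) \<le> (\<Sum>d\<in>UNIV. norm (Ac d v p))" for d
      by (intro member_le_sum) auto
    then have "norm (DN u v p) \<le> (9 * \<beta> + 2 * \<alpha>) * K\<^sup>2 * (norm (v p) + (\<Sum>d\<in>UNIV. norm (Ac d v p)))"
      by (intro norm_DN_le u f) (auto simp: sum_nonneg add_increasing)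
    then show "norm (DN u v p) \<le> (9 * \<beta> + 2 * \<alpha>) * K\<^sup>2 * norm (w p)"
      by (simp add: w_def sum_nonneg)
  qed (use \<alpha>_pos \<beta>_pos in auto)
  also have "nrm w \<le> nrm (\<lambda>p. norm (v p) *\<^sub>R (axis 1 1 :: real^3)) + nrm (\<lambda>p. (\<Sum>d\<in>UNIV. norm (Ac d v p)) *\<^sub>R (axis 1 1 :: real^3))"
    unfolding w_def scaleR_left_distrib by (rule nrm_add)
  also have "nrm (\<lambda>p. norm (v p) *\<^sub>R (axis 1 1 :: real^3)) \<le> 1 * nrm v"
    by (intro nrm_mono) auto
  also have "nrm (\<lambda>p. (\<Sum>d\<in>UNIV. norm (Ac d v p)) *\<^sub>R (axis 1 1 :: real^3)) \<le> 3 * gn v"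
  proof -
    have "nrm (\<lambda>p. norm (Ac d v p) *\<^sub>R (axis 1 1 :: real^3)) \<le> gn v" for d
      using nrm_mono[of "\<lambda>p. norm (Ac d v p) *\<^sub>R (axis 1 1 :: real^3)" 1 "Ac d v"] nrm_Ac_le[of d v] by simp
    from add_mono[OF add_mono[OF this[of 1] this[of 2]] this[of 3]] show ?thesis
      unfolding sum_3 scaleR_left_distrib
      using nrm_add[of "\<lambda>p. norm (Ac 1 v p) *\<^sub>R (axis 1 1 :: real^3) + norm (Ac 2 v p) *\<^sub>R axis 1 1" "\<lambda>p. norm (Ac 3 v p) *\<^sub>R axis 1 1"]
        nrm_add[of "\<lambda>p. norm (Ac 1 v p) *\<^sub>R (axis 1 1 :: real^3)" "\<lambda>p. norm (Ac 2 v p) *\<^sub>R axis 1 1"]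
      by linarith
  qed
  finally show ?thesis using \<alpha>_pos \<beta>_pos by (simp add: mult_left_mono)
qed

end

section \<open>Families of lattices with uniform constants\<close>

text \<open>The index \<omega> later runs over all mesh sizes, time steps and time levels at once,
  and \<open>kh\<close> and \<open>hk\<close> make h and k comparable uniformly in it. Orders in k
  can then be tracked without naming constants.\<close>

locale lattice_family =
  fixes \<Omega> :: "'w set" and B :: "'w \<Rightarrow> 'a set" and sh sb :: "'w \<Rightarrow> 3 \<Rightarrow> 'a \<Rightarrow> 'a"
    and h k :: "'w \<Rightarrow> real" and \<alpha> \<beta> :: real and f :: "'w \<Rightarrow> 'a \<Rightarrow> real^3"
    and ch ck :: real
  assumes lat: "\<omega> \<in> \<Omega> \<Longrightarrow> lattice (B \<omega>) (sh \<omega>) (sb \<omega>) (h \<omega>) (k \<omega>) \<alpha> \<beta>"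
    and k_le: "\<omega> \<in> \<Omega> \<Longrightarrow> k \<omega> \<le> 1"
    and kh: "\<omega> \<in> \<Omega> \<Longrightarrow> k \<omega> \<le> ck * h \<omega>" and hk: "\<omega> \<in> \<Omega> \<Longrightarrow> h \<omega> \<le> ch * k \<omega>"
begin

abbreviation (input) "ZZ u \<omega> \<equiv> lattice.Z (sh \<omega>) (sb \<omega>) (h \<omega>) (k \<omega>) \<beta> (u \<omega>)"
abbreviation (input) "JJ a u \<omega> \<equiv> lattice.J (sh \<omega>) (sb \<omega>) (h \<omega>) (k \<omega>) \<beta> a (u \<omega>)"
abbreviation (input) "NN u \<omega> \<equiv> lattice.NL (sh \<omega>) (sb \<omega>) (h \<omega>) \<alpha> \<beta> (f \<omega>) (u \<omega>)"
abbreviation (input) "DD u v \<omega> \<equiv> lattice.DN (sh \<omega>) (sb \<omega>) (h \<omega>) \<alpha> \<beta> (f \<omega>) (u \<omega>) (v \<omega>)"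

text \<open>
  Each norm is given by the quantities whose supremum it is, so that \<open>bd\<close> needs no suprema. In the dual norm
  \<open>hsem\<close> the index is the test function, and the quotient is \<open>0\<close> where the denominator vanishes.
\<close>
definition psem :: "'w \<Rightarrow> ('a \<Rightarrow> real^3) \<Rightarrow> 'a \<Rightarrow> real"
  where "psem \<omega> u p = norm (u p)"
definition gsem :: "'w \<Rightarrow> ('a \<Rightarrow> real^3) \<Rightarrow> 3 \<times> 'a \<Rightarrow> real"
  where "gsem \<omega> u i = norm (lattice.Dp (sh \<omega>) (h \<omega>) (fst i) u (snd i))"
definition ssem :: "'w \<Rightarrow> ('a \<Rightarrow> real^3) \<Rightarrow> 3 \<times> 'a \<Rightarrow> real"
  where "ssem \<omega> u i = norm (lattice.Sd (sh \<omega>) (sb \<omega>) (h \<omega>) (fst i) u (snd i))"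
definition hsem :: "'w \<Rightarrow> ('a \<Rightarrow> real^3) \<Rightarrow> ('a \<Rightarrow> real^3) \<Rightarrow> real"
  where "hsem \<omega> u e = \<bar>lattice.ip (B \<omega>) (h \<omega>) u e\<bar>
    / (lattice.nrm (B \<omega>) (h \<omega>) e + lattice.gn (B \<omega>) (sh \<omega>) (h \<omega>) e)"
text \<open>The weight sqrt k is there because L2 bounds obtained through a resolvent from dual
  bounds lose exactly this factor.\<close>

definition lsem :: "'w \<Rightarrow> ('a \<Rightarrow> real^3) \<Rightarrow> unit \<Rightarrow> real"
  where "lsem \<omega> u i = sqrt (k \<omega>) * lattice.nrm (B \<omega>) (h \<omega>) u"

definition bd :: "('w \<Rightarrow> ('a \<Rightarrow> real^3) \<Rightarrow> 'i \<Rightarrow> real) \<Rightarrow> nat \<Rightarrow> ('w \<Rightarrow> 'a \<Rightarrow> real^3) \<Rightarrow> bool"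
  where "bd S n u \<longleftrightarrow> (\<exists>C\<ge>0. \<forall>\<omega>\<in>\<Omega>. \<forall>i. S \<omega> (u \<omega>) i \<le> C * k \<omega> ^ n)"

definition sem :: "('w \<Rightarrow> ('a \<Rightarrow> real^3) \<Rightarrow> 'i \<Rightarrow> real) \<Rightarrow> bool"
  where "sem S \<longleftrightarrow> (\<forall>\<omega>\<in>\<Omega>. \<forall>i.
    (\<forall>u v. S \<omega> (\<lambda>p. u p + v p) i \<le> S \<omega> u i + S \<omega> v i) \<and>
    (\<forall>c u. S \<omega> (\<lambda>p. c *\<^sub>R u p) i = \<bar>c\<bar> * S \<omega> u i))"

lemma k_pos: "\<omega> \<in> \<Omega> \<Longrightarrow> k \<omega> > 0" and h_pos: "\<omega> \<in> \<Omega> \<Longrightarrow> h \<omega> > 0"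
  using lat lattice.k_pos lattice.h_pos by blast+

lemma pow_k: "\<omega> \<in> \<Omega> \<Longrightarrow> k \<omega> ^ n \<ge> 0" "\<omega> \<in> \<Omega> \<Longrightarrow> k \<omega> ^ n \<le> 1"
  using k_pos[of \<omega>] k_le[of \<omega>] by (auto intro: power_le_one)

lemma bdI: "C \<ge> 0 \<Longrightarrow> (\<And>\<omega> i. \<omega> \<in> \<Omega> \<Longrightarrow> S \<omega> (u \<omega>) i \<le> C * k \<omega> ^ n) \<Longrightarrow> bd S n u"
  unfolding bd_def by blast

lemma bd_eq:
  assumes "bd S n v" "\<And>\<omega> p. \<omega> \<in> \<Omega> \<Longrightarrow> u \<omega> p = v \<omega> p"
  shows "bd S n u"
proof -
  have "u \<omega> = v \<omega>" if "\<omega> \<in> \<Omega>" for \<omega> using assms(2)[OF that] by auto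
  then show ?thesis using assms(1) unfolding bd_def by auto
qed

lemma bd_mono: "bd S n u \<Longrightarrow> m \<le> n \<Longrightarrow> bd S m u"
proof -
  assume "bd S n u" and mn: "m \<le> n"
  then obtain C where C: "C \<ge> 0" "\<And>\<omega> i. \<omega> \<in> \<Omega> \<Longrightarrow> S \<omega> (u \<omega>) i \<le> C * k \<omega> ^ n"
    unfolding bd_def by blast
  have "C * k \<omega> ^ n \<le> C * k \<omega> ^ m" if "\<omega> \<in> \<Omega>" for \<omega>
    using C k_pos[OF that] k_le[OF that] mn by (intro mult_left_mono power_decreasing) auto
  then have "S \<omega> (u \<omega>) i \<le> C * k \<omega> ^ m" if "\<omega> \<in> \<Omega>" for \<omega> i
    using C(2)[OF that, of i] that by (meson order.trans)
  then show ?thesis using C(1) by (intro bdI[of C]) auto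
qed

lemma bd_add: "sem S \<Longrightarrow> bd S n u \<Longrightarrow> bd S n v \<Longrightarrow> bd S n (\<lambda>\<omega> p. u \<omega> p + v \<omega> p)"
proof -
  assume S: "sem S" and "bd S n u" "bd S n v"
  then obtain C D where C: "C \<ge> 0" "\<And>\<omega> i. \<omega> \<in> \<Omega> \<Longrightarrow> S \<omega> (u \<omega>) i \<le> C * k \<omega> ^ n"
    and D: "D \<ge> 0" "\<And>\<omega> i. \<omega> \<in> \<Omega> \<Longrightarrow> S \<omega> (v \<omega>) i \<le> D * k \<omega> ^ n"
    unfolding bd_def by blast
  show ?thesis
  proof (rule bdI[of "C + D"])
    fix \<omega> i assume w: "\<omega> \<in> \<Omega>"
    have "S \<omega> (\<lambda>p. u \<omega> p + v \<omega> p) i \<le> S \<omega> (u \<omega>) i + S \<omega> (v \<omega>) i"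
      using S w unfolding sem_def by blast
    then show "S \<omega> (\<lambda>p. u \<omega> p + v \<omega> p) i \<le> (C + D) * k \<omega> ^ n"
      using C(2)[OF w, of i] D(2)[OF w, of i] by (simp add: distrib_right)
  qed (use C D in auto)
qed

lemma bd_scale: "sem S \<Longrightarrow> bd S n u \<Longrightarrow> bd S n (\<lambda>\<omega> p. c *\<^sub>R u \<omega> p)"
proof -
  assume S: "sem S" and "bd S n u"
  then obtain C where C: "C \<ge> 0" "\<And>\<omega> i. \<omega> \<in> \<Omega> \<Longrightarrow> S \<omega> (u \<omega>) i \<le> C * k \<omega> ^ n"
    unfolding bd_def by blast
  show ?thesis
  proof (rule bdI[of "\<bar>c\<bar> * C"])
    fix \<omega> i assume w: "\<omega> \<in> \<Omega>"
    have "S \<omega> (\<lambda>p. c *\<^sub>R u \<omega> p) i = \<bar>c\<bar> * S \<omega> (u \<omega>) i"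
      using S w unfolding sem_def by blast
    then show "S \<omega> (\<lambda>p. c *\<^sub>R u \<omega> p) i \<le> (\<bar>c\<bar> * C) * k \<omega> ^ n"
      using C(2)[OF w, of i] by (simp add: mult.assoc mult_left_mono)
  qed (use C in auto)
qed

lemma bd_diff: "sem S \<Longrightarrow> bd S n u \<Longrightarrow> bd S n v \<Longrightarrow> bd S n (\<lambda>\<omega> p. u \<omega> p - v \<omega> p)"
  using bd_add[of S n u "\<lambda>\<omega> p. (-1) *\<^sub>R v \<omega> p"] bd_scale[of S n v "-1"] by simp

lemma bd_k: "sem S \<Longrightarrow> bd S n u \<Longrightarrow> bd S (Suc n) (\<lambda>\<omega> p. k \<omega> *\<^sub>R u \<omega> p)"
proof -
  assume S: "sem S" and "bd S n u"
  then obtain C where C: "C \<ge> 0" "\<And>\<omega> i. \<omega> \<in> \<Omega> \<Longrightarrow> S \<omega> (u \<omega>) i \<le> C * k \<omega> ^ n"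
    unfolding bd_def by blast
  show ?thesis
  proof (rule bdI[of C])
    fix \<omega> i assume w: "\<omega> \<in> \<Omega>"
    have "S \<omega> (\<lambda>p. k \<omega> *\<^sub>R u \<omega> p) i = k \<omega> * S \<omega> (u \<omega>) i"
      using S w k_pos[OF w] unfolding sem_def by (metis abs_of_pos)
    then show "S \<omega> (\<lambda>p. k \<omega> *\<^sub>R u \<omega> p) i \<le> C * k \<omega> ^ Suc n"
      using mult_left_mono[OF C(2)[OF w, of i], of "k \<omega>"] k_pos[OF w] by (simp add: mult.left_commute)
  qed (use C in auto)
qed

lemma sem_p: "sem psem"
  by (simp add: sem_def psem_def norm_triangle_ineq)

lemma sem_g: "sem gsem"
  unfolding sem_def gsem_def
  by (auto simp: lattice.Dp_add[OF lat] lattice.Dp_scale[OF lat] norm_triangle_ineq)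

lemma sem_s: "sem ssem"
proof -
  have "lattice.Sd (sh \<omega>) (sb \<omega>) (h \<omega>) d (\<lambda>p. u p + v p) p
    = lattice.Sd (sh \<omega>) (sb \<omega>) (h \<omega>) d u p + lattice.Sd (sh \<omega>) (sb \<omega>) (h \<omega>) d v p"
    "lattice.Sd (sh \<omega>) (sb \<omega>) (h \<omega>) d (\<lambda>p. c *\<^sub>R u p) p
    = c *\<^sub>R lattice.Sd (sh \<omega>) (sb \<omega>) (h \<omega>) d u p" if "\<omega> \<in> \<Omega>" for \<omega> d u v p c
    by (simp_all add: lattice.Sd_def[OF lat[OF that]] algebra_simps)
  then show ?thesis
    unfolding sem_def ssem_def by (auto simp: norm_triangle_ineq)
qed

lemma sem_l: "sem lsem"
  unfolding sem_def lsem_def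
proof (intro ballI allI conjI)
  fix \<omega> u v c assume w: "\<omega> \<in> \<Omega>"
  show "sqrt (k \<omega>) * lattice.nrm (B \<omega>) (h \<omega>) (\<lambda>p. u p + v p)
    \<le> sqrt (k \<omega>) * lattice.nrm (B \<omega>) (h \<omega>) u + sqrt (k \<omega>) * lattice.nrm (B \<omega>) (h \<omega>) v"
    using mult_left_mono[OF lattice.nrm_add[OF lat[OF w], of u v], of "sqrt (k \<omega>)"] k_pos[OF w]
    by (simp add: distrib_left)
  show "sqrt (k \<omega>) * lattice.nrm (B \<omega>) (h \<omega>) (\<lambda>p. c *\<^sub>R u p) = \<bar>c\<bar> * (sqrt (k \<omega>) * lattice.nrm (B \<omega>) (h \<omega>) u)"
    by (simp add: lattice.nrm_scale[OF lat[OF w]])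
qed

lemma sem_h: "sem hsem"
  unfolding sem_def hsem_def
proof (intro ballI allI conjI)
  fix \<omega> u v c e assume w: "\<omega> \<in> \<Omega>"
  interpret lattice "B \<omega>" "sh \<omega>" "sb \<omega>" "h \<omega>" "k \<omega>" \<alpha> \<beta> "f \<omega>" by (rule lat[OF w])
  show "\<bar>ip (\<lambda>p. u p + v p) e\<bar> / (nrm e + gn e) \<le> \<bar>ip u e\<bar> / (nrm e + gn e) + \<bar>ip v e\<bar> / (nrm e + gn e)"
    unfolding ip_lin add_divide_distrib[symmetric] by (intro divide_right_mono abs_triangle_ineq) auto
  show "\<bar>ip (\<lambda>p. c *\<^sub>R u p) e\<bar> / (nrm e + gn e) = \<bar>c\<bar> * (\<bar>ip u e\<bar> / (nrm e + gn e))"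
    by (simp add: ip_lin abs_mult)
qed

lemmas bd_lin =
  bd_add[OF sem_p] bd_add[OF sem_g] bd_add[OF sem_s] bd_add[OF sem_h] bd_add[OF sem_l]
  bd_diff[OF sem_p] bd_diff[OF sem_g] bd_diff[OF sem_s] bd_diff[OF sem_h] bd_diff[OF sem_l]
  bd_scale[OF sem_p] bd_scale[OF sem_g] bd_scale[OF sem_s] bd_scale[OF sem_h] bd_scale[OF sem_l]
  bd_k[OF sem_p] bd_k[OF sem_g] bd_k[OF sem_s] bd_k[OF sem_h] bd_k[OF sem_l]

lemma bd_hI:
  assumes "C \<ge> 0"
    and "\<And>\<omega> e. \<omega> \<in> \<Omega> \<Longrightarrow> \<bar>lattice.ip (B \<omega>) (h \<omega>) (u \<omega>) e\<bar>
      \<le> C * k \<omega> ^ n * (lattice.nrm (B \<omega>) (h \<omega>) e + lattice.gn (B \<omega>) (sh \<omega>) (h \<omega>) e)"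
  shows "bd hsem n u"
proof (rule bdI[OF assms(1)])
  fix \<omega> e assume w: "\<omega> \<in> \<Omega>"
  let ?d = "lattice.nrm (B \<omega>) (h \<omega>) e + lattice.gn (B \<omega>) (sh \<omega>) (h \<omega>) e"
  have "?d \<ge> 0"
    using lattice.nrm_nonneg[OF lat[OF w]] lattice.gn_nonneg[OF lat[OF w]] by simp
  then consider "?d = 0" | "?d > 0" by linarith
  then show "hsem \<omega> (u \<omega>) e \<le> C * k \<omega> ^ n"
  proof cases
    case 1
    then show ?thesis unfolding hsem_def using assms(1) pow_k[OF w] by simp
  next
    case 2
    then show ?thesis unfolding hsem_def using assms(2)[OF w] by (simp add: pos_divide_le_eq)
  qed
qed

lemma bd_hE:
  assumes "bd hsem n u"
  obtains C where "C \<ge> 0" "\<And>\<omega> e. \<omega> \<in> \<Omega> \<Longrightarrow> \<bar>lattice.ip (B \<omega>) (h \<omega>) (u \<omega>) e\<bar>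
      \<le> C * k \<omega> ^ n * (lattice.nrm (B \<omega>) (h \<omega>) e + lattice.gn (B \<omega>) (sh \<omega>) (h \<omega>) e)"
proof -
  obtain C where C: "C \<ge> 0" "\<And>\<omega> e. \<omega> \<in> \<Omega> \<Longrightarrow> hsem \<omega> (u \<omega>) e \<le> C * k \<omega> ^ n"
    using assms unfolding bd_def by blast
  show thesis
  proof (rule that[OF C(1)])
    fix \<omega> e assume w: "\<omega> \<in> \<Omega>"
    interpret lattice "B \<omega>" "sh \<omega>" "sb \<omega>" "h \<omega>" "k \<omega>" \<alpha> \<beta> "f \<omega>" by (rule lat[OF w])
    show "\<bar>ip (u \<omega>) e\<bar> \<le> C * k \<omega> ^ n * (nrm e + gn e)"
    proof (cases "nrm e + gn e = 0")
      case True
      \<comment> \<open>Where the denominator of \<open>hsem\<close> vanishes, the quotient is 0 and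
        carries no information; the claim then follows from Cauchy-Schwarz.\<close>
      then have "nrm e = 0" by (smt (verit) nrm_nonneg gn_nonneg)
      then show ?thesis using ip_CS[of "u \<omega>" e] True by simp
    next
      case False
      then have "nrm e + gn e > 0" by (smt (verit) nrm_nonneg gn_nonneg)
      then show ?thesis using C(2)[OF w, of e] unfolding hsem_def by (simp add: pos_divide_le_eq)
    qed
  qed
qed

lemma bd_p_h: "bd psem n u \<Longrightarrow> bd hsem n u"
proof -
  assume "bd psem n u"
  then obtain C where C: "C \<ge> 0" "\<And>\<omega> p. \<omega> \<in> \<Omega> \<Longrightarrow> norm (u \<omega> p) \<le> C * k \<omega> ^ n"
    unfolding bd_def psem_def by blast
  show ?thesis
  proof (rule bd_hI[of "3 * C"])
    fix \<omega> e assume w: "\<omega> \<in> \<Omega>"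
    interpret lattice "B \<omega>" "sh \<omega>" "sb \<omega>" "h \<omega>" "k \<omega>" \<alpha> \<beta> "f \<omega>" by (rule lat[OF w])
    have "\<bar>ip (u \<omega>) e\<bar> \<le> nrm (u \<omega>) * nrm e" by (rule ip_CS)
    also have "\<dots> \<le> (3 * (C * k \<omega> ^ n)) * (nrm e + gn e)"
      using C pow_k[OF w] w by (intro mult_mono nrm_le) auto
    finally show "\<bar>ip (u \<omega>) e\<bar> \<le> 3 * C * k \<omega> ^ n * (nrm e + gn e)" by (simp add: mult.assoc)
  qed (use C in auto)
qed

lemma bd_p_l: "bd psem n u \<Longrightarrow> bd lsem n u"
proof -
  assume "bd psem n u"
  then obtain C where C: "C \<ge> 0" "\<And>\<omega> p. \<omega> \<in> \<Omega> \<Longrightarrow> norm (u \<omega> p) \<le> C * k \<omega> ^ n"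
    unfolding bd_def psem_def by blast
  show ?thesis
  proof (rule bdI[of "3 * C"])
    fix \<omega> i assume w: "\<omega> \<in> \<Omega>"
    interpret lattice "B \<omega>" "sh \<omega>" "sb \<omega>" "h \<omega>" "k \<omega>" \<alpha> \<beta> "f \<omega>" by (rule lat[OF w])
    have "sqrt (k \<omega>) * nrm (u \<omega>) \<le> 1 * (3 * (C * k \<omega> ^ n))"
      using C pow_k[OF w] w k_le[OF w] by (intro mult_mono nrm_le) auto
    then show "lsem \<omega> (u \<omega>) i \<le> 3 * C * k \<omega> ^ n" by (simp add: lsem_def)
  qed (use C in auto)
qed

text \<open>One power of k buys one difference quotient, since k is at most a multiple of h.\<close>

lemma bd_p_g: "bd psem (Suc n) u \<Longrightarrow> bd gsem n u"
proof -
  assume "bd psem (Suc n) u"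
  then obtain C where C: "C \<ge> 0" "\<And>\<omega> p. \<omega> \<in> \<Omega> \<Longrightarrow> norm (u \<omega> p) \<le> C * k \<omega> ^ Suc n"
    unfolding bd_def psem_def by blast
  show ?thesis
  proof (rule bdI[of "2 * C * \<bar>ck\<bar>"])
    fix \<omega> i assume w: "\<omega> \<in> \<Omega>"
    interpret lattice "B \<omega>" "sh \<omega>" "sb \<omega>" "h \<omega>" "k \<omega>" \<alpha> \<beta> "f \<omega>" by (rule lat[OF w])
    have "norm (Dp d (u \<omega>) p) \<le> 2 * (C * k \<omega> ^ Suc n) / h \<omega>" for d p
      by (intro norm_Dp_le C w)
    moreover have "k \<omega> / h \<omega> \<le> \<bar>ck\<bar>"
      using kh[OF w] h_pos by (simp add: pos_divide_le_eq) (smt (verit) mult_right_mono)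
    then have "2 * C * k \<omega> ^ n * (k \<omega> / h \<omega>) \<le> 2 * C * k \<omega> ^ n * \<bar>ck\<bar>"
      using C pow_k[OF w] by (intro mult_left_mono) auto
    ultimately show "gsem \<omega> (u \<omega>) i \<le> 2 * C * \<bar>ck\<bar> * k \<omega> ^ n"
      unfolding gsem_def by (simp add: mult_ac) (smt (verit) mult_ac)
  qed (use C in auto)
qed

text \<open>The power gained is the factor k inside \<open>Z\<close>.\<close>

lemma bd_s_Z: "bd ssem n u \<Longrightarrow> bd psem (Suc n) (ZZ u)"
proof -
  assume "bd ssem n u"
  then obtain C where C: "C \<ge> 0" "\<And>\<omega> d p. \<omega> \<in> \<Omega> \<Longrightarrow> norm (lattice.Sd (sh \<omega>) (sb \<omega>) (h \<omega>) d (u \<omega>) p) \<le> C * k \<omega> ^ n"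
    unfolding bd_def ssem_def by (metis fst_conv snd_conv)
  show ?thesis
  proof (rule bdI[of "\<bar>\<beta>\<bar> * (3 * C)"])
    fix \<omega> p assume w: "\<omega> \<in> \<Omega>"
    interpret lattice "B \<omega>" "sh \<omega>" "sb \<omega>" "h \<omega>" "k \<omega>" \<alpha> \<beta> "f \<omega>" by (rule lat[OF w])
    have "norm (\<Sum>d\<in>UNIV. Sd d (u \<omega>) p) \<le> (\<Sum>d\<in>(UNIV::3 set). C * k \<omega> ^ n)"
      by (intro sum_norm_le C w)
    then have "k \<omega> * \<beta> * norm (\<Sum>d\<in>UNIV. Sd d (u \<omega>) p) \<le> k \<omega> * \<beta> * (3 * (C * k \<omega> ^ n))"
      using k_pos \<beta>_pos by (intro mult_left_mono) auto
    then show "psem \<omega> (Z (u \<omega>)) p \<le> \<bar>\<beta>\<bar> * (3 * C) * k \<omega> ^ Suc n"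
      using k_pos \<beta>_pos by (simp add: psem_def Z_def abs_mult mult_ac)
  qed (use C in auto)
qed

text \<open>Differences commute with the resolvent, so the maximum principle applies to them as
  well. In the dual norm the self-adjoint resolvent is moved to the test function, where it
  increases neither the norm nor the gradient.\<close>

lemma bd_J:
  assumes a: "a \<ge> 0"
  shows "bd psem n u \<Longrightarrow> bd psem n (JJ a u)" "bd gsem n u \<Longrightarrow> bd gsem n (JJ a u)"
    "bd ssem n u \<Longrightarrow> bd ssem n (JJ a u)" "bd hsem n u \<Longrightarrow> bd hsem n (JJ a u)"
proof -
  show "bd psem n u \<Longrightarrow> bd psem n (JJ a u)"
    unfolding bd_def psem_def using lattice.norm_J_le[OF lat a] by meson
  show "bd gsem n u \<Longrightarrow> bd gsem n (JJ a u)"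
  proof -
    assume "bd gsem n u"
    then obtain C where C: "C \<ge> 0" "\<And>\<omega> d p. \<omega> \<in> \<Omega> \<Longrightarrow> norm (lattice.Dp (sh \<omega>) (h \<omega>) d (u \<omega>) p) \<le> C * k \<omega> ^ n"
      unfolding bd_def gsem_def by (metis fst_conv snd_conv)
    then show ?thesis
      by (intro bdI[OF C(1)]) (auto simp: gsem_def lattice.Dp_J[OF lat a] intro!: lattice.norm_J_le[OF lat a])
  qed
  show "bd ssem n u \<Longrightarrow> bd ssem n (JJ a u)"
  proof -
    assume "bd ssem n u"
    then obtain C where C: "C \<ge> 0" "\<And>\<omega> d p. \<omega> \<in> \<Omega> \<Longrightarrow> norm (lattice.Sd (sh \<omega>) (sb \<omega>) (h \<omega>) d (u \<omega>) p) \<le> C * k \<omega> ^ n"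
      unfolding bd_def ssem_def by (metis fst_conv snd_conv)
    then show ?thesis
      by (intro bdI[OF C(1)]) (auto simp: ssem_def lattice.Sd_J[OF lat a] intro!: lattice.norm_J_le[OF lat a])
  qed
  show "bd hsem n u \<Longrightarrow> bd hsem n (JJ a u)"
  proof -
    assume "bd hsem n u"
    then obtain C where C: "C \<ge> 0" "\<And>\<omega> e. \<omega> \<in> \<Omega> \<Longrightarrow> \<bar>lattice.ip (B \<omega>) (h \<omega>) (u \<omega>) e\<bar>
      \<le> C * k \<omega> ^ n * (lattice.nrm (B \<omega>) (h \<omega>) e + lattice.gn (B \<omega>) (sh \<omega>) (h \<omega>) e)"
      by (rule bd_hE) blast
    show ?thesis
    proof (rule bd_hI[OF C(1)])
      fix \<omega> e assume w: "\<omega> \<in> \<Omega>"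
      interpret lattice "B \<omega>" "sh \<omega>" "sb \<omega>" "h \<omega>" "k \<omega>" \<alpha> \<beta> "f \<omega>" by (rule lat[OF w])
      have "\<bar>ip (J a (u \<omega>)) e\<bar> \<le> C * k \<omega> ^ n * (nrm (J a e) + gn (J a e))"
        unfolding ip_J[OF a] by (rule C(2)[OF w])
      also have "\<dots> \<le> C * k \<omega> ^ n * (nrm e + gn e)"
        using C pow_k[OF w] by (intro mult_left_mono add_mono nrm_J_le gn_J_le a) auto
      finally show "\<bar>ip (J a (u \<omega>)) e\<bar> \<le> C * k \<omega> ^ n * (nrm e + gn e)" .
    qed
  qed
qed

lemma J_ZZ: "a > 0 \<Longrightarrow> \<omega> \<in> \<Omega> \<Longrightarrow> ZZ (JJ a u) \<omega> p = (1/a) *\<^sub>R (JJ a u \<omega> p - u \<omega> p)"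
  using lattice.J_eq[OF lat, of \<omega> a "u \<omega>" p] by simp

text \<open>After a resolvent \<open>Z\<close> costs nothing, as Z J u = (J u - u)/a; estimated by
  itself from a pointwise bound, \<open>Z\<close> would lose a power of k.\<close>

lemma bd_ZJ:
  assumes a: "a > 0"
  shows "bd psem n u \<Longrightarrow> bd psem n (ZZ (JJ a u))" "bd hsem n u \<Longrightarrow> bd hsem n (ZZ (JJ a u))"
  using a by (auto intro!: bd_eq[OF _ J_ZZ] bd_lin bd_J)

lemma bd_J_smooth:
  assumes a: "a > 0"
  shows "bd hsem n u \<Longrightarrow> bd lsem n (JJ a u)"
proof -
  assume "bd hsem n u"
  then obtain C where C: "C \<ge> 0" "\<And>\<omega> e. \<omega> \<in> \<Omega> \<Longrightarrow> \<bar>lattice.ip (B \<omega>) (h \<omega>) (u \<omega>) e\<bar>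
    \<le> C * k \<omega> ^ n * (lattice.nrm (B \<omega>) (h \<omega>) e + lattice.gn (B \<omega>) (sh \<omega>) (h \<omega>) e)"
    by (rule bd_hE) blast
  show ?thesis
  proof (rule bdI[of "(1 + 1 / sqrt (a * \<bar>\<beta>\<bar>)) * C"])
    fix \<omega> i assume w: "\<omega> \<in> \<Omega>"
    interpret lattice "B \<omega>" "sh \<omega>" "sb \<omega>" "h \<omega>" "k \<omega>" \<alpha> \<beta> "f \<omega>" by (rule lat[OF w])
    have "sqrt (k \<omega>) * nrm (J a (u \<omega>)) \<le> (1 + 1 / sqrt (a * \<beta>)) * (C * k \<omega> ^ n)"
      using C pow_k[OF w] by (intro nrm_J_dual_le a k_le[OF w] C(2)[OF w]) auto
    then show "lsem \<omega> (J a (u \<omega>)) i \<le> (1 + 1 / sqrt (a * \<bar>\<beta>\<bar>)) * C * k \<omega> ^ n"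
      using \<beta>_pos by (simp add: lsem_def mult.assoc)
  qed (use C a in auto)
qed

end

section \<open>Linearisation estimates, uniform over the family\<close>

locale nonlinear_family = lattice_family +
  assumes f_bd: "bd psem 0 f"
begin

text \<open>Filter form of \<open>bd\<close>: any finite number of bounds can be combined by
  \<open>eventually_conj\<close> and then be served by one common constant.\<close>

lemma bd_eventually:
  "bd S n u \<Longrightarrow> \<forall>\<^sub>F C in at_top. \<forall>\<omega>\<in>\<Omega>. \<forall>i. S \<omega> (u \<omega>) i \<le> C * k \<omega> ^ n"
proof -
  assume "bd S n u"
  then obtain C where C: "\<And>\<omega> i. \<omega> \<in> \<Omega> \<Longrightarrow> S \<omega> (u \<omega>) i \<le> C * k \<omega> ^ n"
    unfolding bd_def by blast
  show ?thesis
    unfolding eventually_at_top_linorder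
  proof (intro exI[of _ C] allI impI ballI)
    fix D \<omega> i assume "C \<le> D" "\<omega> \<in> \<Omega>"
    then show "S \<omega> (u \<omega>) i \<le> D * k \<omega> ^ n"
      using C[of \<omega> i] mult_right_mono[of C D "k \<omega> ^ n"] pow_k(1)[of \<omega> n] by linarith
  qed
qed

lemma bd_g_eventually:
  "bd gsem n u \<Longrightarrow> \<forall>\<^sub>F C in at_top. \<forall>\<omega>\<in>\<Omega>. \<forall>d p.
    norm (lattice.Ac (sh \<omega>) (sb \<omega>) (h \<omega>) d (u \<omega>) p) \<le> C * k \<omega> ^ n"
  by (drule bd_eventually, erule eventually_mono)
    (auto simp: gsem_def intro!: lattice.norm_Ac_le[OF lat])

lemma bd_p_eventually:
  "bd psem n u \<Longrightarrow> \<forall>\<^sub>F C in at_top. \<forall>\<omega>\<in>\<Omega>. \<forall>p. norm (u \<omega> p) \<le> C * k \<omega> ^ n"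
  by (drule bd_eventually) (simp add: psem_def)

lemma at_top_real_obtain:
  assumes "eventually P (at_top :: real filter)"
  obtains C where "P C" "C \<ge> 0"
  using eventually_happens'[OF trivial_limit_at_top_linorder eventually_conj[OF assms eventually_ge_at_top[of 0]]]
  by blast

lemma bd_NL_expand:
  assumes u: "bd psem 0 u" "bd gsem 0 u" and v: "bd psem 1 v" "bd gsem 1 v"
  shows "bd psem 2 (\<lambda>\<omega> p. NN (\<lambda>\<omega> p. u \<omega> p + v \<omega> p) \<omega> p - NN u \<omega> p - DD u v \<omega> p)"
proof -
  obtain K where K: "K \<ge> 0"
    "\<And>\<omega> p. \<omega> \<in> \<Omega> \<Longrightarrow> norm (u \<omega> p) \<le> K"
    "\<And>\<omega> d p. \<omega> \<in> \<Omega> \<Longrightarrow> norm (lattice.Ac (sh \<omega>) (sb \<omega>) (h \<omega>) d (u \<omega>) p) \<le> K"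
    "\<And>\<omega> p. \<omega> \<in> \<Omega> \<Longrightarrow> norm (v \<omega> p) \<le> K * k \<omega>"
    "\<And>\<omega> d p. \<omega> \<in> \<Omega> \<Longrightarrow> norm (lattice.Ac (sh \<omega>) (sb \<omega>) (h \<omega>) d (v \<omega>) p) \<le> K * k \<omega>"
    "\<And>\<omega> p. \<omega> \<in> \<Omega> \<Longrightarrow> norm (f \<omega> p) \<le> K"
    using eventually_conj[OF bd_p_eventually[OF u(1)] eventually_conj[OF bd_g_eventually[OF u(2)]
      eventually_conj[OF bd_p_eventually[OF v(1)] eventually_conj[OF bd_g_eventually[OF v(2)] bd_p_eventually[OF f_bd]]]]]
    by (rule at_top_real_obtain) auto
  show ?thesis
  proof (rule bdI[of "(12 * \<bar>\<beta>\<bar> + \<bar>\<alpha>\<bar>) * K * K\<^sup>2"])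
    fix \<omega> p assume w: "\<omega> \<in> \<Omega>"
    interpret lattice "B \<omega>" "sh \<omega>" "sb \<omega>" "h \<omega>" "k \<omega>" \<alpha> \<beta> "f \<omega>" by (rule lat[OF w])
    have "norm (NL (\<lambda>p. u \<omega> p + v \<omega> p) p - NL (u \<omega>) p - DN (u \<omega>) (v \<omega>) p)
      \<le> (12 * \<beta> + \<alpha>) * K * (K * k \<omega>)\<^sup>2"
      using k_le[OF w] K(1) by (intro norm_NL_expand_le K w) (simp add: mult_left_le)
    then show "psem \<omega> (\<lambda>p. NL (\<lambda>p. u \<omega> p + v \<omega> p) p - NL (u \<omega>) p - DN (u \<omega>) (v \<omega>) p) p
      \<le> (12 * \<bar>\<beta>\<bar> + \<bar>\<alpha>\<bar>) * K * K\<^sup>2 * k \<omega> ^ 2"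
      using \<alpha>_pos \<beta>_pos by (simp add: psem_def power_mult_distrib mult.assoc)
  qed (use K in auto)
qed

lemma bd_DD:
  assumes u: "bd psem 0 u" "bd gsem 0 u" and v: "bd psem n v" "bd gsem n v"
  shows "bd psem n (DD u v)"
proof -
  obtain K where K: "K \<ge> 0"
    "\<And>\<omega> p. \<omega> \<in> \<Omega> \<Longrightarrow> norm (u \<omega> p) \<le> K"
    "\<And>\<omega> d p. \<omega> \<in> \<Omega> \<Longrightarrow> norm (lattice.Ac (sh \<omega>) (sb \<omega>) (h \<omega>) d (u \<omega>) p) \<le> K"
    "\<And>\<omega> p. \<omega> \<in> \<Omega> \<Longrightarrow> norm (v \<omega> p) \<le> K * k \<omega> ^ n"
    "\<And>\<omega> d p. \<omega> \<in> \<Omega> \<Longrightarrow> norm (lattice.Ac (sh \<omega>) (sb \<omega>) (h \<omega>) d (v \<omega>) p) \<le> K * k \<omega> ^ n"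
    "\<And>\<omega> p. \<omega> \<in> \<Omega> \<Longrightarrow> norm (f \<omega> p) \<le> K"
    using eventually_conj[OF bd_p_eventually[OF u(1)] eventually_conj[OF bd_g_eventually[OF u(2)]
      eventually_conj[OF bd_p_eventually[OF v(1)] eventually_conj[OF bd_g_eventually[OF v(2)] bd_p_eventually[OF f_bd]]]]]
    by (rule at_top_real_obtain) auto
  show ?thesis
  proof (rule bdI[of "(9 * \<bar>\<beta>\<bar> + 2 * \<bar>\<alpha>\<bar>) * K\<^sup>2 * K"])
    fix \<omega> p assume w: "\<omega> \<in> \<Omega>"
    interpret lattice "B \<omega>" "sh \<omega>" "sb \<omega>" "h \<omega>" "k \<omega>" \<alpha> \<beta> "f \<omega>" by (rule lat[OF w])
    have "norm (DN (u \<omega>) (v \<omega>) p) \<le> (9 * \<beta> + 2 * \<alpha>) * K\<^sup>2 * (K * k \<omega> ^ n)"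
      by (intro norm_DN_le K w)
    then show "psem \<omega> (DN (u \<omega>) (v \<omega>)) p \<le> (9 * \<bar>\<beta>\<bar> + 2 * \<bar>\<alpha>\<bar>) * K\<^sup>2 * K * k \<omega> ^ n"
      using \<alpha>_pos \<beta>_pos by (simp add: psem_def mult.assoc)
  qed (use K in auto)
qed

lemma bd_DD_diff:
  assumes u: "bd psem 0 u" "bd gsem 0 u" and v: "bd psem 1 v" "bd gsem 1 v"
    and w: "bd psem 1 w" "bd gsem 1 w"
  shows "bd psem 2 (\<lambda>\<omega> p. DD (\<lambda>\<omega> p. u \<omega> p + w \<omega> p) v \<omega> p - DD u v \<omega> p)"
proof -
  obtain K where K: "K \<ge> 0"
    "\<And>\<omega> p. \<omega> \<in> \<Omega> \<Longrightarrow> norm (u \<omega> p) \<le> K"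
    "\<And>\<omega> d p. \<omega> \<in> \<Omega> \<Longrightarrow> norm (lattice.Ac (sh \<omega>) (sb \<omega>) (h \<omega>) d (u \<omega>) p) \<le> K"
    "\<And>\<omega> p. \<omega> \<in> \<Omega> \<Longrightarrow> norm (v \<omega> p) \<le> K * k \<omega>"
    "\<And>\<omega> d p. \<omega> \<in> \<Omega> \<Longrightarrow> norm (lattice.Ac (sh \<omega>) (sb \<omega>) (h \<omega>) d (v \<omega>) p) \<le> K * k \<omega>"
    "\<And>\<omega> p. \<omega> \<in> \<Omega> \<Longrightarrow> norm (w \<omega> p) \<le> K * k \<omega>"
    "\<And>\<omega> d p. \<omega> \<in> \<Omega> \<Longrightarrow> norm (lattice.Ac (sh \<omega>) (sb \<omega>) (h \<omega>) d (w \<omega>) p) \<le> K * k \<omega>"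
    "\<And>\<omega> p. \<omega> \<in> \<Omega> \<Longrightarrow> norm (f \<omega> p) \<le> K"
    using eventually_conj[OF bd_p_eventually[OF u(1)] eventually_conj[OF bd_g_eventually[OF u(2)]
      eventually_conj[OF bd_p_eventually[OF v(1)] eventually_conj[OF bd_g_eventually[OF v(2)]
      eventually_conj[OF bd_p_eventually[OF w(1)] eventually_conj[OF bd_g_eventually[OF w(2)] bd_p_eventually[OF f_bd]]]]]]]
    by (rule at_top_real_obtain) auto
  show ?thesis
  proof (rule bdI[of "(27 * \<bar>\<beta>\<bar> + 2 * \<bar>\<alpha>\<bar>) * K * K\<^sup>2"])
    fix \<omega> p assume w: "\<omega> \<in> \<Omega>"
    interpret lattice "B \<omega>" "sh \<omega>" "sb \<omega>" "h \<omega>" "k \<omega>" \<alpha> \<beta> "f \<omega>" by (rule lat[OF w])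
    have "norm (DN (\<lambda>p. u \<omega> p + w \<omega> p) (v \<omega>) p - DN (u \<omega>) (v \<omega>) p)
      \<le> (27 * \<beta> + 2 * \<alpha>) * K * (K * k \<omega>) * (K * k \<omega>)"
      using k_le[OF w] K(1) by (intro norm_DN_diff_le K w) (simp add: mult_left_le)
    then show "psem \<omega> (\<lambda>p. DN (\<lambda>p. u \<omega> p + w \<omega> p) (v \<omega>) p - DN (u \<omega>) (v \<omega>) p) p
      \<le> (27 * \<bar>\<beta>\<bar> + 2 * \<bar>\<alpha>\<bar>) * K * K\<^sup>2 * k \<omega> ^ 2"
      using \<alpha>_pos \<beta>_pos by (simp add: psem_def power2_eq_square mult_ac)
  qed (use K in auto)
qed

text \<open>Only the size of b is known; its differences may be larger by 1/h. In the dual norm they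
  are never formed, as summation by parts removes them.\<close>

lemma bd_DD_h:
  assumes u: "bd psem 0 u" "bd gsem 0 u" "bd ssem 0 u" and b: "bd psem n b"
  shows "bd hsem n (DD u b)"
proof -
  obtain K where K: "K \<ge> 0"
    "\<And>\<omega> p. \<omega> \<in> \<Omega> \<Longrightarrow> norm (u \<omega> p) \<le> K"
    "\<And>\<omega> d p. \<omega> \<in> \<Omega> \<Longrightarrow> norm (lattice.Ac (sh \<omega>) (sb \<omega>) (h \<omega>) d (u \<omega>) p) \<le> K"
    "\<And>\<omega> i. \<omega> \<in> \<Omega> \<Longrightarrow> ssem \<omega> (u \<omega>) i \<le> K"
    "\<And>\<omega> p. \<omega> \<in> \<Omega> \<Longrightarrow> norm (b \<omega> p) \<le> K * k \<omega> ^ n"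
    "\<And>\<omega> p. \<omega> \<in> \<Omega> \<Longrightarrow> norm (f \<omega> p) \<le> K"
    using eventually_conj[OF bd_p_eventually[OF u(1)] eventually_conj[OF bd_g_eventually[OF u(2)]
      eventually_conj[OF bd_eventually[OF u(3)] eventually_conj[OF bd_p_eventually[OF b] bd_p_eventually[OF f_bd]]]]]
    by (rule at_top_real_obtain) auto
  show ?thesis
  proof (rule bd_hI[of "((21 * \<bar>\<beta>\<bar> + 2 * \<bar>\<alpha>\<bar>) * K\<^sup>2) * (3 * K)"])
    fix \<omega> e assume w: "\<omega> \<in> \<Omega>"
    interpret lattice "B \<omega>" "sh \<omega>" "sb \<omega>" "h \<omega>" "k \<omega>" \<alpha> \<beta> "f \<omega>" by (rule lat[OF w])
    have "\<bar>ip (DN (u \<omega>) (b \<omega>)) e\<bar> \<le> ((21 * \<beta> + 2 * \<alpha>) * K\<^sup>2) * nrm (b \<omega>) * (nrm e + gn e)"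
      using K(4)[OF w, unfolded ssem_def, of "(_, _)"] by (intro ip_DN_le K w) simp
    also have "\<dots> \<le> ((21 * \<beta> + 2 * \<alpha>) * K\<^sup>2) * (3 * (K * k \<omega> ^ n)) * (nrm e + gn e)"
      using \<alpha>_pos \<beta>_pos K pow_k[OF w] w by (intro mult_right_mono mult_left_mono nrm_le) auto
    finally show "\<bar>ip (DN (u \<omega>) (b \<omega>)) e\<bar>
      \<le> ((21 * \<bar>\<beta>\<bar> + 2 * \<bar>\<alpha>\<bar>) * K\<^sup>2) * (3 * K) * k \<omega> ^ n * (nrm e + gn e)"
      using \<alpha>_pos \<beta>_pos by (simp add: mult.assoc)
  qed (use K in auto)
qed

text \<open>The resolvent returns the derivative that DN loses: its energy identity bounds sqrt k
  times the gradient of J b by a multiple of the norm of b, and that sqrt k is the weight of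
  \<open>lsem\<close>.\<close>

lemma bd_DD_l:
  assumes u: "bd psem 0 u" "bd gsem 0 u" and b: "bd psem n b" and a: "a > 0"
  shows "bd lsem n (DD u (JJ a b))"
proof -
  obtain K where K: "K \<ge> 0"
    "\<And>\<omega> p. \<omega> \<in> \<Omega> \<Longrightarrow> norm (u \<omega> p) \<le> K"
    "\<And>\<omega> d p. \<omega> \<in> \<Omega> \<Longrightarrow> norm (lattice.Ac (sh \<omega>) (sb \<omega>) (h \<omega>) d (u \<omega>) p) \<le> K"
    "\<And>\<omega> p. \<omega> \<in> \<Omega> \<Longrightarrow> norm (b \<omega> p) \<le> K * k \<omega> ^ n"
    "\<And>\<omega> p. \<omega> \<in> \<Omega> \<Longrightarrow> norm (f \<omega> p) \<le> K"
    using eventually_conj[OF bd_p_eventually[OF u(1)] eventually_conj[OF bd_g_eventually[OF u(2)]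
      eventually_conj[OF bd_p_eventually[OF b] bd_p_eventually[OF f_bd]]]]
    by (rule at_top_real_obtain) auto
  let ?D = "(1 + 3 / sqrt (a * \<bar>\<beta>\<bar>)) * (3 * K)"
  show ?thesis
  proof (rule bdI[of "((9 * \<bar>\<beta>\<bar> + 2 * \<bar>\<alpha>\<bar>) * K\<^sup>2) * ?D"])
    fix \<omega> i assume w: "\<omega> \<in> \<Omega>"
    interpret lattice "B \<omega>" "sh \<omega>" "sb \<omega>" "h \<omega>" "k \<omega>" \<alpha> \<beta> "f \<omega>" by (rule lat[OF w])
    let ?v = "J a (b \<omega>)" and ?s = "sqrt (k \<omega>)"
    have nb: "nrm (b \<omega>) \<le> 3 * (K * k \<omega> ^ n)"
      using K pow_k[OF w] w by (intro nrm_le) auto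
    have nv: "nrm ?v \<le> nrm (b \<omega>)" using a by (intro nrm_J_le) auto
    have "(?s * gn ?v * sqrt (a * \<beta>))\<^sup>2 = a * (k \<omega> * \<beta>) * (gn ?v)\<^sup>2"
      using k_pos a \<beta>_pos by (simp add: power_mult_distrib)
    also have "\<dots> \<le> ip (b \<omega>) ?v"
      using J_energy[of a "b \<omega>"] a by (smt (verit) zero_le_power2)
    also have "\<dots> \<le> nrm (b \<omega>) * nrm ?v" using ip_CS[of "b \<omega>" ?v] by linarith
    also have "\<dots> \<le> nrm (b \<omega>) * nrm (b \<omega>)" by (intro mult_left_mono nv) auto
    finally have "(?s * gn ?v * sqrt (a * \<beta>))\<^sup>2 \<le> (nrm (b \<omega>))\<^sup>2" by (simp add: power2_eq_square)
    then have "?s * gn ?v * sqrt (a * \<beta>) \<le> nrm (b \<omega>)" by (rule power2_le_imp_le) simp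
    then have g: "?s * gn ?v \<le> (1 / sqrt (a * \<beta>)) * nrm (b \<omega>)"
      using a \<beta>_pos by (simp add: field_simps)
    have s1: "?s * nrm ?v \<le> nrm (b \<omega>)"
      using mult_mono[of ?s 1 "nrm ?v" "nrm (b \<omega>)"] nv k_le[OF w] by simp
    have "?s * nrm (DN (u \<omega>) ?v) \<le> ?s * (((9 * \<beta> + 2 * \<alpha>) * K\<^sup>2) * (nrm ?v + 3 * gn ?v))"
      by (intro mult_left_mono nrm_DN_le K w) (simp add: k_pos order_less_imp_le)
    also have "\<dots> = ((9 * \<beta> + 2 * \<alpha>) * K\<^sup>2) * (?s * nrm ?v + 3 * (?s * gn ?v))"
      by (simp add: algebra_simps)
    also have "\<dots> \<le> ((9 * \<beta> + 2 * \<alpha>) * K\<^sup>2) * (nrm (b \<omega>) + 3 * ((1 / sqrt (a * \<beta>)) * nrm (b \<omega>)))"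
      using \<alpha>_pos \<beta>_pos by (intro mult_left_mono add_mono s1 g) auto
    also have "\<dots> = ((9 * \<beta> + 2 * \<alpha>) * K\<^sup>2) * ((1 + 3 / sqrt (a * \<beta>)) * nrm (b \<omega>))"
      by (simp add: algebra_simps)
    also have "\<dots> \<le> ((9 * \<beta> + 2 * \<alpha>) * K\<^sup>2) * ((1 + 3 / sqrt (a * \<beta>)) * (3 * (K * k \<omega> ^ n)))"
      using \<alpha>_pos \<beta>_pos a by (intro mult_left_mono nb) auto
    finally show "lsem \<omega> (DN (u \<omega>) ?v) i \<le> ((9 * \<bar>\<beta>\<bar> + 2 * \<bar>\<alpha>\<bar>) * K\<^sup>2) * ?D * k \<omega> ^ n"
      using \<alpha>_pos \<beta>_pos by (simp add: lsem_def mult.assoc)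
  qed (use K a in auto)
qed

lemma bd_NL_diff:
  assumes u: "bd psem 0 u" "bd gsem 0 u" and v: "bd psem 1 v" "bd gsem 1 v"
  shows "bd psem 1 (\<lambda>\<omega> p. NN (\<lambda>\<omega> p. u \<omega> p + v \<omega> p) \<omega> p - NN u \<omega> p)"
  by (rule bd_eq[OF bd_add[OF sem_p bd_mono[OF bd_NL_expand[OF assms], of 1] bd_DD[OF assms]]]) auto

end

section \<open>Consistency\<close>

context lattice
begin

text \<open>
  With \<open>v\<close> one time step after \<open>u\<close>, \<open>refY u v\<close> is the modified solution at the time of \<open>u\<close>: \<open>refW\<close> cancels
  the second-order part of the residual of the fourth stage, and the increment of \<open>NL\<close> that of the last one.
\<close>
definition refb :: "('a \<Rightarrow> real^3) \<Rightarrow> ('a \<Rightarrow> real^3) \<Rightarrow> 'a \<Rightarrow> real^3"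
  where "refb u v p = (1/24) *\<^sub>R Z (\<lambda>p. v p - u p) p
    - (k/12) *\<^sub>R ((NL v p - NL u p) + 2 *\<^sub>R (NL (J (1/4) u) p - NL u p))"

definition refW :: "('a \<Rightarrow> real^3) \<Rightarrow> ('a \<Rightarrow> real^3) \<Rightarrow> 'a \<Rightarrow> real^3"
  where "refW u v = J (1/12) (refb u v)"

definition refY :: "('a \<Rightarrow> real^3) \<Rightarrow> ('a \<Rightarrow> real^3) \<Rightarrow> 'a \<Rightarrow> real^3"
  where "refY u v p = u p + ((k/4) *\<^sub>R (NL v p - NL u p) + refW u v p)"

definition ref2 :: "('a \<Rightarrow> real^3) \<Rightarrow> ('a \<Rightarrow> real^3) \<Rightarrow> 'a \<Rightarrow> real^3"
  where "ref2 u v = J (1/4) (refY u v)"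

definition ref3 :: "('a \<Rightarrow> real^3) \<Rightarrow> ('a \<Rightarrow> real^3) \<Rightarrow> 'a \<Rightarrow> real^3"
  where "ref3 u v = J (1/4) (\<lambda>p. refY u v p + (k/2) *\<^sub>R NL (ref2 u v) p)"

definition ref4 :: "('a \<Rightarrow> real^3) \<Rightarrow> ('a \<Rightarrow> real^3) \<Rightarrow> 'a \<Rightarrow> real^3"
  where "ref4 u v p = v p + refW u v p"

text \<open>The residual of the Crank-Nicolson scheme v - u = (Z u + Z v)/2 + k (NL u + NL v)/2,
  written in terms of u and the increments from u to v.\<close>

definition cn_res :: "('a \<Rightarrow> real^3) \<Rightarrow> ('a \<Rightarrow> real^3) \<Rightarrow> 'a \<Rightarrow> real^3"
  where "cn_res u v p = v p - u p - Z u p - k *\<^sub>R NL u p - (1/2) *\<^sub>R Z (\<lambda>p. v p - u p) p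
    - (k/2) *\<^sub>R (NL v p - NL u p)"

definition res4 :: "('a \<Rightarrow> real^3) \<Rightarrow> ('a \<Rightarrow> real^3) \<Rightarrow> 'a \<Rightarrow> real^3"
  where "res4 u v p = ref4 u v p - refY u v p - (k/2) *\<^sub>R (NL (ref2 u v) p + NL (ref3 u v) p)
    - (1/3) *\<^sub>R Z (\<lambda>p. ref2 u v p + ref3 u v p + ref4 u v p) p"

definition res5 :: "('a \<Rightarrow> real^3) \<Rightarrow> ('a \<Rightarrow> real^3) \<Rightarrow> ('a \<Rightarrow> real^3) \<Rightarrow> 'a \<Rightarrow> real^3"
  where "res5 u v w p = refY v w p - ref4 u v p - (k/3) *\<^sub>R NL (ref4 u v) p
    + (k/6) *\<^sub>R (NL (ref2 u v) p + NL (ref3 u v) p)"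

text \<open>Half the defect of 2u + (v - u)/2 in the sum of the equations of stages 2 and 3.\<close>

definition mid_err :: "('a \<Rightarrow> real^3) \<Rightarrow> ('a \<Rightarrow> real^3) \<Rightarrow> 'a \<Rightarrow> real^3"
  where "mid_err u v p = refW u v p + (k/8) *\<^sub>R (NL v p - NL u p) - (1/16) *\<^sub>R Z (\<lambda>p. v p - u p) p
    - (1/4) *\<^sub>R cn_res u v p + (k/4) *\<^sub>R (NL (ref2 u v) p - NL u p)"

definition nl_err :: "('a \<Rightarrow> real^3) \<Rightarrow> ('a \<Rightarrow> real^3) \<Rightarrow> 'a \<Rightarrow> real^3"
  where "nl_err u v p = NL (ref2 u v) p + NL (ref3 u v) p - 2 *\<^sub>R NL u p - (1/2) *\<^sub>R (NL v p - NL u p)"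

text \<open>Stages 2 and 3 share the operator 1 - Z/4, so their sum solves one resolvent equation.
  Eliminating k NL u by the Crank-Nicolson identity shows that 2u + (v - u)/2 solves it up to twice
  \<open>mid_err\<close>: the two stages average to the time t + k/4.\<close>

lemma ref23_eq:
  "ref2 u v p + ref3 u v p = 2 *\<^sub>R u p + (1/2) *\<^sub>R (v p - u p) + 2 *\<^sub>R J (1/4) (mid_err u v) p"
proof -
  define a where "a p = 2 *\<^sub>R u p + (1/2) *\<^sub>R (v p - u p)" for p
  have Za: "Z a p = 2 *\<^sub>R Z u p + (1/2) *\<^sub>R Z (\<lambda>p. v p - u p) p" for p
    unfolding a_def by (simp add: Z_lin)
  have "(\<lambda>p. ref2 u v p + ref3 u v p)
      = J (1/4) (\<lambda>p. refY u v p + (refY u v p + (k/2) *\<^sub>R NL (ref2 u v) p))"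
    unfolding ref3_def by (subst (1) ref2_def) (rule J_add[symmetric], simp)
  also have "(\<lambda>p. refY u v p + (refY u v p + (k/2) *\<^sub>R NL (ref2 u v) p))
      = (\<lambda>p. (a p - (1/4) *\<^sub>R Z a p) + 2 *\<^sub>R mid_err u v p)"
  proof
    fix p
    show "refY u v p + (refY u v p + (k/2) *\<^sub>R NL (ref2 u v) p)
      = (a p - (1/4) *\<^sub>R Z a p) + 2 *\<^sub>R mid_err u v p"
      unfolding Za unfolding a_def refY_def mid_err_def cn_res_def
      by (simp add: vec_eq_iff field_simps)
  qed
  also have "J (1/4) \<dots> = (\<lambda>p. a p + 2 *\<^sub>R J (1/4) (mid_err u v) p)"
    by (simp add: J_add J_scale J_cancel)
  finally show ?thesis unfolding a_def by meson
qed

text \<open>The three stages sum to 3u + (3/2)(v - u) + 2 J mid_err + W, and the leading part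
  reproduces the Crank-Nicolson terms. What remains under \<open>Z\<close> is J (1/4) applied to 2
  mid_err + W - Z W/4. There W enters as 3 (W - Z W/12) = 3 \<open>refb\<close>, and the
  coefficients of \<open>refb\<close> are chosen to cancel - Z (v - u)/8, k/4 times the increment of
  NL, and k/2 times NL (J u) - NL u. The argument J u stands in for stage 2, which would make the
  definition of W circular.\<close>

lemma res4_eq:
  "res4 u v p = - (k/2) *\<^sub>R nl_err u v p + cn_res u v p
    - (1/3) *\<^sub>R Z (J (1/4) (\<lambda>p. (k/2) *\<^sub>R (NL (ref2 u v) p - NL (J (1/4) u) p) - (1/2) *\<^sub>R cn_res u v p)) p"
proof -
  define E where "E = (\<lambda>p. v p - u p)"
  have W: "refW u v p - (1/12) *\<^sub>R Z (refW u v) p = refb u v p" for p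
    using J_eq[of "1/12" "refb u v" p] by (simp add: refW_def)
  have "(\<lambda>p. ref2 u v p + ref3 u v p + ref4 u v p)
    = (\<lambda>p. (3 *\<^sub>R u p + (3/2) *\<^sub>R E p) + (2 *\<^sub>R J (1/4) (mid_err u v) p + refW u v p))"
    unfolding ref23_eq ref4_def E_def by (auto simp: vec_eq_iff field_simps)
  then have Zs: "Z (\<lambda>p. ref2 u v p + ref3 u v p + ref4 u v p) p
    = (3 *\<^sub>R Z u p + (3/2) *\<^sub>R Z E p) + (2 *\<^sub>R Z (J (1/4) (mid_err u v)) p + Z (refW u v) p)"
    by (simp add: Z_lin)
  have "(\<lambda>p. 2 *\<^sub>R mid_err u v p + (refW u v p - (1/4) *\<^sub>R Z (refW u v) p))
    = (\<lambda>p. (k/2) *\<^sub>R (NL (ref2 u v) p - NL (J (1/4) u) p) - (1/2) *\<^sub>R cn_res u v p)"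
  proof
    fix p
    \<comment> \<open>The defining equation of W is solved for Z W, after which the cancellation is
      a linear identity in each component.\<close>
    have ZW: "Z (refW u v) p = 12 *\<^sub>R (refW u v p - refb u v p)"
      using W[of p] by (simp add: vec_eq_iff field_simps)
    show "2 *\<^sub>R mid_err u v p + (refW u v p - (1/4) *\<^sub>R Z (refW u v) p)
      = (k/2) *\<^sub>R (NL (ref2 u v) p - NL (J (1/4) u) p) - (1/2) *\<^sub>R cn_res u v p"
      unfolding ZW unfolding mid_err_def refb_def by (simp add: vec_eq_iff field_simps)
  qed
  then have "J (1/4) (\<lambda>p. (k/2) *\<^sub>R (NL (ref2 u v) p - NL (J (1/4) u) p) - (1/2) *\<^sub>R cn_res u v p)
    = (\<lambda>p. 2 *\<^sub>R J (1/4) (mid_err u v) p + refW u v p)"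
    by (simp add: J_add J_scale J_cancel flip: \<open>_ = (\<lambda>p. (k/2) *\<^sub>R (NL (ref2 u v) p - NL (J (1/4) u) p) - (1/2) *\<^sub>R cn_res u v p)\<close>)
  then have "Z (J (1/4) (\<lambda>p. (k/2) *\<^sub>R (NL (ref2 u v) p - NL (J (1/4) u) p) - (1/2) *\<^sub>R cn_res u v p)) p
    = 2 *\<^sub>R Z (J (1/4) (mid_err u v)) p + Z (refW u v) p"
    by (simp add: Z_lin)
  then show ?thesis
    unfolding res4_def Zs
    unfolding ref4_def refY_def nl_err_def cn_res_def E_def by (simp add: vec_eq_iff field_simps)
qed

text \<open>Inserting NL ref2 + NL ref3 = 2 NL u + (NL v - NL u)/2 + nl_err, the update contributes
  (k/3 - k/12) (NL v - NL u). This equals the k/4 term built into \<open>refY\<close>, so only a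
  second time difference of NL is left over.\<close>

lemma res5_eq:
  "res5 u v w p = (k/4) *\<^sub>R ((NL w p - NL v p) - (NL v p - NL u p)) + (refW v w p - refW u v p)
    - (k/3) *\<^sub>R (NL (ref4 u v) p - NL v p) + (k/6) *\<^sub>R nl_err u v p"
  unfolding res5_def refY_def nl_err_def ref4_def by (simp add: vec_eq_iff field_simps)

end

text \<open>\<open>F\<close>, \<open>F1\<close>, \<open>F2\<close> are three consecutive time
  levels. The bound \<open>gZF\<close> concerns third differences of F and is not a consequence of
  the bounds on second differences.\<close>

locale consistency = nonlinear_family +
  fixes F F1 F2 :: "'a \<Rightarrow> 'b \<Rightarrow> real^3"
  assumes F: "bd psem 0 F" "bd gsem 0 F" "bd ssem 0 F" and gZF: "bd gsem 1 (ZZ F)"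
    and E: "bd psem 1 (\<lambda>\<omega> p. F1 \<omega> p - F \<omega> p)" "bd gsem 1 (\<lambda>\<omega> p. F1 \<omega> p - F \<omega> p)"
      "bd ssem 1 (\<lambda>\<omega> p. F1 \<omega> p - F \<omega> p)"
    and E1: "bd psem 1 (\<lambda>\<omega> p. F2 \<omega> p - F1 \<omega> p)" "bd gsem 1 (\<lambda>\<omega> p. F2 \<omega> p - F1 \<omega> p)"
      "bd ssem 1 (\<lambda>\<omega> p. F2 \<omega> p - F1 \<omega> p)"
    and EE: "bd psem 2 (\<lambda>\<omega> p. (F2 \<omega> p - F1 \<omega> p) - (F1 \<omega> p - F \<omega> p))"
      "bd gsem 2 (\<lambda>\<omega> p. (F2 \<omega> p - F1 \<omega> p) - (F1 \<omega> p - F \<omega> p))"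
      "bd ssem 2 (\<lambda>\<omega> p. (F2 \<omega> p - F1 \<omega> p) - (F1 \<omega> p - F \<omega> p))"
    and cn: "bd psem 2 (\<lambda>\<omega>. lattice.cn_res (sh \<omega>) (sb \<omega>) (h \<omega>) (k \<omega>) \<alpha> \<beta> (f \<omega>) (F \<omega>) (F1 \<omega>))"
      "bd hsem 3 (\<lambda>\<omega>. lattice.cn_res (sh \<omega>) (sb \<omega>) (h \<omega>) (k \<omega>) \<alpha> \<beta> (f \<omega>) (F \<omega>) (F1 \<omega>))"
begin

section \<open>Orders of the reference stages and of their residuals\<close>

abbreviation (input) "Ef \<equiv> \<lambda>\<omega> p. F1 \<omega> p - F \<omega> p"
abbreviation (input) "Ef1 \<equiv> \<lambda>\<omega> p. F2 \<omega> p - F1 \<omega> p"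
abbreviation (input) "CN \<equiv> \<lambda>\<omega>. lattice.cn_res (sh \<omega>) (sb \<omega>) (h \<omega>) (k \<omega>) \<alpha> \<beta> (f \<omega>) (F \<omega>) (F1 \<omega>)"
abbreviation (input) "bf \<equiv> \<lambda>\<omega>. lattice.refb (sh \<omega>) (sb \<omega>) (h \<omega>) (k \<omega>) \<alpha> \<beta> (f \<omega>) (F \<omega>) (F1 \<omega>)"
abbreviation (input) "bf1 \<equiv> \<lambda>\<omega>. lattice.refb (sh \<omega>) (sb \<omega>) (h \<omega>) (k \<omega>) \<alpha> \<beta> (f \<omega>) (F1 \<omega>) (F2 \<omega>)"
abbreviation (input) "Wf \<equiv> \<lambda>\<omega>. lattice.refW (sh \<omega>) (sb \<omega>) (h \<omega>) (k \<omega>) \<alpha> \<beta> (f \<omega>) (F \<omega>) (F1 \<omega>)"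
abbreviation (input) "Wf1 \<equiv> \<lambda>\<omega>. lattice.refW (sh \<omega>) (sb \<omega>) (h \<omega>) (k \<omega>) \<alpha> \<beta> (f \<omega>) (F1 \<omega>) (F2 \<omega>)"
abbreviation (input) "Yf \<equiv> \<lambda>\<omega>. lattice.refY (sh \<omega>) (sb \<omega>) (h \<omega>) (k \<omega>) \<alpha> \<beta> (f \<omega>) (F \<omega>) (F1 \<omega>)"
abbreviation (input) "Yf1 \<equiv> \<lambda>\<omega>. lattice.refY (sh \<omega>) (sb \<omega>) (h \<omega>) (k \<omega>) \<alpha> \<beta> (f \<omega>) (F1 \<omega>) (F2 \<omega>)"
abbreviation (input) "w2 \<equiv> \<lambda>\<omega>. lattice.ref2 (sh \<omega>) (sb \<omega>) (h \<omega>) (k \<omega>) \<alpha> \<beta> (f \<omega>) (F \<omega>) (F1 \<omega>)"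
abbreviation (input) "w3 \<equiv> \<lambda>\<omega>. lattice.ref3 (sh \<omega>) (sb \<omega>) (h \<omega>) (k \<omega>) \<alpha> \<beta> (f \<omega>) (F \<omega>) (F1 \<omega>)"
abbreviation (input) "w4 \<equiv> \<lambda>\<omega>. lattice.ref4 (sh \<omega>) (sb \<omega>) (h \<omega>) (k \<omega>) \<alpha> \<beta> (f \<omega>) (F \<omega>) (F1 \<omega>)"
abbreviation (input) "X \<equiv> \<lambda>\<omega>. lattice.nl_err (sh \<omega>) (sb \<omega>) (h \<omega>) (k \<omega>) \<alpha> \<beta> (f \<omega>) (F \<omega>) (F1 \<omega>)"
abbreviation (input) "b3 \<equiv> \<lambda>\<omega>. lattice.mid_err (sh \<omega>) (sb \<omega>) (h \<omega>) (k \<omega>) \<alpha> \<beta> (f \<omega>) (F \<omega>) (F1 \<omega>)"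
abbreviation (input) "RR \<equiv> \<lambda>u. JJ (1/4) u"

lemma F1: "bd psem 0 F1" "bd gsem 0 F1" "bd ssem 0 F1"
proof -
  show "bd psem 0 F1" by (rule bd_eq[OF bd_add[OF sem_p F(1) bd_mono[OF E(1), of 0]]]) simp_all
  show "bd gsem 0 F1" by (rule bd_eq[OF bd_add[OF sem_g F(2) bd_mono[OF E(2), of 0]]]) simp_all
  show "bd ssem 0 F1" by (rule bd_eq[OF bd_add[OF sem_s F(3) bd_mono[OF E(3), of 0]]]) simp_all
qed

lemma ZE: "bd psem 2 (ZZ Ef)" "bd psem 2 (ZZ Ef1)"
  "bd psem 3 (ZZ (\<lambda>\<omega> p. (F2 \<omega> p - F1 \<omega> p) - (F1 \<omega> p - F \<omega> p)))"
  using bd_s_Z[OF E(3)] bd_s_Z[OF E1(3)] bd_s_Z[OF EE(3)] by (simp_all add: numeral_eq_Suc)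

lemma ZF: "bd psem 1 (ZZ F)"
  using bd_s_Z[OF F(3)] by simp

text \<open>J F - F is one quarter of J (Z F), so the order is that of Z F, for the gradient
  too.\<close>

lemma RF_diff: "bd psem 1 (\<lambda>\<omega> p. RR F \<omega> p - F \<omega> p)" "bd gsem 1 (\<lambda>\<omega> p. RR F \<omega> p - F \<omega> p)"
proof -
  have eq: "RR F \<omega> p - F \<omega> p = (1/4) *\<^sub>R RR (ZZ F) \<omega> p" if "\<omega> \<in> \<Omega>" for \<omega> p
    using lattice.J_eq[OF lat[OF that], of "1/4" "F \<omega>" p] lattice.Z_J[OF lat[OF that], of "1/4" "F \<omega>"] by simp
  show "bd psem 1 (\<lambda>\<omega> p. RR F \<omega> p - F \<omega> p)"
    by (rule bd_eq[OF bd_scale[OF sem_p bd_J(1)[OF _ ZF]] eq]) simp_all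
  show "bd gsem 1 (\<lambda>\<omega> p. RR F \<omega> p - F \<omega> p)"
    by (rule bd_eq[OF bd_scale[OF sem_g bd_J(2)[OF _ gZF]] eq]) simp_all
qed

text \<open>Third differences of the time increment are not controlled, so its gradient is estimated
  without a gain in order.\<close>

lemma RE_diff: "bd psem 2 (\<lambda>\<omega> p. RR Ef \<omega> p - Ef \<omega> p)" "bd gsem 1 (\<lambda>\<omega> p. RR Ef \<omega> p - Ef \<omega> p)"
proof -
  have eq: "RR Ef \<omega> p - Ef \<omega> p = (1/4) *\<^sub>R RR (ZZ Ef) \<omega> p" if "\<omega> \<in> \<Omega>" for \<omega> p
    using lattice.J_eq[OF lat[OF that], of "1/4" "Ef \<omega>" p] lattice.Z_J[OF lat[OF that], of "1/4" "Ef \<omega>"] by simp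
  show "bd psem 2 (\<lambda>\<omega> p. RR Ef \<omega> p - Ef \<omega> p)"
    by (rule bd_eq[OF bd_scale[OF sem_p bd_J(1)[OF _ ZE(1)]] eq]) simp_all
  show "bd gsem 1 (\<lambda>\<omega> p. RR Ef \<omega> p - Ef \<omega> p)"
    by (intro bd_lin bd_J E) simp
qed

lemma RE: "bd psem 1 (RR Ef)" "bd gsem 1 (RR Ef)"
  by (intro bd_J E; simp)+

lemma RF1_eq: "\<omega> \<in> \<Omega> \<Longrightarrow> RR F1 \<omega> p = RR F \<omega> p + RR Ef \<omega> p"
  using lattice.J_diff[OF lat, of \<omega> "1/4" "F1 \<omega>" "F \<omega>"] by simp

lemma RF: "bd psem 0 (RR F)" "bd gsem 0 (RR F)" "bd ssem 0 (RR F)"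
  by (intro bd_J F; simp)+

lemma Mf: "bd psem 1 (\<lambda>\<omega> p. NN F1 \<omega> p - NN F \<omega> p)"
  using bd_NL_diff[OF F(1,2) E(1,2)] by simp

lemma Mf1: "bd psem 1 (\<lambda>\<omega> p. NN F2 \<omega> p - NN F1 \<omega> p)"
  using bd_NL_diff[OF F1(1,2) E1(1,2)] by simp

lemma del: "bd psem 1 (\<lambda>\<omega> p. NN (RR F) \<omega> p - NN F \<omega> p)"
  using bd_NL_diff[OF F(1,2) RF_diff] by simp

lemma del1: "bd psem 1 (\<lambda>\<omega> p. NN (RR F1) \<omega> p - NN F1 \<omega> p)"
proof -
  have eq: "RR F1 \<omega> p - F1 \<omega> p = (RR F \<omega> p - F \<omega> p) + (RR Ef \<omega> p - Ef \<omega> p)" if "\<omega> \<in> \<Omega>" for \<omega> p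
    using RF1_eq[OF that, of p] by simp
  have "bd psem 1 (\<lambda>\<omega> p. RR F1 \<omega> p - F1 \<omega> p)" "bd gsem 1 (\<lambda>\<omega> p. RR F1 \<omega> p - F1 \<omega> p)"
    by (rule bd_eq[OF bd_add[OF sem_p RF_diff(1) bd_mono[OF RE_diff(1)]] eq]; simp)
      (rule bd_eq[OF bd_add[OF sem_g RF_diff(2) RE_diff(2)] eq]; simp)
  from bd_NL_diff[OF F1(1,2) this] show ?thesis by simp
qed

lemma bf: "bd psem 2 bf"
proof (rule bd_eq)
  show "bd psem 2 (\<lambda>\<omega> p. (1/24) *\<^sub>R ZZ Ef \<omega> p
     - (1/12) *\<^sub>R (k \<omega> *\<^sub>R ((NN F1 \<omega> p - NN F \<omega> p) + 2 *\<^sub>R (NN (RR F) \<omega> p - NN F \<omega> p))))"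
    using bd_k[OF sem_p bd_add[OF sem_p Mf bd_scale[OF sem_p del, of 2]]]
    by (intro bd_diff[OF sem_p] bd_scale[OF sem_p] ZE) (simp add: numeral_2_eq_2)
qed (simp add: lattice.refb_def[OF lat])

lemma bf1: "bd psem 2 bf1"
proof (rule bd_eq)
  show "bd psem 2 (\<lambda>\<omega> p. (1/24) *\<^sub>R ZZ Ef1 \<omega> p
     - (1/12) *\<^sub>R (k \<omega> *\<^sub>R ((NN F2 \<omega> p - NN F1 \<omega> p) + 2 *\<^sub>R (NN (RR F1) \<omega> p - NN F1 \<omega> p))))"
    using bd_k[OF sem_p bd_add[OF sem_p Mf1 bd_scale[OF sem_p del1, of 2]]]
    by (intro bd_diff[OF sem_p] bd_scale[OF sem_p] ZE) (simp add: numeral_2_eq_2)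
qed (simp add: lattice.refb_def[OF lat])

lemma Wf: "bd psem 2 Wf" "bd gsem 1 Wf" "bd psem 2 Wf1"
proof -
  show "bd psem 2 Wf" by (rule bd_eq[OF bd_J(1)[OF _ bf]]) (auto simp: lattice.refW_def[OF lat])
  then show "bd gsem 1 Wf" by (intro bd_p_g) (simp add: numeral_2_eq_2)
  show "bd psem 2 Wf1" by (rule bd_eq[OF bd_J(1)[OF _ bf1]]) (auto simp: lattice.refW_def[OF lat])
qed

abbreviation (input) "qf \<equiv> \<lambda>\<omega> p. (1/4) *\<^sub>R (k \<omega> *\<^sub>R (NN F1 \<omega> p - NN F \<omega> p)) + Wf \<omega> p"

lemma qf: "bd psem 2 qf"
  using bd_k[OF sem_p Mf] by (intro bd_add[OF sem_p] bd_scale[OF sem_p] Wf) (simp add: numeral_2_eq_2)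

lemma Yf_diff: "bd psem 2 (\<lambda>\<omega> p. Yf \<omega> p - F \<omega> p)" "bd psem 2 (\<lambda>\<omega> p. Yf1 \<omega> p - F1 \<omega> p)"
proof -
  show "bd psem 2 (\<lambda>\<omega> p. Yf \<omega> p - F \<omega> p)"
    by (rule bd_eq[OF qf]) (simp add: lattice.refY_def[OF lat])
  have "bd psem 2 (\<lambda>\<omega> p. (1/4) *\<^sub>R (k \<omega> *\<^sub>R (NN F2 \<omega> p - NN F1 \<omega> p)) + Wf1 \<omega> p)"
    using bd_k[OF sem_p Mf1] by (intro bd_add[OF sem_p] bd_scale[OF sem_p] Wf) (simp add: numeral_2_eq_2)
  then show "bd psem 2 (\<lambda>\<omega> p. Yf1 \<omega> p - F1 \<omega> p)"
    by (rule bd_eq) (simp add: lattice.refY_def[OF lat])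
qed

lemma Rq: "bd psem 2 (RR qf)" "bd gsem 1 (RR qf)"
proof -
  show "bd psem 2 (RR qf)" by (intro bd_J qf) simp
  then show "bd gsem 1 (RR qf)" by (intro bd_p_g) (simp add: numeral_2_eq_2)
qed

lemma w2_eq: "\<omega> \<in> \<Omega> \<Longrightarrow> w2 \<omega> p = RR F \<omega> p + RR qf \<omega> p"
proof -
  assume w: "\<omega> \<in> \<Omega>"
  have "Yf \<omega> = (\<lambda>p. F \<omega> p + qf \<omega> p)"
    by (auto simp: lattice.refY_def[OF lat[OF w]])
  then show ?thesis
    using lattice.J_add[OF lat[OF w], of "1/4" "F \<omega>" "qf \<omega>"]
    by (simp add: lattice.ref2_def[OF lat[OF w]])
qed

lemma w2_diff: "bd psem 1 (\<lambda>\<omega> p. w2 \<omega> p - F \<omega> p)" "bd gsem 1 (\<lambda>\<omega> p. w2 \<omega> p - F \<omega> p)"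
  by (rule bd_eq[OF bd_add[OF sem_p RF_diff(1) bd_mono[OF Rq(1)]]]; simp add: w2_eq)
    (rule bd_eq[OF bd_add[OF sem_g RF_diff(2) Rq(2)]]; simp add: w2_eq)

lemma del2: "bd psem 1 (\<lambda>\<omega> p. NN w2 \<omega> p - NN F \<omega> p)"
  using bd_NL_diff[OF F(1,2) w2_diff] by simp

text \<open>NL F contains the merely bounded field f and cannot be differenced directly. The
  Crank-Nicolson identity expresses k NL F by the increment, Z F and a second-order remainder: the
  first two have gradients of order k by hypothesis, the remainder by the inverse
  inequality.\<close>

lemma kNF: "bd psem 1 (\<lambda>\<omega> p. k \<omega> *\<^sub>R NN F \<omega> p)" "bd gsem 1 (\<lambda>\<omega> p. k \<omega> *\<^sub>R NN F \<omega> p)"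
proof -
  let ?r = "\<lambda>\<omega> p. ((1/2) *\<^sub>R ZZ Ef \<omega> p + (1/2) *\<^sub>R (k \<omega> *\<^sub>R (NN F1 \<omega> p - NN F \<omega> p))) + CN \<omega> p"
  have r: "bd psem 2 ?r"
    using bd_k[OF sem_p Mf]
    by (intro bd_add[OF sem_p] bd_scale[OF sem_p] ZE cn) (simp add: numeral_2_eq_2)
  have rg: "bd gsem 1 ?r" using r by (intro bd_p_g) (simp add: numeral_2_eq_2)
  have eq: "k \<omega> *\<^sub>R NN F \<omega> p = (Ef \<omega> p - ZZ F \<omega> p) - ?r \<omega> p" if "\<omega> \<in> \<Omega>" for \<omega> p
    by (simp add: lattice.cn_res_def[OF lat[OF that]])
  show "bd psem 1 (\<lambda>\<omega> p. k \<omega> *\<^sub>R NN F \<omega> p)"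
    by (rule bd_eq[OF bd_diff[OF sem_p bd_diff[OF sem_p E(1) ZF] bd_mono[OF r]] eq]) simp_all
  show "bd gsem 1 (\<lambda>\<omega> p. k \<omega> *\<^sub>R NN F \<omega> p)"
    by (rule bd_eq[OF bd_diff[OF sem_g bd_diff[OF sem_g E(2) gZF] rg] eq]) simp_all
qed

lemma kNw2: "bd psem 1 (\<lambda>\<omega> p. k \<omega> *\<^sub>R NN w2 \<omega> p)" "bd gsem 1 (\<lambda>\<omega> p. k \<omega> *\<^sub>R NN w2 \<omega> p)"
proof -
  have r: "bd psem 2 (\<lambda>\<omega> p. k \<omega> *\<^sub>R (NN w2 \<omega> p - NN F \<omega> p))"
    using bd_k[OF sem_p del2] by (simp add: numeral_2_eq_2)
  then have rg: "bd gsem 1 (\<lambda>\<omega> p. k \<omega> *\<^sub>R (NN w2 \<omega> p - NN F \<omega> p))"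
    by (intro bd_p_g) (simp add: numeral_2_eq_2)
  show "bd psem 1 (\<lambda>\<omega> p. k \<omega> *\<^sub>R NN w2 \<omega> p)"
    by (rule bd_eq[OF bd_add[OF sem_p kNF(1) bd_mono[OF r]]]) (simp_all add: algebra_simps)
  show "bd gsem 1 (\<lambda>\<omega> p. k \<omega> *\<^sub>R NN w2 \<omega> p)"
    by (rule bd_eq[OF bd_add[OF sem_g kNF(2) rg]]) (simp_all add: algebra_simps)
qed

lemma w3_diff: "bd psem 1 (\<lambda>\<omega> p. w3 \<omega> p - F \<omega> p)" "bd gsem 1 (\<lambda>\<omega> p. w3 \<omega> p - F \<omega> p)"
proof -
  have eq: "w3 \<omega> p - F \<omega> p = (w2 \<omega> p - F \<omega> p) + (1/2) *\<^sub>R RR (\<lambda>\<omega> p. k \<omega> *\<^sub>R NN w2 \<omega> p) \<omega> p"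
    if w: "\<omega> \<in> \<Omega>" for \<omega> p
    using lattice.J_add[OF lat[OF w], of "1/4" "Yf \<omega>" "\<lambda>p. (1/2) *\<^sub>R (k \<omega> *\<^sub>R NN w2 \<omega> p)"]
      lattice.J_scale[OF lat[OF w], of "1/4" "1/2" "\<lambda>p. k \<omega> *\<^sub>R NN w2 \<omega> p"]
    by (simp add: lattice.ref3_def[OF lat[OF w]] lattice.ref2_def[OF lat[OF w]])
  show "bd psem 1 (\<lambda>\<omega> p. w3 \<omega> p - F \<omega> p)"
    by (rule bd_eq[OF bd_add[OF sem_p w2_diff(1) bd_scale[OF sem_p bd_J(1)[OF _ kNw2(1)]]] eq]) simp_all
  show "bd gsem 1 (\<lambda>\<omega> p. w3 \<omega> p - F \<omega> p)"
    by (rule bd_eq[OF bd_add[OF sem_g w2_diff(2) bd_scale[OF sem_g bd_J(2)[OF _ kNw2(2)]]] eq]) simp_all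
qed

lemma b3: "bd psem 2 b3"
proof (rule bd_eq)
  show "bd psem 2 (\<lambda>\<omega> p. Wf \<omega> p + (1/8) *\<^sub>R (k \<omega> *\<^sub>R (NN F1 \<omega> p - NN F \<omega> p)) - (1/16) *\<^sub>R ZZ Ef \<omega> p
     - (1/4) *\<^sub>R CN \<omega> p + (1/4) *\<^sub>R (k \<omega> *\<^sub>R (NN w2 \<omega> p - NN F \<omega> p)))"
    using bd_k[OF sem_p Mf] bd_k[OF sem_p del2]
    by (intro bd_diff[OF sem_p] bd_add[OF sem_p] bd_scale[OF sem_p] ZE cn Wf) (simp_all add: numeral_2_eq_2)
qed (simp add: lattice.mid_err_def[OF lat])

text \<open>The errors of stages 2 and 3 relative to F are each of order k only. DN is linear, and
  by \<open>ref23_eq\<close> their sum minus half the increment is 2 J mid_err, of order k^2; the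
  rest consists of quadratic Taylor remainders. For the L2 bound it matters that
  \<open>mid_err\<close> appears behind a resolvent.\<close>

lemma X: "bd hsem 2 X" "bd lsem 2 X"
proof -
  let ?r = "\<lambda>u \<omega> p. NN (\<lambda>\<omega> p. F \<omega> p + u \<omega> p) \<omega> p - NN F \<omega> p - DD F u \<omega> p"
  let ?e2 = "\<lambda>\<omega> p. w2 \<omega> p - F \<omega> p" and ?e3 = "\<lambda>\<omega> p. w3 \<omega> p - F \<omega> p"
  let ?S = "\<lambda>\<omega> p. ?r ?e2 \<omega> p + ?r ?e3 \<omega> p - (1/2) *\<^sub>R ?r Ef \<omega> p"
  have r: "bd psem 2 ?S"
    by (intro bd_add[OF sem_p] bd_diff[OF sem_p] bd_scale[OF sem_p] bd_NL_expand F w2_diff w3_diff E)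
  have eq: "X \<omega> p = ?S \<omega> p + 2 *\<^sub>R DD F (RR b3) \<omega> p" if w: "\<omega> \<in> \<Omega>" for \<omega> p
  proof -
    interpret lattice "B \<omega>" "sh \<omega>" "sb \<omega>" "h \<omega>" "k \<omega>" \<alpha> \<beta> "f \<omega>" by (rule lat[OF w])
    have "(\<lambda>p. (?e2 \<omega> p + ?e3 \<omega> p) - (1/2) *\<^sub>R Ef \<omega> p) = (\<lambda>p. 2 *\<^sub>R RR b3 \<omega> p)"
      using ref23_eq[of "F \<omega>" "F1 \<omega>"] by (auto simp: vec_eq_iff field_simps)
    then have "DD F ?e2 \<omega> p + DD F ?e3 \<omega> p - (1/2) *\<^sub>R DD F Ef \<omega> p = 2 *\<^sub>R DD F (RR b3) \<omega> p"
      using DN_diff[of "F \<omega>" "\<lambda>p. ?e2 \<omega> p + ?e3 \<omega> p" "\<lambda>p. (1/2) *\<^sub>R Ef \<omega> p" p]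
        DN_add[of "F \<omega>" "?e2 \<omega>" "?e3 \<omega>" p] DN_scale[of "F \<omega>" "1/2" "Ef \<omega>" p] DN_scale[of "F \<omega>" 2 "RR b3 \<omega>" p]
      by simp
    then show ?thesis
      unfolding nl_err_def by (simp add: vec_eq_iff field_simps)
  qed
  show "bd hsem 2 X"
    by (rule bd_eq[OF bd_add[OF sem_h bd_p_h[OF r] bd_scale[OF sem_h bd_DD_h[OF F bd_J(1)[OF _ b3]]]] eq]) simp_all
  show "bd lsem 2 X"
    by (rule bd_eq[OF bd_add[OF sem_l bd_p_l[OF r] bd_scale[OF sem_l bd_DD_l[OF F(1,2) b3]]] eq]) simp_all
qed

text \<open>The perturbation is O(k^2) but its gradient only O(k). That suffices pointwise for the
  quadratic remainder, while the linear part reaches order k^2 only in the dual norm.\<close>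

lemma NN_add_pert_h:
  assumes u: "bd psem 0 u" "bd gsem 0 u" "bd ssem 0 u" and b: "bd psem 2 b" "bd gsem 1 b"
  shows "bd hsem 2 (\<lambda>\<omega> p. NN (\<lambda>\<omega> p. u \<omega> p + b \<omega> p) \<omega> p - NN u \<omega> p)"
  by (rule bd_eq[OF bd_add[OF sem_h bd_p_h[OF bd_NL_expand[OF u(1,2) bd_mono[OF b(1)] b(2)]] bd_DD_h[OF u b(1)]]])
    simp_all

lemma NN_add_pert_l:
  assumes u: "bd psem 0 u" "bd gsem 0 u" "bd ssem 0 u" and b: "bd psem 2 b" and a: "a > 0"
  shows "bd lsem 2 (\<lambda>\<omega> p. NN (\<lambda>\<omega> p. u \<omega> p + JJ a b \<omega> p) \<omega> p - NN u \<omega> p)"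
proof -
  have 1: "bd psem 2 (JJ a b)" using a by (intro bd_J b) simp
  have 2: "bd gsem 1 (JJ a b)" using 1 by (intro bd_p_g) (simp add: numeral_2_eq_2)
  show ?thesis
    by (rule bd_eq[OF bd_add[OF sem_l bd_p_l[OF bd_NL_expand[OF u(1,2) bd_mono[OF 1] 2]] bd_DD_l[OF u(1,2) b a]]])
      simp_all
qed

text \<open>In \<open>res4_eq\<close> the operator \<open>Z\<close> stands before a resolvent and is
  harmless, so NL ref2 - NL (J F) is needed only to second order in the dual norm; the prefactor k
  supplies the third.\<close>

lemma res4: "bd hsem 3 (\<lambda>\<omega>. lattice.res4 (sh \<omega>) (sb \<omega>) (h \<omega>) (k \<omega>) \<alpha> \<beta> (f \<omega>) (F \<omega>) (F1 \<omega>))"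
proof (rule bd_eq)
  let ?d = "\<lambda>\<omega> p. NN w2 \<omega> p - NN (RR F) \<omega> p"
  have d: "bd hsem 2 ?d"
  proof (rule bd_eq[OF NN_add_pert_h[OF RF Rq]])
    fix \<omega> p assume "\<omega> \<in> \<Omega>"
    then show "?d \<omega> p = NN (\<lambda>\<omega> p. RR F \<omega> p + RR qf \<omega> p) \<omega> p - NN (RR F) \<omega> p"
      using w2_eq by presburger
  qed
  show "bd hsem 3 (\<lambda>\<omega> p. (-1/2) *\<^sub>R (k \<omega> *\<^sub>R X \<omega> p) + CN \<omega> p
    - (1/3) *\<^sub>R ZZ (RR (\<lambda>\<omega> p. (1/2) *\<^sub>R (k \<omega> *\<^sub>R ?d \<omega> p) - (1/2) *\<^sub>R CN \<omega> p)) \<omega> p)"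
    using bd_k[OF sem_h X(1)] bd_k[OF sem_h d]
    by (intro bd_diff[OF sem_h] bd_add[OF sem_h] bd_scale[OF sem_h] bd_ZJ cn) (simp_all add: numeral_3_eq_3)
qed (simp add: lattice.res4_eq[OF lat])

text \<open>The derivative at F1 applied to the second time difference, plus the change of the
  derivative from F to F1 applied to the first increment, plus Taylor remainders: each is
  O(k^2).\<close>

lemma MM_diff: "bd psem 2 (\<lambda>\<omega> p. (NN F2 \<omega> p - NN F1 \<omega> p) - (NN F1 \<omega> p - NN F \<omega> p))"
proof -
  let ?r = "\<lambda>u v \<omega> p. NN (\<lambda>\<omega> p. u \<omega> p + v \<omega> p) \<omega> p - NN u \<omega> p - DD u v \<omega> p"
  let ?EE = "\<lambda>\<omega> p. (F2 \<omega> p - F1 \<omega> p) - (F1 \<omega> p - F \<omega> p)"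
  have "bd psem 2 (\<lambda>\<omega> p. (?r F1 Ef1 \<omega> p - ?r F Ef \<omega> p)
    + (DD F1 ?EE \<omega> p + (DD (\<lambda>\<omega> p. F \<omega> p + Ef \<omega> p) Ef \<omega> p - DD F Ef \<omega> p)))"
    by (intro bd_add[OF sem_p] bd_diff[OF sem_p, of 2 "?r F1 Ef1"] bd_NL_expand bd_DD bd_DD_diff F F1 E E1 EE)
  then show ?thesis
  proof (rule bd_eq)
    fix \<omega> p assume "\<omega> \<in> \<Omega>"
    then show "(NN F2 \<omega> p - NN F1 \<omega> p) - (NN F1 \<omega> p - NN F \<omega> p) = (?r F1 Ef1 \<omega> p - ?r F Ef \<omega> p)
    + (DD F1 ?EE \<omega> p + (DD (\<lambda>\<omega> p. F \<omega> p + Ef \<omega> p) Ef \<omega> p - DD F Ef \<omega> p))"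
      using lattice.DN_diff[OF lat, of \<omega> "f \<omega>" "F1 \<omega>" "Ef1 \<omega>" "Ef \<omega>" p] by simp
  qed
qed

text \<open>With J F1 = J F + J E, where E is the increment, the linear parts leave the change of
  the derivative from F to J F acting on J E, and the derivative at F acting on J E - E. The latter
  is O(k^2) without control of its gradient to that order, hence the dual norm.\<close>

lemma del_diff: "bd hsem 2 (\<lambda>\<omega> p. (NN (RR F1) \<omega> p - NN F1 \<omega> p) - (NN (RR F) \<omega> p - NN F \<omega> p))"
proof -
  let ?r = "\<lambda>u v \<omega> p. NN (\<lambda>\<omega> p. u \<omega> p + v \<omega> p) \<omega> p - NN u \<omega> p - DD u v \<omega> p"
  let ?D = "\<lambda>\<omega> p. RR F \<omega> p - F \<omega> p" and ?DE = "\<lambda>\<omega> p. RR Ef \<omega> p - Ef \<omega> p"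
  have "bd hsem 2 (\<lambda>\<omega> p. (?r (RR F) (RR Ef) \<omega> p - ?r F Ef \<omega> p)
    + ((DD (\<lambda>\<omega> p. F \<omega> p + ?D \<omega> p) (RR Ef) \<omega> p - DD F (RR Ef) \<omega> p) + DD F ?DE \<omega> p))"
    by (intro bd_add[OF sem_h] bd_p_h[OF bd_DD_diff] bd_DD_h
      bd_p_h[OF bd_diff[OF sem_p, of 2 "?r (RR F) (RR Ef)"]] bd_NL_expand F RF RE RF_diff RE_diff E)
  then show ?thesis
  proof (rule bd_eq)
    fix \<omega> p assume w: "\<omega> \<in> \<Omega>"
    have "NN (\<lambda>\<omega> p. RR F \<omega> p + RR Ef \<omega> p) \<omega> = NN (RR F1) \<omega>"
      using RF1_eq[OF w] by presburger
    then show "(NN (RR F1) \<omega> p - NN F1 \<omega> p) - (NN (RR F) \<omega> p - NN F \<omega> p)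
      = (?r (RR F) (RR Ef) \<omega> p - ?r F Ef \<omega> p)
    + ((DD (\<lambda>\<omega> p. F \<omega> p + ?D \<omega> p) (RR Ef) \<omega> p - DD F (RR Ef) \<omega> p) + DD F ?DE \<omega> p)"
      using lattice.DN_diff[OF lat[OF w], of "f \<omega>" "F \<omega>" "RR Ef \<omega>" "Ef \<omega>" p] by simp
  qed
qed

text \<open>Each ingredient of \<open>refb\<close> is replaced by its change over one time step,
  which gains an order. The resolvent in W then upgrades the dual bound to the weighted L2
  bound.\<close>

lemma W_diff: "bd hsem 3 (\<lambda>\<omega> p. Wf1 \<omega> p - Wf \<omega> p)" "bd lsem 3 (\<lambda>\<omega> p. Wf1 \<omega> p - Wf \<omega> p)"
proof -
  let ?EE = "\<lambda>\<omega> p. (F2 \<omega> p - F1 \<omega> p) - (F1 \<omega> p - F \<omega> p)"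
  let ?MM = "\<lambda>\<omega> p. (NN F2 \<omega> p - NN F1 \<omega> p) - (NN F1 \<omega> p - NN F \<omega> p)"
  let ?dd = "\<lambda>\<omega> p. (NN (RR F1) \<omega> p - NN F1 \<omega> p) - (NN (RR F) \<omega> p - NN F \<omega> p)"
  have "bd hsem 3 (\<lambda>\<omega> p. (1/24) *\<^sub>R ZZ ?EE \<omega> p - (1/12) *\<^sub>R (k \<omega> *\<^sub>R (?MM \<omega> p + 2 *\<^sub>R ?dd \<omega> p)))"
    using bd_k[OF sem_h bd_add[OF sem_h bd_p_h[OF MM_diff] bd_scale[OF sem_h del_diff, of 2]]]
    by (intro bd_diff[OF sem_h] bd_scale[OF sem_h] bd_p_h[OF ZE(3)]) (simp add: numeral_3_eq_3)
  then have b: "bd hsem 3 (\<lambda>\<omega> p. bf1 \<omega> p - bf \<omega> p)"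
  proof (rule bd_eq)
    fix \<omega> p assume w: "\<omega> \<in> \<Omega>"
    show "bf1 \<omega> p - bf \<omega> p = (1/24) *\<^sub>R ZZ ?EE \<omega> p - (1/12) *\<^sub>R (k \<omega> *\<^sub>R (?MM \<omega> p + 2 *\<^sub>R ?dd \<omega> p))"
      unfolding lattice.refb_def[OF lat[OF w]] lattice.Z_diff[OF lat[OF w], of "Ef1 \<omega>" "Ef \<omega>"]
      by (simp add: vec_eq_iff field_simps)
  qed
  have eq: "Wf1 \<omega> p - Wf \<omega> p = JJ (1/12) (\<lambda>\<omega> p. bf1 \<omega> p - bf \<omega> p) \<omega> p" if "\<omega> \<in> \<Omega>" for \<omega> p
    by (simp add: lattice.refW_def[OF lat[OF that]] lattice.J_diff[OF lat[OF that]])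
  show "bd hsem 3 (\<lambda>\<omega> p. Wf1 \<omega> p - Wf \<omega> p)"
    by (rule bd_eq[OF bd_J(4)[OF _ b] eq]) simp_all
  show "bd lsem 3 (\<lambda>\<omega> p. Wf1 \<omega> p - Wf \<omega> p)"
    by (rule bd_eq[OF bd_J_smooth[OF _ b] eq]) simp_all
qed

lemma N4: "bd hsem 2 (\<lambda>\<omega> p. NN w4 \<omega> p - NN F1 \<omega> p)" "bd lsem 2 (\<lambda>\<omega> p. NN w4 \<omega> p - NN F1 \<omega> p)"
proof -
  \<comment> \<open>Two forms of one perturbation: as a small function for the dual norm, and as the
    resolvent of \<open>refb\<close> for the L2 norm.\<close>
  have eq: "NN w4 \<omega> p - NN F1 \<omega> p = NN (\<lambda>\<omega> p. F1 \<omega> p + Wf \<omega> p) \<omega> p - NN F1 \<omega> p"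
    "NN w4 \<omega> p - NN F1 \<omega> p = NN (\<lambda>\<omega> p. F1 \<omega> p + JJ (1/12) bf \<omega> p) \<omega> p - NN F1 \<omega> p" if w: "\<omega> \<in> \<Omega>" for \<omega> p
    using lattice.ref4_def[OF lat[OF w], abs_def] lattice.refW_def[OF lat[OF w]] by presburger+
  show "bd hsem 2 (\<lambda>\<omega> p. NN w4 \<omega> p - NN F1 \<omega> p)"
    by (rule bd_eq[OF NN_add_pert_h[OF F1 Wf(1,2)] eq(1)])
  show "bd lsem 2 (\<lambda>\<omega> p. NN w4 \<omega> p - NN F1 \<omega> p)"
    by (rule bd_eq[OF NN_add_pert_l[OF F1 bf] eq(2)]) simp
qed

text \<open>An L2 bound is required besides the dual one because no implicit solve follows the last
  update to smooth its residual.\<close>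

lemma res5:
  "bd hsem 3 (\<lambda>\<omega>. lattice.res5 (sh \<omega>) (sb \<omega>) (h \<omega>) (k \<omega>) \<alpha> \<beta> (f \<omega>) (F \<omega>) (F1 \<omega>) (F2 \<omega>))"
  "bd lsem 3 (\<lambda>\<omega>. lattice.res5 (sh \<omega>) (sb \<omega>) (h \<omega>) (k \<omega>) \<alpha> \<beta> (f \<omega>) (F \<omega>) (F1 \<omega>) (F2 \<omega>))"
proof -
  let ?MM = "\<lambda>\<omega> p. (NN F2 \<omega> p - NN F1 \<omega> p) - (NN F1 \<omega> p - NN F \<omega> p)"
  let ?N4 = "\<lambda>\<omega> p. NN w4 \<omega> p - NN F1 \<omega> p"
  let ?W = "\<lambda>\<omega> p. Wf1 \<omega> p - Wf \<omega> p"
  let ?r = "\<lambda>\<omega> p. (1/4) *\<^sub>R (k \<omega> *\<^sub>R ?MM \<omega> p) + ?W \<omega> p - (1/3) *\<^sub>R (k \<omega> *\<^sub>R ?N4 \<omega> p)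
    + (1/6) *\<^sub>R (k \<omega> *\<^sub>R X \<omega> p)"
  have eq: "lattice.res5 (sh \<omega>) (sb \<omega>) (h \<omega>) (k \<omega>) \<alpha> \<beta> (f \<omega>) (F \<omega>) (F1 \<omega>) (F2 \<omega>) p = ?r \<omega> p"
    if "\<omega> \<in> \<Omega>" for \<omega> p
    by (simp add: lattice.res5_eq[OF lat[OF that]])
  have "bd hsem 3 ?r"
    using bd_k[OF sem_h bd_p_h[OF MM_diff]] bd_k[OF sem_h N4(1)] bd_k[OF sem_h X(1)] 
    by (intro bd_add[OF sem_h] bd_diff[OF sem_h, of 3 "\<lambda>\<omega> p. (1/4) *\<^sub>R (k \<omega> *\<^sub>R ?MM \<omega> p) + ?W \<omega> p"]
      bd_scale[OF sem_h] W_diff) (simp_all add: numeral_3_eq_3 numeral_2_eq_2)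
  then show "bd hsem 3 (\<lambda>\<omega>. lattice.res5 (sh \<omega>) (sb \<omega>) (h \<omega>) (k \<omega>) \<alpha> \<beta> (f \<omega>) (F \<omega>) (F1 \<omega>) (F2 \<omega>))"
    by (rule bd_eq[OF _ eq])
  have "bd lsem 3 ?r"
    using bd_k[OF sem_l bd_p_l[OF MM_diff]] bd_k[OF sem_l N4(2)] bd_k[OF sem_l X(2)] 
    by (intro bd_add[OF sem_l] bd_diff[OF sem_l, of 3 "\<lambda>\<omega> p. (1/4) *\<^sub>R (k \<omega> *\<^sub>R ?MM \<omega> p) + ?W \<omega> p"]
      bd_scale[OF sem_l] W_diff) (simp_all add: numeral_3_eq_3 numeral_2_eq_2)
  then show "bd lsem 3 (\<lambda>\<omega>. lattice.res5 (sh \<omega>) (sb \<omega>) (h \<omega>) (k \<omega>) \<alpha> \<beta> (f \<omega>) (F \<omega>) (F1 \<omega>) (F2 \<omega>))"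
    by (rule bd_eq[OF _ eq])
qed

lemma stages_bounded:
  "bd psem 0 w2" "bd gsem 0 w2" "bd psem 0 w3" "bd gsem 0 w3" "bd psem 0 w4" "bd gsem 0 w4"
proof -
  show "bd psem 0 w2" by (rule bd_eq[OF bd_add[OF sem_p F(1) bd_mono[OF w2_diff(1)]]]) simp_all
  show "bd gsem 0 w2" by (rule bd_eq[OF bd_add[OF sem_g F(2) bd_mono[OF w2_diff(2)]]]) simp_all
  show "bd psem 0 w3" by (rule bd_eq[OF bd_add[OF sem_p F(1) bd_mono[OF w3_diff(1)]]]) simp_all
  show "bd gsem 0 w3" by (rule bd_eq[OF bd_add[OF sem_g F(2) bd_mono[OF w3_diff(2)]]]) simp_all
  show "bd psem 0 w4" by (rule bd_eq[OF bd_add[OF sem_p F1(1) bd_mono[OF Wf(1)]]]) (simp_all add: lattice.ref4_def[OF lat])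
  show "bd gsem 0 w4" by (rule bd_eq[OF bd_add[OF sem_g F1(2) bd_mono[OF Wf(2)]]]) (simp_all add: lattice.ref4_def[OF lat])
qed

end

section \<open>Stability\<close>

context lattice
begin

text \<open>\<open>NL_expand\<close> is used with v = - e. The bound |e| \<le> 1 reduces all
  remainder terms to first order, except the squares of differences of e, which are kept.\<close>

lemma norm_NL_diff_le:
  assumes w: "norm (w p) \<le> K" "\<And>d. norm (Ac d w p) \<le> K" and f: "norm (f p) \<le> K"
    and e: "norm (e p) \<le> 1" and K: "K \<ge> 1"
  shows "norm (NL w p - NL (\<lambda>p. w p - e p) p)
    \<le> (13 * \<beta> + 3 * \<alpha>) * K\<^sup>2 * (norm (e p) + (\<Sum>d\<in>UNIV. norm (Ac d e p)) + (\<Sum>d\<in>UNIV. (norm (Ac d e p))\<^sup>2))"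
proof -
  define S Q where "S = (\<Sum>d\<in>UNIV. norm (Ac d e p))" and "Q = (\<Sum>d\<in>UNIV. (norm (Ac d e p))\<^sup>2)"
  have SQ: "S \<ge> 0" "Q \<ge> 0" by (auto simp: S_def Q_def sum_nonneg)
  define v where "v = (\<lambda>p. - e p)"
  have Av: "Ac d v p = - Ac d e p" for d by (simp add: v_def Ac_def flip: scaleR_minus_right)
  have m: "norm (Ac d e p) \<le> S" for d unfolding S_def by (intro member_le_sum) auto
  have D: "norm (DN w v p) \<le> (9 * \<beta> + 2 * \<alpha>) * K\<^sup>2 * (norm (e p) + S)"
  proof (intro norm_DN_le w f)
    show "norm (v p) \<le> norm (e p) + S" using SQ by (simp add: v_def)
    show "norm (Ac d v p) \<le> norm (e p) + S" for d using m[of d] by (simp add: Av add_increasing)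
  qed
  have 1: "norm ((2 * (\<Sum>d\<in>UNIV. Ac d w p \<bullet> Ac d v p)) *\<^sub>R v p) \<le> (2 * (K * S)) * 1"
  proof -
    have "\<bar>\<Sum>d\<in>UNIV. Ac d w p \<bullet> Ac d v p\<bar> \<le> (\<Sum>d\<in>UNIV. K * norm (Ac d e p))"
      using w K by (intro order.trans[OF sum_abs] sum_mono order.trans[OF Cauchy_Schwarz_ineq2])
        (auto simp: Av intro!: mult_right_mono)
    then have "\<bar>\<Sum>d\<in>UNIV. Ac d w p \<bullet> Ac d v p\<bar> \<le> K * S" by (simp add: S_def sum_distrib_left)
    then show ?thesis
      unfolding norm_scaleR abs_mult using e K SQ by (intro mult_mono) (auto simp: v_def)
  qed
  have wv: "norm (w p + v p) \<le> 2 * K"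
    using norm_triangle_ineq4[of "w p" "e p"] w e K by (simp add: v_def)
  have 2: "norm ((\<Sum>d\<in>UNIV. (norm (Ac d v p))\<^sup>2) *\<^sub>R (w p + v p)) \<le> Q * (2 * K)"
    unfolding norm_scaleR Av using wv SQ by (auto simp: Q_def sum_nonneg intro!: mult_mono)
  have 3: "norm (cross3 (v p) (cross3 (v p) (f p))) \<le> norm (e p) * (1 * K)"
    using e f by (intro norm_cross2_le) (auto simp: v_def)
  have R: "norm (NL (\<lambda>p. w p + v p) p - NL w p - DN w v p)
    \<le> \<beta> * ((2 * (K * S)) * 1 + Q * (2 * K)) + \<alpha> * (norm (e p) * (1 * K))"
    unfolding NL_expand
    using \<alpha>_pos \<beta>_pos by (intro norm_scaled_diff_le norm_triangle_mono 1 2 3) auto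
  have "NL w p - NL (\<lambda>p. w p - e p) p = - DN w v p - (NL (\<lambda>p. w p + v p) p - NL w p - DN w v p)"
    by (simp add: v_def)
  then have "norm (NL w p - NL (\<lambda>p. w p - e p) p) \<le> (9 * \<beta> + 2 * \<alpha>) * K\<^sup>2 * (norm (e p) + S)
    + (\<beta> * ((2 * (K * S)) * 1 + Q * (2 * K)) + \<alpha> * (norm (e p) * (1 * K)))"
    using norm_triangle_ineq4[of "- DN w v p" "NL (\<lambda>p. w p + v p) p - NL w p - DN w v p"] D R by simp
  also have "\<dots> \<le> (13 * \<beta> + 3 * \<alpha>) * K\<^sup>2 * (norm (e p) + S + Q)"
  proof -
    have "K \<le> K\<^sup>2" using K self_le_power[of K 2] by simp
    then have m: "K * S \<le> K\<^sup>2 * S" "K * Q \<le> K\<^sup>2 * Q" "K * norm (e p) \<le> K\<^sup>2 * norm (e p)"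
      using SQ by (intro mult_right_mono; simp)+
    define a b c where "a = K\<^sup>2 * norm (e p)" and "b = K\<^sup>2 * S" and "c = K\<^sup>2 * Q"
    have n: "\<beta> * a \<ge> 0" "\<beta> * b \<ge> 0" "\<beta> * c \<ge> 0" "\<alpha> * a \<ge> 0" "\<alpha> * b \<ge> 0" "\<alpha> * c \<ge> 0"
      using \<alpha>_pos \<beta>_pos SQ by (auto simp: a_def b_def c_def)
    have "\<beta> * ((2 * (K * S)) * 1 + Q * (2 * K)) \<le> \<beta> * (2 * b + 2 * c)"
    proof (rule mult_left_mono)
      have "(2 * (K * S)) * 1 + Q * (2 * K) = 2 * (K * S) + 2 * (K * Q)" by simp
      then show "(2 * (K * S)) * 1 + Q * (2 * K) \<le> 2 * b + 2 * c"
        using m unfolding b_def c_def by linarith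
    qed (use \<beta>_pos in simp)
    moreover have "\<alpha> * (norm (e p) * (1 * K)) \<le> \<alpha> * a"
      using m \<alpha>_pos by (intro mult_left_mono) (auto simp: a_def mult.commute)
    moreover have "(9 * \<beta> + 2 * \<alpha>) * K\<^sup>2 * (norm (e p) + S) = 9 * (\<beta> * a) + 9 * (\<beta> * b) + 2 * (\<alpha> * a) + 2 * (\<alpha> * b)"
      by (simp add: a_def b_def algebra_simps)
    moreover have "(13 * \<beta> + 3 * \<alpha>) * K\<^sup>2 * (norm (e p) + S + Q)
      = 13 * (\<beta> * a) + 13 * (\<beta> * b) + 13 * (\<beta> * c) + 3 * (\<alpha> * a) + 3 * (\<alpha> * b) + 3 * (\<alpha> * c)"
      by (simp add: a_def b_def c_def algebra_simps)
    ultimately show ?thesis using n by (simp add: distrib_left)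
  qed
  finally show ?thesis unfolding S_def Q_def .
qed

text \<open>The square of a difference is bounded by its sup times its L2 norm, and the inverse
  inequality for the sup produces the factor h^(-3/2).\<close>

lemma nrm_NL_diff_le:
  assumes w: "\<And>p. norm (w p) \<le> K" "\<And>d p. norm (Ac d w p) \<le> K" and f: "\<And>p. norm (f p) \<le> K"
    and e: "h powr (-3/2) * nrm e \<le> 1" and K: "K \<ge> 1"
  shows "nrm (\<lambda>p. NL w p - NL (\<lambda>p. w p - e p) p)
    \<le> ((13 * \<beta> + 3 * \<alpha>) * K\<^sup>2) * (nrm e + 3 * gn e + 3 * (h powr (-3/2) * (gn e)\<^sup>2))"
proof -
  let ?a = "axis 1 1 :: real^3" and ?C = "(13 * \<beta> + 3 * \<alpha>) * K\<^sup>2" and ?\<sigma> = "h powr (-3/2)"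
  have C: "?C \<ge> 0" using \<alpha>_pos \<beta>_pos by auto
  define x0 x1 x2 where "x0 p = norm (e p) *\<^sub>R ?a" and "x1 d p = norm (Ac d e p) *\<^sub>R ?a"
    and "x2 d p = (norm (Ac d e p))\<^sup>2 *\<^sub>R ?a" for d p
  have n0: "nrm x0 \<le> nrm e" using nrm_mono[of x0 1 e] by (simp add: x0_def)
  have n1: "nrm (x1 d) \<le> gn e" for d
    using nrm_mono[of "x1 d" 1 "Ac d e"] nrm_Ac_le[of d e] by (simp add: x1_def)
  have n2: "nrm (x2 d) \<le> ?\<sigma> * (gn e)\<^sup>2" for d
  proof -
    have "nrm (x2 d) \<le> (?\<sigma> * gn e) * nrm (Ac d e)"
    proof (rule nrm_mono)
      fix p assume "p \<in> B"
      then have "norm (Ac d e p) \<le> ?\<sigma> * nrm (Ac d e)" by (rule norm_le_nrm)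
      also have "\<dots> \<le> ?\<sigma> * gn e" by (intro mult_left_mono nrm_Ac_le) auto
      finally show "norm (x2 d p) \<le> (?\<sigma> * gn e) * norm (Ac d e p)"
        by (simp add: x2_def power2_eq_square mult_right_mono)
    qed simp
    also have "\<dots> \<le> (?\<sigma> * gn e) * gn e" by (intro mult_left_mono nrm_Ac_le) auto
    finally show ?thesis by (simp add: power2_eq_square mult.assoc)
  qed
  define x where "x p = x0 p + ((x1 1 p + x1 2 p + x1 3 p) + (x2 1 p + x2 2 p + x2 3 p))" for p
  have xeq: "x p = (norm (e p) + (\<Sum>d\<in>UNIV. norm (Ac d e p)) + (\<Sum>d\<in>UNIV. (norm (Ac d e p))\<^sup>2)) *\<^sub>R ?a" for p
    by (simp add: x_def x0_def x1_def x2_def sum_3 scaleR_left_distrib)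
  have "nrm (\<lambda>p. NL w p - NL (\<lambda>p. w p - e p) p) \<le> ?C * nrm x"
  proof (rule nrm_mono)
    fix p assume p: "p \<in> B"
    have "norm (e p) \<le> 1" using norm_le_nrm[OF p, of e] e by linarith
    then have "norm (NL w p - NL (\<lambda>p. w p - e p) p)
      \<le> ?C * (norm (e p) + (\<Sum>d\<in>UNIV. norm (Ac d e p)) + (\<Sum>d\<in>UNIV. (norm (Ac d e p))\<^sup>2))"
      by (intro norm_NL_diff_le w f K)
    also have "norm (e p) + (\<Sum>d\<in>UNIV. norm (Ac d e p)) + (\<Sum>d\<in>UNIV. (norm (Ac d e p))\<^sup>2) = norm (x p)"
      by (simp add: xeq sum_nonneg add_nonneg_nonneg)
    finally show "norm (NL w p - NL (\<lambda>p. w p - e p) p) \<le> ?C * norm (x p)" .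
  qed (rule C)
  moreover have "nrm x \<le> nrm e + ((gn e + gn e + gn e) + (?\<sigma> * (gn e)\<^sup>2 + ?\<sigma> * (gn e)\<^sup>2 + ?\<sigma> * (gn e)\<^sup>2))"
    unfolding x_def
    by (intro order.trans[OF nrm_add] add_mono n0 n1 n2)
  then have "nrm x \<le> nrm e + 3 * gn e + 3 * (?\<sigma> * (gn e)\<^sup>2)" by (simp add: mult.commute)
  then have "?C * nrm x \<le> ?C * (nrm e + 3 * gn e + 3 * (?\<sigma> * (gn e)\<^sup>2))"
    by (rule mult_left_mono[OF _ C])
  ultimately show ?thesis by (rule order.trans)
qed

text \<open>The equation for u - v is tested with u + v; later v is the mean of stage errors 2 and
  3, and u is stage error 4. The dissipation is the form (11/12) |grad v|^2 + (1/3) |grad u|^2 +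
  (3/4) <grad u, grad v>, positive definite with margin 1/10. Its first coefficient is 5/12 + 1/2,
  the 1/2 coming from the expansion of |v - Z v/4|^2.\<close>

lemma energy_core:
  assumes v: "\<And>p. v p = e p + (1/4) *\<^sub>R Z v p"
    and u: "\<And>p. u p = v p + g p + (5/12) *\<^sub>R Z v p + (1/3) *\<^sub>R Z u p"
  shows "(nrm u)\<^sup>2 \<le> (nrm e)\<^sup>2 + ip g (\<lambda>p. u p + v p) - (k * \<beta> / 10) * ((gn v)\<^sup>2 + (gn u)\<^sup>2)"
proof -
  have e: "e = (\<lambda>p. v p - (1/4) *\<^sub>R Z v p)" using v by (auto simp: algebra_simps)
  have sq: "ip (\<lambda>p. v p - (1/4) *\<^sub>R z p) (\<lambda>p. v p - (1/4) *\<^sub>R z p)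
    = (nrm v)\<^sup>2 - (1/2) * ip z v + (1/16) * (nrm z)\<^sup>2" for z
    by (simp add: ip_lin ip_commute[of v z] nrm_sq field_simps)
  have ne: "(nrm e)\<^sup>2 = (nrm v)\<^sup>2 + (1/2) * (k * \<beta>) * dip v v + (1/16) * (nrm (Z v))\<^sup>2"
    using sq[of "Z v"] ip_Z[of v v] nrm_sq[of e] unfolding e[symmetric] by simp
  have "ip (\<lambda>p. u p - v p) (\<lambda>p. u p + v p) = (nrm u)\<^sup>2 - (nrm v)\<^sup>2"
    by (simp add: ip_lin nrm_sq ip_commute[of v u])
  moreover have "(\<lambda>p. u p - v p) = (\<lambda>p. g p + ((5/12) *\<^sub>R Z v p + (1/3) *\<^sub>R Z u p))"
  proof
    fix p have "u p - v p = (v p + g p + (5/12) *\<^sub>R Z v p + (1/3) *\<^sub>R Z u p) - v p"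
      using u[of p] by (rule arg_cong)
    then show "u p - v p = g p + ((5/12) *\<^sub>R Z v p + (1/3) *\<^sub>R Z u p)" by (simp add: algebra_simps)
  qed
  then have "ip (\<lambda>p. u p - v p) (\<lambda>p. u p + v p) = ip g (\<lambda>p. u p + v p)
    + (- (k * \<beta>) * ((5/12) * (dip v u + dip v v) + (1/3) * (dip u u + dip u v)))"
    by (simp add: ip_lin ip_Z algebra_simps)
  ultimately have eq: "(nrm u)\<^sup>2 = (nrm e)\<^sup>2 + ip g (\<lambda>p. u p + v p) - (1/16) * (nrm (Z v))\<^sup>2
    - (k * \<beta>) * ((11/12) * (gn v)\<^sup>2 + (1/3) * (gn u)\<^sup>2 + (3/4) * dip u v)"
    unfolding ne by (simp add: dip_commute[of v u] gn_sq algebra_simps)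
  have "- (gn u * gn v) \<le> dip u v" using dip_CS[of u v] by linarith
  moreover have "2 * (gn v * (gn u / 2)) \<le> (gn v)\<^sup>2 + (gn u / 2)\<^sup>2"
    using sum_squares_bound[of "gn v" "gn u / 2"] by (simp only: mult.assoc)
  then have "gn u * gn v \<le> (gn v)\<^sup>2 + (gn u)\<^sup>2 / 4" by (simp add: power2_eq_square mult.commute)
  ultimately have "(1/10) * ((gn v)\<^sup>2 + (gn u)\<^sup>2) \<le> (11/12) * (gn v)\<^sup>2 + (1/3) * (gn u)\<^sup>2 + (3/4) * dip u v"
  proof -
    have *: "(1/10) * (a + b) \<le> (11/12) * a + (1/3) * b + (3/4) * t"
      if "- c \<le> t" "c \<le> a + b / 4" "a \<ge> 0" "b \<ge> 0" for a b c t :: real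
      using that by (simp add: field_simps)
    show "- (gn u * gn v) \<le> dip u v \<Longrightarrow> gn u * gn v \<le> (gn v)\<^sup>2 + (gn u)\<^sup>2 / 4 \<Longrightarrow> ?thesis"
      by (rule *[where c = "gn u * gn v"]) simp_all
  qed
  then have "(k * \<beta>) * ((1/10) * ((gn v)\<^sup>2 + (gn u)\<^sup>2)) \<le> (k * \<beta>) * ((11/12) * (gn v)\<^sup>2 + (1/3) * (gn u)\<^sup>2 + (3/4) * dip u v)"
    using k_pos \<beta>_pos by (intro mult_left_mono) auto
  moreover have "(k * \<beta> / 10) * ((gn v)\<^sup>2 + (gn u)\<^sup>2) = (k * \<beta>) * ((1/10) * ((gn v)\<^sup>2 + (gn u)\<^sup>2))"
    by simp
  ultimately show ?thesis unfolding eq using zero_le_power2[of "nrm (Z v)"] by linarith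
qed

end

section \<open>Scalar inequalities for absorbing the nonlinear terms\<close>

lemma young_bound: "0 < \<eta> \<Longrightarrow> a * b \<le> \<eta> * b\<^sup>2 + a\<^sup>2 / (4 * (\<eta>::real))"
proof -
  assume \<eta>: "0 < \<eta>"
  have "(4 * \<eta>) * (a * b) \<le> (2 * \<eta> * b)\<^sup>2 + a\<^sup>2"
    using sum_squares_bound[of "2 * \<eta> * b" a] by (simp add: mult_ac)
  also have "\<dots> = (4 * \<eta>) * (\<eta> * b\<^sup>2 + a\<^sup>2 / (4 * \<eta>))"
    using \<eta> by (simp add: distrib_left power_mult_distrib power2_eq_square)
  finally show ?thesis using \<eta> by simp
qed

text \<open>A product with \<open>D\<close>, which is linear plus quadratic in \<open>G\<close>, is absorbed by the dissipation \<open>G\<^sup>2\<close>.\<close>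
lemma absorb_product:
  fixes A C \<eta> :: real
  assumes "A > 0" "C > 0" "\<eta> > 0"
  obtains \<theta> M where "\<theta> > 0" "M > 0"
    "\<And>\<kappa> \<sigma> s G D X. 0 \<le> \<kappa> \<Longrightarrow> \<kappa> \<le> \<theta> \<Longrightarrow> 0 \<le> \<sigma> \<Longrightarrow> 0 \<le> s \<Longrightarrow> \<sigma> * s \<le> \<theta> \<Longrightarrow> 0 \<le> G \<Longrightarrow> G \<le> C * s \<Longrightarrow>
      D \<le> A * (\<kappa>\<^sup>2 * (C * s) + 3 * (\<kappa> * G) + 3 * (\<sigma> * G\<^sup>2)) \<Longrightarrow>
      D \<le> \<eta> * s \<and> (0 \<le> X \<longrightarrow> X \<le> C * s \<longrightarrow> D * X \<le> \<eta> * G\<^sup>2 + M * (\<kappa>\<^sup>2 * s\<^sup>2))"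
proof
  \<comment> \<open>The cap 1 gives \<kappa>^2 \<le> \<theta>; the second absorbs the term with
    \<sigma> G^2 into half of \<eta> G^2; the third yields D \<le> \<eta> s.\<close>
  define \<theta> where "\<theta> = min 1 (min (\<eta> / (6 * A * C)) (\<eta> / (A * (4 * C + 3 * C\<^sup>2))))"
  show "\<theta> > 0" using assms by (auto simp: \<theta>_def intro!: divide_pos_pos add_pos_pos mult_pos_pos)
  \<comment> \<open>A C^2 belongs to the \<kappa>^2 term; the other summand is what Young's
    inequality with weight \<eta>/2 leaves of the term 3 A C \<kappa> s G.\<close>
  define M where "M = A * C\<^sup>2 + 9 * A\<^sup>2 * C\<^sup>2 / (2 * \<eta>)"
  show "M > 0" using assms by (auto simp: M_def intro!: add_pos_nonneg)
  fix \<kappa> \<sigma> s G D X :: real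
  assume *: "0 \<le> \<kappa>" "\<kappa> \<le> \<theta>" "0 \<le> \<sigma>" "0 \<le> s" "\<sigma> * s \<le> \<theta>" "0 \<le> G" "G \<le> C * s"
    and D: "D \<le> A * (\<kappa>\<^sup>2 * (C * s) + 3 * (\<kappa> * G) + 3 * (\<sigma> * G\<^sup>2))"
  have \<theta>: "\<theta> \<le> 1" "\<theta> * (6 * A * C) \<le> \<eta>" "\<theta> * (A * (4 * C + 3 * C\<^sup>2)) \<le> \<eta>"
  proof -
    show "\<theta> \<le> 1" by (simp add: \<theta>_def)
    have "\<theta> \<le> \<eta> / (6 * A * C)" by (simp add: \<theta>_def)
    then show "\<theta> * (6 * A * C) \<le> \<eta>" using assms by (simp add: pos_le_divide_eq)
    have "\<theta> \<le> \<eta> / (A * (4 * C + 3 * C\<^sup>2))" by (simp add: \<theta>_def)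
    then show "\<theta> * (A * (4 * C + 3 * C\<^sup>2)) \<le> \<eta>"
      using assms by (simp add: pos_le_divide_eq add_pos_nonneg)
  qed
  have sG: "\<sigma> * G\<^sup>2 \<le> \<theta> * C * G"
  proof -
    have "\<sigma> * G\<^sup>2 \<le> \<sigma> * (C * s * G)"
      using * by (intro mult_left_mono) (auto simp: power2_eq_square mult_right_mono)
    also have "\<dots> = (\<sigma> * s) * (C * G)" by simp
    also have "\<dots> \<le> \<theta> * (C * G)" using * assms by (intro mult_right_mono) auto
    finally show ?thesis by simp
  qed
  have k2: "\<kappa>\<^sup>2 \<le> \<theta>"
    using mult_mono[of \<kappa> \<theta> \<kappa> 1] * \<theta> by (simp add: power2_eq_square)
  have "D \<le> A * (\<theta> * (C * s) + 3 * (\<theta> * (C * s)) + 3 * (\<theta> * C * (C * s)))"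
    using * \<theta> k2 sG assms \<open>\<theta> > 0\<close>
    by (intro order.trans[OF D] mult_left_mono add_mono mult_mono order.trans[OF sG]) auto
  also have "\<dots> = \<theta> * (A * (4 * C + 3 * C\<^sup>2)) * s" by (simp add: algebra_simps power2_eq_square)
  also have "\<dots> \<le> \<eta> * s" using \<theta> * by (intro mult_right_mono) auto
  finally have D1: "D \<le> \<eta> * s" .
  have "D * X \<le> \<eta> * G\<^sup>2 + M * (\<kappa>\<^sup>2 * s\<^sup>2)" if X: "0 \<le> X" "X \<le> C * s"
  proof -
    have "D * X \<le> (A * (\<kappa>\<^sup>2 * (C * s) + 3 * (\<kappa> * G) + 3 * (\<sigma> * G\<^sup>2))) * (C * s)"
      using D X * assms by (intro mult_mono) auto
    also have "\<dots> = A * C\<^sup>2 * (\<kappa>\<^sup>2 * s\<^sup>2) + 3 * A * C * (\<kappa> * s) * G + 3 * A * C * G\<^sup>2 * (\<sigma> * s)"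
      by (simp add: algebra_simps power2_eq_square)
    also have "3 * A * C * G\<^sup>2 * (\<sigma> * s) \<le> 3 * A * C * G\<^sup>2 * \<theta>"
      using * assms by (intro mult_left_mono) auto
    also have "3 * A * C * G\<^sup>2 * \<theta> = (\<theta> * (6 * A * C)) * (G\<^sup>2 / 2)" by simp
    also have "\<dots> \<le> \<eta> * (G\<^sup>2 / 2)" using \<theta> by (intro mult_right_mono) auto
    also have "3 * A * C * (\<kappa> * s) * G \<le> \<eta> / 2 * G\<^sup>2 + (9 * A\<^sup>2 * C\<^sup>2 / (2 * \<eta>)) * (\<kappa>\<^sup>2 * s\<^sup>2)"
      using young_bound[of "\<eta> / 2" "3 * A * C * (\<kappa> * s)" G] assms(3) by (simp add: power_mult_distrib)
    finally show ?thesis by (simp add: M_def algebra_simps)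
  qed
  with D1 show "D \<le> \<eta> * s \<and> (0 \<le> X \<longrightarrow> X \<le> C * s \<longrightarrow> D * X \<le> \<eta> * G\<^sup>2 + M * (\<kappa>\<^sup>2 * s\<^sup>2))" by blast
qed


context lattice
begin

text \<open>The factor 2/sqrt \<beta> comes from the energy identity with a = 1/4.\<close>

lemma J4_bounds:
  assumes "nrm u \<le> c"
  shows "nrm (J (1/4) u) \<le> c" "sqrt k * gn (J (1/4) u) \<le> (2 / sqrt \<beta>) * c"
proof -
  have c: "c \<ge> 0" using assms nrm_nonneg order.trans by blast
  show n: "nrm (J (1/4) u) \<le> c" using nrm_J_le[of "1/4" u] assms by simp
  have "(1/4) * (k * \<beta>) * (gn (J (1/4) u))\<^sup>2 \<le> ip u (J (1/4) u)"
    using J_energy[of "1/4" u] zero_le_power2[of "nrm (J (1/4) u)"] by linarith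
  also have "\<dots> \<le> nrm u * nrm (J (1/4) u)" using ip_CS[of u "J (1/4) u"] by linarith
  also have "\<dots> \<le> c * c" using assms n c by (intro mult_mono) auto
  finally have "k * \<beta> * (gn (J (1/4) u))\<^sup>2 \<le> (2 * c)\<^sup>2"
    by (simp add: power2_eq_square)
  moreover have "(sqrt k * gn (J (1/4) u) * sqrt \<beta>)\<^sup>2 = k * \<beta> * (gn (J (1/4) u))\<^sup>2"
    using k_pos \<beta>_pos by (simp add: power_mult_distrib)
  ultimately have "(sqrt k * gn (J (1/4) u) * sqrt \<beta>)\<^sup>2 \<le> (2 * c)\<^sup>2" by simp
  then have "sqrt k * gn (J (1/4) u) * sqrt \<beta> \<le> 2 * c"
    using c by (auto intro: power2_le_imp_le)
  then show "sqrt k * gn (J (1/4) u) \<le> (2 / sqrt \<beta>) * c"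
    using \<beta>_pos by (simp add: field_simps)
qed

end

lemma square_sum4_le: "(a + b + c + (d::real))\<^sup>2 \<le> 4 * (a\<^sup>2 + b\<^sup>2 + c\<^sup>2 + d\<^sup>2)"
  using sum_squares_bound[of a b] sum_squares_bound[of a c] sum_squares_bound[of a d]
    sum_squares_bound[of b c] sum_squares_bound[of b d] sum_squares_bound[of c d]
  by (simp add: power2_eq_square algebra_simps)

text \<open>In the application the G are sqrt k times gradient norms, q = k s^2, and \<tau> is a
  multiple of k^5. The dissipation controls only Gv and Gu; G2 and G3 are recovered from Gv and the
  difference Gy, which the nonlinear increment D2 controls. With \<eta> at most \<beta>/1000, all
  gradient terms together stay below the margin \<beta>/10.\<close>

lemma absorption_sum:
  fixes \<beta> \<eta> M q K C \<tau> :: real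
  assumes pos: "\<beta> > 0" "\<eta> > 0" "\<eta> \<le> \<beta> / 1000" "M > 0" "q \<ge> 0" "K \<ge> 1"
    and GM: "\<beta> * Gy\<^sup>2 \<le> \<eta> * G2\<^sup>2 + M * q" "0 \<le> G2" "0 \<le> G3"
    and G2: "G2 \<le> Gv + Gy / 2" and G3: "G3 \<le> Gv + Gy / 2"
    and D2: "D2 * n1 \<le> \<eta> * G2\<^sup>2 + M * q" "D2 * nu \<le> \<eta> * G2\<^sup>2 + M * q" "D2 * nv \<le> \<eta> * G2\<^sup>2 + M * q"
      "D2\<^sup>2 \<le> \<eta> * G2\<^sup>2 + M * q"
    and D3: "D3 * nu \<le> \<eta> * G3\<^sup>2 + M * q" "D3 * nv \<le> \<eta> * G3\<^sup>2 + M * q" "D3\<^sup>2 \<le> \<eta> * G3\<^sup>2 + M * q"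
    and D4: "D4 * nu \<le> \<eta> * Gu\<^sup>2 + M * q" "D4\<^sup>2 \<le> \<eta> * Gu\<^sup>2 + M * q"
    and R: "Ru \<le> (C * q + \<tau>) + K * (\<eta> * Gu\<^sup>2 / K + K * \<tau> / (4 * \<eta>))"
      "Rv \<le> (C * q + \<tau>) + K * (\<eta> * Gv\<^sup>2 / K + K * \<tau> / (4 * \<eta>))"
    and nd: "nd\<^sup>2 \<le> K\<^sup>2 * \<tau>"
    and E: "E \<le> n1\<^sup>2 + D2 * n1 / 2 + D2\<^sup>2 / 16 + (D2 * nu / 4 + D2 * nv / 4 + D3 * nu / 2 + D3 * nv / 2) + (Ru + Rv)
      + 2 * (D4 * nu / 3 + D2 * nu / 6 + D3 * nu / 6) + 2 * Ru
      + 4 * (D4\<^sup>2 / 9 + D2\<^sup>2 / 36 + D3\<^sup>2 / 36 + nd\<^sup>2) - (\<beta> / 10) * (Gv\<^sup>2 + Gu\<^sup>2)"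
  shows "E \<le> n1\<^sup>2 + (8 * M + 4 * C) * q + (4 + K\<^sup>2 / \<eta> + 4 * K\<^sup>2) * \<tau>"
proof -
  have Gy2: "Gy\<^sup>2 \<le> G2\<^sup>2 / 1000 + M * q / \<beta>"
  proof -
    have "\<beta> * Gy\<^sup>2 \<le> (\<beta> / 1000) * G2\<^sup>2 + M * q"
      using GM(1) mult_right_mono[OF pos(3), of "G2\<^sup>2"] by simp
    then show ?thesis using pos(1) by (simp add: field_simps)
  qed
  have sq: "G\<^sup>2 \<le> 2 * Gv\<^sup>2 + Gy\<^sup>2 / 2" if "0 \<le> G" "G \<le> Gv + Gy / 2" for G
  proof -
    have "G\<^sup>2 \<le> (Gv + Gy / 2)\<^sup>2" using that by (intro power_mono) auto
    also have "\<dots> \<le> 2 * Gv\<^sup>2 + Gy\<^sup>2 / 2"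
      using sum_squares_bound[of Gv "Gy/2"] by (simp add: power2_sum power_divide)
    finally show ?thesis .
  qed
  have Mq: "M * q / \<beta> \<ge> 0" using pos by simp
  have g2: "G2\<^sup>2 \<le> 3 * Gv\<^sup>2 + M * q / \<beta>"
    using sq[OF GM(2) G2] Gy2 zero_le_power2[of Gv] Mq by linarith
  have g3: "G3\<^sup>2 \<le> 3 * Gv\<^sup>2 + M * q / \<beta>"
    using sq[OF GM(3) G3] Gy2 zero_le_power2[of Gv] Mq g2 by linarith
  have e: "\<eta> * (M * q / \<beta>) \<le> M * q / 1000"
    using mult_right_mono[OF pos(3), of "M * q / \<beta>"] pos by simp
  have "\<eta> * (3 * Gv\<^sup>2 + M * q / \<beta>) = 3 * (\<eta> * Gv\<^sup>2) + \<eta> * (M * q / \<beta>)"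
    by (simp only: distrib_left mult.left_commute)
  then have eg2: "\<eta> * G2\<^sup>2 \<le> 3 * (\<eta> * Gv\<^sup>2) + M * q / 1000" and eg3: "\<eta> * G3\<^sup>2 \<le> 3 * (\<eta> * Gv\<^sup>2) + M * q / 1000"
    using mult_left_mono[OF g2, of \<eta>] mult_left_mono[OF g3, of \<eta>] e pos(2) by linarith+
  have ev: "\<eta> * Gv\<^sup>2 \<le> \<beta> * Gv\<^sup>2 / 1000" and eu: "\<eta> * Gu\<^sup>2 \<le> \<beta> * Gu\<^sup>2 / 1000"
    using mult_right_mono[OF pos(3), of "Gv\<^sup>2"] mult_right_mono[OF pos(3), of "Gu\<^sup>2"] by simp_all
  have Ru: "Ru \<le> C * q + \<tau> + \<eta> * Gu\<^sup>2 + K\<^sup>2 / \<eta> * \<tau> / 4"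
    and Rv: "Rv \<le> C * q + \<tau> + \<eta> * Gv\<^sup>2 + K\<^sup>2 / \<eta> * \<tau> / 4"
    using R pos by (simp_all add: algebra_simps power2_eq_square)
  have nn: "\<eta> * Gv\<^sup>2 \<ge> 0" "\<eta> * Gu\<^sup>2 \<ge> 0" "M * q \<ge> 0" using pos by auto
  define Mq kt where "Mq = M * q" and "kt = K\<^sup>2 / \<eta> * \<tau>"
  define gv gu g2 g3 where "gv = \<eta> * Gv\<^sup>2" and "gu = \<eta> * Gu\<^sup>2" and "g2 = \<eta> * G2\<^sup>2" and "g3 = \<eta> * G3\<^sup>2"
  define bv bu where "bv = \<beta> * Gv\<^sup>2" and "bu = \<beta> * Gu\<^sup>2"
  note defs = Mq_def[symmetric] kt_def[symmetric] gv_def[symmetric] gu_def[symmetric]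
    g2_def[symmetric] g3_def[symmetric] bv_def[symmetric] bu_def[symmetric]
  have E': "E \<le> n1\<^sup>2 + D2 * n1 / 2 + D2\<^sup>2 / 16 + (D2 * nu / 4 + D2 * nv / 4 + D3 * nu / 2 + D3 * nv / 2) + (Ru + Rv)
      + 2 * (D4 * nu / 3 + D2 * nu / 6 + D3 * nu / 6) + 2 * Ru
      + 4 * (D4\<^sup>2 / 9 + D2\<^sup>2 / 36 + D3\<^sup>2 / 36 + nd\<^sup>2) - (bv + bu) / 10"
    using E unfolding bv_def bu_def by (simp add: distrib_left add_divide_distrib)
  have "E \<le> n1\<^sup>2 + 8 * Mq + 4 * (C * q) + 4 * \<tau> + kt + 4 * (K\<^sup>2 * \<tau>)"
  proof -
    define a1 a2 a3 a4 b1 b2 b3 c1 c2 Cq Kt where "a1 = D2 * n1" and "a2 = D2 * nu" and "a3 = D2 * nv" and "a4 = D2\<^sup>2"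
      and "b1 = D3 * nu" and "b2 = D3 * nv" and "b3 = D3\<^sup>2" and "c1 = D4 * nu" and "c2 = D4\<^sup>2"
      and "Cq = C * q" and "Kt = K\<^sup>2 * \<tau>"
    note defs2 = defs a1_def[symmetric] a2_def[symmetric] a3_def[symmetric] a4_def[symmetric] b1_def[symmetric]
      b2_def[symmetric] b3_def[symmetric] c1_def[symmetric] c2_def[symmetric] Cq_def[symmetric] Kt_def[symmetric]
    have "0 \<le> g2 + Mq" "0 \<le> g3 + Mq" using D2(4) D3(3) zero_le_power2 order.trans unfolding defs by blast+
    then show ?thesis
      using E' D2 D3 D4 Ru Rv nd eg2 eg3 ev eu nn unfolding defs2 by (simp add: field_simps)
  qed
  then show ?thesis by (simp add: Mq_def kt_def distrib_left distrib_right)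
qed


text \<open>A crude bound of every stage error by a multiple of s = |e1| + k^(5/2) makes the
  nonlinear differences small relative to s. Only then is the energy identity applied, which keeps
  the leading coefficient 1 that a Gronwall argument over T/k steps needs.\<close>

theorem step_stability:
  fixes \<alpha> \<beta> K :: real
  assumes pos: "\<alpha> > 0" "\<beta> > 0" "K \<ge> 1"
  obtains \<theta> M where "\<theta> > 0" "M > 0"
    "\<And>(B :: 'a set) sh sb h k f w2 w3 w4 e1 e2 e3 e4 e5 r d.
      lattice B sh sb h k \<alpha> \<beta> \<Longrightarrow> k \<le> \<theta> \<Longrightarrow>
      h powr (-3/2) * (lattice.nrm B h e1 + k\<^sup>2 * sqrt k) \<le> \<theta> \<Longrightarrow>
      (\<And>p. norm (f p) \<le> K) \<Longrightarrow>
      (\<And>p. norm (w2 p) \<le> K) \<Longrightarrow> (\<And>d p. norm (lattice.Ac sh sb h d w2 p) \<le> K) \<Longrightarrow>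
      (\<And>p. norm (w3 p) \<le> K) \<Longrightarrow> (\<And>d p. norm (lattice.Ac sh sb h d w3 p) \<le> K) \<Longrightarrow>
      (\<And>p. norm (w4 p) \<le> K) \<Longrightarrow> (\<And>d p. norm (lattice.Ac sh sb h d w4 p) \<le> K) \<Longrightarrow>
      (\<And>p. e2 p = e1 p + (1/4) *\<^sub>R lattice.Z sh sb h k \<beta> e2 p) \<Longrightarrow>
      (\<And>p. e3 p = e1 p + (k/2) *\<^sub>R (lattice.NL sh sb h \<alpha> \<beta> f w2 p - lattice.NL sh sb h \<alpha> \<beta> f (\<lambda>p. w2 p - e2 p) p)
        + (1/4) *\<^sub>R lattice.Z sh sb h k \<beta> e3 p) \<Longrightarrow>
      (\<And>p. e4 p = e1 p + (k/2) *\<^sub>R ((lattice.NL sh sb h \<alpha> \<beta> f w2 p - lattice.NL sh sb h \<alpha> \<beta> f (\<lambda>p. w2 p - e2 p) p)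
          + (lattice.NL sh sb h \<alpha> \<beta> f w3 p - lattice.NL sh sb h \<alpha> \<beta> f (\<lambda>p. w3 p - e3 p) p))
        + (1/3) *\<^sub>R lattice.Z sh sb h k \<beta> (\<lambda>p. e2 p + e3 p + e4 p) p + r p) \<Longrightarrow>
      (\<And>p. e5 p = e4 p + (k/3) *\<^sub>R (lattice.NL sh sb h \<alpha> \<beta> f w4 p - lattice.NL sh sb h \<alpha> \<beta> f (\<lambda>p. w4 p - e4 p) p)
        - (k/6) *\<^sub>R ((lattice.NL sh sb h \<alpha> \<beta> f w2 p - lattice.NL sh sb h \<alpha> \<beta> f (\<lambda>p. w2 p - e2 p) p)
          + (lattice.NL sh sb h \<alpha> \<beta> f w3 p - lattice.NL sh sb h \<alpha> \<beta> f (\<lambda>p. w3 p - e3 p) p)) + d p) \<Longrightarrow>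
      (\<And>x. \<bar>lattice.ip B h r x\<bar> \<le> K * k ^ 3 * (lattice.nrm B h x + lattice.gn B sh h x)) \<Longrightarrow>
      (\<And>x. \<bar>lattice.ip B h d x\<bar> \<le> K * k ^ 3 * (lattice.nrm B h x + lattice.gn B sh h x)) \<Longrightarrow>
      sqrt k * lattice.nrm B h d \<le> K * k ^ 3 \<Longrightarrow>
      (lattice.nrm B h e5)\<^sup>2 \<le> (1 + M * k) * (lattice.nrm B h e1)\<^sup>2 + M * k ^ 5"
proof -
  define Bi where "Bi = 1 / sqrt \<beta>"
  have Bi: "Bi > 0" using pos by (simp add: Bi_def)
  define A where "A = (13 * \<beta> + 3 * \<alpha>) * K\<^sup>2"
  have A: "A > 0" using pos by (auto simp: A_def intro!: mult_pos_pos add_pos_pos)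
  \<comment> \<open>\<open>C4\<close> and \<open>CG\<close> are the constants that solve the
    quadratic inequality \<open>en4\<close> for the norm of e4 and for its weighted gradient; in
    \<open>C4\<close> the summand 2 K Bi dominates the inhomogeneous term.\<close>
  define C4 where "C4 = 10 + K + 2 * K * Bi"
  define CG where "CG = sqrt ((6 / \<beta>) * ((10 + K) * C4 + (3/2) * K\<^sup>2 / \<beta>))"
  define C where "C = 5 + 4 * Bi + C4 + CG"
  have C4: "C4 > 0" using pos Bi by (auto simp: C4_def intro!: add_pos_nonneg)
  have CG: "CG \<ge> 0" using pos C4 by (auto simp: CG_def intro!: mult_nonneg_nonneg add_nonneg_nonneg)
  have C: "C \<ge> 5" "4 * Bi \<le> C" "2 * Bi \<le> C" "C4 \<le> C" "CG \<le> C" using Bi C4 CG by (auto simp: C_def)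
  define \<eta> where "\<eta> = min 1 (\<beta> / 1000)"
  have \<eta>: "\<eta> > 0" "\<eta> \<le> 1" "\<eta> \<le> \<beta> / 1000" using pos by (auto simp: \<eta>_def)
  obtain \<theta>0 M where th0: "\<theta>0 > 0" and M: "M > 0" and absorb:
    "\<And>\<kappa> \<sigma> s G D X. 0 \<le> \<kappa> \<Longrightarrow> \<kappa> \<le> \<theta>0 \<Longrightarrow> 0 \<le> \<sigma> \<Longrightarrow> 0 \<le> s \<Longrightarrow> \<sigma> * s \<le> \<theta>0 \<Longrightarrow> 0 \<le> G \<Longrightarrow> G \<le> C * s \<Longrightarrow>
      D \<le> A * (\<kappa>\<^sup>2 * (C * s) + 3 * (\<kappa> * G) + 3 * (\<sigma> * G\<^sup>2)) \<Longrightarrow>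
      D \<le> \<eta> * s \<and> (0 \<le> X \<longrightarrow> X \<le> C * s \<longrightarrow> D * X \<le> \<eta> * G\<^sup>2 + M * (\<kappa>\<^sup>2 * s\<^sup>2))"
    using absorb_product[OF A _ \<eta>(1), of C] C(1) by auto
  \<comment> \<open>\<theta>0^2 gives sqrt k \<le> \<theta>0, and 1/C ensures h^(-3/2) |e| \<le> 1
    for each stage error, as \<open>nrm_NL_diff_le\<close> demands.\<close>
  define \<theta> where "\<theta> = min (min 1 (\<theta>0\<^sup>2)) (min \<theta>0 (1 / C))"
  have th: "\<theta> > 0" "\<theta> \<le> 1" "\<theta> \<le> \<theta>0" "\<theta> \<le> \<theta>0\<^sup>2" "\<theta> * C \<le> 1"
  proof -
    show "\<theta> > 0" using th0 C by (simp add: \<theta>_def)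
    have "\<theta> \<le> 1 / C" by (simp add: \<theta>_def)
    then show "\<theta> * C \<le> 1" using C by (simp add: pos_le_divide_eq)
  qed (auto simp: \<theta>_def)
  define M1 where "M1 = 8 * M + 4 * (K * C\<^sup>2)"
  define M2 where "M2 = K * (4 + K\<^sup>2 / \<eta> + 4 * K\<^sup>2)"
  have M12: "M1 > 0" "M2 \<ge> 0" using M pos \<eta> by (auto simp: M1_def M2_def intro!: add_pos_nonneg mult_nonneg_nonneg add_nonneg_nonneg)
  show thesis
  proof (rule that[of \<theta> "2 * M1 + M2"])
    show "0 < \<theta>" "0 < 2 * M1 + M2" using th M12 by auto
    fix B :: "'a set" and sh sb h k f w2 w3 w4 e1 e2 e3 e4 e5 r d
    assume "lattice B sh sb h k \<alpha> \<beta>"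
    then interpret lattice B sh sb h k \<alpha> \<beta> f .
    assume k: "k \<le> \<theta>" and s0: "h powr (-3/2) * (nrm e1 + k\<^sup>2 * sqrt k) \<le> \<theta>"
      and f: "\<And>p. norm (f p) \<le> K"
      and w2: "\<And>p. norm (w2 p) \<le> K" "\<And>d p. norm (Ac d w2 p) \<le> K"
      and w3: "\<And>p. norm (w3 p) \<le> K" "\<And>d p. norm (Ac d w3 p) \<le> K"
      and w4: "\<And>p. norm (w4 p) \<le> K" "\<And>d p. norm (Ac d w4 p) \<le> K"
      and e2: "\<And>p. e2 p = e1 p + (1/4) *\<^sub>R Z e2 p"
      and e3': "\<And>p. e3 p = e1 p + (k/2) *\<^sub>R (NL w2 p - NL (\<lambda>p. w2 p - e2 p) p) + (1/4) *\<^sub>R Z e3 p"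
      and e4': "\<And>p. e4 p = e1 p + (k/2) *\<^sub>R ((NL w2 p - NL (\<lambda>p. w2 p - e2 p) p) + (NL w3 p - NL (\<lambda>p. w3 p - e3 p) p))
        + (1/3) *\<^sub>R Z (\<lambda>p. e2 p + e3 p + e4 p) p + r p"
      and e5': "\<And>p. e5 p = e4 p + (k/3) *\<^sub>R (NL w4 p - NL (\<lambda>p. w4 p - e4 p) p)
        - (k/6) *\<^sub>R ((NL w2 p - NL (\<lambda>p. w2 p - e2 p) p) + (NL w3 p - NL (\<lambda>p. w3 p - e3 p) p)) + d p"
      and r: "\<And>x. \<bar>ip r x\<bar> \<le> K * k ^ 3 * (nrm x + gn x)"
      and d: "\<And>x. \<bar>ip d x\<bar> \<le> K * k ^ 3 * (nrm x + gn x)"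
      and nd: "sqrt k * nrm d \<le> K * k ^ 3"
    define l2 l3 l4 where "l2 p = NL w2 p - NL (\<lambda>p. w2 p - e2 p) p" and "l3 p = NL w3 p - NL (\<lambda>p. w3 p - e3 p) p"
      and "l4 p = NL w4 p - NL (\<lambda>p. w4 p - e4 p) p" for p
    note e3 = e3'[folded l2_def] and e4 = e4'[folded l2_def l3_def] and e5 = e5'[folded l2_def l3_def l4_def]
    \<comment> \<open>In these units gradients appear as \<kappa> gn, and the residual size splits
      as k^3 = (k^2 \<kappa>) \<kappa>: one factor \<kappa> accompanies the gradient, the other
      factor has the square k^5 = \<tau>.\<close>
    define \<kappa> \<sigma> s \<tau> where "\<kappa> = sqrt k" and "\<sigma> = h powr (-3/2)" and "s = nrm e1 + k\<^sup>2 * sqrt k" and "\<tau> = k ^ 5"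
    have \<kappa>: "\<kappa> > 0" "\<kappa>\<^sup>2 = k" "\<kappa> \<le> \<theta>0" "\<kappa> \<le> 1"
    proof -
      show "\<kappa> > 0" "\<kappa>\<^sup>2 = k" using k_pos by (auto simp: \<kappa>_def)
      show "\<kappa> \<le> \<theta>0" using th k th0 unfolding \<kappa>_def by (intro real_le_lsqrt) auto
      show "\<kappa> \<le> 1" using th k unfolding \<kappa>_def by simp
    qed
    have \<tau>: "(k\<^sup>2 * \<kappa>)\<^sup>2 = \<tau>" "\<tau> > 0"
      using \<kappa> k_pos by (auto simp: \<tau>_def power_mult_distrib eval_nat_numeral)
    have k3: "k ^ 3 = (k\<^sup>2 * \<kappa>) * \<kappa>" using \<kappa>(2) by (simp add: power2_eq_square eval_nat_numeral)
    have s: "nrm e1 \<le> s" "k\<^sup>2 * \<kappa> \<le> s" "s > 0" "\<sigma> * s \<le> \<theta>" "\<sigma> \<ge> 0"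
      using s0 \<kappa> k_pos by (auto simp: s_def \<kappa>_def \<sigma>_def add_nonneg_pos)
    have k3s: "k ^ 3 \<le> s"
      using mult_left_mono[OF \<kappa>(4), of "k\<^sup>2 * \<kappa>"] \<kappa>(1) s(2) unfolding k3 by simp
    define D where "D e w = k * nrm (\<lambda>p. NL w p - NL (\<lambda>p. w p - e p) p)" for e w
    have D0: "D e w \<ge> 0" for e w using k_pos by (simp add: D_def)
    have Dk: "D e w \<le> \<eta> * s" "\<And>X. 0 \<le> X \<Longrightarrow> X \<le> C * s \<Longrightarrow> D e w * X \<le> \<eta> * (\<kappa> * gn e)\<^sup>2 + M * (\<kappa>\<^sup>2 * s\<^sup>2)"
      if w: "\<And>p. norm (w p) \<le> K" "\<And>d p. norm (Ac d w p) \<le> K" and e: "nrm e \<le> C * s" "\<kappa> * gn e \<le> C * s" for e w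
    proof -
      have "\<sigma> * nrm e \<le> \<sigma> * (C * s)" using e s by (intro mult_left_mono) auto
      also have "\<dots> = C * (\<sigma> * s)" by simp
      also have "\<dots> \<le> C * \<theta>" using s C by (intro mult_left_mono) auto
      finally have "\<sigma> * nrm e \<le> 1" using th by (simp add: mult.commute)
      then have "D e w \<le> k * (A * (nrm e + 3 * gn e + 3 * (\<sigma> * (gn e)\<^sup>2)))"
        unfolding D_def A_def \<sigma>_def using k_pos pos by (intro mult_left_mono nrm_NL_diff_le w f) auto
      also have "\<dots> = A * (\<kappa>\<^sup>2 * nrm e + 3 * (\<kappa> * (\<kappa> * gn e)) + 3 * (\<sigma> * (\<kappa> * gn e)\<^sup>2))"
        unfolding \<kappa>(2)[symmetric] by (simp add: power2_eq_square algebra_simps)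
      also have "\<dots> \<le> A * (\<kappa>\<^sup>2 * (C * s) + 3 * (\<kappa> * (\<kappa> * gn e)) + 3 * (\<sigma> * (\<kappa> * gn e)\<^sup>2))"
        using A e by (intro mult_left_mono add_mono order_refl) auto
      finally have "D e w \<le> \<dots>" .
      from absorb[OF _ _ _ _ _ _ _ this] \<kappa> s th e
      show "D e w \<le> \<eta> * s" "\<And>X. 0 \<le> X \<Longrightarrow> X \<le> C * s \<Longrightarrow> D e w * X \<le> \<eta> * (\<kappa> * gn e)\<^sup>2 + M * (\<kappa>\<^sup>2 * s\<^sup>2)"
        by auto
    qed
    have Cs: "x \<le> C * s" if "x \<le> c * s" "c \<le> C" for x c
      using that mult_right_mono[of c C s] s by linarith
    have n_half: "nrm (\<lambda>p. (k/2) *\<^sub>R l2 p) = D e2 w2 / 2"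
      using k_pos by (simp add: nrm_scale D_def l2_def)
    have J2: "e2 = J (1/4) e1" by (rule J_unique[symmetric]) (use e2 in auto)
    have b2: "nrm e2 \<le> s" "\<kappa> * gn e2 \<le> 2 * Bi * s"
      using J4_bounds[OF s(1)] unfolding J2 \<kappa>_def Bi_def by auto
    have b2C: "nrm e2 \<le> C * s" "\<kappa> * gn e2 \<le> C * s"
      using Cs[of "nrm e2" 1] Cs[OF b2(2)] b2 C by auto
    note D2 = Dk[OF w2 b2C]
    have D2s: "D e2 w2 \<le> s" using D2(1) mult_right_mono[OF \<eta>(2), of s] s by linarith
    have J3: "e3 = J (1/4) (\<lambda>p. e1 p + (k/2) *\<^sub>R l2 p)" by (rule J_unique[symmetric]) (use e3 in auto)
    have "nrm (\<lambda>p. e1 p + (k/2) *\<^sub>R l2 p) \<le> 2 * s"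
      using nrm_add[of e1 "\<lambda>p. (k/2) *\<^sub>R l2 p"] n_half D2s s by linarith
    from J4_bounds[OF this] have b3: "nrm e3 \<le> 2 * s" "\<kappa> * gn e3 \<le> 4 * Bi * s"
      unfolding J3 \<kappa>_def Bi_def by auto
    have b3C: "nrm e3 \<le> C * s" "\<kappa> * gn e3 \<le> C * s"
      using Cs[OF b3(1)] Cs[OF b3(2)] C by auto
    note D3 = Dk[OF w3 b3C]
    have D3s: "D e3 w3 \<le> s" using D3(1) mult_right_mono[OF \<eta>(2), of s] s by linarith
    \<comment> \<open>\<open>Z\<close> of stage errors 2 and 3 is eliminated through their own
      equations, Z e = 4 (e - data). Stage error 4 then solves a resolvent equation with data of
      size s; the bound 10 s adds 1 + 1/2 + 1/2 + 8/3 + 16/3.\<close>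
    define g0 where "g0 p = e1 p + (k/2) *\<^sub>R l2 p + (k/2) *\<^sub>R l3 p + (4/3) *\<^sub>R (e2 p - e1 p)
      + (4/3) *\<^sub>R (e3 p - (e1 p + (k/2) *\<^sub>R l2 p))" for p
    have n_half3: "nrm (\<lambda>p. (k/2) *\<^sub>R l3 p) = D e3 w3 / 2"
      using k_pos by (simp add: nrm_scale D_def l3_def)
    have g0: "nrm g0 \<le> 10 * s"
    proof -
      have "nrm g0 \<le> nrm e1 + nrm (\<lambda>p. (k/2) *\<^sub>R l2 p) + nrm (\<lambda>p. (k/2) *\<^sub>R l3 p) + nrm (\<lambda>p. (4/3) *\<^sub>R (e2 p - e1 p))
        + nrm (\<lambda>p. (4/3) *\<^sub>R (e3 p - (e1 p + (k/2) *\<^sub>R l2 p)))"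
        unfolding g0_def by (intro order.trans[OF nrm_add] add_mono order_refl)
      moreover have "nrm (\<lambda>p. (4/3) *\<^sub>R (e2 p - e1 p)) \<le> 8 * s / 3"
        unfolding nrm_scale using nrm_diff[of e2 e1] b2 s by simp
      moreover have "nrm (\<lambda>p. (4/3) *\<^sub>R (e3 p - (e1 p + (k/2) *\<^sub>R l2 p))) \<le> 16 * s / 3"
        unfolding nrm_scale using nrm_diff[of e3 "\<lambda>p. e1 p + (k/2) *\<^sub>R l2 p"] b3
          \<open>nrm (\<lambda>p. e1 p + (k/2) *\<^sub>R l2 p) \<le> 2 * s\<close> by simp
      ultimately show ?thesis using n_half n_half3 D2s D3s s(1) by (simp add: field_simps)
    qed
    have e4g: "e4 p = g0 p + r p + (1/3) *\<^sub>R Z e4 p" for p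
    proof -
      have z2: "Z e2 p = 4 *\<^sub>R (e2 p - e1 p)"
        using arg_cong[OF e2[of p], of "\<lambda>x. 4 *\<^sub>R (x - e1 p)"] by simp
      have z3: "Z e3 p = 4 *\<^sub>R (e3 p - (e1 p + (k/2) *\<^sub>R l2 p))"
        using arg_cong[OF e3[of p], of "\<lambda>x. 4 *\<^sub>R (x - (e1 p + (k/2) *\<^sub>R l2 p))"] by simp
      show ?thesis
        by (subst e4) (simp add: Z_lin z2 z3 g0_def vec_eq_iff field_simps)
    qed
    have "(nrm e4)\<^sup>2 + (1/3) * (k * \<beta>) * (gn e4)\<^sup>2 = ip (\<lambda>p. g0 p + r p) e4"
    proof -
      have "e4 = J (1/3) (\<lambda>p. g0 p + r p)" by (rule J_unique[symmetric]) (use e4g in auto)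
      then show ?thesis using J_energy[of "1/3" "\<lambda>p. g0 p + r p"] by simp
    qed
    also have "\<dots> \<le> 10 * s * nrm e4 + K * k ^ 3 * (nrm e4 + gn e4)"
      using ip_CS[of g0 e4] mult_right_mono[OF g0, of "nrm e4"] r[of e4] by (simp add: ip_lin)
    \<comment> \<open>The gradient part of the dual bound is absorbed by half the dissipation, which
      explains the weight \<beta>/6.\<close>
    also have "K * k ^ 3 * (nrm e4 + gn e4) \<le> K * s * nrm e4 + (\<beta>/6 * (\<kappa> * gn e4)\<^sup>2 + (3/2) * K\<^sup>2 / \<beta> * s\<^sup>2)"
    proof -
      have a: "K * k ^ 3 * nrm e4 \<le> K * s * nrm e4"
        using pos k3s by (intro mult_right_mono mult_left_mono) auto
      have e: "K * k ^ 3 * gn e4 = (K * (k\<^sup>2 * \<kappa>)) * (\<kappa> * gn e4)" unfolding k3 by simp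
      have c: "(K * (k\<^sup>2 * \<kappa>)) * (\<kappa> * gn e4) \<le> (\<beta>/6) * (\<kappa> * gn e4)\<^sup>2 + (K * (k\<^sup>2 * \<kappa>))\<^sup>2 / (4 * (\<beta>/6))"
        using pos by (intro young_bound) auto
      have dd: "(K * (k\<^sup>2 * \<kappa>))\<^sup>2 / (4 * (\<beta>/6)) \<le> (3/2) * K\<^sup>2 / \<beta> * s\<^sup>2"
      proof -
        have "(k\<^sup>2 * \<kappa>)\<^sup>2 \<le> s\<^sup>2" using s \<kappa> by (intro power_mono) auto
        then have "(3/2) * K\<^sup>2 / \<beta> * (k\<^sup>2 * \<kappa>)\<^sup>2 \<le> (3/2) * K\<^sup>2 / \<beta> * s\<^sup>2"
          using pos by (intro mult_left_mono) auto
        then show ?thesis by (simp add: power_mult_distrib)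
      qed
      have "K * k ^ 3 * gn e4 \<le> (\<beta>/6) * (\<kappa> * gn e4)\<^sup>2 + (3/2) * K\<^sup>2 / \<beta> * s\<^sup>2"
        unfolding e by (rule order.trans[OF c add_left_mono[OF dd]])
      with a show ?thesis unfolding distrib_left by (rule add_mono)
    qed
    finally have en4: "(nrm e4)\<^sup>2 + (\<beta>/6) * (\<kappa> * gn e4)\<^sup>2 \<le> (10 + K) * s * nrm e4 + (3/2) * K\<^sup>2 / \<beta> * s\<^sup>2"
      using \<kappa>(2) by (simp add: power_mult_distrib algebra_simps)
    have b4: "nrm e4 \<le> C4 * s" 
    proof (rule ccontr)
      assume "\<not> ?thesis"
      then have gt: "nrm e4 > C4 * s" by simp
      have "(3/2) * K\<^sup>2 / \<beta> = (3/2) * (K * Bi)\<^sup>2" using pos by (simp add: Bi_def power_mult_distrib power_divide)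
      also have "\<dots> \<le> 2 * K * Bi * (2 * K * Bi)" using pos Bi by (simp add: power2_eq_square)
      also have "\<dots> \<le> 2 * K * Bi * C4" using pos Bi by (intro mult_left_mono) (auto simp: C4_def)
      finally have "(3/2) * K\<^sup>2 / \<beta> * s\<^sup>2 \<le> (2 * K * Bi * C4) * s\<^sup>2" by (intro mult_right_mono) auto
      also have "\<dots> = (2 * K * Bi * s) * (C4 * s)" by (simp add: power2_eq_square)
      also have "\<dots> < (2 * K * Bi * s) * nrm e4" using gt pos Bi s by (intro mult_strict_left_mono) auto
      finally have "(nrm e4)\<^sup>2 < (10 + K) * s * nrm e4 + (2 * K * Bi * s) * nrm e4"
        using en4 pos zero_le_power2[of "\<kappa> * gn e4"] by (smt (verit) divide_nonneg_pos mult_nonneg_nonneg)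
      also have "\<dots> = (C4 * s) * nrm e4" by (simp add: C4_def algebra_simps)
      also have "\<dots> \<le> nrm e4 * nrm e4" using gt by (intro mult_right_mono) auto
      finally show False by (simp add: power2_eq_square)
    qed
    have g4: "\<kappa> * gn e4 \<le> CG * s"
    proof -
      have "(\<beta>/6) * (\<kappa> * gn e4)\<^sup>2 \<le> (10 + K) * s * (C4 * s) + (3/2) * K\<^sup>2 / \<beta> * s\<^sup>2"
      proof -
        have "(10 + K) * s * nrm e4 \<le> (10 + K) * s * (C4 * s)"
          using b4 pos s by (intro mult_left_mono) auto
        then show ?thesis using en4 zero_le_power2[of "nrm e4"] by linarith
      qed
      then have "(\<kappa> * gn e4)\<^sup>2 \<le> (6/\<beta>) * ((10 + K) * C4 + (3/2) * K\<^sup>2 / \<beta>) * s\<^sup>2"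
        using pos by (simp add: field_simps power2_eq_square)
      also have "\<dots> = (CG * s)\<^sup>2"
        using pos C4 by (simp add: CG_def power_mult_distrib add_nonneg_nonneg)
      finally show ?thesis using CG s by (auto intro: power2_le_imp_le)
    qed
    have b4C: "nrm e4 \<le> C * s" "\<kappa> * gn e4 \<le> C * s"
      using Cs[OF b4] Cs[OF g4] C by auto
    note D4 = Dk[OF w4 b4C]
    \<comment> \<open>Stages 2 and 3 enter the fourth equation through their mean v. Their deviation
      y from each other is J (1/4) of (k/2) l2, so its gradient is bounded by the nonlinear
      increment alone.\<close>
    define v where "v p = (1/2) *\<^sub>R (e2 p + e3 p)" for p
    define y where "y p = e3 p - e2 p" for p
    have nv: "nrm v \<le> C * s"
    proof -
      have "nrm v \<le> (1/2) * (nrm e2 + nrm e3)"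
        unfolding v_def nrm_scale using nrm_add[of e2 e3] by simp
      then show ?thesis using Cs[of "nrm v" 2] b2 b3 C s by simp
    qed
    have Jy: "y = J (1/4) (\<lambda>p. (k/2) *\<^sub>R l2 p)"
      unfolding y_def J2 J3 by (simp add: J_add)
    have gy: "\<kappa> * gn y \<le> Bi * D e2 w2"
      using J4_bounds(2)[of "\<lambda>p. (k/2) *\<^sub>R l2 p" "D e2 w2 / 2"] n_half
      unfolding Jy \<kappa>_def Bi_def by simp
    have gy2: "\<beta> * (\<kappa> * gn y)\<^sup>2 \<le> (D e2 w2)\<^sup>2"
    proof -
      have "\<beta> * (\<kappa> * gn y)\<^sup>2 \<le> \<beta> * (Bi * D e2 w2)\<^sup>2"
        using gy pos \<kappa> by (intro mult_left_mono power_mono) auto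
      also have "\<dots> = (D e2 w2)\<^sup>2" using pos by (simp add: Bi_def power_mult_distrib power_divide)
      finally show ?thesis .
    qed
    have sqD: "(D e w)\<^sup>2 \<le> \<eta> * (\<kappa> * gn e)\<^sup>2 + M * (\<kappa>\<^sup>2 * s\<^sup>2)"
      if "D e w \<le> \<eta> * s" "\<And>X. 0 \<le> X \<Longrightarrow> X \<le> C * s \<Longrightarrow> D e w * X \<le> \<eta> * (\<kappa> * gn e)\<^sup>2 + M * (\<kappa>\<^sup>2 * s\<^sup>2)" for e w
    proof -
      have "D e w \<le> C * s" using Cs[OF that(1)] \<eta> C by auto
      then show ?thesis using that(2)[of "D e w"] D0 by (simp add: power2_eq_square)
    qed
    have g2: "\<kappa> * gn e2 \<le> \<kappa> * gn v + \<kappa> * gn y / 2" and g3: "\<kappa> * gn e3 \<le> \<kappa> * gn v + \<kappa> * gn y / 2"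
    proof -
      have e2v: "e2 = (\<lambda>p. v p - (1/2) *\<^sub>R y p)" and e3v: "e3 = (\<lambda>p. v p + (1/2) *\<^sub>R y p)"
        by (auto simp: v_def y_def vec_eq_iff field_simps)
      have "gn e2 \<le> gn v + gn y / 2" unfolding e2v using gn_diff[of v "\<lambda>p. (1/2) *\<^sub>R y p"] by (simp add: gn_scale)
      then show "\<kappa> * gn e2 \<le> \<kappa> * gn v + \<kappa> * gn y / 2"
        using mult_left_mono[of "gn e2" "gn v + gn y / 2" \<kappa>] \<kappa> by (simp add: distrib_left)
      have "gn e3 \<le> gn v + gn y / 2" unfolding e3v using gn_add[of v "\<lambda>p. (1/2) *\<^sub>R y p"] by (simp add: gn_scale)
      then show "\<kappa> * gn e3 \<le> \<kappa> * gn v + \<kappa> * gn y / 2"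
        using mult_left_mono[of "gn e3" "gn v + gn y / 2" \<kappa>] \<kappa> by (simp add: distrib_left)
    qed
    define ev where "ev p = e1 p + (k/4) *\<^sub>R l2 p" for p
    define g where "g p = (k/4) *\<^sub>R l2 p + (k/2) *\<^sub>R l3 p + r p" for p
    have core: "(nrm e4)\<^sup>2 \<le> (nrm ev)\<^sup>2 + ip g (\<lambda>p. e4 p + v p) - (k * \<beta> / 10) * ((gn v)\<^sup>2 + (gn e4)\<^sup>2)"
    proof (rule energy_core)
      have Zv: "Z v p = (1/2) *\<^sub>R (Z e2 p + Z e3 p)" for p unfolding v_def by (simp add: Z_lin)
      show v1: "v p = ev p + (1/4) *\<^sub>R Z v p" for p
      proof -
        have "v p = (1/2) *\<^sub>R ((e1 p + (1/4) *\<^sub>R Z e2 p) + (e1 p + (k/2) *\<^sub>R l2 p + (1/4) *\<^sub>R Z e3 p))"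
          unfolding v_def using e2[of p] e3[of p] by simp
        then show ?thesis unfolding Zv ev_def by (simp add: vec_eq_iff field_simps)
      qed
      \<comment> \<open>5/12 = 2/3 - 1/4: two thirds from stages 2 and 3 in the fourth equation,
        less the quarter in the equation for v.\<close>
      show "e4 p = v p + g p + (5/12) *\<^sub>R Z v p + (1/3) *\<^sub>R Z e4 p" for p
        by (subst e4, subst v1) (simp add: Z_lin Zv ev_def g_def vec_eq_iff field_simps)
    qed
    let ?D2 = "D e2 w2" and ?D3 = "D e3 w3" and ?D4 = "D e4 w4"
    let ?n1 = "nrm e1" and ?nu = "nrm e4" and ?nv = "nrm v"
    define Rt where "Rt x = K * k ^ 3 * (nrm x + gn x)" for x
    have nl: "nrm (\<lambda>p. c *\<^sub>R l2 p) = \<bar>c\<bar> / k * ?D2" "nrm (\<lambda>p. c *\<^sub>R l3 p) = \<bar>c\<bar> / k * ?D3" "nrm (\<lambda>p. c *\<^sub>R l4 p) = \<bar>c\<bar> / k * ?D4" for c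
      using k_pos by (simp_all add: nrm_scale D_def l2_def l3_def l4_def)
    have E1: "(nrm ev)\<^sup>2 \<le> ?n1\<^sup>2 + ?D2 * ?n1 / 2 + ?D2\<^sup>2 / 16"
    proof -
      have "nrm ev \<le> ?n1 + ?D2 / 4"
        unfolding ev_def using nrm_add[of e1 "\<lambda>p. (k/4) *\<^sub>R l2 p"] nl(1)[of "k/4"] k_pos by simp
      then have "(nrm ev)\<^sup>2 \<le> (?n1 + ?D2 / 4)\<^sup>2" by (intro power_mono) auto
      then show ?thesis by (simp add: power2_sum power_divide algebra_simps)
    qed
    have ipl: "\<bar>ip (\<lambda>p. c *\<^sub>R l2 p) x\<bar> \<le> \<bar>c\<bar> / k * (?D2 * nrm x)" "\<bar>ip (\<lambda>p. c *\<^sub>R l3 p) x\<bar> \<le> \<bar>c\<bar> / k * (?D3 * nrm x)"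
      "\<bar>ip (\<lambda>p. c *\<^sub>R l4 p) x\<bar> \<le> \<bar>c\<bar> / k * (?D4 * nrm x)" for c x
      using ip_CS[of "\<lambda>p. c *\<^sub>R l2 p" x] ip_CS[of "\<lambda>p. c *\<^sub>R l3 p" x] ip_CS[of "\<lambda>p. c *\<^sub>R l4 p" x]
      unfolding nl by (simp_all add: mult.assoc)
    have E2: "ip g (\<lambda>p. e4 p + v p) \<le> (?D2 * ?nu / 4 + ?D2 * ?nv / 4 + ?D3 * ?nu / 2 + ?D3 * ?nv / 2) + (Rt e4 + Rt v)"
    proof -
      have "ip g (\<lambda>p. e4 p + v p) = ip (\<lambda>p. (k/4) *\<^sub>R l2 p) e4 + ip (\<lambda>p. (k/4) *\<^sub>R l2 p) v
        + ip (\<lambda>p. (k/2) *\<^sub>R l3 p) e4 + ip (\<lambda>p. (k/2) *\<^sub>R l3 p) v + ip r e4 + ip r v"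
        unfolding g_def by (simp add: ip_add_left ip_add_right)
      moreover have "k \<noteq> 0" "\<bar>k\<bar> = k" using k_pos by auto
      ultimately show ?thesis
        using ipl(1)[of "k/4" e4] ipl(1)[of "k/4" v] ipl(2)[of "k/2" e4] ipl(2)[of "k/2" v] r[of e4] r[of v]
        unfolding Rt_def by simp
    qed
    define g5 where "g5 p = (k/3) *\<^sub>R l4 p + (- k/6) *\<^sub>R l2 p + (- k/6) *\<^sub>R l3 p" for p
    have e5g: "e5 = (\<lambda>p. e4 p + (g5 p + d p))"
      using e5 by (auto simp: g5_def vec_eq_iff field_simps)
    have E3: "ip g5 e4 \<le> ?D4 * ?nu / 3 + ?D2 * ?nu / 6 + ?D3 * ?nu / 6"
    proof -
      have "ip g5 e4 = ip (\<lambda>p. (k/3) *\<^sub>R l4 p) e4 + ip (\<lambda>p. (- k/6) *\<^sub>R l2 p) e4 + ip (\<lambda>p. (- k/6) *\<^sub>R l3 p) e4"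
        unfolding g5_def by (simp only: ip_add_left)
      moreover have "k \<noteq> 0" "\<bar>k\<bar> = k" using k_pos by auto
      ultimately show ?thesis
        using ipl(3)[of "k/3" e4] ipl(1)[of "- k/6" e4] ipl(2)[of "- k/6" e4] by simp
    qed
    have E4: "(nrm (\<lambda>p. g5 p + d p))\<^sup>2 \<le> 4 * (?D4\<^sup>2 / 9 + ?D2\<^sup>2 / 36 + ?D3\<^sup>2 / 36 + (nrm d)\<^sup>2)"
    proof -
      have "k \<noteq> 0" "\<bar>k\<bar> = k" using k_pos by auto
      moreover have "nrm (\<lambda>p. g5 p + d p) \<le> nrm (\<lambda>p. (k/3) *\<^sub>R l4 p) + nrm (\<lambda>p. (- k/6) *\<^sub>R l2 p)
          + nrm (\<lambda>p. (- k/6) *\<^sub>R l3 p) + nrm d"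
        unfolding g5_def by (intro order.trans[OF nrm_add] add_mono order_refl)
      ultimately have "nrm (\<lambda>p. g5 p + d p) \<le> ?D4 / 3 + ?D2 / 6 + ?D3 / 6 + nrm d"
        using nl(3)[of "k/3"] nl(1)[of "- k/6"] nl(2)[of "- k/6"] by simp
      then have "(nrm (\<lambda>p. g5 p + d p))\<^sup>2 \<le> (?D4 / 3 + ?D2 / 6 + ?D3 / 6 + nrm d)\<^sup>2" by (intro power_mono) auto
      also have "\<dots> \<le> 4 * ((?D4 / 3)\<^sup>2 + (?D2 / 6)\<^sup>2 + (?D3 / 6)\<^sup>2 + (nrm d)\<^sup>2)" by (rule square_sum4_le)
      finally show ?thesis by (simp add: power_divide)
    qed
    have E5: "(nrm e5)\<^sup>2 = ?nu\<^sup>2 + 2 * ip g5 e4 + 2 * ip d e4 + (nrm (\<lambda>p. g5 p + d p))\<^sup>2"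
    proof -
      have "(nrm e5)\<^sup>2 = ip (\<lambda>p. e4 p + (g5 p + d p)) (\<lambda>p. e4 p + (g5 p + d p))" unfolding e5g nrm_sq ..
      also have "\<dots> = ip e4 e4 + ip (\<lambda>p. g5 p + d p) e4 + (ip (\<lambda>p. g5 p + d p) e4 + ip (\<lambda>p. g5 p + d p) (\<lambda>p. g5 p + d p))"
        unfolding ip_add_left[of e4 "\<lambda>p. g5 p + d p"] ip_add_right[of _ e4 "\<lambda>p. g5 p + d p"] ip_commute[of e4 "\<lambda>p. g5 p + d p"] by simp
      finally show ?thesis by (simp add: nrm_sq ip_add_left)
    qed
    \<comment> \<open>Young's inequality is used twice: the norm part becomes k s^2 plus k^5, and
      the gradient part is left with a coefficient \<eta> small enough for the dissipation.\<close>
    have Rb: "Rt x \<le> (K * C\<^sup>2 * (\<kappa>\<^sup>2 * s\<^sup>2) + K * \<tau>) + K * (\<eta> * (\<kappa> * gn x)\<^sup>2 / K + K * \<tau> / (4 * \<eta>))"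
      if x: "nrm x \<le> C * s" for x
    proof -
      have "(k\<^sup>2 * \<kappa>) * (\<kappa> * nrm x) \<le> 1 * (\<kappa> * nrm x)\<^sup>2 + (k\<^sup>2 * \<kappa>)\<^sup>2 / (4 * 1)"
        by (rule young_bound) simp
      also have "(\<kappa> * nrm x)\<^sup>2 \<le> (\<kappa> * (C * s))\<^sup>2" using x \<kappa> by (intro power_mono mult_left_mono) auto
      finally have 1: "k ^ 3 * nrm x \<le> C\<^sup>2 * (\<kappa>\<^sup>2 * s\<^sup>2) + \<tau>"
        using \<tau> unfolding k3 by (simp add: power_mult_distrib mult_ac)
      have 2: "(K * (k\<^sup>2 * \<kappa>)) * (\<kappa> * gn x) \<le> \<eta> * (\<kappa> * gn x)\<^sup>2 + (K * (k\<^sup>2 * \<kappa>))\<^sup>2 / (4 * \<eta>)"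
        using \<eta> by (intro young_bound)
      have "Rt x = K * (k ^ 3 * nrm x) + (K * (k\<^sup>2 * \<kappa>)) * (\<kappa> * gn x)"
        unfolding Rt_def k3 by (simp add: algebra_simps)
      also have "\<dots> \<le> K * (C\<^sup>2 * (\<kappa>\<^sup>2 * s\<^sup>2) + \<tau>) + (\<eta> * (\<kappa> * gn x)\<^sup>2 + (K * (k\<^sup>2 * \<kappa>))\<^sup>2 / (4 * \<eta>))"
        using pos by (intro add_mono mult_left_mono 1 2) auto
      also have "\<dots> = (K * C\<^sup>2 * (\<kappa>\<^sup>2 * s\<^sup>2) + K * \<tau>) + K * (\<eta> * (\<kappa> * gn x)\<^sup>2 / K + K * \<tau> / (4 * \<eta>))"
        using pos \<tau>(1)[symmetric] \<eta> by (simp add: power_mult_distrib field_simps power2_eq_square)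
      finally show ?thesis .
    qed
    have ndb: "(nrm d)\<^sup>2 \<le> K\<^sup>2 * \<tau>"
    proof -
      have "\<kappa> * nrm d \<le> \<kappa> * (K * (k\<^sup>2 * \<kappa>))" using nd unfolding \<kappa>_def[symmetric] k3 by (simp add: mult_ac)
      then have "nrm d \<le> K * (k\<^sup>2 * \<kappa>)" using \<kappa> by simp
      then have "(nrm d)\<^sup>2 \<le> (K * (k\<^sup>2 * \<kappa>))\<^sup>2" by (intro power_mono) auto
      then show ?thesis using \<tau>(1) by (simp add: power_mult_distrib)
    qed
    have kg: "(k * \<beta> / 10) * ((gn v)\<^sup>2 + (gn e4)\<^sup>2) = (\<beta> / 10) * ((\<kappa> * gn v)\<^sup>2 + (\<kappa> * gn e4)\<^sup>2)"
      unfolding \<kappa>(2)[symmetric] by (simp add: power_mult_distrib algebra_simps)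
    have q0: "\<kappa>\<^sup>2 * s\<^sup>2 \<ge> 0" by simp
    have sC: "nrm e1 \<le> C * s" using Cs[of "nrm e1" 1] s C by simp
    \<comment> \<open>The bookkeeping lemma is instantiated with K C^2 for its C and K \<tau> for
      its \<tau>.\<close>
    have "(nrm e5)\<^sup>2 \<le> ?n1\<^sup>2 + (8 * M + 4 * (K * C\<^sup>2)) * (\<kappa>\<^sup>2 * s\<^sup>2) + (4 + K\<^sup>2 / \<eta> + 4 * K\<^sup>2) * (K * \<tau>)"
    proof (rule absorption_sum[OF pos(2) \<eta>(1,3) M q0 pos(3), where Gy = "\<kappa> * gn y" and ?G2.0 = "\<kappa> * gn e2"
        and ?G3.0 = "\<kappa> * gn e3" and Gv = "\<kappa> * gn v" and Gu = "\<kappa> * gn e4" and ?D2.0 = ?D2 and ?D3.0 = ?D3 and ?D4.0 = ?D4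
        and nu = ?nu and nv = ?nv and Ru = "Rt e4" and Rv = "Rt v" and nd = "nrm d"])
      show "\<beta> * (\<kappa> * gn y)\<^sup>2 \<le> \<eta> * (\<kappa> * gn e2)\<^sup>2 + M * (\<kappa>\<^sup>2 * s\<^sup>2)" using gy2 sqD[OF D2] by linarith
      show "0 \<le> \<kappa> * gn e2" "0 \<le> \<kappa> * gn e3" using \<kappa> by auto
      show "(nrm d)\<^sup>2 \<le> K\<^sup>2 * (K * \<tau>)"
      proof -
        have "\<tau> \<le> K * \<tau>" using pos \<tau> by simp
        then have "K\<^sup>2 * \<tau> \<le> K\<^sup>2 * (K * \<tau>)" by (intro mult_left_mono) auto
        with ndb show ?thesis by (rule order.trans)
      qed
      have m: "K * (\<eta> * z / K + K * \<tau> / (4 * \<eta>)) \<le> K * (\<eta> * z / K + K * (K * \<tau>) / (4 * \<eta>))" for z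
        using pos \<tau> \<eta> by (intro mult_left_mono add_mono divide_right_mono) auto
      show "Rt e4 \<le> K * C\<^sup>2 * (\<kappa>\<^sup>2 * s\<^sup>2) + K * \<tau> + K * (\<eta> * (\<kappa> * gn e4)\<^sup>2 / K + K * (K * \<tau>) / (4 * \<eta>))"
        using Rb[OF b4C(1)] m[of "(\<kappa> * gn e4)\<^sup>2"] by linarith
      show "Rt v \<le> K * C\<^sup>2 * (\<kappa>\<^sup>2 * s\<^sup>2) + K * \<tau> + K * (\<eta> * (\<kappa> * gn v)\<^sup>2 / K + K * (K * \<tau>) / (4 * \<eta>))"
        using Rb[OF nv] m[of "(\<kappa> * gn v)\<^sup>2"] by linarith
      show "(nrm e5)\<^sup>2 \<le> ?n1\<^sup>2 + ?D2 * ?n1 / 2 + ?D2\<^sup>2 / 16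
        + (?D2 * ?nu / 4 + ?D2 * ?nv / 4 + ?D3 * ?nu / 2 + ?D3 * ?nv / 2) + (Rt e4 + Rt v)
        + 2 * (?D4 * ?nu / 3 + ?D2 * ?nu / 6 + ?D3 * ?nu / 6) + 2 * Rt e4
        + 4 * (?D4\<^sup>2 / 9 + ?D2\<^sup>2 / 36 + ?D3\<^sup>2 / 36 + (nrm d)\<^sup>2) - \<beta> / 10 * ((\<kappa> * gn v)\<^sup>2 + (\<kappa> * gn e4)\<^sup>2)"
      proof -
        have gen: "E \<le> V + P + R + 2 * Q + 2 * S + W - T"
          if "E = x + 2 * a + 2 * b + z" "x \<le> y + g - T" "y \<le> V" "g \<le> P + R" "a \<le> Q" "z \<le> W" "\<bar>b\<bar> \<le> S"
          for E V P R Q S W T x a b z y g :: real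
          using that by linarith
        show ?thesis
          by (rule gen[OF E5 core[unfolded kg] E1 E2 E3 E4 d[of e4, folded Rt_def]])
      qed
    qed (use g2 g3 D2 D3 D4 sqD[OF D2] sqD[OF D3] sqD[OF D4] sC b4C nv in auto)
    also have "\<dots> = ?n1\<^sup>2 + M1 * (k * s\<^sup>2) + M2 * \<tau>"
      using \<kappa>(2) by (simp add: M1_def M2_def)
    also have "\<dots> \<le> (1 + (2 * M1 + M2) * k) * ?n1\<^sup>2 + (2 * M1 + M2) * k ^ 5"
    proof -
      have "s\<^sup>2 \<le> 2 * ?n1\<^sup>2 + 2 * \<tau>"
        using sum_squares_bound[of ?n1 "k\<^sup>2 * \<kappa>"] \<tau>(1) unfolding s_def \<kappa>_def[symmetric] by (simp add: power2_sum)
      then have "M1 * (k * s\<^sup>2) \<le> M1 * (k * (2 * ?n1\<^sup>2 + 2 * \<tau>))"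
        using M12 k_pos by (intro mult_left_mono) auto
      also have "\<dots> = 2 * M1 * k * ?n1\<^sup>2 + 2 * M1 * (k * \<tau>)" by (simp add: algebra_simps)
      also have "2 * M1 * (k * \<tau>) \<le> 2 * M1 * \<tau>"
        using M12 \<tau> k th k_pos by (intro mult_left_mono) (auto simp: mult_left_le_one_le)
      finally have "M1 * (k * s\<^sup>2) \<le> 2 * M1 * k * ?n1\<^sup>2 + 2 * M1 * \<tau>" by simp
      moreover have "0 \<le> M2 * k * ?n1\<^sup>2" using M12 k_pos by simp
      ultimately show ?thesis by (simp add: \<tau>_def[symmetric] distrib_right)
    qed
    finally show "(nrm e5)\<^sup>2 \<le> (1 + (2 * M1 + M2) * k) * ?n1\<^sup>2 + (2 * M1 + M2) * k ^ 5" .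
  qed
qed

section \<open>The grid as half of a periodic lattice\<close>

text \<open>
  Even reflection turns the Neumann grid into a torus of side \<open>2 N\<close>. A point \<open>(\<sigma>, p)\<close> carries in
  \<open>\<sigma>\<close> the set of coordinates that have been reflected; moving past an end of a coordinate line
  changes the sheet instead of the index.
\<close>

definition upd :: "nat^3 \<Rightarrow> 3 \<Rightarrow> nat \<Rightarrow> nat^3"
  where "upd p d x = (\<chi> e. if e = d then x else p $ e)"

lemma upd_nth [simp]: "upd p d x $ e = (if e = d then x else p $ e)"
  by (simp add: upd_def)

lemma upd_upd [simp]: "upd (upd p d x) d y = upd p d y"
  by (simp add: vec_eq_iff)

lemma upd_same [simp]: "upd p d (p $ d) = p"
  by (simp add: vec_eq_iff)

lemma upd_comm: "d \<noteq> e \<Longrightarrow> upd (upd p d x) e y = upd (upd p e y) d x"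
  by (simp add: vec_eq_iff)

lemma upd_grid: "p \<in> grid N \<Longrightarrow> upd p d x \<in> grid N \<longleftrightarrow> 1 \<le> x \<and> x \<le> N"
  by (auto simp: grid_def)

lemma plus_axis: "p + axis d 1 = upd p d (p $ d + 1)"
  by (simp add: vec_eq_iff axis_def)

lemma minus_axis: "p - axis d 1 = upd p d (p $ d - 1)"
  by (simp add: vec_eq_iff axis_def)

type_synonym tpoint = "(3 \<Rightarrow> bool) \<times> (nat^3)"

definition torus :: "nat \<Rightarrow> tpoint set"
  where "torus N = UNIV \<times> grid N"

text \<open>Motion on one coordinate line: the move raises the index on the sheet s = b and lowers
  it on the other. At an end the sheet flips and the index stays, since an end cell is adjacent to
  its own mirror image; this is the ghost value rule.\<close>

definition step1 :: "nat \<Rightarrow> bool \<Rightarrow> bool \<times> nat \<Rightarrow> bool \<times> nat"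
  where "step1 N b r = (case r of (s, x) \<Rightarrow>
    if s = b then (if x < N then (s, x + 1) else (\<not> s, x))
    else (if 1 < x then (s, x - 1) else (\<not> s, x)))"

text \<open>\<open>b = False\<close> is the forward shift and \<open>b = True\<close> the backward
  one. Points off the grid are fixed, as the locale \<open>lattice\<close> demands.\<close>

definition tmove :: "nat \<Rightarrow> bool \<Rightarrow> 3 \<Rightarrow> tpoint \<Rightarrow> tpoint"
  where "tmove N b d q = (if snd q \<notin> grid N then q
    else ((fst q)(d := fst (step1 N b (fst q d, snd q $ d))), upd (snd q) d (snd (step1 N b (fst q d, snd q $ d)))))"

lemma step1_range: "1 \<le> x \<Longrightarrow> x \<le> N \<Longrightarrow> 1 \<le> snd (step1 N b (s, x)) \<and> snd (step1 N b (s, x)) \<le> N"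
  by (auto simp: step1_def)

lemma step1_inverse: "1 \<le> x \<Longrightarrow> x \<le> N \<Longrightarrow> step1 N b (step1 N (\<not> b) (s, x)) = (s, x)"
  by (auto simp: step1_def)

lemma tmove_in: "p \<in> grid N \<Longrightarrow> tmove N b d (\<sigma>, p)
    = (\<sigma>(d := fst (step1 N b (\<sigma> d, p $ d))), upd p d (snd (step1 N b (\<sigma> d, p $ d))))"
  by (simp add: tmove_def)

lemma grid_bounds: "p \<in> grid N \<Longrightarrow> 1 \<le> p $ d" "p \<in> grid N \<Longrightarrow> p $ d \<le> N"
  by (auto simp: grid_def)

lemma upd_step1_grid: "p \<in> grid N \<Longrightarrow> upd p d (snd (step1 N b (s, p $ d))) \<in> grid N"
  using step1_range[OF grid_bounds] by (simp add: upd_grid)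

abbreviation "tsh N \<equiv> tmove N False"
abbreviation "tsb N \<equiv> tmove N True"

lemma tmove_inverse: "tmove N b d (tmove N (\<not> b) d q) = q"
proof (cases "snd q \<in> grid N")
  case True
  obtain \<sigma> p where q: "q = (\<sigma>, p)" by (cases q)
  have p: "p \<in> grid N" using True q by simp
  have "step1 N b (step1 N (\<not> b) (\<sigma> d, p $ d)) = (\<sigma> d, p $ d)"
    by (intro step1_inverse grid_bounds[OF p])
  then show ?thesis
    unfolding q tmove_in[OF p] tmove_in[OF upd_step1_grid[OF p]] by simp
qed (simp add: tmove_def)

lemma tmove_comm: "tmove N b d (tmove N b e q) = tmove N b e (tmove N b d q)"
proof (cases "snd q \<in> grid N \<and> d \<noteq> e")
  case True
  obtain \<sigma> p where q: "q = (\<sigma>, p)" by (cases q)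
  have p: "p \<in> grid N" and de: "d \<noteq> e" using True q by auto
  show ?thesis
    unfolding q tmove_in[OF p] tmove_in[OF upd_step1_grid[OF p]]
    using de upd_comm[OF de] by (simp add: fun_upd_twist)
qed (auto simp: tmove_def)

lemma tmove_torus: "tmove N b d q \<in> torus N \<longleftrightarrow> q \<in> torus N"
  by (cases q) (auto simp: tmove_def torus_def upd_step1_grid)

lemma tmove_out: "q \<notin> torus N \<Longrightarrow> tmove N b d q = q"
  by (cases q) (auto simp: tmove_def torus_def)

lemma finite_grid: "finite (grid N)" and card_grid: "card (grid N) \<le> N ^ 3"
proof -
  let ?S = "PiE (UNIV :: 3 set) (\<lambda>_. {1..N})"
  have sub: "grid N \<subseteq> (\<lambda>f. \<chi> d. f d) ` ?S"
  proof
    fix p assume "p \<in> grid N"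
    then show "p \<in> (\<lambda>f. \<chi> d. f d) ` ?S"
      by (intro image_eqI[where x = "\<lambda>d. p $ d"]) (auto simp: grid_def PiE_UNIV_domain vec_eq_iff)
  qed
  have fin: "finite ?S" by (intro finite_PiE) auto
  then show "finite (grid N)" using sub finite_subset by blast
  have "card (grid N) \<le> card ((\<lambda>f. \<chi> d. f d :: nat^3) ` ?S)" using fin sub by (intro card_mono) auto
  also have "\<dots> \<le> card ?S" using fin by (rule card_image_le)
  also have "\<dots> = N ^ 3" by (simp add: card_PiE)
  finally show "card (grid N) \<le> N ^ 3" .
qed

lemma card_sheets: "card (UNIV :: (3 \<Rightarrow> bool) set) = 8"
  by (simp add: card_fun)

lemma mesh_pos: "N \<ge> 1 \<Longrightarrow> mesh N > 0"
  by (simp add: mesh_def)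

lemma torus_lattice:
  assumes "N \<ge> 1" "k > 0" "\<alpha> > 0" "\<beta> > 0"
  shows "lattice (torus N) (tsh N) (tsb N) (mesh N) k \<alpha> \<beta>"
proof
  show "finite (torus N)" by (simp add: torus_def finite_grid)
  show "tsh N d (tsb N d p) = p" for d p using tmove_inverse[of N False d p] by simp
  show "tsb N d (tsh N d p) = p" for d p using tmove_inverse[of N True d p] by simp
  have "card (torus N) = 8 * card (grid N)"
    by (simp add: torus_def card_cartesian_product card_sheets)
  then have "card (torus N) \<le> 8 * N ^ 3" using card_grid[of N] by simp
  from of_nat_mono[OF this, where 'a = real] have "real (card (torus N)) \<le> 8 * real N ^ 3" by simp
  then have "mesh N ^ 3 * real (card (torus N)) \<le> mesh N ^ 3 * (8 * real N ^ 3)"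
    using mesh_pos[OF assms(1)] by (intro mult_left_mono) auto
  also have "\<dots> = 8" using assms(1) by (simp add: mesh_def power_divide)
  finally show "mesh N ^ 3 * real (card (torus N)) \<le> 8" .
  show "tsh N d (tsh N e p) = tsh N e (tsh N d p)" for d e p by (rule tmove_comm)
  show "tsh N d p \<in> torus N \<longleftrightarrow> p \<in> torus N" for d p by (rule tmove_torus)
  show "p \<notin> torus N \<Longrightarrow> tsh N d p = p" for d p by (rule tmove_out)
  show "mesh N > 0" by (rule mesh_pos[OF assms(1)])
qed (use assms in auto)

section \<open>Lifting grid functions and the scheme to the torus\<close>

definition lift :: "nat \<Rightarrow> (nat^3 \<Rightarrow> real^3) \<Rightarrow> tpoint \<Rightarrow> real^3"
  where "lift N g q = (if snd q \<in> grid N then g (snd q) else 0)"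

lemma lift_diff: "lift N (\<lambda>p. g p - g' p) = (\<lambda>q. lift N g q - lift N g' q)"
  and lift_cong: "(\<And>p. p \<in> grid N \<Longrightarrow> g p = g' p) \<Longrightarrow> lift N g = lift N g'"
  by (auto simp: lift_def)

text \<open>At an end of a line the move keeps the index, while the grid formula refers to the ghost
  layer; the discrete Neumann condition identifies the two values. On a reflected sheet the two
  neighbours are exchanged.\<close>

lemma lift_tmove:
  assumes dn: "discrete_neumann N g" and p: "p \<in> grid N"
  shows "lift N g (tmove N b d (\<sigma>, p)) = (if \<sigma> d = b then g (p + axis d 1) else g (p - axis d 1))"
proof -
  have b: "1 \<le> p $ e \<and> p $ e \<le> N" for e using p by (simp add: grid_def)
  have N1: "g (p + axis d 1) = g p" if "p $ d = N"
  proof -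
    have "g (p + axis d 1) = g (p + axis d 1 - axis d 1)"
      using dn[unfolded discrete_neumann_def, rule_format, of d "p + axis d 1"] b that
      by (simp add: plus_axis del: One_nat_def)
    then show ?thesis by simp
  qed
  have N0: "g (p - axis d 1) = g p" if "p $ d = 1"
  proof -
    have "g (p - axis d 1) = g (p - axis d 1 + axis d 1)"
      using dn[unfolded discrete_neumann_def, rule_format, of d "p - axis d 1"] b that
      by (simp add: minus_axis del: One_nat_def)
    also have "p - axis d 1 + axis d 1 = p"
      using that by (simp add: vec_eq_iff axis_def)
    finally show ?thesis .
  qed
  show ?thesis
  proof (cases "\<sigma> d = b")
    case True
    then show ?thesis
      using N1 p b[of d] by (cases "p $ d < N") (auto simp: tmove_in[OF p] step1_def lift_def upd_grid plus_axis simp del: One_nat_def)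
  next
    case False
    have "upd p d 1 = p" if "p $ d = 1" using upd_same[of p d] that by simp
    with False show ?thesis
      using N0 p b[of d] by (cases "1 < p $ d") (auto simp: tmove_in[OF p] step1_def lift_def upd_grid minus_axis simp del: One_nat_def)
  qed
qed

context
  fixes N :: nat and k \<alpha> \<beta> :: real
  assumes N: "N \<ge> 1" and k: "k > 0" and ab: "\<alpha> > 0" "\<beta> > 0"
begin

interpretation lattice "torus N" "tsh N" "tsb N" "mesh N" k \<alpha> \<beta> f for f
  by (rule torus_lattice) (use N k ab in auto)

lemma Sd_lift:
  assumes "discrete_neumann N g" "p \<in> grid N"
  shows "lattice.Sd (tsh N) (tsb N) (mesh N) d (lift N g) (\<sigma>, p)
    = (g (p + axis d 1) - 2 *\<^sub>R g p + g (p - axis d 1)) /\<^sub>R (mesh N)\<^sup>2"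
  using lift_tmove[OF assms, of False d \<sigma>] lift_tmove[OF assms, of True d \<sigma>] assms(2)
  by (cases "\<sigma> d") (simp_all add: Sd_def lift_def[of _ _ "(\<sigma>, p)"] algebra_simps)

lemma Z_lift:
  assumes dn: "discrete_neumann N g"
  shows "lattice.Z (tsh N) (tsb N) (mesh N) k \<beta> (lift N g) = (\<lambda>q. k *\<^sub>R lift N (Lh \<beta> N g) q)"
proof
  fix q :: tpoint
  obtain \<sigma> p where q: "q = (\<sigma>, p)" by (cases q)
  show "Z (lift N g) q = k *\<^sub>R lift N (Lh \<beta> N g) q"
  proof (cases "p \<in> grid N")
    case True
    then show ?thesis
      by (simp add: q Z_def Sd_lift[OF dn True] lift_def Lh_def discrete_laplacian_def)
  next
    case False
    then show ?thesis by (simp add: q Z_def Sd_def lift_def tmove_def)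
  qed
qed

text \<open>On reflected sheets the centred difference changes sign, but only its norm
  enters.\<close>

lemma NL_lift:
  assumes dn: "discrete_neumann N g"
  shows "lattice.NL (tsh N) (tsb N) (mesh N) \<alpha> \<beta> (lift N (\<lambda>p. f (grid_point N p))) (lift N g)
    = lift N (Nh \<alpha> \<beta> f N g)"
proof
  fix q :: tpoint
  obtain \<sigma> p where q: "q = (\<sigma>, p)" by (cases q)
  show "NL (lift N (\<lambda>p. f (grid_point N p))) (lift N g) q = lift N (Nh \<alpha> \<beta> f N g) q"
  proof (cases "p \<in> grid N")
    case True
    have "norm (Ac d (lift N g) (\<sigma>, p)) = norm (averaged_diff N d g p)" for d
      using lift_tmove[OF dn True, of False d \<sigma>] lift_tmove[OF dn True, of True d \<sigma>]
      by (cases "\<sigma> d") (simp_all add: Ac_def averaged_diff_def norm_minus_commute)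
    then show ?thesis
      using True by (simp add: q NL_def lift_def Nh_def)
  next
    case False
    then show ?thesis by (simp add: q NL_def lift_def)
  qed
qed

text \<open>The 2^3 = 8 sheets carry identical copies of g.\<close>

lemma nrm_lift: "lattice.nrm (torus N) (mesh N) (lift N g) = sqrt 8 * grid_norm N g"
proof -
  have "(\<Sum>q\<in>torus N. lift N g q \<bullet> lift N g q) = (\<Sum>q\<in>torus N. (norm (g (snd q)))\<^sup>2)"
    by (intro sum.cong) (auto simp: torus_def lift_def power2_norm_eq_inner)
  also have "\<dots> = (\<Sum>\<sigma>\<in>(UNIV :: (3 \<Rightarrow> bool) set). \<Sum>p\<in>grid N. (norm (g p))\<^sup>2)"
    unfolding torus_def sum.cartesian_product by (simp only: split_def)
  also have "\<dots> = 8 * (\<Sum>p\<in>grid N. (norm (g p))\<^sup>2)"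
    by (simp add: card_sheets)
  finally have "nrm (lift N g) = sqrt (mesh N ^ 3 * (8 * (\<Sum>p\<in>grid N. (norm (g p))\<^sup>2)))"
    unfolding nrm_def ip_def by (rule arg_cong)
  also have "\<dots> = sqrt (8 * (mesh N ^ 3 * (\<Sum>p\<in>grid N. (norm (g p))\<^sup>2)))"
    by (simp only: mult.left_commute)
  also have "\<dots> = sqrt 8 * grid_norm N g"
    unfolding grid_norm_def by (rule real_sqrt_mult)
  finally show ?thesis .
qed

end

section \<open>Function spaces on the cube\<close>

lemma cube_iff: "x \<in> cube \<longleftrightarrow> (\<forall>d. 0 < x $ d \<and> x $ d < 1)"
  by (simp add: cube_def mem_box_cart)

lemma closure_cube_iff: "x \<in> closure cube \<longleftrightarrow> (\<forall>d. 0 \<le> x $ d \<and> x $ d \<le> 1)"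
proof -
  have "(\<chi> d. 1/2) \<in> cube" by (simp add: cube_iff)
  then have "box (0::real^3) 1 \<noteq> {}" unfolding cube_def by blast
  then have "closure cube = cbox 0 1" unfolding cube_def by simp
  then show ?thesis by (simp add: mem_box_cart)
qed

lemma cube_subset_closure: "x \<in> cube \<Longrightarrow> x \<in> closure cube"
  using closure_subset by blast

lemma open_line_cube: "open {s. x + s *\<^sub>R axis d 1 \<in> cube}"
proof -
  have "{s. x + s *\<^sub>R axis d 1 \<in> cube} = (\<lambda>s. x + s *\<^sub>R axis d 1) -` cube" by auto
  also have "open \<dots>"
    by (intro open_vimage) (auto simp: cube_def intro!: continuous_intros)
  finally show ?thesis .
qed

lemma has_partial:
  assumes "v \<in> Cr_closure r" "length ds < r" "x \<in> cube"
  shows "((\<lambda>s. partials ds v (x + s *\<^sub>R axis d 1)) has_vector_derivative partials (d # ds) v x) (at 0)"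
  using assms unfolding Cr_closure_def by (simp add: partial_def vector_derivative_works)

text \<open>A partial derivative at x is determined by lower ones near x, so linearity of those must
  be known in the whole open cube first; the induction is therefore over all x at once.\<close>

lemma partials_lin:
  assumes u: "u \<in> Cr_closure r" and v: "v \<in> Cr_closure r"
  shows "length ds \<le> r \<Longrightarrow> x \<in> cube \<Longrightarrow>
    partials ds (\<lambda>x. a *\<^sub>R u x + b *\<^sub>R v x) x = a *\<^sub>R partials ds u x + b *\<^sub>R partials ds v x"
    and "length ds < r \<Longrightarrow> x \<in> cube \<Longrightarrow>
    ((\<lambda>s. partials ds (\<lambda>x. a *\<^sub>R u x + b *\<^sub>R v x) (x + s *\<^sub>R axis d 1)) has_vector_derivative
      a *\<^sub>R partials (d # ds) u x + b *\<^sub>R partials (d # ds) v x) (at 0)"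
proof -
  let ?w = "\<lambda>x. a *\<^sub>R u x + b *\<^sub>R v x"
  have der: "((\<lambda>s. partials ds ?w (x + s *\<^sub>R axis d 1)) has_vector_derivative
      a *\<^sub>R partials (d # ds) u x + b *\<^sub>R partials (d # ds) v x) (at 0)"
    if eq: "\<And>x. x \<in> cube \<Longrightarrow> partials ds ?w x = a *\<^sub>R partials ds u x + b *\<^sub>R partials ds v x"
      and l: "length ds < r" and x: "x \<in> cube" for ds x d
  proof (rule has_vector_derivative_transform_within_open)
    show "((\<lambda>s. a *\<^sub>R partials ds u (x + s *\<^sub>R axis d 1) + b *\<^sub>R partials ds v (x + s *\<^sub>R axis d 1))
      has_vector_derivative a *\<^sub>R partials (d # ds) u x + b *\<^sub>R partials (d # ds) v x) (at 0)"
      by (intro has_vector_derivative_add bounded_linear.has_vector_derivative[OF bounded_linear_scaleR_right]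
        has_partial[OF u l x] has_partial[OF v l x])
    show "open {s. x + s *\<^sub>R axis d 1 \<in> cube}" by (rule open_line_cube)
    show "0 \<in> {s. x + s *\<^sub>R axis d 1 \<in> cube}" using x by simp
  qed (simp add: eq)
  have main: "length ds \<le> r \<Longrightarrow> x \<in> cube \<Longrightarrow>
    partials ds ?w x = a *\<^sub>R partials ds u x + b *\<^sub>R partials ds v x" for ds x
  proof (induction ds arbitrary: x)
    case (Cons d ds)
    have "((\<lambda>s. partials ds ?w (x + s *\<^sub>R axis d 1)) has_vector_derivative
      a *\<^sub>R partials (d # ds) u x + b *\<^sub>R partials (d # ds) v x) (at 0)"
      using Cons.prems by (intro der Cons.IH) auto
    from vector_derivative_at[OF this] show ?case by (simp add: partial_def)
  qed simp
  show "length ds \<le> r \<Longrightarrow> x \<in> cube \<Longrightarrow> partials ds ?w x = a *\<^sub>R partials ds u x + b *\<^sub>R partials ds v x"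
    by (rule main)
  show "length ds < r \<Longrightarrow> x \<in> cube \<Longrightarrow> ((\<lambda>s. partials ds ?w (x + s *\<^sub>R axis d 1)) has_vector_derivative
      a *\<^sub>R partials (d # ds) u x + b *\<^sub>R partials (d # ds) v x) (at 0)"
    by (intro der main) auto
qed

lemma Cr_closure_lin:
  assumes u: "u \<in> Cr_closure r" and v: "v \<in> Cr_closure r"
  shows "(\<lambda>x. a *\<^sub>R u x + b *\<^sub>R v x) \<in> Cr_closure r"
proof -
  let ?w = "\<lambda>x. a *\<^sub>R u x + b *\<^sub>R v x"
  have 1: "continuous_on (closure cube) ?w"
    using u v unfolding Cr_closure_def by (auto intro!: continuous_intros)
  have 2: "(\<lambda>s. partials ds ?w (x + s *\<^sub>R axis d 1)) differentiable (at 0)"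
    if "length ds < r" "x \<in> cube" for ds d x
    using partials_lin(2)[OF u v that, of a b d] by (rule differentiableI_vector)
  have 3: "\<exists>w. continuous_on (closure cube) w \<and> (\<forall>x\<in>cube. w x = partials ds ?w x)"
    if ds: "length ds \<le> r" for ds
  proof -
    obtain wu wv where w: "continuous_on (closure cube) wu" "\<forall>x\<in>cube. wu x = partials ds u x"
      "continuous_on (closure cube) wv" "\<forall>x\<in>cube. wv x = partials ds v x"
      using u v ds unfolding Cr_closure_def by blast
    show ?thesis
      using w partials_lin(1)[OF u v ds] by (intro exI[of _ "\<lambda>x. a *\<^sub>R wu x + b *\<^sub>R wv x"])
        (auto intro!: continuous_intros)
  qed
  show ?thesis unfolding Cr_closure_def using 1 2 3 by simp
qed

lemma Cr_closure_diff:
  assumes "u \<in> Cr_closure r" "v \<in> Cr_closure r"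
  shows "(\<lambda>x. u x - v x) \<in> Cr_closure r"
    and "length ds \<le> r \<Longrightarrow> x \<in> cube \<Longrightarrow> partials ds (\<lambda>x. u x - v x) x = partials ds u x - partials ds v x"
  using Cr_closure_lin[OF assms, of 1 "-1"] partials_lin(1)[OF assms, of ds x 1 "-1"] by simp_all

lemma Cr_closure_scale:
  assumes "u \<in> Cr_closure r"
  shows "(\<lambda>x. a *\<^sub>R u x) \<in> Cr_closure r"
    and "length ds \<le> r \<Longrightarrow> x \<in> cube \<Longrightarrow> partials ds (\<lambda>x. a *\<^sub>R u x) x = a *\<^sub>R partials ds u x"
  using Cr_closure_lin[OF assms assms, of a 0] partials_lin(1)[OF assms assms, of ds x a 0] by simp_all

lemma compact_closure_cube: "compact (closure cube)"
  unfolding cube_def by (simp add: compact_closure)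

text \<open>The supremum in \<open>Cr_norm\<close> is meaningful only over a bounded set.
  Boundedness comes from the continuous extensions to the compact closure and from the finite number
  of derivative lists of length at most r.\<close>

lemma norm_partials_le:
  assumes v: "v \<in> Cr_closure r" and ds: "length ds \<le> r" and x: "x \<in> cube"
  shows "norm (partials ds v x) \<le> Cr_norm r v"
proof -
  have "\<exists>M\<ge>0. \<forall>x\<in>cube. norm (partials ds v x) \<le> M" if l: "length ds \<le> r" for ds
  proof -
    obtain w where w: "continuous_on (closure cube) w" "\<forall>x\<in>cube. w x = partials ds v x"
      using v l unfolding Cr_closure_def by blast
    have "bounded (w ` closure cube)"
      by (intro compact_imp_bounded compact_continuous_image w compact_closure_cube)
    then obtain M where "\<forall>x\<in>closure cube. norm (w x) \<le> M" unfolding bounded_iff by blast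
    then have "\<forall>x\<in>cube. norm (partials ds v x) \<le> max M 0"
      using w(2) cube_subset_closure by (metis max.coboundedI1)
    then show ?thesis by (intro exI[of _ "max M 0"]) auto
  qed
  then obtain M where M: "\<And>ds. length ds \<le> r \<Longrightarrow> M ds \<ge> 0"
    "\<And>ds x. length ds \<le> r \<Longrightarrow> x \<in> cube \<Longrightarrow> norm (partials ds v x) \<le> M ds"
    by metis
  have fin: "finite {ds :: 3 list. length ds \<le> r}"
    using finite_lists_length_le[of "UNIV :: 3 set" r] by simp
  have "bdd_above {norm (partials ds v x) |ds x. length ds \<le> r \<and> x \<in> cube}"
  proof (rule bdd_aboveI[where M = "\<Sum>ds | length ds \<le> r. M ds"])
    fix y assume "y \<in> {norm (partials ds v x) |ds x. length ds \<le> r \<and> x \<in> cube}"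
    then obtain ds x where y: "y = norm (partials ds v x)" "length ds \<le> r" "x \<in> cube" by blast
    then have "y \<le> M ds" using M by simp
    also have "\<dots> \<le> (\<Sum>ds | length ds \<le> r. M ds)"
      using fin M y by (intro member_le_sum) auto
    finally show "y \<le> (\<Sum>ds | length ds \<le> r. M ds)" .
  qed
  then show ?thesis
    unfolding Cr_norm_def using ds x by (intro cSup_upper) auto
qed

lemma Cq_time_closure: "Cq_time q r T u \<Longrightarrow> t \<in> {0..T} \<Longrightarrow> u t \<in> Cr_closure r"
  by (cases q) auto

text \<open>\<open>Cr_norm\<close> dominates every partial derivative at every point, so convergence
  of the time quotients in this norm already contains the exchange of time and space
  derivatives.\<close>

lemma Cq_time_Suc_derivative:
  assumes "Cq_time (Suc q) r T u"
  obtains u' where "Cq_time q r T u'"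
    "\<And>t (ds :: 3 list) x. t \<in> {0..T} \<Longrightarrow> length ds \<le> r \<Longrightarrow> x \<in> cube \<Longrightarrow>
      ((\<lambda>s. partials ds (u s) x) has_vector_derivative partials ds (u' t) x) (at t within {0..T})"
proof -
  obtain u' where u': "Cq_time q r T u'" and lim: "\<And>t. t \<in> {0..T} \<Longrightarrow>
      ((\<lambda>s. Cr_norm r (\<lambda>x. (u s x - u t x) /\<^sub>R (s - t) - u' t x)) \<longlongrightarrow> 0) (at t within {0..T})"
    using assms by auto
  have u: "u t \<in> Cr_closure r" "u' t \<in> Cr_closure r" if "t \<in> {0..T}" for t
    using Cq_time_closure[OF assms that] Cq_time_closure[OF u' that] .
  show thesis
  proof (rule that[OF u'])
    fix t and ds :: "3 list" and x assume t: "t \<in> {0..T}" and ds: "length ds \<le> r" and x: "x \<in> cube"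
    show "((\<lambda>s. partials ds (u s) x) has_vector_derivative partials ds (u' t) x) (at t within {0..T})"
      unfolding has_vector_derivative_def
    proof (rule has_derivativeI_sandwich[where e = 1])
      show "bounded_linear (\<lambda>h. h *\<^sub>R partials ds (u' t) x)" by (intro bounded_linear_intros)
      show "((\<lambda>s. Cr_norm r (\<lambda>x. (u s x - u t x) /\<^sub>R (s - t) - u' t x)) \<longlongrightarrow> 0) (at t within {0..T})"
        by (rule lim[OF t])
      fix s assume s: "s \<in> {0..T}" "s \<noteq> t"
      let ?q = "\<lambda>x. (u s x - u t x) /\<^sub>R (s - t) - u' t x"
      note d = Cr_closure_diff[OF u(1)[OF s(1)] u(1)[OF t]]
      note e = Cr_closure_scale[OF d(1), where a = "inverse (s - t)"]
      have q: "?q \<in> Cr_closure r" by (rule Cr_closure_diff(1)[OF e(1) u(2)[OF t]])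
      have "partials ds ?q x = (partials ds (u s) x - partials ds (u t) x) /\<^sub>R (s - t) - partials ds (u' t) x"
        using Cr_closure_diff(2)[OF e(1) u(2)[OF t] ds x] e(2)[OF ds x] d(2)[OF ds x] by simp
      also have "\<dots> = (1 / (s - t)) *\<^sub>R (partials ds (u s) x - partials ds (u t) x - (s - t) *\<^sub>R partials ds (u' t) x)"
        using s by (simp add: scaleR_diff_right divide_inverse)
      finally have "norm (partials ds ?q x) = norm (partials ds (u s) x - partials ds (u t) x - (s - t) *\<^sub>R partials ds (u' t) x) / norm (s - t)"
        by (simp add: divide_inverse mult.commute)
      then show "norm (partials ds (u s) x - partials ds (u t) x - (s - t) *\<^sub>R partials ds (u' t) x) / norm (s - t)
        \<le> Cr_norm r ?q"
        using norm_partials_le[OF q ds x] by simp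
    qed simp
  qed
qed

text \<open>Continuity in time gives a bound near each time, and finitely many neighbourhoods cover
  [0,T].\<close>

lemma Cq_time_0_bounded:
  assumes u: "Cq_time 0 r T u"
  obtains K where "K \<ge> 0"
    "\<And>t (ds :: 3 list) x. t \<in> {0..T} \<Longrightarrow> length ds \<le> r \<Longrightarrow> x \<in> cube \<Longrightarrow> norm (partials ds (u t) x) \<le> K"
proof -
  have loc: "\<exists>\<delta>>0. \<forall>s\<in>{0..T}. \<bar>s - t\<bar> < \<delta> \<longrightarrow> (\<forall>ds x. length ds \<le> r \<longrightarrow> x \<in> cube \<longrightarrow>
      norm (partials ds (u s) x) \<le> Cr_norm r (u t) + 1)" if t: "t \<in> {0..T}" for t
  proof -
    have "((\<lambda>s. Cr_norm r (\<lambda>x. u s x - u t x)) \<longlongrightarrow> 0) (at t within {0..T})"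
      using u t by simp
    from tendstoD[OF this, of 1] obtain \<delta> where \<delta>: "\<delta> > 0"
      "\<And>s. s \<in> {0..T} \<Longrightarrow> s \<noteq> t \<Longrightarrow> dist s t < \<delta> \<Longrightarrow> \<bar>Cr_norm r (\<lambda>x. u s x - u t x)\<bar> < 1"
      unfolding eventually_at by (auto simp: dist_real_def)
    have "norm (partials ds (u s) x) \<le> Cr_norm r (u t) + 1"
      if s: "s \<in> {0..T}" "\<bar>s - t\<bar> < \<delta>" and ds: "length ds \<le> r" and x: "x \<in> cube" for s ds x
    proof (cases "s = t")
      case True
      then show ?thesis
        using norm_partials_le[OF Cq_time_closure[OF u t] ds x] by simp
    next
      case False
      note d = Cr_closure_diff[OF Cq_time_closure[OF u s(1)] Cq_time_closure[OF u t]]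
      have "norm (partials ds (u s) x - partials ds (u t) x) \<le> 1"
        using norm_partials_le[OF d(1) ds x] d(2)[OF ds x] \<delta>(2)[OF s(1) False] s(2)
        by (simp add: dist_real_def)
      then show ?thesis
        using norm_partials_le[OF Cq_time_closure[OF u t] ds x]
          norm_triangle_sub[of "partials ds (u s) x" "partials ds (u t) x"] by linarith
    qed
    with \<delta>(1) show ?thesis by blast
  qed
  then obtain \<delta> where \<delta>: "\<And>t. t \<in> {0..T} \<Longrightarrow> \<delta> t > 0"
    "\<And>t s ds x. t \<in> {0..T} \<Longrightarrow> s \<in> {0..T} \<Longrightarrow> \<bar>s - t\<bar> < \<delta> t \<Longrightarrow> length ds \<le> r \<Longrightarrow> x \<in> cube \<Longrightarrow>
      norm (partials ds (u s) x) \<le> Cr_norm r (u t) + 1"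
    by metis
  have "{0..T} \<subseteq> (\<Union>t\<in>{0..T}. ball t (\<delta> t))" using \<delta>(1) by force
  then obtain C where C: "C \<subseteq> {0..T}" "finite C" "{0..T} \<subseteq> (\<Union>t\<in>C. ball t (\<delta> t))"
    using compactE_image[of "{0..T}" "{0..T}" "\<lambda>t. ball t (\<delta> t)"] by (metis compact_Icc open_ball)
  show thesis
  proof (rule that[of "\<Sum>t\<in>C. \<bar>Cr_norm r (u t) + 1\<bar>"])
    show "0 \<le> (\<Sum>t\<in>C. \<bar>Cr_norm r (u t) + 1\<bar>)" by (simp add: sum_nonneg)
    fix s and ds :: "3 list" and x assume s: "s \<in> {0..T}" "length ds \<le> r" "x \<in> cube"
    then obtain t where t: "t \<in> C" "\<bar>s - t\<bar> < \<delta> t" using C(3) by (force simp: dist_real_def)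
    have "norm (partials ds (u s) x) \<le> \<bar>Cr_norm r (u t) + 1\<bar>"
      using \<delta>(2)[of t s ds x] t C(1) s by force
    also have "\<dots> \<le> (\<Sum>t\<in>C. \<bar>Cr_norm r (u t) + 1\<bar>)"
      using t C by (intro member_le_sum) auto
    finally show "norm (partials ds (u s) x) \<le> (\<Sum>t\<in>C. \<bar>Cr_norm r (u t) + 1\<bar>)" .
  qed
qed

section \<open>Taylor estimates\<close>

lemma norm_increment_le:
  fixes f :: "real \<Rightarrow> 'a::real_inner"
  assumes cont: "continuous_on {min x y..max x y} f"
    and der: "\<And>s. min x y < s \<Longrightarrow> s < max x y \<Longrightarrow> (f has_vector_derivative f' s) (at s)"
    and bound: "\<And>s. min x y < s \<Longrightarrow> s < max x y \<Longrightarrow> norm (f' s) \<le> K"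
  shows "norm (f y - f x) \<le> K * \<bar>y - x\<bar>"
proof (cases "x = y")
  case False
  define a b where "a = min x y" and "b = max x y"
  have lt: "a < b" using False by (auto simp: a_def b_def)
  obtain s where s: "s \<in> {a<..<b}" "norm (f b - f a) \<le> norm ((b - a) *\<^sub>R f' s)"
    using mvt_general[OF lt, of f "\<lambda>s h. h *\<^sub>R f' s"] cont der
    unfolding has_vector_derivative_def a_def[symmetric] b_def[symmetric] by blast
  have "norm (f y - f x) = norm (f b - f a)" by (auto simp: a_def b_def min_def max_def norm_minus_commute)
  also have "\<dots> \<le> \<bar>b - a\<bar> * norm (f' s)" using s by simp
  also have "\<dots> \<le> \<bar>b - a\<bar> * K" using s bound by (intro mult_left_mono) (auto simp: a_def b_def)
  also have "\<bar>b - a\<bar> = \<bar>y - x\<bar>" by (auto simp: a_def b_def)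
  finally show ?thesis by (simp add: mult.commute)
qed simp

text \<open>The derivative of a Taylor remainder is the remainder of the derivative, so the mean
  value inequality raises the order by one. The factorial is lost, which is harmless. Derivatives
  are required in the open interval and continuity in the closed one, so the expansion point may be
  an end point, as needed at the boundary of the cube.\<close>

lemma taylor_bound:
  fixes g :: "nat \<Rightarrow> real \<Rightarrow> 'a::real_inner"
  assumes cont: "\<And>i. i \<le> n \<Longrightarrow> continuous_on {a..b} (g i)"
    and der: "\<And>i s. i < n \<Longrightarrow> a < s \<Longrightarrow> s < b \<Longrightarrow> (g i has_vector_derivative g (Suc i) s) (at s)"
    and bound: "\<And>s. s \<in> {a..b} \<Longrightarrow> norm (g n s) \<le> K"
    and x: "x \<in> {a..b}"
  shows "i + m = n \<Longrightarrow> s \<in> {a..b} \<Longrightarrow>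
    norm (g i s - (\<Sum>j<m. ((s - x) ^ j / fact j) *\<^sub>R g (i + j) x)) \<le> K * \<bar>s - x\<bar> ^ m"
proof (induction m arbitrary: i s)
  case 0
  then show ?case using bound by simp
next
  case (Suc m)
  define p where "p i m s = (\<Sum>j<m. ((s - x) ^ j / fact j) *\<^sub>R g (i + j) x)" for i m s
  have K: "K \<ge> 0" using bound[OF x] norm_ge_zero order.trans by blast
  have sub: "{min x s..max x s} \<subseteq> {a..b}" using x Suc.prems by auto
  have dp: "(p i (Suc m) has_vector_derivative p (Suc i) m s) (at s)" for s
  proof -
    have eq: "p i (Suc m) = (\<lambda>s. g i x + (\<Sum>j<m. ((s - x) ^ Suc j / fact (Suc j)) *\<^sub>R g (i + Suc j) x))"
      unfolding p_def by (subst sum.lessThan_Suc_shift) simp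
    have "((\<lambda>s. ((s - x) ^ Suc j / fact (Suc j)) *\<^sub>R g (i + Suc j) x) has_vector_derivative
       ((s - x) ^ j / fact j) *\<^sub>R g (Suc i + j) x) (at s)" for j
    proof -
      have "((\<lambda>s. (s - x) ^ Suc j / fact (Suc j)) has_real_derivative (s - x) ^ j / fact j) (at s)"
        by (rule derivative_eq_intros refl | simp)+
      from has_vector_derivative_scaleR[OF this has_vector_derivative_const]
      show ?thesis by simp
    qed
    then have "((\<lambda>s. \<Sum>j<m. ((s - x) ^ Suc j / fact (Suc j)) *\<^sub>R g (i + Suc j) x) has_vector_derivative p (Suc i) m s) (at s)"
      unfolding p_def by (rule has_vector_derivative_sum)
    from has_vector_derivative_add[OF has_vector_derivative_const this] show ?thesis
      unfolding eq by simp
  qed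
  have "norm ((g i s - p i (Suc m) s) - (g i x - p i (Suc m) x)) \<le> (K * \<bar>s - x\<bar> ^ m) * \<bar>s - x\<bar>"
  proof (rule norm_increment_le[where f' = "\<lambda>s. g (Suc i) s - p (Suc i) m s"])
    show "continuous_on {min x s..max x s} (\<lambda>s. g i s - p i (Suc m) s)"
      using Suc.prems sub unfolding p_def
      by (intro continuous_intros continuous_on_subset[OF cont[of i]]) auto
    fix y assume y: "min x s < y" "y < max x s"
    then have "a < y" "y < b" using x Suc.prems by auto
    then show "((\<lambda>s. g i s - p i (Suc m) s) has_vector_derivative g (Suc i) y - p (Suc i) m y) (at y)"
      using Suc.prems by (intro derivative_intros der dp) auto
    have "norm (g (Suc i) y - p (Suc i) m y) \<le> K * \<bar>y - x\<bar> ^ m"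
      unfolding p_def using Suc.prems \<open>a < y\<close> \<open>y < b\<close> by (intro Suc.IH) auto
    also have "\<dots> \<le> K * \<bar>s - x\<bar> ^ m"
      using y K by (intro mult_left_mono power_mono) auto
    finally show "norm (g (Suc i) y - p (Suc i) m y) \<le> K * \<bar>s - x\<bar> ^ m" .
  qed
  moreover have "p i (Suc m) x = g i x"
    unfolding p_def by (subst sum.lessThan_Suc_shift) simp
  ultimately show ?case by (simp add: p_def mult_ac)
qed

lemma taylor1:
  fixes g :: "nat \<Rightarrow> real \<Rightarrow> 'a::real_inner"
  assumes "\<And>i. i \<le> Suc i0 \<Longrightarrow> continuous_on {a..b} (g i)"
    and "\<And>i s. i < Suc i0 \<Longrightarrow> a < s \<Longrightarrow> s < b \<Longrightarrow> (g i has_vector_derivative g (Suc i) s) (at s)"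
    and "\<And>s. s \<in> {a..b} \<Longrightarrow> norm (g (Suc i0) s) \<le> K" and "x \<in> {a..b}" "s \<in> {a..b}"
  shows "norm (g i0 s - g i0 x) \<le> K * \<bar>s - x\<bar>"
  using taylor_bound[of "Suc i0" a b g K x i0 1 s] assms by simp

lemma taylor2:
  fixes g :: "nat \<Rightarrow> real \<Rightarrow> 'a::real_inner"
  assumes "\<And>i. i \<le> Suc (Suc i0) \<Longrightarrow> continuous_on {a..b} (g i)"
    and "\<And>i s. i < Suc (Suc i0) \<Longrightarrow> a < s \<Longrightarrow> s < b \<Longrightarrow> (g i has_vector_derivative g (Suc i) s) (at s)"
    and "\<And>s. s \<in> {a..b} \<Longrightarrow> norm (g (Suc (Suc i0)) s) \<le> K" and "x \<in> {a..b}" "s \<in> {a..b}"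
  shows "norm (g i0 s - (g i0 x + (s - x) *\<^sub>R g (Suc i0) x)) \<le> K * \<bar>s - x\<bar>\<^sup>2"
  using taylor_bound[of "Suc (Suc i0)" a b g K x i0 2 s] assms by (simp add: numeral_2_eq_2)

lemma taylor3:
  fixes g :: "nat \<Rightarrow> real \<Rightarrow> 'a::real_inner"
  assumes "\<And>i. i \<le> Suc (Suc (Suc i0)) \<Longrightarrow> continuous_on {a..b} (g i)"
    and "\<And>i s. i < Suc (Suc (Suc i0)) \<Longrightarrow> a < s \<Longrightarrow> s < b \<Longrightarrow> (g i has_vector_derivative g (Suc i) s) (at s)"
    and "\<And>s. s \<in> {a..b} \<Longrightarrow> norm (g (Suc (Suc (Suc i0))) s) \<le> K" and "x \<in> {a..b}" "s \<in> {a..b}"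
  shows "norm (g i0 s - (g i0 x + (s - x) *\<^sub>R g (Suc i0) x + ((s - x)\<^sup>2 / 2) *\<^sub>R g (Suc (Suc i0)) x)) \<le> K * \<bar>s - x\<bar> ^ 3"
  using taylor_bound[of "Suc (Suc (Suc i0))" a b g K x i0 3 s] assms
  by (simp add: eval_nat_numeral)

section \<open>Consistency of the difference quotients\<close>

text \<open>Proper derivatives are meaningful only in the open cube and are replaced by a continuous
  extension; for the empty list v itself is kept, since it is already continuous on the
  closure.\<close>

definition pext :: "3 list \<Rightarrow> (real^3 \<Rightarrow> real^3) \<Rightarrow> real^3 \<Rightarrow> real^3"
  where "pext ds v = (if ds = [] then v
    else (SOME w. continuous_on (closure cube) w \<and> (\<forall>x\<in>cube. w x = partials ds v x)))"

lemma pext: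
  assumes "v \<in> Cr_closure r" "length ds \<le> r"
  shows "continuous_on (closure cube) (pext ds v)" "x \<in> cube \<Longrightarrow> pext ds v x = partials ds v x"
proof -
  have "continuous_on (closure cube) (pext ds v) \<and> (\<forall>x\<in>cube. pext ds v x = partials ds v x)"
  proof (cases "ds = []")
    case True
    then show ?thesis using assms unfolding Cr_closure_def pext_def by simp
  next
    case False
    have "\<exists>w. continuous_on (closure cube) w \<and> (\<forall>x\<in>cube. w x = partials ds v x)"
      using assms unfolding Cr_closure_def by blast
    from someI_ex[OF this] show ?thesis using False unfolding pext_def by simp
  qed
  then show "continuous_on (closure cube) (pext ds v)" "x \<in> cube \<Longrightarrow> pext ds v x = partials ds v x" by auto
qed

definition lset :: "real^3 \<Rightarrow> 3 \<Rightarrow> real \<Rightarrow> real^3"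
  where "lset x d s = (\<chi> e. if e = d then s else x $ e)"

lemma lset_nth [simp]: "lset x d s $ e = (if e = d then s else x $ e)"
  by (simp add: lset_def)

lemma lset_cube: "x \<in> cube \<Longrightarrow> 0 < s \<Longrightarrow> s < 1 \<Longrightarrow> lset x d s \<in> cube"
  by (simp add: cube_iff)

lemma lset_closure: "x \<in> cube \<Longrightarrow> s \<in> {0..1} \<Longrightarrow> lset x d s \<in> closure cube"
  by (simp add: cube_iff closure_cube_iff less_imp_le)

lemma lset_lset [simp]: "lset (lset x d s) d t = lset x d t"
  by (simp add: vec_eq_iff)

lemma lset_axis: "lset x d (s + t) = lset x d s + t *\<^sub>R axis d 1"
  by (simp add: vec_eq_iff axis_def)

lemma continuous_lset: "continuous_on S (\<lambda>s. lset x d s)"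
proof -
  have "continuous_on S (\<lambda>s. lset x d 0 + s *\<^sub>R axis d 1)" by (intro continuous_intros)
  then show ?thesis by (rule continuous_on_eq) (metis add_0 lset_axis)
qed

text \<open>Restriction to a coordinate line. The derivatives along the line are prepended to the
  list, so that differentiating once more raises i by one.\<close>

definition gl :: "3 list \<Rightarrow> (real^3 \<Rightarrow> real^3) \<Rightarrow> real^3 \<Rightarrow> 3 \<Rightarrow> nat \<Rightarrow> real \<Rightarrow> real^3"
  where "gl ds v x d i s = pext (replicate i d @ ds) v (lset x d s)"

lemma gl_continuous:
  assumes "v \<in> Cr_closure r" "x \<in> cube" "i + length ds \<le> r"
  shows "continuous_on {0..1} (gl ds v x d i)"
  unfolding gl_def using assms
  by (intro continuous_on_compose2[OF pext(1) continuous_lset]) (auto simp: lset_closure)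

lemma gl_derivative:
  assumes v: "v \<in> Cr_closure r" and x: "x \<in> cube" and i: "i + length ds < r" and s: "0 < s" "s < 1"
  shows "(gl ds v x d i has_vector_derivative gl ds v x d (Suc i) s) (at s)"
proof -
  let ?ds = "replicate i d @ ds"
  have y: "lset x d s \<in> cube" by (rule lset_cube[OF x s])
  have "((\<lambda>h. partials ?ds v (lset x d s + h *\<^sub>R axis d 1)) has_vector_derivative partials (d # ?ds) v (lset x d s)) (at (s - s))"
    using has_partial[OF v _ y, of ?ds d] i by simp
  then have "((\<lambda>h. partials ?ds v (lset x d s + h *\<^sub>R axis d 1)) \<circ> (\<lambda>t. t - s) has_vector_derivative
      1 *\<^sub>R partials (d # ?ds) v (lset x d s)) (at s)"
    by (intro vector_diff_chain_at) (auto intro!: derivative_eq_intros)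
  then have "((\<lambda>t. partials ?ds v (lset x d t)) has_vector_derivative partials (d # ?ds) v (lset x d s)) (at s)"
    by (simp add: comp_def flip: lset_axis)
  moreover have "gl ds v x d (Suc i) s = partials (d # ?ds) v (lset x d s)"
    unfolding gl_def using i by (subst pext(2)[OF v _ y]) auto
  ultimately have "((\<lambda>t. partials ?ds v (lset x d t)) has_vector_derivative gl ds v x d (Suc i) s) (at s)" by simp
  then show ?thesis
  proof (rule has_vector_derivative_transform_within_open)
    show "open {0<..<1::real}" "s \<in> {0<..<1}" using s by auto
    show "partials ?ds v (lset x d t) = gl ds v x d i t" if "t \<in> {0<..<1}" for t
      unfolding gl_def using that i by (subst pext(2)[OF v _ lset_cube[OF x]]) auto
  qed
qed

text \<open>The last clause is the Neumann condition in the form used below: the extended normal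
  derivative vanishes at both ends of each coordinate line through the cube.\<close>

definition nice :: "nat \<Rightarrow> real \<Rightarrow> (real^3 \<Rightarrow> real^3) \<Rightarrow> bool"
  where "nice r K v \<longleftrightarrow> v \<in> Cr_closure r \<and>
    (\<forall>ds x. length ds \<le> r \<longrightarrow> x \<in> cube \<longrightarrow> norm (partials ds v x) \<le> K) \<and>
    (\<forall>x\<in>cube. \<forall>d. gl [] v x d 1 0 = 0 \<and> gl [] v x d 1 1 = 0)"

lemma gl_bound:
  assumes v: "nice r K v" and x: "x \<in> cube" and i: "i + length ds \<le> r" and s: "s \<in> {0..1}"
  shows "norm (gl ds v x d i s) \<le> K"
  unfolding gl_def
proof (rule continuous_on_closure_norm_le[where s = cube and f = "pext (replicate i d @ ds) v" and x = "lset x d s"])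
  have v': "v \<in> Cr_closure r" using v by (simp add: nice_def)
  show "continuous_on (closure cube) (pext (replicate i d @ ds) v)" using v' i by (intro pext) auto
  show "\<forall>y\<in>cube. norm (pext (replicate i d @ ds) v y) \<le> K"
  proof
    fix y assume "y \<in> cube"
    then show "norm (pext (replicate i d @ ds) v y) \<le> K"
      using v i by (subst pext(2)[OF v']) (auto simp: nice_def)
  qed
  show "lset x d s \<in> closure cube" by (rule lset_closure[OF x s])
qed

lemma niceD: "nice r K v \<Longrightarrow> v \<in> Cr_closure r" "nice r K v \<Longrightarrow> x \<in> cube \<Longrightarrow> gl [] v x d 1 0 = 0"
  "nice r K v \<Longrightarrow> x \<in> cube \<Longrightarrow> gl [] v x d 1 1 = 0"
  by (auto simp: nice_def)

lemma line_taylor: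
  assumes v: "nice r K v" and x: "x \<in> cube" and s: "s \<in> {0..1}" and t: "t \<in> {0..1}"
  shows "i + 1 \<le> r \<Longrightarrow> norm (gl [] v x d i s - gl [] v x d i t) \<le> K * \<bar>s - t\<bar>"
    and "i + 2 \<le> r \<Longrightarrow> norm (gl [] v x d i s - (gl [] v x d i t + (s - t) *\<^sub>R gl [] v x d (Suc i) t)) \<le> K * \<bar>s - t\<bar>\<^sup>2"
    and "i + 3 \<le> r \<Longrightarrow> norm (gl [] v x d i s - (gl [] v x d i t + (s - t) *\<^sub>R gl [] v x d (Suc i) t
      + ((s - t)\<^sup>2 / 2) *\<^sub>R gl [] v x d (Suc (Suc i)) t)) \<le> K * \<bar>s - t\<bar> ^ 3"
proof -
  have c: "continuous_on {0..1} (gl [] v x d j)" if "j \<le> r" for j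
    using that by (intro gl_continuous[OF niceD(1)[OF v] x]) simp
  have de: "(gl [] v x d j has_vector_derivative gl [] v x d (Suc j) y) (at y)" if "j < r" "0 < y" "y < 1" for j y
    using that by (intro gl_derivative[OF niceD(1)[OF v] x]) simp_all
  have b: "norm (gl [] v x d j y) \<le> K" if "j \<le> r" "y \<in> {0..1}" for j y
    using that by (intro gl_bound[OF v x]) simp_all
  show "i + 1 \<le> r \<Longrightarrow> norm (gl [] v x d i s - gl [] v x d i t) \<le> K * \<bar>s - t\<bar>"
    by (rule taylor1[where g = "gl [] v x d" and ?i0.0 = i and a = 0 and b = 1]) (use s t c de b in simp_all)
  show "i + 2 \<le> r \<Longrightarrow> norm (gl [] v x d i s - (gl [] v x d i t + (s - t) *\<^sub>R gl [] v x d (Suc i) t)) \<le> K * \<bar>s - t\<bar>\<^sup>2"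
    by (rule taylor2[where g = "gl [] v x d" and ?i0.0 = i and a = 0 and b = 1]) (use s t c de b in simp_all)
  show "i + 3 \<le> r \<Longrightarrow> norm (gl [] v x d i s - (gl [] v x d i t + (s - t) *\<^sub>R gl [] v x d (Suc i) t
      + ((s - t)\<^sup>2 / 2) *\<^sub>R gl [] v x d (Suc (Suc i)) t)) \<le> K * \<bar>s - t\<bar> ^ 3"
    by (rule taylor3[where g = "gl [] v x d" and ?i0.0 = i and a = 0 and b = 1]) (use s t c de b in simp_all)
qed

text \<open>The one-sided difference quotient in the Neumann condition tends to the boundary value of the
  extended first derivative.\<close>
lemma niceI:
  assumes v: "v \<in> Cr_closure r" and r: "r \<ge> 2" and nm: "neumann_bc v"
    and bd: "\<And>ds x. length ds \<le> r \<Longrightarrow> x \<in> cube \<Longrightarrow> norm (partials ds v x) \<le> K"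
  shows "nice r K v"
proof -
  have bnd: "norm (gl [] v x d 2 s) \<le> K" if "x \<in> cube" "s \<in> {0..1}" for x d s
    unfolding gl_def
  proof (rule continuous_on_closure_norm_le[where s = cube and f = "pext (replicate 2 d @ []) v" and x = "lset x d s"])
    show "continuous_on (closure cube) (pext (replicate 2 d @ []) v)" using v r by (intro pext) auto
    show "\<forall>y\<in>cube. norm (pext (replicate 2 d @ []) v y) \<le> K"
      using bd r by (auto simp: pext(2)[OF v])
    show "lset x d s \<in> closure cube" by (rule lset_closure[OF that])
  qed
  have "gl [] v x d 1 c = 0" if x: "x \<in> cube" and c: "c = 0 \<and> sg = 1 \<or> c = 1 \<and> sg = -1" for x d c and sg :: real
  proof -
    let ?g = "gl [] v x d"
    have on: "outward_normal (lset x d c) (- sg *\<^sub>R axis d 1)"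
      unfolding outward_normal_def using x c by (intro exI[of _ d]) (auto simp: cube_iff)
    have "((\<lambda>s. (v (lset x d c) - v (lset x d c - s *\<^sub>R (- sg *\<^sub>R axis d 1))) /\<^sub>R s) \<longlongrightarrow> 0) (at_right 0)"
      using nm on unfolding neumann_bc_def by blast
    moreover have "v (lset x d c) - v (lset x d c - s *\<^sub>R (- sg *\<^sub>R axis d 1)) = ?g 0 c - ?g 0 (c + sg * s)" for s
      by (simp add: gl_def pext_def lset_axis mult.commute)
    ultimately have lim: "((\<lambda>s. (?g 0 c - ?g 0 (c + sg * s)) /\<^sub>R s) \<longlongrightarrow> 0) (at_right 0)" by simp
    have ev: "\<forall>\<^sub>F s in at_right 0. norm ((?g 0 c - ?g 0 (c + sg * s)) /\<^sub>R s + sg *\<^sub>R ?g 1 c) \<le> K * s"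
      unfolding eventually_at_right_field
    proof (intro exI[of _ 1] conjI allI impI)
      fix s :: real assume s: "0 < s" "s < 1"
      have "norm (?g 0 (c + sg * s) - (?g 0 c + (c + sg * s - c) *\<^sub>R ?g (Suc 0) c)) \<le> K * \<bar>c + sg * s - c\<bar>\<^sup>2"
      proof (rule taylor2[where a = 0 and b = 1])
        show "continuous_on {0..1} (?g i)" if "i \<le> Suc (Suc 0)" for i using that r by (intro gl_continuous[OF v x]) auto
        show "(?g i has_vector_derivative ?g (Suc i) s) (at s)" if "i < Suc (Suc 0)" "0 < s" "s < 1" for i s
          using that r by (intro gl_derivative[OF v x]) auto
        show "norm (?g (Suc (Suc 0)) s) \<le> K" if "s \<in> {0..1}" for s
          using bnd[OF x that] by (simp add: numeral_2_eq_2)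
      qed (use c s in auto)
      also have "\<bar>c + sg * s - c\<bar>\<^sup>2 = s\<^sup>2" using c by auto
      finally have *: "norm (?g 0 (c + sg * s) - (?g 0 c + (sg * s) *\<^sub>R ?g 1 c)) \<le> K * s\<^sup>2" by simp
      have "(?g 0 c - ?g 0 (c + sg * s)) /\<^sub>R s + sg *\<^sub>R ?g 1 c
        = (- (1/s)) *\<^sub>R (?g 0 (c + sg * s) - (?g 0 c + (sg * s) *\<^sub>R ?g 1 c))"
        using s by (simp add: vec_eq_iff field_simps)
      then have "norm ((?g 0 c - ?g 0 (c + sg * s)) /\<^sub>R s + sg *\<^sub>R ?g 1 c)
        = norm (?g 0 (c + sg * s) - (?g 0 c + (sg * s) *\<^sub>R ?g 1 c)) / s"
        using s by simp
      also have "\<dots> \<le> K * s\<^sup>2 / s" using * s by (intro divide_right_mono) auto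
      finally show "norm ((?g 0 c - ?g 0 (c + sg * s)) /\<^sub>R s + sg *\<^sub>R ?g 1 c) \<le> K * s"
        using s by (simp add: power2_eq_square)
    qed simp
    have "((\<lambda>s. K * s) \<longlongrightarrow> K * 0) (at_right 0)" by (intro tendsto_intros)
    then have z: "((\<lambda>s. (?g 0 c - ?g 0 (c + sg * s)) /\<^sub>R s + sg *\<^sub>R ?g 1 c) \<longlongrightarrow> 0) (at_right 0)"
      by (intro Lim_null_comparison[OF ev]) simp
    from tendsto_add[OF lim tendsto_const] 
    have "((\<lambda>s. (?g 0 c - ?g 0 (c + sg * s)) /\<^sub>R s + sg *\<^sub>R ?g 1 c) \<longlongrightarrow> 0 + sg *\<^sub>R ?g 1 c) (at_right 0)" .
    from tendsto_unique[OF trivial_limit_at_right_real this z] have "sg *\<^sub>R ?g 1 c = 0" by simp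
    then show ?thesis using c by auto
  qed
  from this[of _ 0 1] this[of _ 1 "-1"] show ?thesis
    unfolding nice_def using v bd by auto
qed

section \<open>Difference quotients and derivatives at cell faces\<close>

lemma half_powers:
  fixes K c x :: real
  shows "K * (c/2)\<^sup>2 + K * (c/2)\<^sup>2 = K * c\<^sup>2 / 2" "K * (c/2) ^ 3 + K * (c/2) ^ 3 = K * c ^ 3 / 4"
    and "c > 0 \<Longrightarrow> K \<ge> 0 \<Longrightarrow> K * c\<^sup>2 / 2 \<le> K * c\<^sup>2" "c > 0 \<Longrightarrow> K \<ge> 0 \<Longrightarrow> K * c ^ 3 / 4 \<le> K * c ^ 3"
    and "c > 0 \<Longrightarrow> x \<le> K * c \<Longrightarrow> x / c \<le> K" "c > 0 \<Longrightarrow> x \<le> K * c\<^sup>2 \<Longrightarrow> x / c \<le> K * c"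
      "c > 0 \<Longrightarrow> x \<le> K * c ^ 3 \<Longrightarrow> x / c \<le> K * c\<^sup>2"
  by (simp_all add: power2_eq_square power3_eq_cube pos_divide_le_eq mult.assoc)

lemma central2:
  fixes A B P G :: "real^3" and s t y c K :: real
  assumes "norm (A - (P + (s - y) *\<^sub>R G)) \<le> K * \<bar>s - y\<bar>\<^sup>2" "norm (B - (P + (t - y) *\<^sub>R G)) \<le> K * \<bar>t - y\<bar>\<^sup>2"
    and st: "s - y = c / 2" "t - y = - (c / 2)" and c: "c > 0" "K \<ge> 0"
  shows "norm (A - B - c *\<^sub>R G) \<le> K * c\<^sup>2"
proof -
  have eq: "A - B - c *\<^sub>R G = (A - (P + (c/2) *\<^sub>R G)) - (B - (P + (- (c/2)) *\<^sub>R G))"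
    by (simp add: vec_eq_iff)
  have "norm (A - B - c *\<^sub>R G) \<le> K * (c/2)\<^sup>2 + K * (c/2)\<^sup>2"
    unfolding eq using assms(1,2) unfolding st using c(1)
    by - (rule order.trans[OF norm_triangle_ineq4], rule add_mono, simp_all)
  then show ?thesis unfolding half_powers(1) using half_powers(3)[OF c] by (rule order.trans)
qed

text \<open>The quadratic terms of the two expansions about the midpoint coincide and cancel, so the
  symmetric difference gains an order.\<close>

lemma central3:
  fixes A B P G H :: "real^3" and s t y c K :: real
  assumes "norm (A - (P + (s - y) *\<^sub>R G + ((s - y)\<^sup>2 / 2) *\<^sub>R H)) \<le> K * \<bar>s - y\<bar> ^ 3"
    "norm (B - (P + (t - y) *\<^sub>R G + ((t - y)\<^sup>2 / 2) *\<^sub>R H)) \<le> K * \<bar>t - y\<bar> ^ 3"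
    and st: "s - y = c / 2" "t - y = - (c / 2)" and c: "c > 0" "K \<ge> 0"
  shows "norm (A - B - c *\<^sub>R G) \<le> K * c ^ 3"
proof -
  have eq: "A - B - c *\<^sub>R G = (A - (P + (c/2) *\<^sub>R G + ((c/2)\<^sup>2 / 2) *\<^sub>R H))
      - (B - (P + (- (c/2)) *\<^sub>R G + ((- (c/2))\<^sup>2 / 2) *\<^sub>R H))"
    by (simp add: vec_eq_iff)
  have "norm (A - B - c *\<^sub>R G) \<le> K * (c/2) ^ 3 + K * (c/2) ^ 3"
    unfolding eq using assms(1,2) unfolding st using c(1)
    by - (rule order.trans[OF norm_triangle_ineq4], rule add_mono, simp_all)
  then show ?thesis unfolding half_powers(2) using half_powers(4)[OF c] by (rule order.trans)
qed

lemma norm_signed_quotient: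
  "c > 0 \<Longrightarrow> norm ((if b then -1 else 1 :: real) *\<^sub>R (x /\<^sub>R c)) = norm (x :: real^3) / c"
  by (simp add: divide_inverse mult.commute)

context
  fixes N :: nat
  assumes N: "N \<ge> 1"
begin

abbreviation (input) "hN \<equiv> mesh N"

lemma hN: "hN > 0" by (rule mesh_pos[OF N])

lemma grid_coord:
  assumes "p \<in> grid N"
  shows "0 \<le> (real (p $ d) - 1) * hN" "real (p $ d) * hN \<le> 1" "0 < (real (p $ d) - 1/2) * hN" "(real (p $ d) - 1/2) * hN < 1"
proof -
  have b: "1 \<le> real (p $ d)" "real (p $ d) \<le> real N"
    using grid_bounds[OF assms, of d] by auto
  show "0 \<le> (real (p $ d) - 1) * hN" "0 < (real (p $ d) - 1/2) * hN" using b hN by auto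
  have "real (p $ d) * hN \<le> real N * hN" using b hN by (intro mult_right_mono) auto
  also have "\<dots> = 1" using N by (simp add: mesh_def)
  finally show 1: "real (p $ d) * hN \<le> 1" .
  have "(real (p $ d) - 1/2) * hN = real (p $ d) * hN - hN / 2" by (simp add: algebra_simps)
  then show "(real (p $ d) - 1/2) * hN < 1" using 1 hN by linarith
qed

lemma grid_point_cube: "p \<in> grid N \<Longrightarrow> grid_point N p \<in> cube"
  using grid_coord(3,4) by (simp add: cube_iff grid_point_def)

lemma grid_point_upd: "grid_point N (upd p d j) = lset (grid_point N p) d ((real j - 1/2) * hN)"
  by (simp add: vec_eq_iff grid_point_def)

lemma grid_point_line: "grid_point N p = lset (grid_point N p) d ((real (p $ d) - 1/2) * hN)"
  by (simp add: vec_eq_iff grid_point_def)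

text \<open>The derivative in direction \<open>d\<close> at the cell face between a lattice point and its successor.\<close>
definition face :: "3 \<Rightarrow> (real^3 \<Rightarrow> real^3) \<Rightarrow> tpoint \<Rightarrow> real^3"
  where "face d v q = (if snd q \<notin> grid N then 0
    else if fst q d then - gl [] v (grid_point N (snd q)) d 1 ((real (snd q $ d) - 1) * hN)
    else gl [] v (grid_point N (snd q)) d 1 (real (snd q $ d) * hN))"

definition vl :: "(real^3 \<Rightarrow> real^3) \<Rightarrow> tpoint \<Rightarrow> real^3"
  where "vl v = lift N (\<lambda>p. v (grid_point N p))"

interpretation lattice "torus N" "tsh N" "tsb N" hN 1 1 1 f for f
  by (rule torus_lattice) (use N in auto)

lemma vl_gl: "p \<in> grid N \<Longrightarrow> vl v (\<sigma>, p) = gl [] v (grid_point N p) d 0 ((real (p $ d) - 1/2) * hN)"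
  by (simp add: vl_def lift_def gl_def pext_def flip: grid_point_line)

lemma vl_upd: "upd p d j \<in> grid N \<Longrightarrow> vl v (\<sigma>, upd p d j) = gl [] v (grid_point N p) d 0 ((real j - 1/2) * hN)"
  by (simp add: vl_def lift_def gl_def pext_def grid_point_upd)

text \<open>Between two cells of one sheet the quotient is symmetric about the common face. Between
  mirror cells the values agree and the quotient is 0, as is the face derivative by the Neumann
  condition, so first differences have no boundary error.\<close>

lemma Dp_cases:
  assumes p: "p \<in> grid N"
  obtains (inner) y where "y - hN/2 \<in> {0..1}" "y + hN/2 \<in> {0..1}" "y \<in> {0..1}"
      "\<And>v. Dp d (vl v) (\<sigma>, p) = (if \<sigma> d then -1 else 1) *\<^sub>R
        ((gl [] v (grid_point N p) d 0 (y + hN/2) - gl [] v (grid_point N p) d 0 (y - hN/2)) /\<^sub>R hN)"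
      "\<And>v. face d v (\<sigma>, p) = (if \<sigma> d then -1 else 1) *\<^sub>R gl [] v (grid_point N p) d 1 y"
    | (edge) "\<And>v. Dp d (vl v) (\<sigma>, p) = 0"
      "\<And>v r K. nice r K v \<Longrightarrow> face d v (\<sigma>, p) = 0"
proof -
  note b = grid_bounds[OF p, of d] and x = grid_point_cube[OF p] and co = grid_coord[OF p, of d]
  have Nh: "real N * hN = 1" using N by (simp add: mesh_def)
  show thesis
  proof (cases "\<sigma> d")
    case False
    show thesis
    proof (cases "p $ d < N")
      case True
      let ?y = "real (p $ d) * hN"
      have "(real (p $ d) + 1) * hN \<le> real N * hN" using True hN by (intro mult_right_mono) auto
      then have y: "?y - hN/2 \<in> {0..1}" "?y + hN/2 \<in> {0..1}" "?y \<in> {0..1}"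
        using co hN Nh by (auto simp: algebra_simps)
      have g: "upd p d (p $ d + 1) \<in> grid N" using True p by (simp add: upd_grid)
      have "Dp d (vl v) (\<sigma>, p) = (if \<sigma> d then -1 else 1) *\<^sub>R
        ((gl [] v (grid_point N p) d 0 (?y + hN/2) - gl [] v (grid_point N p) d 0 (?y - hN/2)) /\<^sub>R hN)" for v
        using False True vl_upd[OF g, of v "\<sigma>(d := False)"] vl_gl[OF p, of v \<sigma> d]
        by (simp add: Dp_def tmove_in[OF p] step1_def algebra_simps)
      moreover have "face d v (\<sigma>, p) = (if \<sigma> d then -1 else 1) *\<^sub>R gl [] v (grid_point N p) d 1 ?y" for v
        using False p by (simp add: face_def)
      ultimately show thesis using y inner by blast
    next
      case F2: False
      then have e: "p $ d = N" "upd p d N = p" using b upd_same[of p d] by auto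
      have "Dp d (vl v) (\<sigma>, p) = 0" for v
        using False e p by (simp add: Dp_def tmove_in[OF p] step1_def vl_def lift_def)
      moreover have "face d v (\<sigma>, p) = 0" if "nice r K v" for v r K
        using False p e niceD(3)[OF that x, of d] Nh by (simp add: face_def)
      ultimately show thesis using edge by blast
    qed
  next
    case T: True
    show thesis
    proof (cases "1 < p $ d")
      case True
      let ?y = "(real (p $ d) - 1) * hN"
      have "2 * hN \<le> real (p $ d) * hN" using True hN by (intro mult_right_mono) auto
      then have y: "?y - hN/2 \<in> {0..1}" "?y + hN/2 \<in> {0..1}" "?y \<in> {0..1}"
        using co hN by (auto simp: algebra_simps)
      have g: "upd p d (p $ d - 1) \<in> grid N" using True p b by (auto simp: upd_grid)
      have "Dp d (vl v) (\<sigma>, p) = (if \<sigma> d then -1 else 1) *\<^sub>R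
        ((gl [] v (grid_point N p) d 0 (?y + hN/2) - gl [] v (grid_point N p) d 0 (?y - hN/2)) /\<^sub>R hN)" for v
        using T True vl_upd[OF g, of v "\<sigma>(d := True)"] vl_gl[OF p, of v \<sigma> d]
        by (simp add: Dp_def tmove_in[OF p] step1_def algebra_simps of_nat_diff)
      moreover have "face d v (\<sigma>, p) = (if \<sigma> d then -1 else 1) *\<^sub>R gl [] v (grid_point N p) d 1 ?y" for v
        using T p by (simp add: face_def)
      ultimately show thesis using y inner by blast
    next
      case F2: False
      then have e: "p $ d = 1" "upd p d 1 = p" using b upd_same[of p d] by auto
      have "Dp d (vl v) (\<sigma>, p) = 0" for v
        using T e p by (simp add: Dp_def tmove_in[OF p] step1_def vl_def lift_def)
      moreover have "face d v (\<sigma>, p) = 0" if "nice r K v" for v r K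
        using T p e niceD(2)[OF that x, of d] by (simp add: face_def)
      ultimately show thesis using edge by blast
    qed
  qed
qed

lemma Dp_out: "p \<notin> grid N \<Longrightarrow> Dp d (vl v) (\<sigma>, p) = 0"
  by (simp add: Dp_def tmove_def)

lemma face_out: "p \<notin> grid N \<Longrightarrow> face d v (\<sigma>, p) = 0"
  by (simp add: face_def)

lemma nice_K: "nice r K v \<Longrightarrow> K \<ge> 0"
proof -
  assume "nice r K v"
  moreover have "(\<chi> d. 1/2) \<in> cube" by (simp add: cube_iff)
  ultimately have "norm (partials [] v (\<chi> d. 1/2)) \<le> K" unfolding nice_def by (metis list.size(3) zero_le)
  then show ?thesis using norm_ge_zero order.trans by blast
qed

lemma norm_Dp_vl_le:
  assumes v: "nice r K v" and r: "r \<ge> 1"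
  shows "norm (Dp d (vl v) q) \<le> K"
proof -
  obtain \<sigma> p where q: "q = (\<sigma>, p)" by (cases q)
  have K: "K \<ge> 0" using v by (rule nice_K)
  show ?thesis
  proof (cases "p \<in> grid N")
    case True
    note x = grid_point_cube[OF True]
    show ?thesis
    proof (cases rule: Dp_cases[OF True, of d \<sigma>])
      case (1 y)
      let ?g = "gl [] v (grid_point N p) d"
      have "norm (?g 0 (y + hN/2) - ?g 0 (y - hN/2)) \<le> K * \<bar>(y + hN/2) - (y - hN/2)\<bar>"
        using 1 r by (intro line_taylor(1)[OF v x]) simp_all
      then have "norm (?g 0 (y + hN/2) - ?g 0 (y - hN/2)) / hN \<le> K"
        using hN by (simp add: pos_divide_le_eq)
      then show ?thesis unfolding q 1(4) norm_signed_quotient[OF hN] .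
    qed (use K in \<open>simp add: q\<close>)
  qed (use K in \<open>simp add: q Dp_out\<close>)
qed

lemma norm_Dp_face_le:
  assumes v: "nice r K v"
  shows "r \<ge> 2 \<Longrightarrow> norm (Dp d (vl v) q - face d v q) \<le> K * hN"
    and "r \<ge> 3 \<Longrightarrow> norm (Dp d (vl v) q - face d v q) \<le> K * hN\<^sup>2"
proof -
  obtain \<sigma> p where q: "q = (\<sigma>, p)" by (cases q)
  have K: "K \<ge> 0" using v by (rule nice_K)
  have "(r \<ge> 2 \<longrightarrow> norm (Dp d (vl v) q - face d v q) \<le> K * hN) \<and>
    (r \<ge> 3 \<longrightarrow> norm (Dp d (vl v) q - face d v q) \<le> K * hN\<^sup>2)"
  proof (cases "p \<in> grid N")
    case True
    note x = grid_point_cube[OF True]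
    show ?thesis
    proof (cases rule: Dp_cases[OF True, of d \<sigma>])
      case (1 y)
      let ?g = "gl [] v (grid_point N p) d"
      let ?a = "?g 0 (y + hN/2)" and ?b = "?g 0 (y - hN/2)"
      have ab: "\<bar>(y + hN/2) - y\<bar> = hN/2" "\<bar>(y - hN/2) - y\<bar> = hN/2" using hN by simp_all
      have eq: "norm (Dp d (vl v) q - face d v q) = norm (?a - ?b - hN *\<^sub>R ?g 1 y) / hN"
      proof -
        have "Dp d (vl v) q - face d v q = (if \<sigma> d then -1 else 1) *\<^sub>R ((?a - ?b - hN *\<^sub>R ?g 1 y) /\<^sub>R hN)"
          unfolding q 1(4) 1(5) using hN by (simp add: scaleR_diff_right)
        then show ?thesis using norm_signed_quotient[OF hN] by metis
      qed
      have "norm (?a - ?b - hN *\<^sub>R ?g 1 y) \<le> K * hN\<^sup>2" if r: "r \<ge> 2"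
      proof -
        have t: "norm (?g 0 s - (?g 0 y + (s - y) *\<^sub>R ?g (Suc 0) y)) \<le> K * \<bar>s - y\<bar>\<^sup>2" if "s \<in> {0..1}" for s
          using that r 1 by (intro line_taylor(2)[OF v x]) simp_all
        show ?thesis
          using central2[OF t[OF 1(2)] t[OF 1(1)] _ _ hN K] by simp
      qed
      moreover have "norm (?a - ?b - hN *\<^sub>R ?g 1 y) \<le> K * hN ^ 3" if r: "r \<ge> 3"
      proof -
        have t: "norm (?g 0 s - (?g 0 y + (s - y) *\<^sub>R ?g (Suc 0) y + ((s - y)\<^sup>2 / 2) *\<^sub>R ?g (Suc (Suc 0)) y)) \<le> K * \<bar>s - y\<bar> ^ 3"
          if "s \<in> {0..1}" for s
          using that r 1 by (intro line_taylor(3)[OF v x]) simp_all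
        show ?thesis
          using central3[OF t[OF 1(2)] t[OF 1(1)] _ _ hN K] by simp
      qed
      ultimately show ?thesis
        unfolding eq by (intro conjI impI half_powers(6,7)[OF hN]) auto
    next
      case 2
      then show ?thesis using K hN v by (simp add: q)
    qed
  next
    case False
    then show ?thesis using K hN by (simp add: q Dp_out face_out)
  qed
  then show "r \<ge> 2 \<Longrightarrow> norm (Dp d (vl v) q - face d v q) \<le> K * hN"
    "r \<ge> 3 \<Longrightarrow> norm (Dp d (vl v) q - face d v q) \<le> K * hN\<^sup>2" by auto
qed

text \<open>The two faces of a cell lie half a step to either side of its centre; a reflected sheet
  exchanges them and reverses the sign. At the ends of the line the Neumann condition makes the
  values fit together.\<close>

lemma face_tsb:
  fixes d :: 3
  assumes v: "nice r K v" and p: "p \<in> grid N"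
  defines "g \<equiv> gl [] v (grid_point N p) d 1"
  shows "face d v (\<sigma>, p) = (if \<sigma> d then - g ((real (p $ d) - 1) * hN) else g (real (p $ d) * hN))"
    and "face d v (tsb N d (\<sigma>, p)) = (if \<sigma> d then - g (real (p $ d) * hN) else g ((real (p $ d) - 1) * hN))"
proof -
  note b = grid_bounds[OF p, of d] and x = grid_point_cube[OF p]
  have Nh: "real N * hN = 1" using N by (simp add: mesh_def)
  show "face d v (\<sigma>, p) = (if \<sigma> d then - g ((real (p $ d) - 1) * hN) else g (real (p $ d) * hN))"
    using p by (simp add: face_def g_def)
  have gu: "gl [] v (grid_point N (upd p d j)) d 1 = g" for j
    unfolding g_def grid_point_upd gl_def by simp
  show "face d v (tsb N d (\<sigma>, p)) = (if \<sigma> d then - g (real (p $ d) * hN) else g ((real (p $ d) - 1) * hN))"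
  proof (cases "\<sigma> d")
    case True
    show ?thesis
    proof (cases "p $ d < N")
      case T: True
      then have "upd p d (p $ d + 1) \<in> grid N" using p by (simp add: upd_grid)
      then show ?thesis using True T by (simp add: tmove_in[OF p] step1_def face_def gu[unfolded One_nat_def])
    next
      case False
      then have "p $ d = N" "upd p d N = p" using b upd_same[of p d] by auto
      then show ?thesis using True p Nh niceD(3)[OF v x, of d]
        by (simp add: tmove_in[OF p] step1_def face_def g_def)
    qed
  next
    case False
    show ?thesis
    proof (cases "1 < p $ d")
      case T: True
      then have "upd p d (p $ d - 1) \<in> grid N" using p b T by (auto simp: upd_grid)
      then show ?thesis using False T by (simp add: tmove_in[OF p] step1_def face_def gu[unfolded One_nat_def] of_nat_diff)
    next
      case F: False
      then have "p $ d = 1" "upd p d 1 = p" using b upd_same[of p d] by auto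
      then show ?thesis using False p niceD(2)[OF v x, of d]
        by (simp add: tmove_in[OF p] step1_def face_def g_def)
    qed
  qed
qed

text \<open>The second difference is the divergence of the flux error plus a second derivative.\<close>
lemma Sd_vl:
  fixes d :: 3
  assumes v: "nice r K v" and r: "r \<ge> 2"
  obtains a where "\<And>q. Sd d (vl v) q = ((Dp d (vl v) q - face d v q)
      - (Dp d (vl v) (tsb N d q) - face d v (tsb N d q))) /\<^sub>R hN + a q"
    "\<And>q. norm (a q) \<le> K" "\<And>q. r \<ge> 4 \<Longrightarrow> norm (a q - vl (partials [d, d] v) q) \<le> K * hN\<^sup>2"
proof
  \<comment> \<open>The difference quotient of the two exact face derivatives is centred at the
    cell, so it approximates the second derivative to second order in boundary cells too; all of the
    order loss sits in the flux error.\<close>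
  define a where "a q = (face d v q - face d v (tsb N d q)) /\<^sub>R hN" for q
  have K: "K \<ge> 0" using v by (rule nice_K)
  show "Sd d (vl v) q = ((Dp d (vl v) q - face d v q)
      - (Dp d (vl v) (tsb N d q) - face d v (tsb N d q))) /\<^sub>R hN + a q" for q
    unfolding Sd_Dp a_def by (simp add: vec_eq_iff field_simps)
  have main: "norm (a q) \<le> K \<and> (r \<ge> 4 \<longrightarrow> norm (a q - vl (partials [d, d] v) q) \<le> K * hN\<^sup>2)" for q
  proof -
    obtain \<sigma> p where q: "q = (\<sigma>, p)" by (cases q)
    show ?thesis
    proof (cases "p \<in> grid N")
      case True
      note x = grid_point_cube[OF True] and co = grid_coord[OF True, of d]
      let ?g = "gl [] v (grid_point N p) d"
      let ?s = "real (p $ d) * hN" and ?t = "(real (p $ d) - 1) * hN" and ?y = "(real (p $ d) - 1/2) * hN"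
      have st: "?s \<in> {0..1}" "?t \<in> {0..1}" "?y \<in> {0..1}" "?s - ?y = hN/2" "?t - ?y = -(hN/2)" "?s - ?t = hN"
        using co hN by (auto simp: algebra_simps)
      have ab: "\<bar>?s - ?y\<bar> = hN/2" "\<bar>?t - ?y\<bar> = hN/2" "\<bar>?s - ?t\<bar> = hN"
        unfolding st using hN by simp_all
      have aq: "a q = (?g 1 ?s - ?g 1 ?t) /\<^sub>R hN"
        unfolding a_def q face_tsb[OF v True] by simp
      have "norm (?g (Suc 0) ?s - ?g (Suc 0) ?t) \<le> K * \<bar>?s - ?t\<bar>"
        by (rule line_taylor(1)[OF v x st(1,2)]) (use r in simp)
      then have 1: "norm (a q) \<le> K"
        unfolding aq using norm_signed_quotient[OF hN, of False "?g 1 ?s - ?g 1 ?t"] hN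
        unfolding ab by (simp add: pos_divide_le_eq)
      have 2: "norm (a q - vl (partials [d, d] v) q) \<le> K * hN\<^sup>2" if r: "r \<ge> 4"
      proof -
        have t: "norm (?g (Suc 0) s - (?g (Suc 0) ?y + (s - ?y) *\<^sub>R ?g (Suc (Suc 0)) ?y + ((s - ?y)\<^sup>2 / 2) *\<^sub>R ?g (Suc (Suc (Suc 0))) ?y)) \<le> K * \<bar>s - ?y\<bar> ^ 3"
          if "s \<in> {0..1}" for s
          by (rule line_taylor(3)[OF v x that st(3)]) (use r in simp)
        have vq: "vl (partials [d, d] v) q = ?g 2 ?y"
        proof -
          have "?g 2 ?y = pext [d, d] v (grid_point N p)"
            unfolding gl_def grid_point_line[symmetric] by (simp add: numeral_2_eq_2)
          also have "\<dots> = partials [d, d] v (grid_point N p)"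
            using r x by (intro pext(2)[OF niceD(1)[OF v]]) auto
          finally show ?thesis using True by (simp add: q vl_def lift_def)
        qed
        have *: "norm (?g 1 ?s - ?g 1 ?t - hN *\<^sub>R ?g 2 ?y) \<le> K * hN ^ 3"
          using central3[OF t[OF st(1)] t[OF st(2)] st(4) st(5) hN K] by (simp add: numeral_2_eq_2)
        have "a q - vl (partials [d, d] v) q = (?g 1 ?s - ?g 1 ?t - hN *\<^sub>R ?g 2 ?y) /\<^sub>R hN"
          unfolding aq vq using hN by (simp add: scaleR_diff_right)
        then have "norm (a q - vl (partials [d, d] v) q) = norm (?g 1 ?s - ?g 1 ?t - hN *\<^sub>R ?g 2 ?y) / hN"
          using norm_signed_quotient[OF hN, of False] by simp
        then show ?thesis
          using half_powers(7)[OF hN *] by simp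
      qed
      show ?thesis using 1 2 by blast
    next
      case False
      then show ?thesis
        using K hN by (simp add: q a_def face_out tmove_def vl_def lift_def)
    qed
  qed
  show "norm (a q) \<le> K" "r \<ge> 4 \<Longrightarrow> norm (a q - vl (partials [d, d] v) q) \<le> K * hN\<^sup>2" for q
    using main by auto
qed

end

text \<open>The equation in the form of a harmonic map heat flow, to which the scheme is a direct
  discretisation; \<open>rhs_eq\<close> identifies the two forms for unit fields.\<close>

definition rhs :: "real \<Rightarrow> real \<Rightarrow> (real^3 \<Rightarrow> real^3) \<Rightarrow> (real^3 \<Rightarrow> real^3) \<Rightarrow> real^3 \<Rightarrow> real^3"
  where "rhs \<alpha> \<beta> f v x = \<beta> *\<^sub>R laplacian v x + (\<beta> * (\<Sum>d\<in>UNIV. (norm (partials [d] v x))\<^sup>2)) *\<^sub>R v x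
    - \<alpha> *\<^sub>R cross3 (v x) (cross3 (v x) (f x))"

context
  fixes N :: nat and k \<alpha> \<beta> :: real
  assumes N: "N \<ge> 1" and k: "k > 0" and ab: "\<alpha> > 0" "\<beta> > 0"
begin


interpretation lattice "torus N" "tsh N" "tsb N" "mesh N" k \<alpha> \<beta> f for f
  by (rule torus_lattice) (use N k ab in auto)

lemma mesh_range: "mesh N > 0" "mesh N \<le> 1"
  using N by (auto simp: mesh_def)

lemma mesh_sq_le: "(mesh N)\<^sup>2 \<le> mesh N" using mesh_range by (simp add: power2_eq_square mult_left_le)

section \<open>Spatial consistency of the lifted operators\<close>

lemma norm_Sd_vl_le:
  assumes v: "nice r K v" and r: "r \<ge> 2"
  shows "norm (lattice.Sd (tsh N) (tsb N) (mesh N) d (vl N v) q) \<le> 3 * K"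
proof -
  obtain a where a: "\<And>q. Sd d (vl N v) q = ((Dp d (vl N v) q - face N d v q)
      - (Dp d (vl N v) (tsb N d q) - face N d v (tsb N d q))) /\<^sub>R mesh N + a q" "\<And>q. norm (a q) \<le> K"
  proof (rule Sd_vl[OF N v r, of d], goal_cases)
    case (1 a)
    show thesis by (rule that[of a]) (fact 1)+
  qed
  have "norm ((Dp d (vl N v) q - face N d v q) - (Dp d (vl N v) (tsb N d q) - face N d v (tsb N d q))) \<le> K * mesh N + K * mesh N"
    by (intro order.trans[OF norm_triangle_ineq4] add_mono norm_Dp_face_le(1)[OF N v r])
  then have "norm (((Dp d (vl N v) q - face N d v q) - (Dp d (vl N v) (tsb N d q) - face N d v (tsb N d q))) /\<^sub>R mesh N) \<le> 2 * K"
    using norm_signed_quotient[OF mesh_range(1), of False] half_powers(5)[OF mesh_range(1), of _ "2 * K"] by simp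
  then show ?thesis
    unfolding a(1) using a(2)[of q] by (intro order.trans[OF norm_triangle_ineq]) linarith
qed

text \<open>Pointwise the flux error of order h^2 is divided by h. In the dual norm summation by
  parts puts the outer difference on the test function, and the full order survives up to the
  boundary.\<close>

lemma Sd_vl_consistent:
  assumes v: "nice 4 K v"
  shows "norm (lattice.Sd (tsh N) (tsb N) (mesh N) d (vl N v) q - vl N (partials [d, d] v) q) \<le> 3 * K * mesh N"
    and "\<bar>lattice.ip (torus N) (mesh N) (\<lambda>q. lattice.Sd (tsh N) (tsb N) (mesh N) d (vl N v) q - vl N (partials [d, d] v) q) e\<bar>
      \<le> 3 * K * (mesh N)\<^sup>2 * (lattice.nrm (torus N) (mesh N) e + lattice.gn (torus N) (tsh N) (mesh N) e)"
proof -
  obtain a where a: "\<And>q. Sd d (vl N v) q = ((Dp d (vl N v) q - face N d v q)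
      - (Dp d (vl N v) (tsb N d q) - face N d v (tsb N d q))) /\<^sub>R mesh N + a q" "\<And>q. norm (a q) \<le> K"
    "\<And>q. norm (a q - vl N (partials [d, d] v) q) \<le> K * (mesh N)\<^sup>2"
  proof (rule Sd_vl[OF N v, of d], goal_cases)
    case (2 a)
    show thesis by (rule that[of a]) (fact 2(2) 2(3) 2(4)[OF order_refl])+
  qed simp
  have K: "K \<ge> 0" using v by (rule nice_K[OF N])
  define \<phi> where "\<phi> q = Dp d (vl N v) q - face N d v q" for q
  have \<phi>: "norm (\<phi> q) \<le> K * (mesh N)\<^sup>2" for q
    unfolding \<phi>_def by (intro norm_Dp_face_le(2)[OF N v]) simp
  define b where "b q = a q - vl N (partials [d, d] v) q" for q
  have eq: "Sd d (vl N v) q - vl N (partials [d, d] v) q = (\<phi> q - \<phi> (tsb N d q)) /\<^sub>R mesh N + b q" for q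
    unfolding a(1) b_def \<phi>_def by simp
  have "norm (\<phi> q - \<phi> (tsb N d q)) \<le> K * (mesh N)\<^sup>2 + K * (mesh N)\<^sup>2"
    by (intro order.trans[OF norm_triangle_ineq4] add_mono \<phi>)
  then have "norm ((\<phi> q - \<phi> (tsb N d q)) /\<^sub>R mesh N) \<le> 2 * K * mesh N"
    using norm_signed_quotient[OF mesh_range(1), of False] half_powers(6)[OF mesh_range(1), of _ "2 * K"] by simp
  moreover have "norm (b q) \<le> K * mesh N"
    using a(3)[of q] mult_left_mono[OF mesh_sq_le K] unfolding b_def by linarith
  ultimately show "norm (Sd d (vl N v) q - vl N (partials [d, d] v) q) \<le> 3 * K * mesh N"
    unfolding eq by (intro order.trans[OF norm_triangle_ineq]) linarith
  have n\<phi>: "nrm \<phi> \<le> 3 * (K * (mesh N)\<^sup>2)" and nb: "nrm b \<le> 3 * (K * (mesh N)\<^sup>2)"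
    using \<phi> a(3) K by (auto intro!: nrm_le simp: b_def)
  have "ip (\<lambda>q. Sd d (vl N v) q - vl N (partials [d, d] v) q) e = - ip \<phi> (Dp d e) + ip b e"
    unfolding eq ip_add_left ip_div ..
  also have "\<bar>\<dots>\<bar> \<le> nrm \<phi> * nrm (Dp d e) + nrm b * nrm e"
    using ip_CS[of \<phi> "Dp d e"] ip_CS[of b e] by linarith
  also have "\<dots> \<le> 3 * (K * (mesh N)\<^sup>2) * gn e + 3 * (K * (mesh N)\<^sup>2) * nrm e"
    using K by (intro add_mono mult_mono n\<phi> nb nrm_Dp_le) auto
  finally show "\<bar>ip (\<lambda>q. Sd d (vl N v) q - vl N (partials [d, d] v) q) e\<bar> \<le> 3 * K * (mesh N)\<^sup>2 * (nrm e + gn e)"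
    by (simp add: algebra_simps)
qed

lemma vl_pext: "v \<in> Cr_closure r \<Longrightarrow> length ds \<le> r \<Longrightarrow> vl N (pext ds v) = vl N (partials ds v)"
  unfolding vl_def[OF N] by (intro lift_cong pext(2) grid_point_cube[OF N])

text \<open>The second difference is the second derivative, which is Lipschitz, plus an error of
  order h, whose difference quotient is bounded by the inverse inequality.\<close>

lemma norm_Dp_Sd_vl_le:
  assumes v: "nice 4 K v"
  shows "norm (lattice.Dp (tsh N) (mesh N) c (lattice.Sd (tsh N) (tsb N) (mesh N) d (vl N v)) q) \<le> 7 * K"
proof -
  note v' = niceD(1)[OF v]
  have K: "K \<ge> 0" using v by (rule nice_K[OF N])
  let ?w = "pext [d, d] v"
  let ?r = "\<lambda>q. Sd d (vl N v) q - vl N ?w q"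
  have w: "vl N ?w = vl N (partials [d, d] v)" by (intro vl_pext[OF v']) simp
  have 1: "norm (Dp c (vl N ?w) q) \<le> K"
  proof -
    obtain \<sigma> p where q: "q = (\<sigma>, p)" by (cases q)
    show ?thesis
    proof (cases "p \<in> grid N")
      case True
      note x = grid_point_cube[OF N True]
      show ?thesis
      proof (cases rule: Dp_cases[OF N True, of c \<sigma>])
        case (1 y)
        let ?g = "gl [d, d] v (grid_point N p) c"
        have g0: "gl [] ?w (grid_point N p) c 0 = ?g 0" by (auto simp: gl_def pext_def)
        have "norm (?g 0 (y + mesh N/2) - ?g 0 (y - mesh N/2)) \<le> K * \<bar>(y + mesh N/2) - (y - mesh N/2)\<bar>"
          by (rule taylor1[where g = ?g and a = 0 and b = 1];
            (intro gl_continuous[OF v' x] gl_derivative[OF v' x] gl_bound[OF v x] 1)?; simp?)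
        then have "norm (?g 0 (y + mesh N/2) - ?g 0 (y - mesh N/2)) / mesh N \<le> K"
          using mesh_range by (simp add: pos_divide_le_eq)
        then show ?thesis unfolding q 1(4) norm_signed_quotient[OF mesh_range(1)] g0 .
      qed (use K in \<open>simp add: q\<close>)
    qed (use K in \<open>simp add: q Dp_out[OF N]\<close>)
  qed
  have "norm (Dp c ?r q) \<le> 2 * (3 * K * mesh N) / mesh N"
    by (intro norm_Dp_le) (use Sd_vl_consistent(1)[OF v] in \<open>simp add: w\<close>)
  then have 2: "norm (Dp c ?r q) \<le> 6 * K" using mesh_range by simp
  have "Dp c (Sd d (vl N v)) q = Dp c (vl N ?w) q + Dp c ?r q"
    unfolding Dp_diff by simp
  then show ?thesis using 1 2 norm_triangle_ineq[of "Dp c (vl N ?w) q" "Dp c ?r q"] by simp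
qed

text \<open>The centred difference is the mean of two adjacent face quotients, each accurate to
  order h^2, and the linear terms of the two face expansions cancel. Squared lengths are compared
  because the sign is reversed on reflected sheets.\<close>

lemma norm_Ac_vl_sq:
  assumes v: "nice r K v" and r: "r \<ge> 3" and p: "p \<in> grid N"
  shows "\<bar>(norm (lattice.Ac (tsh N) (tsb N) (mesh N) d (vl N v) (\<sigma>, p)))\<^sup>2 - (norm (partials [d] v (grid_point N p)))\<^sup>2\<bar>
    \<le> 4 * K\<^sup>2 * (mesh N)\<^sup>2"
proof -
  note v' = niceD(1)[OF v] and x = grid_point_cube[OF N p] and co = grid_coord[OF N p, of d]
  have K: "K \<ge> 0" using v by (rule nice_K[OF N])
  let ?q = "(\<sigma>, p)" and ?g = "gl [] v (grid_point N p) d"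
  let ?s = "real (p $ d) * mesh N" and ?t = "(real (p $ d) - 1) * mesh N" and ?y = "(real (p $ d) - 1/2) * mesh N"
  have st: "?s \<in> {0..1}" "?t \<in> {0..1}" "?y \<in> {0..1}" "?s - ?y = mesh N/2" "?t - ?y = -(mesh N/2)"
    using co mesh_range by (auto simp: algebra_simps)
  define sg where "sg = (if \<sigma> d then -1 else 1 :: real)"
  define \<phi> where "\<phi> q = Dp d (vl N v) q - face N d v q" for q
  have \<phi>: "norm (\<phi> q) \<le> K * (mesh N)\<^sup>2" for q
    unfolding \<phi>_def using norm_Dp_face_le(2)[OF N v r] .
  have f: "face N d v ?q + face N d v (tsb N d ?q) = sg *\<^sub>R (?g 1 ?s + ?g 1 ?t)"
    unfolding face_tsb[OF N v p] sg_def by simp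
  have t: "norm (?g (Suc 0) z - (?g (Suc 0) ?y + (z - ?y) *\<^sub>R ?g (Suc (Suc 0)) ?y)) \<le> K * \<bar>z - ?y\<bar>\<^sup>2" if "z \<in> {0..1}" for z
    by (rule line_taylor(2)[OF v x that st(3)]) (use r in simp)
  define A where "A = ?g 1 ?s - (?g 1 ?y + (mesh N/2) *\<^sub>R ?g 2 ?y)"
  define B where "B = ?g 1 ?t - (?g 1 ?y + (-(mesh N/2)) *\<^sub>R ?g 2 ?y)"
  have nA: "norm A \<le> K * (mesh N)\<^sup>2" and nB: "norm B \<le> K * (mesh N)\<^sup>2"
  proof -
    have a: "K * \<bar>mesh N/2\<bar>\<^sup>2 \<le> K * (mesh N)\<^sup>2" "K * \<bar>-(mesh N/2)\<bar>\<^sup>2 \<le> K * (mesh N)\<^sup>2"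
      using K by (auto simp: power_divide intro!: mult_left_mono)
    have "norm A \<le> K * \<bar>mesh N/2\<bar>\<^sup>2" using t[OF st(1)] unfolding st A_def by (simp add: numeral_2_eq_2)
    then show "norm A \<le> K * (mesh N)\<^sup>2" using a(1) by (rule order.trans)
    have "norm B \<le> K * \<bar>-(mesh N/2)\<bar>\<^sup>2" using t[OF st(2)] unfolding st B_def by (simp add: numeral_2_eq_2)
    then show "norm B \<le> K * (mesh N)\<^sup>2" using a(2) by (rule order.trans)
  qed
  have gp: "?g 1 ?y = partials [d] v (grid_point N p)"
  proof -
    have "?g 1 ?y = pext [d] v (grid_point N p)"
      unfolding gl_def grid_point_line[OF N, symmetric] by simp
    also have "\<dots> = partials [d] v (grid_point N p)" using r by (intro pext(2)[OF v' _ x]) simp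
    finally show ?thesis .
  qed
  let ?P = "partials [d] v (grid_point N p)"
  have "Ac d (vl N v) ?q = sg *\<^sub>R ?P + (1/2) *\<^sub>R ((\<phi> ?q + \<phi> (tsb N d ?q)) + sg *\<^sub>R (A + B))"
  proof -
    have "Ac d (vl N v) ?q = (1/2) *\<^sub>R ((\<phi> ?q + \<phi> (tsb N d ?q)) + (face N d v ?q + face N d v (tsb N d ?q)))"
      unfolding Ac_Dp \<phi>_def by simp
    also have "face N d v ?q + face N d v (tsb N d ?q) = sg *\<^sub>R (2 *\<^sub>R ?P + (A + B))"
      unfolding f A_def B_def gp[symmetric] by (simp add: vec_eq_iff)
    finally show ?thesis by (simp add: vec_eq_iff field_simps)
  qed
  moreover have "norm ((1/2) *\<^sub>R ((\<phi> ?q + \<phi> (tsb N d ?q)) + sg *\<^sub>R (A + B))) \<le> 2 * K * (mesh N)\<^sup>2"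
  proof -
    have "norm ((\<phi> ?q + \<phi> (tsb N d ?q)) + sg *\<^sub>R (A + B)) \<le> (K * (mesh N)\<^sup>2 + K * (mesh N)\<^sup>2) + (K * (mesh N)\<^sup>2 + K * (mesh N)\<^sup>2)"
    proof (intro norm_triangle_mono \<phi>)
      have "norm (sg *\<^sub>R (A + B)) = norm (A + B)" by (simp add: sg_def)
      also have "\<dots> \<le> K * (mesh N)\<^sup>2 + K * (mesh N)\<^sup>2" by (intro norm_triangle_mono nA nB)
      finally show "norm (sg *\<^sub>R (A + B)) \<le> K * (mesh N)\<^sup>2 + K * (mesh N)\<^sup>2" .
    qed
    then show ?thesis by simp
  qed
  ultimately have "norm (Ac d (vl N v) ?q - sg *\<^sub>R ?P) \<le> 2 * K * (mesh N)\<^sup>2" by simp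
  moreover have "norm (sg *\<^sub>R ?P) = norm ?P" by (simp add: sg_def)
  ultimately have d: "\<bar>norm (Ac d (vl N v) ?q) - norm ?P\<bar> \<le> 2 * K * (mesh N)\<^sup>2"
    using norm_triangle_ineq3[of "Ac d (vl N v) ?q" "sg *\<^sub>R ?P"] by linarith
  have n1: "norm (Ac d (vl N v) ?q) \<le> K" using r by (intro norm_Ac_le norm_Dp_vl_le[OF N v]) simp
  have n2: "norm ?P \<le> K"
    using v[unfolded nice_def, THEN conjunct2, THEN conjunct1, rule_format, of "[d]", OF _ x] r by simp
  have "\<bar>(norm (Ac d (vl N v) ?q))\<^sup>2 - (norm ?P)\<^sup>2\<bar> = \<bar>norm (Ac d (vl N v) ?q) - norm ?P\<bar> * (norm (Ac d (vl N v) ?q) + norm ?P)"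
    by (simp add: square_diff_square_factored power2_eq_square abs_mult mult.commute)
  also have "\<dots> \<le> (2 * K * (mesh N)\<^sup>2) * (K + K)" using d n1 n2 K by (intro mult_mono add_mono) auto
  finally show ?thesis by (simp add: power2_eq_square mult_ac)
qed

lemma NL_vl_consistent:
  assumes v: "nice r K v" and r: "r \<ge> 3"
  shows "norm (lattice.NL (tsh N) (tsb N) (mesh N) \<alpha> \<beta> (vl N f) (vl N v) q
    - vl N (\<lambda>x. (\<beta> * (\<Sum>d\<in>UNIV. (norm (partials [d] v x))\<^sup>2)) *\<^sub>R v x - \<alpha> *\<^sub>R cross3 (v x) (cross3 (v x) (f x))) q)
    \<le> 12 * \<beta> * K ^ 3 * (mesh N)\<^sup>2"
proof -
  obtain \<sigma> p where q: "q = (\<sigma>, p)" by (cases q)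
  have K: "K \<ge> 0" using v by (rule nice_K[OF N])
  show ?thesis
  proof (cases "p \<in> grid N")
    case True
    let ?x = "grid_point N p"
    let ?A = "\<Sum>d\<in>UNIV. (norm (Ac d (vl N v) q))\<^sup>2" and ?P = "\<Sum>d\<in>UNIV. (norm (partials [d] v ?x))\<^sup>2"
    have vx: "norm (v ?x) \<le> K"
      using v grid_point_cube[OF N True] unfolding nice_def by (metis list.size(3) partials.simps(1) zero_le)
    have "\<bar>?A - ?P\<bar> \<le> (\<Sum>d\<in>(UNIV::3 set). 4 * K\<^sup>2 * (mesh N)\<^sup>2)"
      unfolding sum_subtractf[symmetric] q
      by (intro order.trans[OF sum_abs] sum_mono norm_Ac_vl_sq[OF v r True])
    then have A: "\<bar>?A - ?P\<bar> \<le> 12 * K\<^sup>2 * (mesh N)\<^sup>2" by simp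
    have "NL (vl N f) (vl N v) q - vl N (\<lambda>x. (\<beta> * (\<Sum>d\<in>UNIV. (norm (partials [d] v x))\<^sup>2)) *\<^sub>R v x - \<alpha> *\<^sub>R cross3 (v x) (cross3 (v x) (f x))) q
      = (\<beta> * (?A - ?P)) *\<^sub>R v ?x"
    proof -
      have "vl N g q = g ?x" for g using True by (simp add: q vl_def[OF N] lift_def)
      then show ?thesis by (simp only: NL_def right_diff_distrib scaleR_diff_left) simp
    qed
    also have "norm \<dots> = \<beta> * \<bar>?A - ?P\<bar> * norm (v ?x)" using ab by (simp add: abs_mult)
    also have "\<dots> \<le> \<beta> * (12 * K\<^sup>2 * (mesh N)\<^sup>2) * K" using A vx ab K by (intro mult_mono mult_left_mono) auto
    finally show ?thesis by (simp add: power2_eq_square power3_eq_cube mult_ac)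
  next
    case False
    then show ?thesis using K ab mesh_range by (simp add: q NL_def vl_def[OF N] lift_def)
  qed
qed

text \<open>The spatial truncation error; u stands for the time derivative of v.\<close>

definition tau :: "(real^3 \<Rightarrow> real^3) \<Rightarrow> (real^3 \<Rightarrow> real^3) \<Rightarrow> (real^3 \<Rightarrow> real^3) \<Rightarrow> tpoint \<Rightarrow> real^3"
  where "tau f v u q = \<beta> *\<^sub>R (\<Sum>d\<in>UNIV. lattice.Sd (tsh N) (tsb N) (mesh N) d (vl N v) q)
    + lattice.NL (tsh N) (tsb N) (mesh N) \<alpha> \<beta> (vl N f) (vl N v) q - vl N u q"

text \<open>The constant combines 9 = 3 directions times the 3 of \<open>Sd_vl_consistent\<close>,
  and 36 = 12 times the factor 3 of \<open>nrm_le\<close>.\<close>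

lemma tau_bounds:
  assumes v: "nice 4 K v" and u: "\<And>x. x \<in> cube \<Longrightarrow> u x = rhs \<alpha> \<beta> f v x"
  shows "norm (tau f v u q) \<le> (9 * \<beta> * K + 36 * \<beta> * K ^ 3) * mesh N"
    and "\<bar>lattice.ip (torus N) (mesh N) (tau f v u) e\<bar>
      \<le> (9 * \<beta> * K + 36 * \<beta> * K ^ 3) * (mesh N)\<^sup>2 * (lattice.nrm (torus N) (mesh N) e + lattice.gn (torus N) (tsh N) (mesh N) e)"
proof -
  have K: "K \<ge> 0" using v by (rule nice_K[OF N])
  define R where "R q = NL (vl N f) (vl N v) q
    - vl N (\<lambda>x. (\<beta> * (\<Sum>d\<in>UNIV. (norm (partials [d] v x))\<^sup>2)) *\<^sub>R v x - \<alpha> *\<^sub>R cross3 (v x) (cross3 (v x) (f x))) q" for q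
  define S where "S d q = Sd d (vl N v) q - vl N (partials [d, d] v) q" for d q
  have R: "norm (R q) \<le> 12 * \<beta> * K ^ 3 * (mesh N)\<^sup>2" for q
    unfolding R_def by (rule NL_vl_consistent[OF v]) simp
  have eq: "tau f v u q = (\<Sum>d\<in>UNIV. \<beta> *\<^sub>R S d q) + R q" for q
  proof -
    have "vl N u = vl N (rhs \<alpha> \<beta> f v)"
      unfolding vl_def[OF N] by (intro lift_cong u grid_point_cube[OF N])
    then have "vl N u q = \<beta> *\<^sub>R (\<Sum>d\<in>UNIV. vl N (partials [d, d] v) q) + vl N (\<lambda>x. (\<beta> * (\<Sum>d\<in>UNIV. (norm (partials [d] v x))\<^sup>2)) *\<^sub>R v x - \<alpha> *\<^sub>R cross3 (v x) (cross3 (v x) (f x))) q"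
      by (simp add: vl_def[OF N] lift_def rhs_def laplacian_def)
    then show ?thesis
      unfolding tau_def R_def S_def by (simp add: sum_subtractf scaleR_diff_right scaleR_sum_right)
  qed
  have "norm (\<Sum>d\<in>UNIV. \<beta> *\<^sub>R S d q) \<le> (\<Sum>d\<in>(UNIV::3 set). \<beta> * (3 * K * mesh N))"
    unfolding S_def using ab Sd_vl_consistent(1)[OF v]
    by (intro sum_norm_le) (simp add: mult.assoc del: partials.simps)
  moreover have "12 * \<beta> * K ^ 3 * (mesh N)\<^sup>2 \<le> 36 * \<beta> * K ^ 3 * mesh N"
    using K ab mesh_sq_le mesh_range by (intro mult_mono) auto
  ultimately show "norm (tau f v u q) \<le> (9 * \<beta> * K + 36 * \<beta> * K ^ 3) * mesh N"
    unfolding eq using R[of q]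
    by (intro order.trans[OF norm_triangle_ineq]) (simp add: algebra_simps)
  have ipS: "\<bar>ip (S d) e\<bar> \<le> 3 * K * (mesh N)\<^sup>2 * (nrm e + gn e)" for d
    unfolding S_def by (rule Sd_vl_consistent(2)[OF v])
  have "ip (tau f v u) e = (\<Sum>d\<in>UNIV. \<beta> * ip (S d) e) + ip R e"
    unfolding eq[abs_def] ip_add_left ip_sum_left ip_scale_left ..
  also have "\<bar>\<dots>\<bar> \<le> (\<Sum>d\<in>(UNIV::3 set). \<beta> * (3 * K * (mesh N)\<^sup>2 * (nrm e + gn e))) + (3 * (12 * \<beta> * K ^ 3 * (mesh N)\<^sup>2)) * (nrm e + gn e)"
  proof (intro order.trans[OF abs_triangle_ineq] add_mono order.trans[OF sum_abs] sum_mono)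
    show "\<bar>\<beta> * ip (S d) e\<bar> \<le> \<beta> * (3 * K * (mesh N)\<^sup>2 * (nrm e + gn e))" for d
      using ab ipS[of d] by (simp add: abs_mult)
    have "\<bar>ip R e\<bar> \<le> nrm R * nrm e" by (rule ip_CS)
    also have "\<dots> \<le> (3 * (12 * \<beta> * K ^ 3 * (mesh N)\<^sup>2)) * (nrm e + gn e)"
      using R K ab by (intro mult_mono nrm_le) auto
    finally show "\<bar>ip R e\<bar> \<le> (3 * (12 * \<beta> * K ^ 3 * (mesh N)\<^sup>2)) * (nrm e + gn e)" .
  qed
  also have "\<dots> = (9 * \<beta> * K + 36 * \<beta> * K ^ 3) * (mesh N)\<^sup>2 * (nrm e + gn e)"
    by (simp add: algebra_simps)
  finally show "\<bar>ip (tau f v u) e\<bar> \<le> (9 * \<beta> * K + 36 * \<beta> * K ^ 3) * (mesh N)\<^sup>2 * (nrm e + gn e)" .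
qed

end

section \<open>Regularity in time of the exact solution\<close>

text \<open>Extensions are chosen separately for each function, so linearity has to be derived: both
  sides are continuous on the closure and agree in the open cube.\<close>

lemma pext_diff:
  assumes u: "u \<in> Cr_closure r" and v: "v \<in> Cr_closure r" and ds: "length ds \<le> r" and y: "y \<in> closure cube"
  shows "pext ds (\<lambda>x. u x - v x) y = pext ds u y - pext ds v y"
proof -
  note d = Cr_closure_diff[OF u v]
  have "norm (pext ds (\<lambda>x. u x - v x) y - (pext ds u y - pext ds v y)) \<le> 0"
  proof (rule continuous_on_closure_norm_le[OF _ _ y])
    show "continuous_on (closure cube) (\<lambda>y. pext ds (\<lambda>x. u x - v x) y - (pext ds u y - pext ds v y))"
      by (intro continuous_intros pext[OF d(1) ds] pext[OF u ds] pext[OF v ds])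
    show "\<forall>y\<in>cube. norm (pext ds (\<lambda>x. u x - v x) y - (pext ds u y - pext ds v y)) \<le> 0"
      using pext(2)[OF d(1) ds] pext(2)[OF u ds] pext(2)[OF v ds] d(2)[OF ds] by simp
  qed
  then show ?thesis by simp
qed

lemma gl_diff:
  assumes u: "u \<in> Cr_closure r" and v: "v \<in> Cr_closure r" and i: "i \<le> r" and x: "x \<in> cube" and s: "s \<in> {0..1}"
  shows "gl [] (\<lambda>x. u x - v x) x d i s = gl [] u x d i s - gl [] v x d i s"
  unfolding gl_def using i by (intro pext_diff[OF u v _ lset_closure[OF x s]]) simp

lemma nice_diff:
  assumes u: "nice r K u" and v: "nice r K' v" and r: "r \<ge> 1"
    and b: "\<And>ds x. length ds \<le> r \<Longrightarrow> x \<in> cube \<Longrightarrow> norm (partials ds u x - partials ds v x) \<le> B"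
  shows "nice r B (\<lambda>x. u x - v x)"
  unfolding nice_def
proof (intro conjI allI impI ballI)
  note d = Cr_closure_diff[OF niceD(1)[OF u] niceD(1)[OF v]]
  show "(\<lambda>x. u x - v x) \<in> Cr_closure r" by (rule d(1))
  show "norm (partials ds (\<lambda>x. u x - v x) x) \<le> B" if "length ds \<le> r" "x \<in> cube" for ds x
    using b[OF that] d(2)[OF that] by simp
  show "gl [] (\<lambda>x. u x - v x) x d 1 0 = 0" "gl [] (\<lambda>x. u x - v x) x d 1 1 = 0" if "x \<in> cube" for x d
    using gl_diff[OF niceD(1)[OF u] niceD(1)[OF v] r that, of 0 d]
      gl_diff[OF niceD(1)[OF u] niceD(1)[OF v] r that, of 1 d]
      niceD(2,3)[OF u that, of d] niceD(2,3)[OF v that, of d] by (simp_all del: One_nat_def)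
qed

text \<open>The constraint |v|^2 = 1 is differentiated twice in each coordinate direction.\<close>

lemma inner_laplacian_unit:
  assumes v: "v \<in> Cr_closure 2" and n: "\<And>x. x \<in> cube \<Longrightarrow> norm (v x) = 1" and x: "x \<in> cube"
  shows "v x \<bullet> laplacian v x = - (\<Sum>d\<in>UNIV. (norm (partials [d] v x))\<^sup>2)"
proof -
  have const: "D = 0" if "y \<in> cube" "\<And>y. y \<in> cube \<Longrightarrow> g y = c"
    "((\<lambda>s. g (y + s *\<^sub>R axis d 1)) has_vector_derivative D) (at 0)" for g :: "real^3 \<Rightarrow> real" and y d c D
  proof -
    have "((\<lambda>s. c) has_vector_derivative D) (at 0)"
      by (rule has_vector_derivative_transform_within_open[OF that(3) open_line_cube[of y d]])
        (use that(1,2) in auto)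
    then show ?thesis using vector_derivative_unique_at[OF _ has_vector_derivative_const] by blast
  qed
  note ip = bounded_bilinear.has_vector_derivative[OF bounded_bilinear_inner]
  have 1: "v y \<bullet> partials [d] v y = 0" if y: "y \<in> cube" for y d
  proof -
    have h: "((\<lambda>s. v (y + s *\<^sub>R axis d 1)) has_vector_derivative partials [d] v y) (at 0)"
      using has_partial[OF v _ y, of "[]" d] by simp
    have "v y \<bullet> partials [d] v y + partials [d] v y \<bullet> v y = 0"
    proof (rule const[OF y, where g = "\<lambda>y. v y \<bullet> v y" and c = 1 and d = d])
      show "((\<lambda>s. v (y + s *\<^sub>R axis d 1) \<bullet> v (y + s *\<^sub>R axis d 1)) has_vector_derivative
          v y \<bullet> partials [d] v y + partials [d] v y \<bullet> v y) (at 0)"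
        using ip[OF h h] by simp
    qed (use n in \<open>simp add: norm_eq_1\<close>)
    then show ?thesis by (simp add: inner_commute)
  qed
  have "v x \<bullet> partials [d, d] v x + partials [d] v x \<bullet> partials [d] v x = 0" for d
  proof (rule const[OF x, where g = "\<lambda>y. v y \<bullet> partials [d] v y" and c = 0 and d = d])
    have h: "((\<lambda>s. v (x + s *\<^sub>R axis d 1)) has_vector_derivative partials [d] v x) (at 0)"
      using has_partial[OF v _ x, of "[]" d] by simp
    have h': "((\<lambda>s. partials [d] v (x + s *\<^sub>R axis d 1)) has_vector_derivative partials [d, d] v x) (at 0)"
      using has_partial[OF v _ x, of "[d]" d] by simp
    show "((\<lambda>s. v (x + s *\<^sub>R axis d 1) \<bullet> partials [d] v (x + s *\<^sub>R axis d 1)) has_vector_derivative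
        v x \<bullet> partials [d, d] v x + partials [d] v x \<bullet> partials [d] v x) (at 0)"
      using ip[OF h h'] by simp
  qed (rule 1)
  then have "v x \<bullet> partials [d, d] v x = - (norm (partials [d] v x))\<^sup>2" for d
    unfolding power2_norm_eq_inner by (metis eq_neg_iff_add_eq_0)
  then show ?thesis
    unfolding laplacian_def inner_sum_right by (simp only: sum_negf)
qed

text \<open>By the Lagrange identity the double cross product with a unit vector is minus the
  tangential projection, and the normal part of the Laplacian is - |grad v|^2.\<close>

lemma rhs_eq:
  assumes v: "v \<in> Cr_closure 2" and n: "\<And>x. x \<in> cube \<Longrightarrow> norm (v x) = 1" and x: "x \<in> cube"
  shows "- \<alpha> *\<^sub>R cross3 (v x) (cross3 (v x) (\<epsilon> *\<^sub>R laplacian v x + f x)) = rhs \<alpha> (\<alpha> * \<epsilon>) f v x"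
proof -
  let ?L = "laplacian v x" and ?G = "\<Sum>d\<in>UNIV. (norm (partials [d] v x))\<^sup>2"
  have 1: "v x \<bullet> v x = 1" using n[OF x] by (simp add: norm_eq_1)
  have L: "v x \<bullet> ?L = - ?G" by (rule inner_laplacian_unit[OF v _ x]) (rule n)
  have "cross3 (v x) (cross3 (v x) (\<epsilon> *\<^sub>R ?L)) = \<epsilon> *\<^sub>R cross3 (v x) (cross3 (v x) ?L)"
    by (simp add: cross_mult_right)
  also have "cross3 (v x) (cross3 (v x) ?L) = (v x \<bullet> ?L) *\<^sub>R v x - (v x \<bullet> v x) *\<^sub>R ?L"
    by (rule Lagrange)
  also have "\<dots> = - (?G *\<^sub>R v x) - ?L"
    unfolding 1 L by simp
  finally have e: "cross3 (v x) (cross3 (v x) (\<epsilon> *\<^sub>R ?L)) = \<epsilon> *\<^sub>R (- (?G *\<^sub>R v x) - ?L)" .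
  show ?thesis
    unfolding rhs_def cross_add_right e by (simp add: algebra_simps del: partials.simps)
qed

lemma Cq_time_continuous:
  assumes u: "Cq_time q r T u" and ds: "length ds \<le> r" and x: "x \<in> cube"
  shows "continuous_on {0..T} (\<lambda>t. partials ds (u t) x)"
proof (cases q)
  case 0
  show ?thesis unfolding continuous_on_def
  proof
    fix t assume t: "t \<in> {0..T}"
    have l: "((\<lambda>s. Cr_norm r (\<lambda>x. u s x - u t x)) \<longlongrightarrow> 0) (at t within {0..T})"
      using u t unfolding 0 by simp
    have "((\<lambda>s. partials ds (u s) x - partials ds (u t) x) \<longlongrightarrow> 0) (at t within {0..T})"
    proof (rule Lim_null_comparison[OF _ l])
      show "\<forall>\<^sub>F s in at t within {0..T}. norm (partials ds (u s) x - partials ds (u t) x) \<le> Cr_norm r (\<lambda>x. u s x - u t x)"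
        unfolding eventually_at_filter
      proof (intro always_eventually allI impI)
        fix s assume s: "s \<in> {0..T}"
        note d = Cr_closure_diff[OF Cq_time_closure[OF u s] Cq_time_closure[OF u t]]
        show "norm (partials ds (u s) x - partials ds (u t) x) \<le> Cr_norm r (\<lambda>x. u s x - u t x)"
          using norm_partials_le[OF d(1) ds x] d(2)[OF ds x] by simp
      qed
    qed
    then show "((\<lambda>s. partials ds (u s) x) \<longlongrightarrow> partials ds (u t) x) (at t within {0..T})"
      by (rule LIM_zero_cancel)
  qed
next
  case (Suc q')
  obtain u' where "\<And>t. t \<in> {0..T} \<Longrightarrow>
      ((\<lambda>s. partials ds (u s) x) has_vector_derivative partials ds (u' t) x) (at t within {0..T})"
    using Cq_time_Suc_derivative[of q' r T u thesis] u ds x unfolding Suc by blast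
  then show ?thesis
    unfolding continuous_on_eq_continuous_within by (blast intro: has_vector_derivative_continuous)
qed

text \<open>By the induction hypothesis the time derivative is Lipschitz in time, hence bounded, and
  the mean value inequality applies to u. At the base of the induction the derivative is bounded by
  compactness.\<close>

lemma Cq_time_increment:
  assumes u: "Cq_time (Suc q) r T u"
  obtains K where "K \<ge> 0"
    "\<And>s t (ds :: 3 list) x. s \<in> {0..T} \<Longrightarrow> t \<in> {0..T} \<Longrightarrow> length ds \<le> r \<Longrightarrow> x \<in> cube \<Longrightarrow>
      norm (partials ds (u t) x - partials ds (u s) x) \<le> K * \<bar>t - s\<bar>"
  using u
proof (induction q arbitrary: u thesis)
  have *: "norm (partials ds (u t) x - partials ds (u s) x) \<le> K * \<bar>t - s\<bar>"
    if u: "Cq_time (Suc q) r T u" and st: "s \<in> {0..T}" "t \<in> {0..T}" and ds: "length ds \<le> r" and x: "x \<in> cube"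
      and d: "\<And>t (ds :: 3 list) x. t \<in> {0..T} \<Longrightarrow> length ds \<le> r \<Longrightarrow> x \<in> cube \<Longrightarrow>
        ((\<lambda>s. partials ds (u s) x) has_vector_derivative partials ds (u' t) x) (at t within {0..T})"
      and b: "\<And>t (ds :: 3 list) x. t \<in> {0..T} \<Longrightarrow> length ds \<le> r \<Longrightarrow> x \<in> cube \<Longrightarrow> norm (partials ds (u' t) x) \<le> K"
    for u u' :: "real \<Rightarrow> real^3 \<Rightarrow> real^3" and q s t ds x K
  proof (rule norm_increment_le)
    show "continuous_on {min s t..max s t} (\<lambda>t. partials ds (u t) x)"
      using st by (intro continuous_on_subset[OF Cq_time_continuous[OF u ds x]]) auto
    fix y assume y: "min s t < y" "y < max s t"
    then have y': "y \<in> {0..T}" "at y within {0..T} = at y"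
      using st by (auto intro!: at_within_interior)
    show "((\<lambda>t. partials ds (u t) x) has_vector_derivative partials ds (u' y) x) (at y)"
      using d[OF y'(1) ds x] unfolding y'(2) .
    show "norm (partials ds (u' y) x) \<le> K" by (rule b[OF y'(1) ds x])
  qed
  {
    case 0
    obtain u' where u': "Cq_time 0 r T u'"
      "\<And>t (ds :: 3 list) x. t \<in> {0..T} \<Longrightarrow> length ds \<le> r \<Longrightarrow> x \<in> cube \<Longrightarrow>
        ((\<lambda>s. partials ds (u s) x) has_vector_derivative partials ds (u' t) x) (at t within {0..T})"
      using Cq_time_Suc_derivative[OF 0(2)] by blast
    obtain K where K: "K \<ge> 0"
      "\<And>t (ds :: 3 list) x. t \<in> {0..T} \<Longrightarrow> length ds \<le> r \<Longrightarrow> x \<in> cube \<Longrightarrow> norm (partials ds (u' t) x) \<le> K"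
      using Cq_time_0_bounded[OF u'(1)] by blast
    show ?case by (rule 0(1)[OF K(1)]) (rule *[OF 0(2) _ _ _ _ u'(2) K(2)])
  next
    case (Suc q)
    obtain u' where u': "Cq_time (Suc q) r T u'"
      "\<And>t (ds :: 3 list) x. t \<in> {0..T} \<Longrightarrow> length ds \<le> r \<Longrightarrow> x \<in> cube \<Longrightarrow>
        ((\<lambda>s. partials ds (u s) x) has_vector_derivative partials ds (u' t) x) (at t within {0..T})"
      using Cq_time_Suc_derivative[OF Suc.prems(2)] by blast
    obtain K where K: "K \<ge> 0"
      "\<And>s t (ds :: 3 list) x. s \<in> {0..T} \<Longrightarrow> t \<in> {0..T} \<Longrightarrow> length ds \<le> r \<Longrightarrow> x \<in> cube \<Longrightarrow>
        norm (partials ds (u' t) x - partials ds (u' s) x) \<le> K * \<bar>t - s\<bar>"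
      using Suc.IH[OF _ u'(1)] by blast
    have b: "norm (partials ds (u' t) x) \<le> \<bar>Cr_norm r (u' 0)\<bar> + K * \<bar>T\<bar>"
      if t: "t \<in> {0..T}" and ds: "length ds \<le> r" and x: "x \<in> cube" for t ds x
    proof -
      have 0: "0 \<in> {0..T}" using t by auto
      have "K * \<bar>t - 0\<bar> \<le> K * \<bar>T\<bar>" using t K(1) by (intro mult_left_mono) auto
      then show ?thesis
        using norm_partials_le[OF Cq_time_closure[OF u'(1) 0] ds x] K(2)[OF 0 t ds x]
          norm_triangle_sub[of "partials ds (u' t) x" "partials ds (u' 0) x"] by linarith
    qed
    show ?case
      by (rule Suc.prems(1)[of "\<bar>Cr_norm r (u' 0)\<bar> + K * \<bar>T\<bar>"])
        (use K(1) in simp, rule *[OF Suc.prems(2) _ _ _ _ u'(2) b])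
  }
qed

lemma Cq_time_bounded:
  assumes u: "Cq_time q r T u"
  obtains K where "K \<ge> 0"
    "\<And>t (ds :: 3 list) x. t \<in> {0..T} \<Longrightarrow> length ds \<le> r \<Longrightarrow> x \<in> cube \<Longrightarrow> norm (partials ds (u t) x) \<le> K"
proof (cases q)
  case 0
  then show thesis using Cq_time_0_bounded[of r T u thesis] u that by blast
next
  case (Suc q')
  obtain K where K: "K \<ge> 0"
    "\<And>s t (ds :: 3 list) x. s \<in> {0..T} \<Longrightarrow> t \<in> {0..T} \<Longrightarrow> length ds \<le> r \<Longrightarrow> x \<in> cube \<Longrightarrow>
      norm (partials ds (u t) x - partials ds (u s) x) \<le> K * \<bar>t - s\<bar>"
    using Cq_time_increment[of q' r T u thesis] u unfolding Suc by blast
  show thesis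
  proof (rule that[of "\<bar>Cr_norm r (u 0)\<bar> + K * \<bar>T\<bar>"])
    fix t ds x assume t: "t \<in> {0..T}" and ds: "length (ds :: 3 list) \<le> r" and x: "x \<in> cube"
    have 0: "0 \<in> {0..T}" using t by auto
    have "K * \<bar>t - 0\<bar> \<le> K * \<bar>T\<bar>" using t K(1) by (intro mult_left_mono) auto
    then show "norm (partials ds (u t) x) \<le> \<bar>Cr_norm r (u 0)\<bar> + K * \<bar>T\<bar>"
      using norm_partials_le[OF Cq_time_closure[OF u 0] ds x] K(2)[OF 0 t ds x]
        norm_triangle_sub[of "partials ds (u t) x" "partials ds (u 0) x"] by linarith
  qed (use K in simp)
qed

section \<open>Passing from almost every time to all times\<close>

lemma dense_le:
  fixes c :: "real \<Rightarrow> real"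
  assumes c: "continuous_on {0..T} c" and D: "{0..T} \<subseteq> closure D" "D \<subseteq> {0..T}"
    and le: "\<And>t. t \<in> D \<Longrightarrow> c t \<le> B" and t: "t \<in> {0..T}"
  shows "c t \<le> B"
proof -
  have "closed {t \<in> {0..T}. c t \<le> B}"
    by (intro continuous_on_closed_Collect_le c) auto
  then have "closure D \<subseteq> {t \<in> {0..T}. c t \<le> B}"
    using D(2) le by (intro closure_minimal) auto
  then show ?thesis using D(1) t by blast
qed

text \<open>An interval without good times would have positive length and measure 0. Time 0 is left
  out since the equation and the boundary condition are assumed for positive times only.\<close>

lemma AE_dense:
  assumes T: "T > 0" and ae: "AE t in lebesgue_on {0..T::real}. P t"
  shows "{0..T} \<subseteq> closure {t \<in> {0<..T}. P t}"
proof
  fix t assume t: "t \<in> {0..T}"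
  show "t \<in> closure {t \<in> {0<..T}. P t}"
    unfolding closure_approachable
  proof (intro allI impI)
    fix e :: real assume e: "e > 0"
    define a where "a = max 0 (t - e)"
    define b where "b = min T (t + e)"
    have ab: "a < b" "0 \<le> a" "b \<le> T" using t T e by (auto simp: a_def b_def)
    have "\<exists>s\<in>{a<..<b}. P s"
    proof (rule ccontr)
      assume no: "\<not> (\<exists>s\<in>{a<..<b}. P s)"
      have "AE s in lebesgue. s \<in> {0..T} \<longrightarrow> P s"
        using ae by (subst (asm) AE_restrict_space_iff) auto
      then have "AE s in lebesgue. s \<notin> {a<..<b}"
        by eventually_elim (use no ab in auto)
      then have "emeasure lebesgue {a<..<b} = 0"
        by (subst (asm) AE_iff_measurable[where N = "{a<..<b}"]) auto
      then show False using ab by simp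
    qed
    then obtain s where "s \<in> {a<..<b}" "P s" by blast
    then show "\<exists>s\<in>{t \<in> {0<..T}. P t}. dist s t < e"
      using ab by (intro bexI[of _ s]) (auto simp: a_def b_def dist_real_def)
  qed
qed

text \<open>On a fixed lattice each of these quantities is a finite expression in point values, so
  continuity in time at every grid point suffices.\<close>

lemma continuous_on_tau:
  fixes k \<alpha> \<beta> :: real and S :: "real set"
  assumes N: "N \<ge> 1" and k: "k > 0" and ab: "\<alpha> > 0" "\<beta> > 0"
    and v: "\<And>q. continuous_on S (\<lambda>t. vl N (v t) q)" and u: "\<And>q. continuous_on S (\<lambda>t. vl N (u t) q)"
  shows "continuous_on S (\<lambda>t. lattice.Dp (tsh N) (mesh N) c (lattice.Sd (tsh N) (tsb N) (mesh N) d (vl N (v t))) q)"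
    and "continuous_on S (\<lambda>t. tau N \<alpha> \<beta> f (v t) (u t) q)"
    and "continuous_on S (\<lambda>t. lattice.ip (torus N) (mesh N) (tau N \<alpha> \<beta> f (v t) (u t)) e)"
proof -
  interpret lattice "torus N" "tsh N" "tsb N" "mesh N" k \<alpha> \<beta> f for f
    by (rule torus_lattice) (use N k ab in auto)
  have h: "mesh N > 0" using N by (simp add: mesh_def)
  have D: "continuous_on S (\<lambda>t. Dp d (w t) q)" if "\<And>q. continuous_on S (\<lambda>t. w t q)" for w :: "real \<Rightarrow> tpoint \<Rightarrow> real^3" and d q
    unfolding Dp_def by (intro continuous_intros that)
  have Sd: "continuous_on S (\<lambda>t. Sd d (vl N (v t)) q)" for d q
    unfolding Sd_def by (intro continuous_intros v)
  have Ac: "continuous_on S (\<lambda>t. Ac d (vl N (v t)) q)" for d q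
    unfolding Ac_def by (intro continuous_intros v)
  show "continuous_on S (\<lambda>t. Dp c (Sd d (vl N (v t))) q)" by (intro D Sd)
  have t: "continuous_on S (\<lambda>t. tau N \<alpha> \<beta> f (v t) (u t) q)" for q
    unfolding tau_def[OF N k ab] NL_def by (intro continuous_intros Sd Ac v u continuous_on_cross)
  then show "continuous_on S (\<lambda>t. tau N \<alpha> \<beta> f (v t) (u t) q)" .
  show "continuous_on S (\<lambda>t. ip (tau N \<alpha> \<beta> f (v t) (u t)) e)"
    unfolding ip_def by (intro continuous_intros t)
qed

definition lattice_C2 :: "nat \<Rightarrow> real \<Rightarrow> (tpoint \<Rightarrow> real^3) \<Rightarrow> bool"
  where "lattice_C2 N K w \<longleftrightarrow> (\<forall>q d. norm (w q) \<le> K \<and>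
    norm (lattice.Dp (tsh N) (mesh N) d w q) \<le> K \<and> norm (lattice.Sd (tsh N) (tsb N) (mesh N) d w q) \<le> K)"

lemma nice_lattice_C2:
  assumes N: "N \<ge> 1" and v: "nice 2 K v"
  shows "lattice_C2 N (3 * K) (vl N v)"
proof -
  have K: "K \<ge> 0" using v by (rule nice_K[OF N])
  have "norm (vl N v q) \<le> K" for q
    using v grid_point_cube[OF N, of "snd q"] K unfolding vl_def[OF N] lift_def nice_def
    by (auto dest: spec[of _ "[]"])
  moreover have "norm (lattice.Dp (tsh N) (mesh N) d (vl N v) q) \<le> K" for d q
    by (rule norm_Dp_vl_le[OF N v]) simp
  moreover have "norm (lattice.Sd (tsh N) (tsb N) (mesh N) d (vl N v) q) \<le> 3 * K" for d q
    by (rule norm_Sd_vl_le[where k = 1 and \<alpha> = 1 and \<beta> = 1, OF N _ _ _ v]) simp_all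
  ultimately show ?thesis unfolding lattice_C2_def using K by (smt (verit))
qed

lemma vl_diff: "N \<ge> 1 \<Longrightarrow> vl N (\<lambda>x. u x - v x) = (\<lambda>q. vl N u q - vl N v q)"
  by (simp add: vl_def lift_diff)

section \<open>Uniform lattice bounds for the exact solution\<close>

locale exact =
  fixes \<alpha> \<epsilon> T :: real and f :: "real^3 \<Rightarrow> real^3" and \<Phi> :: "real \<Rightarrow> real^3 \<Rightarrow> real^3"
  assumes ae: "\<alpha> > 0" "\<epsilon> > 0" and T: "T > 0" and f_bounded: "bounded (f ` cube)"
    and sol: "exact_solution \<alpha> \<epsilon> f T \<Phi>"
    and C3: "Cq_time 3 0 T \<Phi>" and C22: "Cq_time 2 2 T \<Phi>" and L4: "Linf_time 4 T \<Phi>"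
begin

lemma Phi_C2: "t \<in> {0..T} \<Longrightarrow> \<Phi> t \<in> Cr_closure 2"
  by (rule Cq_time_closure[OF C22])

lemma norm_Phi: "t \<in> {0..T} \<Longrightarrow> x \<in> cube \<Longrightarrow> norm (\<Phi> t x) = 1"
  using sol cube_subset_closure unfolding exact_solution_def by blast

lemma time_increments:
  obtains K where "K \<ge> 0"
    "\<And>ds x t. length ds \<le> 2 \<Longrightarrow> x \<in> cube \<Longrightarrow> t \<in> {0..T} \<Longrightarrow> norm (partials ds (\<Phi> t) x) \<le> K"
    "\<And>ds x s t. length ds \<le> 2 \<Longrightarrow> x \<in> cube \<Longrightarrow> s \<in> {0..T} \<Longrightarrow> t \<in> {0..T} \<Longrightarrow>
      norm (partials ds (\<Phi> t) x - partials ds (\<Phi> s) x) \<le> K * \<bar>t - s\<bar>"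
    "\<And>ds x t k. length ds \<le> 2 \<Longrightarrow> x \<in> cube \<Longrightarrow> t - k \<in> {0..T} \<Longrightarrow> t \<in> {0..T} \<Longrightarrow> t + k \<in> {0..T} \<Longrightarrow>
      norm ((partials ds (\<Phi> (t + k)) x - partials ds (\<Phi> t) x) - (partials ds (\<Phi> t) x - partials ds (\<Phi> (t - k)) x)) \<le> K * k\<^sup>2"
proof -
  have C22': "Cq_time (Suc 1) 2 T \<Phi>" using C22 by (simp only: numeral_2_eq_2 One_nat_def)
  obtain V where V: "Cq_time (Suc 0) 2 T V"
    "\<And>t (ds :: 3 list) x. t \<in> {0..T} \<Longrightarrow> length ds \<le> 2 \<Longrightarrow> x \<in> cube \<Longrightarrow>
      ((\<lambda>s. partials ds (\<Phi> s) x) has_vector_derivative partials ds (V t) x) (at t within {0..T})"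
    using Cq_time_Suc_derivative[OF C22', unfolded One_nat_def] by blast
  obtain W where W: "Cq_time 0 2 T W"
    "\<And>t (ds :: 3 list) x. t \<in> {0..T} \<Longrightarrow> length ds \<le> 2 \<Longrightarrow> x \<in> cube \<Longrightarrow>
      ((\<lambda>s. partials ds (V s) x) has_vector_derivative partials ds (W t) x) (at t within {0..T})"
    using Cq_time_Suc_derivative[OF V(1)] by blast
  obtain K where K: "K \<ge> 0"
    "\<And>t (ds :: 3 list) x. t \<in> {0..T} \<Longrightarrow> length ds \<le> 2 \<Longrightarrow> x \<in> cube \<Longrightarrow> norm (partials ds (W t) x) \<le> K"
    using Cq_time_0_bounded[OF W(1)] by blast
  have interior: "at t within {0..T} = at t" if "0 < t" "t < T" for t
    using that by (intro at_within_interior) simp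
  define g where "g ds x i t = (if i = 0 then partials ds (\<Phi> t) x else if i = 1 then partials ds (V t) x else partials ds (W t) x)"
    for ds x and i :: nat and t
  have gc: "continuous_on {0..T} (g ds x i)" if "length ds \<le> 2" "x \<in> cube" for ds x i
    using Cq_time_continuous[OF C22 that] Cq_time_continuous[OF V(1) that] Cq_time_continuous[OF W(1) that]
    unfolding g_def by (cases "i = 0"; cases "i = 1") simp_all
  have gd: "(g ds x i has_vector_derivative g ds x (Suc i) t) (at t)"
    if "length ds \<le> 2" "x \<in> cube" "i < 2" "0 < t" "t < T" for ds x i t
    using V(2)[of t ds x] W(2)[of t ds x] that interior[of t] unfolding g_def
    by (cases "i = 0") (auto simp: less_2_cases_iff)
  have t2: "norm (g ds x 0 s - (g ds x 0 t + (s - t) *\<^sub>R g ds x (Suc 0) t)) \<le> K * \<bar>s - t\<bar>\<^sup>2"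
    if "length ds \<le> 2" "x \<in> cube" "s \<in> {0..T}" "t \<in> {0..T}" for ds x s t
    by (rule taylor2[where g = "g ds x"])
      (use that gc[OF that(1,2)] gd[OF that(1,2)] K(2)[OF _ that(1,2)] in \<open>auto simp: g_def\<close>)
  obtain K0 where K0: "K0 \<ge> 0"
    "\<And>t (ds :: 3 list) x. t \<in> {0..T} \<Longrightarrow> length ds \<le> 2 \<Longrightarrow> x \<in> cube \<Longrightarrow> norm (partials ds (\<Phi> t) x) \<le> K0"
    using Cq_time_bounded[OF C22] by blast
  obtain K1 where K1: "K1 \<ge> 0"
    "\<And>s t (ds :: 3 list) x. s \<in> {0..T} \<Longrightarrow> t \<in> {0..T} \<Longrightarrow> length ds \<le> 2 \<Longrightarrow> x \<in> cube \<Longrightarrow>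
      norm (partials ds (\<Phi> t) x - partials ds (\<Phi> s) x) \<le> K1 * \<bar>t - s\<bar>"
    using Cq_time_increment[OF C22'] by blast
  \<comment> \<open>2 K accounts for the two Taylor remainders, one on each side of t, in the second
    time difference.\<close>
  let ?K = "K0 + K1 + 2 * K"
  show thesis
  proof (rule that[of ?K])
    show "0 \<le> ?K" using K K0 K1 by simp
    show "norm (partials ds (\<Phi> t) x) \<le> ?K" if "length ds \<le> 2" "x \<in> cube" "t \<in> {0..T}" for ds x t
      using K0(2)[OF that(3,1,2)] K K1 by simp
    show "norm (partials ds (\<Phi> t) x - partials ds (\<Phi> s) x) \<le> ?K * \<bar>t - s\<bar>"
      if "length ds \<le> 2" "x \<in> cube" "s \<in> {0..T}" "t \<in> {0..T}" for ds x s t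
      by (rule order.trans[OF K1(2)[OF that(3,4,1,2)]]) (use K K0 in \<open>simp add: mult_right_mono\<close>)
    show "norm ((partials ds (\<Phi> (t + k)) x - partials ds (\<Phi> t) x) - (partials ds (\<Phi> t) x - partials ds (\<Phi> (t - k)) x)) \<le> ?K * k\<^sup>2"
      if "length ds \<le> 2" "x \<in> cube" "t - k \<in> {0..T}" "t \<in> {0..T}" "t + k \<in> {0..T}" for ds x t k
    proof -
      have g: "partials ds (\<Phi> s) x = g ds x 0 s" for s by (simp add: g_def)
      let ?a = "g ds x 0 (t + k) - (g ds x 0 t + k *\<^sub>R g ds x (Suc 0) t)"
        and ?b = "g ds x 0 (t - k) - (g ds x 0 t + (- k) *\<^sub>R g ds x (Suc 0) t)"
      have "norm ?a \<le> K * k\<^sup>2" "norm ?b \<le> K * k\<^sup>2"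
        using t2[OF that(1,2) that(5,4)] t2[OF that(1,2) that(3,4)] by simp_all
      then have "norm (?a + ?b) \<le> K * k\<^sup>2 + K * k\<^sup>2" by (rule norm_triangle_mono)
      also have "\<dots> \<le> ?K * k\<^sup>2" using K0 K1 by (simp add: algebra_simps)
      also have "?a + ?b = (g ds x 0 (t + k) - g ds x 0 t) - (g ds x 0 t - g ds x 0 (t - k))" by simp
      finally show ?thesis unfolding g .
    qed
  qed
qed

text \<open>The boundary condition is given only for t > 0; it extends to t = 0 because first
  spatial derivatives are Lipschitz in time uniformly up to the boundary.\<close>

lemma nice_Phi:
  obtains K where "K \<ge> 0" "\<And>t. t \<in> {0..T} \<Longrightarrow> nice 2 K (\<Phi> t)"
    "\<And>s t. s \<in> {0..T} \<Longrightarrow> t \<in> {0..T} \<Longrightarrow> nice 2 (K * \<bar>t - s\<bar>) (\<lambda>x. \<Phi> t x - \<Phi> s x)"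
    "\<And>t k. t - k \<in> {0..T} \<Longrightarrow> t \<in> {0..T} \<Longrightarrow> t + k \<in> {0..T} \<Longrightarrow>
      nice 2 (K * k\<^sup>2) (\<lambda>x. (\<Phi> (t + k) x - \<Phi> t x) - (\<Phi> t x - \<Phi> (t - k) x))"
proof -
  obtain K where K: "K \<ge> 0"
    "\<And>ds x t. length ds \<le> 2 \<Longrightarrow> x \<in> cube \<Longrightarrow> t \<in> {0..T} \<Longrightarrow> norm (partials ds (\<Phi> t) x) \<le> K"
    "\<And>ds x s t. length ds \<le> 2 \<Longrightarrow> x \<in> cube \<Longrightarrow> s \<in> {0..T} \<Longrightarrow> t \<in> {0..T} \<Longrightarrow>
      norm (partials ds (\<Phi> t) x - partials ds (\<Phi> s) x) \<le> K * \<bar>t - s\<bar>"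
    "\<And>ds x t k. length ds \<le> 2 \<Longrightarrow> x \<in> cube \<Longrightarrow> t - k \<in> {0..T} \<Longrightarrow> t \<in> {0..T} \<Longrightarrow> t + k \<in> {0..T} \<Longrightarrow>
      norm ((partials ds (\<Phi> (t + k)) x - partials ds (\<Phi> t) x) - (partials ds (\<Phi> t) x - partials ds (\<Phi> (t - k)) x)) \<le> K * k\<^sup>2"
    by (rule time_increments, rule that)
  have pos: "nice 2 K (\<Phi> t)" if t: "t \<in> {0<..T}" for t
    using t sol K(2) by (intro niceI Phi_C2) (auto simp: exact_solution_def)
  have zero: "gl [] (\<Phi> 0) x d 1 y = 0" if x: "x \<in> cube" and y: "y = 0 \<or> y = 1" for x d y
  proof -
    have y': "y \<in> {0..1}" using y by auto
    have "norm (gl [] (\<Phi> 0) x d 1 y) \<le> e" if e: "e > 0" for e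
    proof -
      define s where "s = min T (e / (K + 1))"
      have s: "s \<in> {0<..T}" "K * s \<le> e"
      proof -
        show "s \<in> {0<..T}" using T e K by (simp add: s_def)
        have "K * s \<le> (K + 1) * (e / (K + 1))" using K e T by (intro mult_mono) (auto simp: s_def)
        then show "K * s \<le> e" using K by simp
      qed
      have m: "s \<in> {0..T}" "0 \<in> {0..T}" using s(1) T by auto
      note d' = Cr_closure_diff[OF Phi_C2[OF m(1)] Phi_C2[OF m(2)]]
      have "norm (pext [d] (\<lambda>x. \<Phi> s x - \<Phi> 0 x) (lset x d y)) \<le> K * s"
      proof (rule continuous_on_closure_norm_le[OF _ _ lset_closure[OF x y']])
        show "continuous_on (closure cube) (pext [d] (\<lambda>x. \<Phi> s x - \<Phi> 0 x))" by (rule pext[OF d'(1)]) simp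
        show "\<forall>z\<in>cube. norm (pext [d] (\<lambda>x. \<Phi> s x - \<Phi> 0 x) z) \<le> K * s"
          using pext(2)[OF d'(1), of "[d]"] d'(2)[of "[d]"] K(3)[of "[d]" _ 0 s] m s(1) by simp
      qed
      then have "norm (gl [] (\<lambda>x. \<Phi> s x - \<Phi> 0 x) x d 1 y) \<le> K * s" by (simp add: gl_def)
      moreover have "gl [] (\<Phi> s) x d 1 y = 0" using niceD(2,3)[OF pos[OF s(1)] x] y by blast
      ultimately show ?thesis
        using gl_diff[OF Phi_C2[OF m(1)] Phi_C2[OF m(2)] _ x y', of 1 d] s(2) by (simp del: One_nat_def)
    qed
    then show ?thesis by (metis field_le_epsilon add_0 norm_le_zero_iff)
  qed
  have nice: "nice 2 K (\<Phi> t)" if t: "t \<in> {0..T}" for t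
  proof (cases "t = 0")
    case True
    then show ?thesis using zero K(2) t Phi_C2[OF t] unfolding nice_def by simp
  qed (use pos t in auto)
  show thesis
  proof (rule that[OF K(1) nice])
    show d: "nice 2 (K * \<bar>t - s\<bar>) (\<lambda>x. \<Phi> t x - \<Phi> s x)" if "s \<in> {0..T}" "t \<in> {0..T}" for s t
      by (rule nice_diff[OF nice[OF that(2)] nice[OF that(1)]]) (use K(3) that in auto)
    show "nice 2 (K * k\<^sup>2) (\<lambda>x. (\<Phi> (t + k) x - \<Phi> t x) - (\<Phi> t x - \<Phi> (t - k) x))"
      if "t - k \<in> {0..T}" "t \<in> {0..T}" "t + k \<in> {0..T}" for t k
      by (rule nice_diff[OF d[OF that(2,3)] d[OF that(1,2)]])
        (use K(4) that Cr_closure_diff(2)[OF Phi_C2 Phi_C2] in auto)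
  qed
qed

definition Phi' :: "real \<Rightarrow> real^3 \<Rightarrow> real^3"
  where "Phi' t x = vector_derivative (\<lambda>s. \<Phi> s x) (at t within {0..T})"

text \<open>The last claim is the error of the trapezoidal rule. The Taylor expansion of the
  derivative, multiplied by (t - s)/2, is subtracted from that of \<Phi>; the second derivatives
  cancel and both remainders are of third order.\<close>

lemma Phi':
  shows "\<And>x. x \<in> cube \<Longrightarrow> continuous_on {0..T} (\<lambda>t. Phi' t x)"
    and "\<And>t x. t \<in> {0<..T} \<Longrightarrow> x \<in> cube \<Longrightarrow> Phi' t x = rhs \<alpha> (\<alpha> * \<epsilon>) f (\<Phi> t) x"
    and "\<exists>K\<ge>0. \<forall>x\<in>cube. \<forall>s\<in>{0..T}. \<forall>t\<in>{s..T}.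
      norm (\<Phi> t x - \<Phi> s x - ((t - s) / 2) *\<^sub>R (Phi' s x + Phi' t x)) \<le> K * (t - s) ^ 3"
proof -
  have C3': "Cq_time (Suc (Suc (Suc 0))) 0 T \<Phi>" using C3 by (simp only: numeral_3_eq_3)
  obtain U where U: "Cq_time (Suc (Suc 0)) 0 T U" "\<And>t (ds :: 3 list) x. t \<in> {0..T} \<Longrightarrow> length ds \<le> 0 \<Longrightarrow> x \<in> cube \<Longrightarrow>
      ((\<lambda>s. partials ds (\<Phi> s) x) has_vector_derivative partials ds (U t) x) (at t within {0..T})"
    using Cq_time_Suc_derivative[OF C3'] by blast
  obtain V where V: "Cq_time (Suc 0) 0 T V" "\<And>t (ds :: 3 list) x. t \<in> {0..T} \<Longrightarrow> length ds \<le> 0 \<Longrightarrow> x \<in> cube \<Longrightarrow>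
      ((\<lambda>s. partials ds (U s) x) has_vector_derivative partials ds (V t) x) (at t within {0..T})"
    using Cq_time_Suc_derivative[OF U(1)] by blast
  obtain W where W: "Cq_time 0 0 T W" "\<And>t (ds :: 3 list) x. t \<in> {0..T} \<Longrightarrow> length ds \<le> 0 \<Longrightarrow> x \<in> cube \<Longrightarrow>
      ((\<lambda>s. partials ds (V s) x) has_vector_derivative partials ds (W t) x) (at t within {0..T})"
    using Cq_time_Suc_derivative[OF V(1)] by blast
  obtain K where K: "K \<ge> 0" "\<And>t (ds :: 3 list) x. t \<in> {0..T} \<Longrightarrow> length ds \<le> 0 \<Longrightarrow> x \<in> cube \<Longrightarrow> norm (partials ds (W t) x) \<le> K"
    using Cq_time_bounded[OF W(1)] by blast
  note der = U(2)[where ds = "[]", simplified] V(2)[where ds = "[]", simplified] W(2)[where ds = "[]", simplified]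
  note con = Cq_time_continuous[OF C3', where ds = "[]", simplified] Cq_time_continuous[OF U(1), where ds = "[]", simplified]
    Cq_time_continuous[OF V(1), where ds = "[]", simplified] Cq_time_continuous[OF W(1), where ds = "[]", simplified]
  have eq: "Phi' t x = U t x" if "t \<in> {0..T}" "x \<in> cube" for t x
    unfolding Phi'_def using T that by (intro vector_derivative_within_closed_interval[of 0 T] der) auto
  show "continuous_on {0..T} (\<lambda>t. Phi' t x)" if x: "x \<in> cube" for x
    by (rule continuous_on_eq[OF con(2)[OF x]]) (simp add: eq x)
  show "Phi' t x = rhs \<alpha> (\<alpha> * \<epsilon>) f (\<Phi> t) x" if t: "t \<in> {0<..T}" and x: "x \<in> cube" for t x
  proof -
    have t': "t \<in> {0..T}" using t by auto
    have "Phi' t x = - \<alpha> *\<^sub>R cross3 (\<Phi> t x) (cross3 (\<Phi> t x) (\<epsilon> *\<^sub>R laplacian (\<Phi> t) x + f x))"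
      unfolding Phi'_def using T t' sol t x
      by (intro vector_derivative_within_closed_interval[of 0 T]) (auto simp: exact_solution_def)
    also have "\<dots> = rhs \<alpha> (\<alpha> * \<epsilon>) f (\<Phi> t) x"
      by (rule rhs_eq[OF Phi_C2[OF t'] _ x]) (rule norm_Phi[OF t'])
    finally show ?thesis .
  qed
  have trap: "norm (\<Phi> t x - \<Phi> s x - ((t - s) / 2) *\<^sub>R (Phi' s x + Phi' t x)) \<le> (2 * K) * (t - s) ^ 3"
    if x: "x \<in> cube" and s: "s \<in> {0..T}" and t: "t \<in> {s..T}" for x s t
  proof -
    have t': "t \<in> {0..T}" using s t by auto
    define g where "g i t = (if i = 0 then \<Phi> t x else if i = 1 then U t x else if i = 2 then V t x else W t x)" for i :: nat and t
    have gc: "continuous_on {0..T} (g i)" for i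
      unfolding g_def using con[OF x] by (cases "i = 0"; cases "i = 1"; cases "i = 2") simp_all
    have gd: "(g i has_vector_derivative g (Suc i) t) (at t)" if "i < 3" "0 < t" "t < T" for i t
    proof -
      have "at t within {0..T} = at t" using that by (intro at_within_interior) simp
      moreover have "i = 0 \<or> i = 1 \<or> i = 2" using that by auto
      ultimately show ?thesis using der[of t x] x that unfolding g_def by auto
    qed
    have gb: "norm (g 3 t) \<le> K" if "t \<in> {0..T}" for t
      using K(2)[OF that _ x, of "[]"] by (simp add: g_def)
    let ?A = "g 0 t - (g 0 s + (t - s) *\<^sub>R g (Suc 0) s + ((t - s)\<^sup>2 / 2) *\<^sub>R g (Suc (Suc 0)) s)"
    let ?B = "g 1 t - (g 1 s + (t - s) *\<^sub>R g (Suc 1) s)"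
    have A: "norm ?A \<le> K * \<bar>t - s\<bar> ^ 3"
      by (rule taylor3[where g = g]) (use gc gd gb s t' in \<open>auto simp: numeral_3_eq_3\<close>)
    have B: "norm ?B \<le> K * \<bar>t - s\<bar>\<^sup>2"
      by (rule taylor2[where g = g]) (use gc gd gb s t' in \<open>auto simp: numeral_3_eq_3\<close>)
    have "\<Phi> t x - \<Phi> s x - ((t - s) / 2) *\<^sub>R (Phi' s x + Phi' t x) = ?A - ((t - s) / 2) *\<^sub>R ?B"
    proof -
      have "((t - s)\<^sup>2 / 2) *\<^sub>R V s x = ((t - s) / 2) *\<^sub>R (t - s) *\<^sub>R V s x" by (simp add: power2_eq_square)
      then show ?thesis
        unfolding eq[OF s x] eq[OF t' x] g_def
        by (simp add: scaleR_add_right scaleR_diff_right del: scaleR_scaleR) (simp add: vec_eq_iff)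
    qed
    also have "norm \<dots> \<le> K * \<bar>t - s\<bar> ^ 3 + ((t - s) / 2) * (K * \<bar>t - s\<bar>\<^sup>2)"
      by (rule order.trans[OF norm_triangle_ineq4]) (use A B t in \<open>auto intro!: add_mono mult_left_mono\<close>)
    also have "\<dots> \<le> (2 * K) * (t - s) ^ 3"
      using t K by (simp add: power2_eq_square power3_eq_cube)
    finally show ?thesis .
  qed
  then show "\<exists>K\<ge>0. \<forall>x\<in>cube. \<forall>s\<in>{0..T}. \<forall>t\<in>{s..T}.
      norm (\<Phi> t x - \<Phi> s x - ((t - s) / 2) *\<^sub>R (Phi' s x + Phi' t x)) \<le> K * (t - s) ^ 3"
    using K(1) by (intro exI[of _ "2 * K"]) simp
qed

lemma nice_dense:
  obtains K where "K \<ge> 0" "{0..T} \<subseteq> closure {t \<in> {0<..T}. nice 4 K (\<Phi> t)}"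
proof -
  obtain K where K: "AE t in lebesgue_on {0..T}. Cr_norm 4 (\<Phi> t) \<le> K"
    "AE t in lebesgue_on {0..T}. \<Phi> t \<in> Cr_closure 4"
    using L4 unfolding Linf_time_def by blast
  then have "AE t in lebesgue_on {0..T}. \<Phi> t \<in> Cr_closure 4 \<and> Cr_norm 4 (\<Phi> t) \<le> K"
    by eventually_elim simp
  from AE_dense[OF T this]
  have d: "{0..T} \<subseteq> closure {t \<in> {0<..T}. \<Phi> t \<in> Cr_closure 4 \<and> Cr_norm 4 (\<Phi> t) \<le> K}" .
  have "nice 4 (max K 0) (\<Phi> t)" if t: "t \<in> {0<..T}" "\<Phi> t \<in> Cr_closure 4" "Cr_norm 4 (\<Phi> t) \<le> K" for t
  proof (rule niceI[OF t(2)])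
    show "neumann_bc (\<Phi> t)" using sol t(1) by (simp add: exact_solution_def)
    show "norm (partials ds (\<Phi> t) x) \<le> max K 0" if "length ds \<le> 4" "x \<in> cube" for ds x
      using norm_partials_le[OF t(2) that] t(3) by simp
  qed simp
  then have "{t \<in> {0<..T}. \<Phi> t \<in> Cr_closure 4 \<and> Cr_norm 4 (\<Phi> t) \<le> K} \<subseteq> {t \<in> {0<..T}. nice 4 (max K 0) (\<Phi> t)}"
    by auto
  from order.trans[OF d closure_mono[OF this]] show thesis by (intro that[of "max K 0"]) auto
qed

lemma lattice_C2_Phi:
  obtains K where "K \<ge> 0" "\<And>N t. N \<ge> 1 \<Longrightarrow> t \<in> {0..T} \<Longrightarrow> lattice_C2 N K (vl N (\<Phi> t))"
    "\<And>N s t. N \<ge> 1 \<Longrightarrow> s \<in> {0..T} \<Longrightarrow> t \<in> {0..T} \<Longrightarrow>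
      lattice_C2 N (K * \<bar>t - s\<bar>) (\<lambda>q. vl N (\<Phi> t) q - vl N (\<Phi> s) q)"
    "\<And>N t k. N \<ge> 1 \<Longrightarrow> t - k \<in> {0..T} \<Longrightarrow> t \<in> {0..T} \<Longrightarrow> t + k \<in> {0..T} \<Longrightarrow>
      lattice_C2 N (K * k\<^sup>2) (\<lambda>q. (vl N (\<Phi> (t + k)) q - vl N (\<Phi> t) q) - (vl N (\<Phi> t) q - vl N (\<Phi> (t - k)) q))"
proof -
  obtain K where K: "K \<ge> 0" "\<And>t. t \<in> {0..T} \<Longrightarrow> nice 2 K (\<Phi> t)"
    "\<And>s t. s \<in> {0..T} \<Longrightarrow> t \<in> {0..T} \<Longrightarrow> nice 2 (K * \<bar>t - s\<bar>) (\<lambda>x. \<Phi> t x - \<Phi> s x)"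
    "\<And>t k. t - k \<in> {0..T} \<Longrightarrow> t \<in> {0..T} \<Longrightarrow> t + k \<in> {0..T} \<Longrightarrow>
      nice 2 (K * k\<^sup>2) (\<lambda>x. (\<Phi> (t + k) x - \<Phi> t x) - (\<Phi> t x - \<Phi> (t - k) x))"
    by (rule nice_Phi, rule that)
  show thesis
  proof (rule that[of "3 * K"])
    show "lattice_C2 N (3 * K) (vl N (\<Phi> t))" if "N \<ge> 1" "t \<in> {0..T}" for N t
      by (rule nice_lattice_C2[OF that(1) K(2)[OF that(2)]])
    show "lattice_C2 N (3 * K * \<bar>t - s\<bar>) (\<lambda>q. vl N (\<Phi> t) q - vl N (\<Phi> s) q)"
      if "N \<ge> 1" "s \<in> {0..T}" "t \<in> {0..T}" for N s t
      using nice_lattice_C2[OF that(1) K(3)[OF that(2,3)]] by (simp only: vl_diff[OF that(1)] mult.assoc)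
    show "lattice_C2 N (3 * K * k\<^sup>2) (\<lambda>q. (vl N (\<Phi> (t + k)) q - vl N (\<Phi> t) q) - (vl N (\<Phi> t) q - vl N (\<Phi> (t - k)) q))"
      if "N \<ge> 1" "t - k \<in> {0..T}" "t \<in> {0..T}" "t + k \<in> {0..T}" for N t k
      using nice_lattice_C2[OF that(1) K(4)[OF that(2,3,4)]] by (simp only: vl_diff[OF that(1)] mult.assoc)
  qed (use K in simp)
qed

lemma consistency_all_times:
  obtains K where "K \<ge> 0"
    "\<And>N t c d q. N \<ge> 1 \<Longrightarrow> t \<in> {0..T} \<Longrightarrow>
      norm (lattice.Dp (tsh N) (mesh N) c (lattice.Sd (tsh N) (tsb N) (mesh N) d (vl N (\<Phi> t))) q) \<le> K"
    "\<And>N t q. N \<ge> 1 \<Longrightarrow> t \<in> {0..T} \<Longrightarrow> norm (tau N \<alpha> (\<alpha> * \<epsilon>) f (\<Phi> t) (Phi' t) q) \<le> K * mesh N"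
    "\<And>N t e. N \<ge> 1 \<Longrightarrow> t \<in> {0..T} \<Longrightarrow> \<bar>lattice.ip (torus N) (mesh N) (tau N \<alpha> (\<alpha> * \<epsilon>) f (\<Phi> t) (Phi' t)) e\<bar>
      \<le> K * (mesh N)\<^sup>2 * (lattice.nrm (torus N) (mesh N) e + lattice.gn (torus N) (tsh N) (mesh N) e)"
proof -
  let ?\<beta> = "\<alpha> * \<epsilon>"
  have b: "?\<beta> > 0" using ae by simp
  obtain K where K: "K \<ge> 0" and D: "{0..T} \<subseteq> closure {t \<in> {0<..T}. nice 4 K (\<Phi> t)}" (is "_ \<subseteq> closure ?D")
    by (rule nice_dense, rule that)
  have D': "?D \<subseteq> {0..T}" by auto
  define K' where "K' = 7 * K + (9 * ?\<beta> * K + 36 * ?\<beta> * K ^ 3)"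
  have c0: "9 * ?\<beta> * K + 36 * ?\<beta> * K ^ 3 \<ge> 0" using K b by simp
  then have K': "K' \<ge> 0" "7 * K \<le> K'" "9 * ?\<beta> * K + 36 * ?\<beta> * K ^ 3 \<le> K'" using K by (auto simp: K'_def)
  show thesis
  proof (rule that[OF K'(1)])
    fix N :: nat and t :: real assume N: "N \<ge> 1" and t: "t \<in> {0..T}"
    interpret lattice "torus N" "tsh N" "tsb N" "mesh N" 1 \<alpha> ?\<beta> F for F
      by (rule torus_lattice) (use N ae b in auto)
    have P: "continuous_on {0..T} (\<lambda>t. \<Phi> t x)" if "x \<in> cube" for x
      using Cq_time_continuous[OF C22, of "[]", OF _ that] by simp
    have cv: "continuous_on {0..T} (\<lambda>t. vl N (w t) q)"
      if "\<And>x. x \<in> cube \<Longrightarrow> continuous_on {0..T} (\<lambda>t. w t x)" for w :: "real \<Rightarrow> real^3 \<Rightarrow> real^3" and q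
    proof (cases "snd q \<in> grid N")
      case True
      then show ?thesis using that[OF grid_point_cube[OF N True]] by (simp add: vl_def[OF N] lift_def)
    qed (simp add: vl_def[OF N] lift_def)
    note con = continuous_on_tau[OF N zero_less_one ae(1) b cv[OF P] cv[OF Phi'(1)]]
    have g: "nice 4 K (\<Phi> t)" "\<And>x. x \<in> cube \<Longrightarrow> Phi' t x = rhs \<alpha> ?\<beta> f (\<Phi> t) x" if "t \<in> ?D" for t
    proof -
      show "nice 4 K (\<Phi> t)" using that by simp
      show "Phi' t x = rhs \<alpha> ?\<beta> f (\<Phi> t) x" if "x \<in> cube" for x
        using \<open>t \<in> ?D\<close> that by (intro Phi'(2)) auto
    qed
    show "norm (Dp c (Sd d (vl N (\<Phi> t))) q) \<le> K'" for c d q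
    proof (rule dense_le[OF continuous_on_norm[OF con(1)] D D' _ t])
      fix t assume "t \<in> ?D"
      from norm_Dp_Sd_vl_le[OF N zero_less_one ae(1) b g(1)[OF this]]
      show "norm (Dp c (Sd d (vl N (\<Phi> t))) q) \<le> K'" using K'(2) by (rule order.trans)
    qed
    show "norm (tau N \<alpha> ?\<beta> f (\<Phi> t) (Phi' t) q) \<le> K' * mesh N" for q
    proof (rule dense_le[OF continuous_on_norm[OF con(2)] D D' _ t])
      fix t assume t: "t \<in> ?D"
      have "norm (tau N \<alpha> ?\<beta> f (\<Phi> t) (Phi' t) q) \<le> (9 * ?\<beta> * K + 36 * ?\<beta> * K ^ 3) * mesh N"
        by (rule tau_bounds(1)[OF N zero_less_one ae(1) b g(1)[OF t] g(2)[OF t]])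
      also have "\<dots> \<le> K' * mesh N" using h_pos by (intro mult_right_mono K') simp
      finally show "norm (tau N \<alpha> ?\<beta> f (\<Phi> t) (Phi' t) q) \<le> K' * mesh N" .
    qed
    show "\<bar>ip (tau N \<alpha> ?\<beta> f (\<Phi> t) (Phi' t)) e\<bar> \<le> K' * (mesh N)\<^sup>2 * (nrm e + gn e)" for e
    proof (rule dense_le[OF continuous_on_rabs[OF con(3)] D D' _ t])
      fix t assume t: "t \<in> ?D"
      have "\<bar>ip (tau N \<alpha> ?\<beta> f (\<Phi> t) (Phi' t)) e\<bar> \<le> (9 * ?\<beta> * K + 36 * ?\<beta> * K ^ 3) * (mesh N)\<^sup>2 * (nrm e + gn e)"
        by (rule tau_bounds(2)[OF N zero_less_one ae(1) b g(1)[OF t] g(2)[OF t]])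
      also have "\<dots> \<le> K' * (mesh N)\<^sup>2 * (nrm e + gn e)" by (intro mult_right_mono K') auto
      finally show "\<bar>ip (tau N \<alpha> ?\<beta> f (\<Phi> t) (Phi' t)) e\<bar> \<le> K' * (mesh N)\<^sup>2 * (nrm e + gn e)" .
    qed
  qed
qed

text \<open>The residual is the trapezoidal error minus k/2 times the sum of the spatial truncation
  errors at both ends, since the time derivatives contained in the two cancel. The spatial error
  enters only through h pointwise but through h^2 in the dual norm.\<close>

lemma crank_nicolson_residual:
  obtains K where "K \<ge> 0"
    "\<And>N k t q. N \<ge> 1 \<Longrightarrow> k > 0 \<Longrightarrow> t \<in> {0..T} \<Longrightarrow> t + k \<in> {0..T} \<Longrightarrow>
      norm (lattice.cn_res (tsh N) (tsb N) (mesh N) k \<alpha> (\<alpha> * \<epsilon>) (vl N f) (vl N (\<Phi> t)) (vl N (\<Phi> (t + k))) q)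
        \<le> K * k * (k\<^sup>2 + mesh N)"
    "\<And>N k t e. N \<ge> 1 \<Longrightarrow> k > 0 \<Longrightarrow> t \<in> {0..T} \<Longrightarrow> t + k \<in> {0..T} \<Longrightarrow>
      \<bar>lattice.ip (torus N) (mesh N)
        (lattice.cn_res (tsh N) (tsb N) (mesh N) k \<alpha> (\<alpha> * \<epsilon>) (vl N f) (vl N (\<Phi> t)) (vl N (\<Phi> (t + k)))) e\<bar>
        \<le> K * k * (k\<^sup>2 + (mesh N)\<^sup>2) * (lattice.nrm (torus N) (mesh N) e + lattice.gn (torus N) (tsh N) (mesh N) e)"
proof -
  let ?\<beta> = "\<alpha> * \<epsilon>"
  have b: "?\<beta> > 0" using ae by simp
  obtain K1 where K1: "K1 \<ge> 0"
    "\<And>N t q. N \<ge> 1 \<Longrightarrow> t \<in> {0..T} \<Longrightarrow> norm (tau N \<alpha> ?\<beta> f (\<Phi> t) (Phi' t) q) \<le> K1 * mesh N"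
    "\<And>N t e. N \<ge> 1 \<Longrightarrow> t \<in> {0..T} \<Longrightarrow> \<bar>lattice.ip (torus N) (mesh N) (tau N \<alpha> ?\<beta> f (\<Phi> t) (Phi' t)) e\<bar>
      \<le> K1 * (mesh N)\<^sup>2 * (lattice.nrm (torus N) (mesh N) e + lattice.gn (torus N) (tsh N) (mesh N) e)"
    by (rule consistency_all_times, rule that)
  obtain K2 where K2: "K2 \<ge> 0" "\<And>x s t. x \<in> cube \<Longrightarrow> s \<in> {0..T} \<Longrightarrow> t \<in> {s..T} \<Longrightarrow>
      norm (\<Phi> t x - \<Phi> s x - ((t - s) / 2) *\<^sub>R (Phi' s x + Phi' t x)) \<le> K2 * (t - s) ^ 3"
    using Phi'(3) by blast
  show thesis
  proof (rule that[of "K1 + 3 * K2"])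
    show "0 \<le> K1 + 3 * K2" using K1 K2 by simp
    fix N :: nat and k t :: real assume N: "N \<ge> 1" and k: "k > 0" and t: "t \<in> {0..T}" "t + k \<in> {0..T}"
    interpret lattice "torus N" "tsh N" "tsb N" "mesh N" k \<alpha> ?\<beta> "vl N f"
      by (rule torus_lattice) (use N ae b k in auto)
    define \<rho> where "\<rho> q = vl N (\<Phi> (t + k)) q - vl N (\<Phi> t) q - (k / 2) *\<^sub>R (vl N (Phi' t) q + vl N (Phi' (t + k)) q)" for q
    let ?\<tau> = "\<lambda>t. tau N \<alpha> ?\<beta> f (\<Phi> t) (Phi' t)"
    have \<rho>: "norm (\<rho> q) \<le> K2 * k ^ 3" for q
      using K2(2)[OF grid_point_cube[OF N, of "snd q"] t(1), of "t + k"] K2(1) t k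
      by (auto simp: \<rho>_def vl_def[OF N] lift_def)
    have eq: "cn_res (vl N (\<Phi> t)) (vl N (\<Phi> (t + k))) q = \<rho> q - (k / 2) *\<^sub>R (?\<tau> t q + ?\<tau> (t + k) q)" for q
    proof -
      have Z: "(k / 2) *\<^sub>R (?\<beta> *\<^sub>R (\<Sum>d\<in>UNIV. Sd d u q)) = (1/2) *\<^sub>R Z u q" for u
        unfolding Z_def by simp
      have "(k / 2) *\<^sub>R (?\<tau> t q + ?\<tau> (t + k) q) = (1/2) *\<^sub>R Z (vl N (\<Phi> t)) q + (1/2) *\<^sub>R Z (vl N (\<Phi> (t + k))) q
          + (k / 2) *\<^sub>R (NL (vl N (\<Phi> t)) q + NL (vl N (\<Phi> (t + k))) q)
          - (k / 2) *\<^sub>R (vl N (Phi' t) q + vl N (Phi' (t + k)) q)"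
        unfolding tau_def[OF N k ae(1) b] Z[symmetric] by (simp only: scaleR_add_right scaleR_diff_right) simp
      moreover have "k *\<^sub>R NL (vl N (\<Phi> t)) q = (k / 2) *\<^sub>R NL (vl N (\<Phi> t)) q + (k / 2) *\<^sub>R NL (vl N (\<Phi> t)) q"
        unfolding scaleR_left_distrib[symmetric] by simp
      moreover have "Z (vl N (\<Phi> t)) q = (1/2) *\<^sub>R Z (vl N (\<Phi> t)) q + (1/2) *\<^sub>R Z (vl N (\<Phi> t)) q"
        unfolding scaleR_left_distrib[symmetric] by simp
      ultimately show ?thesis
        unfolding cn_res_def \<rho>_def Z_diff by (simp only: scaleR_add_right scaleR_diff_right) (simp add: algebra_simps)
    qed
    show "norm (cn_res (vl N (\<Phi> t)) (vl N (\<Phi> (t + k))) q) \<le> (K1 + 3 * K2) * k * (k\<^sup>2 + mesh N)" for q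
    proof -
      have "norm (?\<tau> t q + ?\<tau> (t + k) q) \<le> K1 * mesh N + K1 * mesh N"
        by (intro norm_triangle_mono K1(2)[OF N] t)
      then have "(k / 2) * norm (?\<tau> t q + ?\<tau> (t + k) q) \<le> (k / 2) * (K1 * mesh N + K1 * mesh N)"
        using k by (intro mult_left_mono) auto
      then have "norm (cn_res (vl N (\<Phi> t)) (vl N (\<Phi> (t + k))) q) \<le> K2 * k ^ 3 + (k / 2) * (K1 * mesh N + K1 * mesh N)"
        unfolding eq using \<rho>[of q] k
        by (intro order.trans[OF norm_triangle_ineq4] add_mono) simp_all
      also have "\<dots> \<le> (K1 + 3 * K2) * k * (k\<^sup>2 + mesh N)"
        using K1(1) K2(1) k h_pos by (simp add: algebra_simps power2_eq_square power3_eq_cube)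
      finally show ?thesis .
    qed
    show "\<bar>ip (cn_res (vl N (\<Phi> t)) (vl N (\<Phi> (t + k)))) e\<bar> \<le> (K1 + 3 * K2) * k * (k\<^sup>2 + (mesh N)\<^sup>2) * (nrm e + gn e)" for e
    proof -
      let ?s = "nrm e + gn e"
      have s: "nrm e \<le> ?s" "?s \<ge> 0" by simp_all
      have "\<bar>ip \<rho> e\<bar> \<le> nrm \<rho> * nrm e" by (rule ip_CS)
      also have "\<dots> \<le> (3 * (K2 * k ^ 3)) * ?s"
        using \<rho> s K2(1) k by (intro mult_mono nrm_le) auto
      finally have 1: "\<bar>ip \<rho> e\<bar> \<le> 3 * (K2 * k ^ 3) * ?s" .
      have "\<bar>ip (?\<tau> t) e + ip (?\<tau> (t + k)) e\<bar> \<le> K1 * (mesh N)\<^sup>2 * ?s + K1 * (mesh N)\<^sup>2 * ?s"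
        by (intro order.trans[OF abs_triangle_ineq] add_mono K1(3)[OF N] t)
      then have 2: "(k / 2) * \<bar>ip (?\<tau> t) e + ip (?\<tau> (t + k)) e\<bar> \<le> (k / 2) * (K1 * (mesh N)\<^sup>2 * ?s + K1 * (mesh N)\<^sup>2 * ?s)"
        using k by (intro mult_left_mono) auto
      have "ip (cn_res (vl N (\<Phi> t)) (vl N (\<Phi> (t + k)))) e = ip \<rho> e - (k / 2) * (ip (?\<tau> t) e + ip (?\<tau> (t + k)) e)"
        unfolding eq[abs_def] ip_diff_left ip_scale_left ip_add_left ..
      then have "\<bar>ip (cn_res (vl N (\<Phi> t)) (vl N (\<Phi> (t + k)))) e\<bar> \<le> \<bar>ip \<rho> e\<bar> + (k / 2) * \<bar>ip (?\<tau> t) e + ip (?\<tau> (t + k)) e\<bar>"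
        using k abs_triangle_ineq4[of "ip \<rho> e" "(k / 2) * (ip (?\<tau> t) e + ip (?\<tau> (t + k)) e)"]
        by (simp add: abs_mult)
      also have "\<dots> \<le> (3 * K2 * k ^ 3 + K1 * k * (mesh N)\<^sup>2) * ?s"
        using 1 2 by (simp add: algebra_simps)
      also have "\<dots> \<le> (K1 + 3 * K2) * k * (k\<^sup>2 + (mesh N)\<^sup>2) * ?s"
        using K1(1) K2(1) k s(2) by (intro mult_right_mono) (auto simp: algebra_simps power2_eq_square power3_eq_cube)
      finally show ?thesis .
    qed
  qed
qed

end

section \<open>Convergence\<close>

lemma numerical_lift:
  fixes k \<alpha> \<beta> :: real
  assumes N: "N \<ge> 1" and k: "k > 0" and ab: "\<alpha> > 0" "\<beta> > 0" and st: "scheme_step \<alpha> \<beta> f N k m m'"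
  obtains M2 M3 M4 where
    "\<And>q. M2 q = lift N m q + (1/4) *\<^sub>R lattice.Z (tsh N) (tsb N) (mesh N) k \<beta> M2 q"
    "\<And>q. M3 q = lift N m q + (k/2) *\<^sub>R lattice.NL (tsh N) (tsb N) (mesh N) \<alpha> \<beta> (vl N f) M2 q
      + (1/4) *\<^sub>R lattice.Z (tsh N) (tsb N) (mesh N) k \<beta> M3 q"
    "\<And>q. M4 q = lift N m q + (k/2) *\<^sub>R (lattice.NL (tsh N) (tsb N) (mesh N) \<alpha> \<beta> (vl N f) M2 q
        + lattice.NL (tsh N) (tsb N) (mesh N) \<alpha> \<beta> (vl N f) M3 q)
      + (1/3) *\<^sub>R lattice.Z (tsh N) (tsb N) (mesh N) k \<beta> (\<lambda>q. M2 q + M3 q + M4 q) q"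
    "\<And>q. lift N m' q = M4 q + (k/3) *\<^sub>R lattice.NL (tsh N) (tsb N) (mesh N) \<alpha> \<beta> (vl N f) M4 q
      - (k/6) *\<^sub>R (lattice.NL (tsh N) (tsb N) (mesh N) \<alpha> \<beta> (vl N f) M2 q
        + lattice.NL (tsh N) (tsb N) (mesh N) \<alpha> \<beta> (vl N f) M3 q)"
proof -
  interpret lattice "torus N" "tsh N" "tsb N" "mesh N" k \<alpha> \<beta> "vl N f"
    by (rule torus_lattice) (use N k ab in auto)
  obtain m2 m3 m4 where dn: "discrete_neumann N m2" "discrete_neumann N m3" "discrete_neumann N m4"
    and eq: "\<And>p. p \<in> grid N \<Longrightarrow> m2 p = m p + (k/4) *\<^sub>R Lh \<beta> N m2 p"
      "\<And>p. p \<in> grid N \<Longrightarrow> m3 p = m p + (k/2) *\<^sub>R Nh \<alpha> \<beta> f N m2 p + (k/4) *\<^sub>R Lh \<beta> N m3 p"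
      "\<And>p. p \<in> grid N \<Longrightarrow> m4 p = m p + (k/2) *\<^sub>R (Nh \<alpha> \<beta> f N m2 p + Nh \<alpha> \<beta> f N m3 p)
        + (k/3) *\<^sub>R (Lh \<beta> N m2 p + Lh \<beta> N m3 p + Lh \<beta> N m4 p)"
      "\<And>p. p \<in> grid N \<Longrightarrow> m' p = m p + (k/3) *\<^sub>R (Nh \<alpha> \<beta> f N m2 p + Nh \<alpha> \<beta> f N m3 p + Nh \<alpha> \<beta> f N m4 p)
        + (k/3) *\<^sub>R (Lh \<beta> N m2 p + Lh \<beta> N m3 p + Lh \<beta> N m4 p)"
    using st unfolding scheme_step_def Let_def by blast
  have Zl: "Z (lift N g) q = k *\<^sub>R lift N (Lh \<beta> N g) q" if "discrete_neumann N g" for g q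
    using Z_lift[OF N k ab that] by simp
  have NLl: "NL (lift N g) q = lift N (Nh \<alpha> \<beta> f N g) q" if "discrete_neumann N g" for g q
    using NL_lift[OF N k ab that, of f] by (simp add: vl_def[OF N])
  show thesis
  proof (rule that[of "lift N m2" "lift N m3" "lift N m4"])
    fix q
    show "lift N m2 q = lift N m q + (1/4) *\<^sub>R Z (lift N m2) q"
      unfolding Zl[OF dn(1)] using eq(1)[of "snd q"] by (simp add: lift_def)
    show "lift N m3 q = lift N m q + (k/2) *\<^sub>R NL (lift N m2) q + (1/4) *\<^sub>R Z (lift N m3) q"
      unfolding Zl[OF dn(2)] NLl[OF dn(1)] using eq(2)[of "snd q"] by (simp add: lift_def)
    show "lift N m4 q = lift N m q + (k/2) *\<^sub>R (NL (lift N m2) q + NL (lift N m3) q)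
      + (1/3) *\<^sub>R Z (\<lambda>q. lift N m2 q + lift N m3 q + lift N m4 q) q"
      unfolding Z_add Zl[OF dn(1)] Zl[OF dn(2)] Zl[OF dn(3)] NLl[OF dn(1)] NLl[OF dn(2)]
      using eq(3)[of "snd q"] by (simp add: lift_def scaleR_add_right)
    show "lift N m' q = lift N m4 q + (k/3) *\<^sub>R NL (lift N m4) q - (k/6) *\<^sub>R (NL (lift N m2) q + NL (lift N m3) q)"
    proof (cases "snd q \<in> grid N")
      case True
      \<comment> \<open>The last two equations contain the same sum of Laplacians. Subtracting them
        and splitting k/2 = k/3 + k/6 leaves an update from the fourth stage without
        \<open>Z\<close>.\<close>
      have h: "(k/2) *\<^sub>R x = (k/3) *\<^sub>R x + (k/6) *\<^sub>R x" for x :: "real^3"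
        unfolding scaleR_left_distrib[symmetric] by simp
      show ?thesis
        unfolding NLl[OF dn(1)] NLl[OF dn(2)] NLl[OF dn(3)]
        using True by (simp add: lift_def eq(4)[OF True] eq(3)[OF True, unfolded h] scaleR_add_right)
    qed (simp add: NLl dn lift_def)
  qed
qed

text \<open>The step inequality is demanded only at indices where the bound already holds, so that
  smallness of the error and its growth estimate are obtained in the same induction.\<close>

lemma discrete_gronwall:
  fixes a :: "nat \<Rightarrow> real"
  assumes M: "M \<ge> 0" and b: "b \<ge> 0" and a0: "a 0 \<ge> 0"
    and step: "\<And>i. i < n \<Longrightarrow> a i \<le> (1 + M) ^ i * (a 0 + real i * b) \<Longrightarrow> a (Suc i) \<le> (1 + M) * a i + b"
    and i: "i \<le> n"
  shows "a i \<le> (1 + M) ^ i * (a 0 + real i * b)"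
  using i
proof (induction i)
  case (Suc i)
  then have IH: "a i \<le> (1 + M) ^ i * (a 0 + real i * b)" by simp
  have "b \<le> (1 + M) ^ Suc i * b"
    using mult_right_mono[OF one_le_power[of "1 + M" "Suc i"] b] M by simp
  then have "a (Suc i) \<le> (1 + M) * ((1 + M) ^ i * (a 0 + real i * b)) + (1 + M) ^ Suc i * b"
    using step[OF _ IH] Suc.prems mult_left_mono[OF IH, of "1 + M"] M by linarith
  also have "\<dots> = (1 + M) ^ Suc i * (a 0 + real (Suc i) * b)"
    by (simp add: algebra_simps)
  finally show ?case .
qed simp

text \<open>As k \<le> C2 h, the factor h^(-3/2) k^2 is at most C2^(3/2) sqrt k; an error of order
  k^2 thus remains small after the inverse inequality.\<close>

lemma small_data:
  fixes h k C C2 \<theta> :: real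
  assumes h: "h > 0" and k: "0 < k" "k \<le> 1" "k \<le> C2 * h" and C2: "C2 > 0" and C: "C \<ge> 0"
    and s: "k \<le> (\<theta> / (C2 powr (3/2) * (C + 1)))\<^sup>2" and th: "\<theta> > 0" and e: "e \<le> C * k\<^sup>2"
  shows "h powr (-3/2) * (e + k\<^sup>2 * sqrt k) \<le> \<theta>"
proof -
  have P: "C2 powr (3/2) > 0" using C2 by simp
  have "h powr (-3/2) \<le> (k / C2) powr (-3/2)"
    using h k C2 by (intro powr_mono2') (auto simp: field_simps)
  also have "\<dots> = C2 powr (3/2) * k powr (-3/2)"
    using k C2 by (simp add: powr_divide powr_minus_divide)
  finally have hk: "h powr (-3/2) \<le> C2 powr (3/2) * k powr (-3/2)" .
  have sk: "sqrt k \<le> 1" "sqrt k > 0" using k by auto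
  have "k powr (-3/2) * k\<^sup>2 = k powr (-3/2) * k powr 2" using k by (simp add: powr_numeral)
  also have "\<dots> = k powr (1/2)" unfolding powr_add[symmetric] by simp
  finally have kk: "k powr (-3/2) * k\<^sup>2 = sqrt k" using k by (simp add: powr_half_sqrt)
  have "e + k\<^sup>2 * sqrt k \<le> (C + 1) * k\<^sup>2"
    using e mult_left_le[OF sk(1), of "k\<^sup>2"] by (simp add: algebra_simps)
  then have "h powr (-3/2) * (e + k\<^sup>2 * sqrt k) \<le> h powr (-3/2) * ((C + 1) * k\<^sup>2)"
    by (intro mult_left_mono) auto
  also have "\<dots> \<le> (C2 powr (3/2) * k powr (-3/2)) * ((C + 1) * k\<^sup>2)"
    using C by (intro mult_right_mono hk) auto
  also have "\<dots> = (C2 powr (3/2) * (C + 1)) * (k powr (-3/2) * k\<^sup>2)" by (simp add: mult_ac)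
  also have "\<dots> = (C2 powr (3/2) * (C + 1)) * sqrt k" unfolding kk ..
  also have "\<dots> \<le> (C2 powr (3/2) * (C + 1)) * (\<theta> / (C2 powr (3/2) * (C + 1)))"
    using s P C th by (intro mult_left_mono real_le_lsqrt) auto
  also have "\<dots> = \<theta>" using P C by simp
  finally show ?thesis .
qed

context exact
begin

text \<open>The reference of a step involves the next time level; the linear continuation beyond \<open>T\<close> provides
  it at the last level.\<close>
definition levels :: "nat \<Rightarrow> real \<Rightarrow> nat \<Rightarrow> tpoint \<Rightarrow> real^3"
  where "levels N k n = (if real n * k \<le> T then vl N (\<Phi> (real n * k))
    else (\<lambda>q. 2 *\<^sub>R vl N (\<Phi> (real (n - 1) * k)) q - vl N (\<Phi> (real (n - 2) * k)) q))"

text \<open>The time level belongs to the index, so constants obtained from the family are uniform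
  in n as well. The step from n to n + 1 has to end by T.\<close>

definition family :: "real \<Rightarrow> real \<Rightarrow> (nat \<times> real \<times> nat) set"
  where "family C1 C2 = {(N, k, n). N \<ge> 1 \<and> k > 0 \<and> k \<le> 1 \<and> C1 * mesh N \<le> k \<and> k \<le> C2 * mesh N \<and> real (Suc n) * k \<le> T}"

abbreviation "rY N k n \<equiv> lattice.refY (tsh N) (tsb N) (mesh N) k \<alpha> (\<alpha> * \<epsilon>) (vl N f) (levels N k n) (levels N k (Suc n))"
abbreviation "r2 N k n \<equiv> lattice.ref2 (tsh N) (tsb N) (mesh N) k \<alpha> (\<alpha> * \<epsilon>) (vl N f) (levels N k n) (levels N k (Suc n))"
abbreviation "r3 N k n \<equiv> lattice.ref3 (tsh N) (tsb N) (mesh N) k \<alpha> (\<alpha> * \<epsilon>) (vl N f) (levels N k n) (levels N k (Suc n))"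
abbreviation "r4 N k n \<equiv> lattice.ref4 (tsh N) (tsb N) (mesh N) k \<alpha> (\<alpha> * \<epsilon>) (vl N f) (levels N k n) (levels N k (Suc n))"
abbreviation "d4 N k n \<equiv> lattice.res4 (tsh N) (tsb N) (mesh N) k \<alpha> (\<alpha> * \<epsilon>) (vl N f) (levels N k n) (levels N k (Suc n))"
abbreviation "d5 N k n \<equiv> lattice.res5 (tsh N) (tsb N) (mesh N) k \<alpha> (\<alpha> * \<epsilon>) (vl N f)
  (levels N k n) (levels N k (Suc n)) (levels N k (Suc (Suc n)))"

text \<open>Beyond T the linear continuation repeats the previous increment and has second
  difference 0, so it inherits all bounds.\<close>

lemma levels_bounds:
  obtains K where "K \<ge> 0"
    "\<And>N k n. (N, k, n) \<in> family C1 C2 \<Longrightarrow> lattice_C2 N K (levels N k n)"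
    "\<And>N k n. (N, k, n) \<in> family C1 C2 \<Longrightarrow>
      lattice_C2 N (K * k) (\<lambda>q. levels N k (Suc n) q - levels N k n q)"
    "\<And>N k n. (N, k, n) \<in> family C1 C2 \<Longrightarrow>
      lattice_C2 N (K * k) (\<lambda>q. levels N k (Suc (Suc n)) q - levels N k (Suc n) q)"
    "\<And>N k n. (N, k, n) \<in> family C1 C2 \<Longrightarrow>
      lattice_C2 N (K * k\<^sup>2) (\<lambda>q. (levels N k (Suc (Suc n)) q - levels N k (Suc n) q) - (levels N k (Suc n) q - levels N k n q))"
proof -
  obtain K where K: "K \<ge> 0" "\<And>N t. N \<ge> 1 \<Longrightarrow> t \<in> {0..T} \<Longrightarrow> lattice_C2 N K (vl N (\<Phi> t))"
    "\<And>N s t. N \<ge> 1 \<Longrightarrow> s \<in> {0..T} \<Longrightarrow> t \<in> {0..T} \<Longrightarrow>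
      lattice_C2 N (K * \<bar>t - s\<bar>) (\<lambda>q. vl N (\<Phi> t) q - vl N (\<Phi> s) q)"
    "\<And>N t k. N \<ge> 1 \<Longrightarrow> t - k \<in> {0..T} \<Longrightarrow> t \<in> {0..T} \<Longrightarrow> t + k \<in> {0..T} \<Longrightarrow>
      lattice_C2 N (K * k\<^sup>2) (\<lambda>q. (vl N (\<Phi> (t + k)) q - vl N (\<Phi> t) q) - (vl N (\<Phi> t) q - vl N (\<Phi> (t - k)) q))"
    by (rule lattice_C2_Phi, rule that)
  show thesis
  proof (rule that[OF K(1)])
    fix N n :: nat and k :: real assume w: "(N, k, n) \<in> family C1 C2"
    then have N: "N \<ge> 1" and k: "k > 0" and le: "real (Suc n) * k \<le> T" by (auto simp: family_def)
    have t: "real n * k \<in> {0..T}" "real (Suc n) * k \<in> {0..T}" "real (Suc n) * k - real n * k = k"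
      using k le by (auto simp: algebra_simps)
    have L: "levels N k n = vl N (\<Phi> (real n * k))" "levels N k (Suc n) = vl N (\<Phi> (real (Suc n) * k))"
      using t by (auto simp: levels_def)
    show "lattice_C2 N K (levels N k n)" unfolding L by (rule K(2)[OF N t(1)])
    show E: "lattice_C2 N (K * k) (\<lambda>q. levels N k (Suc n) q - levels N k n q)"
      using K(3)[OF N t(1,2)] k unfolding L t(3) by simp
    have ex: "levels N k (Suc (Suc n)) q - levels N k (Suc n) q = levels N k (Suc n) q - levels N k n q"
      if "\<not> real (Suc (Suc n)) * k \<le> T" for q
      unfolding L using that by (simp add: levels_def scaleR_2)
    have L2: "levels N k (Suc (Suc n)) = vl N (\<Phi> (real (Suc (Suc n)) * k))"
      and t2: "real (Suc (Suc n)) * k \<in> {0..T}" "real (Suc (Suc n)) * k - real (Suc n) * k = k"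
      "real (Suc n) * k + k = real (Suc (Suc n)) * k" "real (Suc n) * k - k = real n * k"
      if "real (Suc (Suc n)) * k \<le> T"
      using that k by (simp_all add: levels_def algebra_simps)
    show "lattice_C2 N (K * k) (\<lambda>q. levels N k (Suc (Suc n)) q - levels N k (Suc n) q)"
    proof (cases "real (Suc (Suc n)) * k \<le> T")
      case True
      show ?thesis using K(3)[OF N t(2) t2(1)[OF True]] k unfolding L L2[OF True] t2(2)[OF True] by simp
    next
      case False
      show ?thesis unfolding ex[OF False] by (rule E)
    qed
    show "lattice_C2 N (K * k\<^sup>2) (\<lambda>q. (levels N k (Suc (Suc n)) q - levels N k (Suc n) q) - (levels N k (Suc n) q - levels N k n q))"
    proof (cases "real (Suc (Suc n)) * k \<le> T")
      case True
      have "real (Suc n) * k - k \<in> {0..T}" "real (Suc n) * k + k \<in> {0..T}"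
        unfolding t2(3)[OF True] t2(4)[OF True] using t t2(1)[OF True] by auto
      from K(4)[OF N this(1) t(2) this(2)] show ?thesis
        unfolding t2(3)[OF True] t2(4)[OF True] L L2[OF True] .
    next
      case False
      interpret lattice "torus N" "tsh N" "tsb N" "mesh N" k 1 1 F for F
        by (rule torus_lattice) (use N k in auto)
      show ?thesis
        unfolding ex[OF False] lattice_C2_def using K(1) by (simp add: Dp_def Sd_def)
    qed
  qed
qed

text \<open>Here orders in k turn back into constants: the abstract analysis is applied to the whole
  family at once, so a single K serves all meshes, time steps and levels.\<close>

lemma reference_bounds:
  assumes C: "C1 > 0" "C2 > 0"
  obtains K where "K \<ge> 1"
    "\<And>N k n q. (N, k, n) \<in> family C1 C2 \<Longrightarrow> norm (rY N k n q - levels N k n q) \<le> K * k\<^sup>2"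
    "\<And>N k n q. (N, k, n) \<in> family C1 C2 \<Longrightarrow> norm (rY N k (Suc n) q - levels N k (Suc n) q) \<le> K * k\<^sup>2"
    "\<And>N k n q. (N, k, n) \<in> family C1 C2 \<Longrightarrow> norm (vl N f q) \<le> K"
    "\<And>N k n q. (N, k, n) \<in> family C1 C2 \<Longrightarrow> norm (r2 N k n q) \<le> K \<and> norm (r3 N k n q) \<le> K \<and> norm (r4 N k n q) \<le> K"
    "\<And>N k n d q. (N, k, n) \<in> family C1 C2 \<Longrightarrow> norm (lattice.Ac (tsh N) (tsb N) (mesh N) d (r2 N k n) q) \<le> K
      \<and> norm (lattice.Ac (tsh N) (tsb N) (mesh N) d (r3 N k n) q) \<le> K
      \<and> norm (lattice.Ac (tsh N) (tsb N) (mesh N) d (r4 N k n) q) \<le> K"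
    "\<And>N k n e. (N, k, n) \<in> family C1 C2 \<Longrightarrow> \<bar>lattice.ip (torus N) (mesh N) (d4 N k n) e\<bar>
      \<le> K * k ^ 3 * (lattice.nrm (torus N) (mesh N) e + lattice.gn (torus N) (tsh N) (mesh N) e)"
    "\<And>N k n e. (N, k, n) \<in> family C1 C2 \<Longrightarrow> \<bar>lattice.ip (torus N) (mesh N) (d5 N k n) e\<bar>
      \<le> K * k ^ 3 * (lattice.nrm (torus N) (mesh N) e + lattice.gn (torus N) (tsh N) (mesh N) e)"
    "\<And>N k n. (N, k, n) \<in> family C1 C2 \<Longrightarrow> sqrt k * lattice.nrm (torus N) (mesh N) (d5 N k n) \<le> K * k ^ 3"
proof -
  let ?\<beta> = "\<alpha> * \<epsilon>"
  have b: "?\<beta> > 0" using ae by simp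
  define \<Omega> where "\<Omega> = family C1 C2"
  define kk :: "nat \<times> real \<times> nat \<Rightarrow> real" where "kk \<omega> = fst (snd \<omega>)" for \<omega>
  define G where "G j \<omega> = levels (fst \<omega>) (kk \<omega>) (j + snd (snd \<omega>))" for j and \<omega> :: "nat \<times> real \<times> nat"
  have w: "fst \<omega> \<ge> 1" "kk \<omega> > 0" "kk \<omega> \<le> 1" "C1 * mesh (fst \<omega>) \<le> kk \<omega>" "kk \<omega> \<le> C2 * mesh (fst \<omega>)"
    "(fst \<omega>, kk \<omega>, snd (snd \<omega>)) \<in> family C1 C2" if "\<omega> \<in> \<Omega>" for \<omega>
    using that by (auto simp: \<Omega>_def family_def kk_def)
  interpret lattice_family \<Omega> "\<lambda>\<omega>. torus (fst \<omega>)" "\<lambda>\<omega>. tsh (fst \<omega>)" "\<lambda>\<omega>. tsb (fst \<omega>)" "\<lambda>\<omega>. mesh (fst \<omega>)" kk \<alpha> ?\<beta>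
    "\<lambda>\<omega>. vl (fst \<omega>) f" "1 / C1" C2
  proof (rule lattice_family.intro)
    fix \<omega> assume "\<omega> \<in> \<Omega>"
    note w = w[OF this]
    show "lattice (torus (fst \<omega>)) (tsh (fst \<omega>)) (tsb (fst \<omega>)) (mesh (fst \<omega>)) (kk \<omega>) \<alpha> ?\<beta>"
      by (rule torus_lattice) (use w ae b in auto)
    show "kk \<omega> \<le> 1" "kk \<omega> \<le> C2 * mesh (fst \<omega>)" "mesh (fst \<omega>) \<le> 1 / C1 * kk \<omega>"
      using w C by (auto simp: field_simps)
  qed
  have C2I: "bd psem j u" "bd gsem j u" "bd ssem j u"
    if "c \<ge> 0" "\<And>\<omega>. \<omega> \<in> \<Omega> \<Longrightarrow> lattice_C2 (fst \<omega>) (c * kk \<omega> ^ j) (u \<omega>)" for c j u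
    using that by (auto intro!: bdI[of c] simp: lattice_C2_def psem_def gsem_def ssem_def)
  obtain Bf where Bf: "\<And>x. x \<in> cube \<Longrightarrow> norm (f x) \<le> Bf" "Bf \<ge> 0"
  proof -
    obtain B where B: "\<forall>x\<in>cube. norm (f x) \<le> B" using f_bounded unfolding bounded_iff by auto
    show thesis by (rule that[of "max B 0"]) (use B in \<open>auto simp: le_max_iff_disj\<close>)
  qed
  interpret nonlinear_family \<Omega> "\<lambda>\<omega>. torus (fst \<omega>)" "\<lambda>\<omega>. tsh (fst \<omega>)" "\<lambda>\<omega>. tsb (fst \<omega>)" "\<lambda>\<omega>. mesh (fst \<omega>)" kk \<alpha> ?\<beta>
    "\<lambda>\<omega>. vl (fst \<omega>) f" "1 / C1" C2
  proof
    have "norm (vl (fst \<omega>) f q) \<le> Bf" if "\<omega> \<in> \<Omega>" for \<omega> and q :: tpoint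
      using Bf grid_point_cube[OF w(1)[OF that], of "snd q"] by (simp add: vl_def[OF w(1)[OF that]] lift_def)
    then show "bd psem 0 (\<lambda>\<omega>. vl (fst \<omega>) f)" using Bf(2) by (intro bdI[of Bf]) (auto simp: psem_def)
  qed
  obtain K1 where K1: "K1 \<ge> 0"
    "\<And>N k n. (N, k, n) \<in> family C1 C2 \<Longrightarrow> lattice_C2 N K1 (levels N k n)"
    "\<And>N k n. (N, k, n) \<in> family C1 C2 \<Longrightarrow>
      lattice_C2 N (K1 * k) (\<lambda>q. levels N k (Suc n) q - levels N k n q)"
    "\<And>N k n. (N, k, n) \<in> family C1 C2 \<Longrightarrow>
      lattice_C2 N (K1 * k) (\<lambda>q. levels N k (Suc (Suc n)) q - levels N k (Suc n) q)"
    "\<And>N k n. (N, k, n) \<in> family C1 C2 \<Longrightarrow>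
      lattice_C2 N (K1 * k\<^sup>2) (\<lambda>q. (levels N k (Suc (Suc n)) q - levels N k (Suc n) q) - (levels N k (Suc n) q - levels N k n q))"
    by (rule levels_bounds, rule that)
  obtain K2 where K2: "K2 \<ge> 0" "\<And>N t c d q. N \<ge> 1 \<Longrightarrow> t \<in> {0..T} \<Longrightarrow>
      norm (lattice.Dp (tsh N) (mesh N) c (lattice.Sd (tsh N) (tsb N) (mesh N) d (vl N (\<Phi> t))) q) \<le> K2"
    by (rule consistency_all_times, rule that)
  obtain K3 where K3: "K3 \<ge> 0"
    "\<And>N k t q. N \<ge> 1 \<Longrightarrow> k > 0 \<Longrightarrow> t \<in> {0..T} \<Longrightarrow> t + k \<in> {0..T} \<Longrightarrow>
      norm (lattice.cn_res (tsh N) (tsb N) (mesh N) k \<alpha> ?\<beta> (vl N f) (vl N (\<Phi> t)) (vl N (\<Phi> (t + k))) q)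
        \<le> K3 * k * (k\<^sup>2 + mesh N)"
    "\<And>N k t e. N \<ge> 1 \<Longrightarrow> k > 0 \<Longrightarrow> t \<in> {0..T} \<Longrightarrow> t + k \<in> {0..T} \<Longrightarrow>
      \<bar>lattice.ip (torus N) (mesh N)
        (lattice.cn_res (tsh N) (tsb N) (mesh N) k \<alpha> ?\<beta> (vl N f) (vl N (\<Phi> t)) (vl N (\<Phi> (t + k)))) e\<bar>
        \<le> K3 * k * (k\<^sup>2 + (mesh N)\<^sup>2) * (lattice.nrm (torus N) (mesh N) e + lattice.gn (torus N) (tsh N) (mesh N) e)"
    by (rule crank_nicolson_residual, rule that)
  have lev: "real (snd (snd \<omega>)) * kk \<omega> \<in> {0..T}" "real (snd (snd \<omega>)) * kk \<omega> + kk \<omega> \<in> {0..T}"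
    "G 0 \<omega> = vl (fst \<omega>) (\<Phi> (real (snd (snd \<omega>)) * kk \<omega>))"
    "G 1 \<omega> = vl (fst \<omega>) (\<Phi> (real (snd (snd \<omega>)) * kk \<omega> + kk \<omega>))" if "\<omega> \<in> \<Omega>" for \<omega>
    using w[OF that] by (auto simp: family_def G_def levels_def algebra_simps)
  have hk': "kk \<omega> * (kk \<omega>)\<^sup>2 \<le> (kk \<omega>)\<^sup>2" "mesh (fst \<omega>) \<le> (1 / C1) * kk \<omega>" "(mesh (fst \<omega>))\<^sup>2 \<le> (1 / C1)\<^sup>2 * (kk \<omega>)\<^sup>2"
    if "\<omega> \<in> \<Omega>" for \<omega>
  proof -
    show "kk \<omega> * (kk \<omega>)\<^sup>2 \<le> (kk \<omega>)\<^sup>2" using w(2,3)[OF that] by (simp add: mult_left_le_one_le)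
    show m: "mesh (fst \<omega>) \<le> (1 / C1) * kk \<omega>" by (rule hk[OF that])
    show "(mesh (fst \<omega>))\<^sup>2 \<le> (1 / C1)\<^sup>2 * (kk \<omega>)\<^sup>2"
      unfolding power_mult_distrib[symmetric] using m by (rule power_mono) (simp add: mesh_def)
  qed
  interpret consistency \<Omega> "\<lambda>\<omega>. torus (fst \<omega>)" "\<lambda>\<omega>. tsh (fst \<omega>)" "\<lambda>\<omega>. tsb (fst \<omega>)" "\<lambda>\<omega>. mesh (fst \<omega>)" kk \<alpha> ?\<beta>
    "\<lambda>\<omega>. vl (fst \<omega>) f" "1 / C1" C2 "G 0" "G 1" "G 2"
  proof
    have "lattice_C2 (fst \<omega>) (K1 * kk \<omega> ^ 0) (G 0 \<omega>)" if "\<omega> \<in> \<Omega>" for \<omega>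
      using K1(2)[OF w(6)[OF that]] by (simp add: G_def)
    note I = C2I[OF K1(1) this]
    show "bd psem 0 (G 0)" "bd gsem 0 (G 0)" "bd ssem 0 (G 0)" by (rule I, assumption)+
    have "lattice_C2 (fst \<omega>) (K1 * kk \<omega> ^ 1) (\<lambda>q. G 1 \<omega> q - G 0 \<omega> q)" if "\<omega> \<in> \<Omega>" for \<omega>
      using K1(3)[OF w(6)[OF that]] by (simp add: G_def)
    note I = C2I[OF K1(1) this]
    show "bd psem 1 (\<lambda>\<omega> q. G 1 \<omega> q - G 0 \<omega> q)" "bd gsem 1 (\<lambda>\<omega> q. G 1 \<omega> q - G 0 \<omega> q)" "bd ssem 1 (\<lambda>\<omega> q. G 1 \<omega> q - G 0 \<omega> q)"
      by (rule I, assumption)+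
    have "lattice_C2 (fst \<omega>) (K1 * kk \<omega> ^ 1) (\<lambda>q. G 2 \<omega> q - G 1 \<omega> q)" if "\<omega> \<in> \<Omega>" for \<omega>
      using K1(4)[OF w(6)[OF that]] by (simp add: G_def)
    note I = C2I[OF K1(1) this]
    show "bd psem 1 (\<lambda>\<omega> q. G 2 \<omega> q - G 1 \<omega> q)" "bd gsem 1 (\<lambda>\<omega> q. G 2 \<omega> q - G 1 \<omega> q)" "bd ssem 1 (\<lambda>\<omega> q. G 2 \<omega> q - G 1 \<omega> q)"
      by (rule I, assumption)+
    have "lattice_C2 (fst \<omega>) (K1 * kk \<omega> ^ 2) (\<lambda>q. (G 2 \<omega> q - G 1 \<omega> q) - (G 1 \<omega> q - G 0 \<omega> q))" if "\<omega> \<in> \<Omega>" for \<omega>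
      using K1(5)[OF w(6)[OF that]] by (simp add: G_def)
    note I = C2I[OF K1(1) this]
    show "bd psem 2 (\<lambda>\<omega> q. (G 2 \<omega> q - G 1 \<omega> q) - (G 1 \<omega> q - G 0 \<omega> q))"
      "bd gsem 2 (\<lambda>\<omega> q. (G 2 \<omega> q - G 1 \<omega> q) - (G 1 \<omega> q - G 0 \<omega> q))"
      "bd ssem 2 (\<lambda>\<omega> q. (G 2 \<omega> q - G 1 \<omega> q) - (G 1 \<omega> q - G 0 \<omega> q))"
      by (rule I, assumption)+
    show "bd gsem 1 (\<lambda>\<omega>. lattice.Z (tsh (fst \<omega>)) (tsb (fst \<omega>)) (mesh (fst \<omega>)) (kk \<omega>) ?\<beta> (G 0 \<omega>))"
    proof (rule bdI[of "3 * ?\<beta> * K2"])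
      show "0 \<le> 3 * ?\<beta> * K2" using K2(1) b by simp
      fix \<omega> and i :: "3 \<times> tpoint" assume \<omega>: "\<omega> \<in> \<Omega>"
      interpret lattice "torus (fst \<omega>)" "tsh (fst \<omega>)" "tsb (fst \<omega>)" "mesh (fst \<omega>)" "kk \<omega>" \<alpha> ?\<beta> F for F by (rule lat[OF \<omega>])
      have "Dp (fst i) (Z (G 0 \<omega>)) (snd i) = (kk \<omega> * ?\<beta>) *\<^sub>R (\<Sum>d\<in>UNIV. Dp (fst i) (Sd d (G 0 \<omega>)) (snd i))"
        unfolding Dp_def Z_def
        by (simp add: scaleR_sum_right[symmetric] sum_subtractf scaleR_diff_right mult_ac)
      also have "norm \<dots> \<le> (kk \<omega> * ?\<beta>) * (\<Sum>d\<in>(UNIV::3 set). K2)"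
      proof -
        have "norm (\<Sum>d\<in>UNIV. Dp (fst i) (Sd d (G 0 \<omega>)) (snd i)) \<le> (\<Sum>d\<in>(UNIV::3 set). K2)"
          unfolding lev(3)[OF \<omega>] by (intro sum_norm_le K2(2) w(1)[OF \<omega>] lev(1)[OF \<omega>])
        moreover have "\<bar>kk \<omega> * ?\<beta>\<bar> = kk \<omega> * ?\<beta>" using ae w(2)[OF \<omega>] by simp
        ultimately show ?thesis
          unfolding norm_scaleR using ae w(2)[OF \<omega>] by (metis abs_ge_zero mult_left_mono)
      qed
      finally show "gsem \<omega> (Z (G 0 \<omega>)) i \<le> 3 * ?\<beta> * K2 * kk \<omega> ^ 1"
        by (simp add: gsem_def mult_ac)
    qed
    show "bd psem 2 (\<lambda>\<omega>. lattice.cn_res (tsh (fst \<omega>)) (tsb (fst \<omega>)) (mesh (fst \<omega>)) (kk \<omega>) \<alpha> ?\<beta> (vl (fst \<omega>) f) (G 0 \<omega>) (G 1 \<omega>))"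
    proof (rule bdI[of "K3 * (1 + 1 / C1)"])
      show "0 \<le> K3 * (1 + 1 / C1)" using K3(1) C by simp
      fix \<omega> and i :: tpoint assume \<omega>: "\<omega> \<in> \<Omega>"
      have "K3 * kk \<omega> * ((kk \<omega>)\<^sup>2 + mesh (fst \<omega>)) \<le> K3 * (1 + 1 / C1) * kk \<omega> ^ 2"
      proof -
        have "kk \<omega> * mesh (fst \<omega>) \<le> kk \<omega> * ((1 / C1) * kk \<omega>)"
          using hk'(2)[OF \<omega>] w(2)[OF \<omega>] by (intro mult_left_mono) auto
        then have "kk \<omega> * (kk \<omega>)\<^sup>2 + kk \<omega> * mesh (fst \<omega>) \<le> (1 + 1 / C1) * (kk \<omega>)\<^sup>2"
          using hk'(1)[OF \<omega>] by (simp add: power2_eq_square algebra_simps)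
        from mult_left_mono[OF this K3(1)] show ?thesis by (simp add: algebra_simps)
      qed
      with K3(2)[OF w(1,2)[OF \<omega>] lev(1,2)[OF \<omega>], of i]
      show "psem \<omega> (lattice.cn_res (tsh (fst \<omega>)) (tsb (fst \<omega>)) (mesh (fst \<omega>)) (kk \<omega>) \<alpha> ?\<beta> (vl (fst \<omega>) f) (G 0 \<omega>) (G 1 \<omega>)) i
        \<le> K3 * (1 + 1 / C1) * kk \<omega> ^ 2"
        unfolding psem_def lev(3,4)[OF \<omega>] by (rule order.trans)
    qed
    show "bd hsem 3 (\<lambda>\<omega>. lattice.cn_res (tsh (fst \<omega>)) (tsb (fst \<omega>)) (mesh (fst \<omega>)) (kk \<omega>) \<alpha> ?\<beta> (vl (fst \<omega>) f) (G 0 \<omega>) (G 1 \<omega>))"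
    proof (rule bd_hI[of "K3 * (1 + (1 / C1)\<^sup>2)"])
      show "0 \<le> K3 * (1 + (1 / C1)\<^sup>2)" using K3(1) by simp
      fix \<omega> e assume \<omega>: "\<omega> \<in> \<Omega>"
      interpret lattice "torus (fst \<omega>)" "tsh (fst \<omega>)" "tsb (fst \<omega>)" "mesh (fst \<omega>)" "kk \<omega>" \<alpha> ?\<beta> F for F by (rule lat[OF \<omega>])
      have "K3 * kk \<omega> * ((kk \<omega>)\<^sup>2 + (mesh (fst \<omega>))\<^sup>2) \<le> K3 * kk \<omega> * ((kk \<omega>)\<^sup>2 + (1 / C1)\<^sup>2 * (kk \<omega>)\<^sup>2)"
        using hk'(3)[OF \<omega>] w(2)[OF \<omega>] K3(1) by (intro mult_left_mono) auto
      also have "\<dots> = K3 * (1 + (1 / C1)\<^sup>2) * kk \<omega> ^ 3" by (simp add: power2_eq_square power3_eq_cube algebra_simps)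
      finally have "K3 * kk \<omega> * ((kk \<omega>)\<^sup>2 + (mesh (fst \<omega>))\<^sup>2) * (nrm e + gn e) \<le> K3 * (1 + (1 / C1)\<^sup>2) * kk \<omega> ^ 3 * (nrm e + gn e)"
        by (rule mult_right_mono) simp
      with K3(3)[OF w(1,2)[OF \<omega>] lev(1,2)[OF \<omega>], of e]
      show "\<bar>ip (lattice.cn_res (tsh (fst \<omega>)) (tsb (fst \<omega>)) (mesh (fst \<omega>)) (kk \<omega>) \<alpha> ?\<beta> (vl (fst \<omega>) f) (G 0 \<omega>) (G 1 \<omega>)) e\<bar>
        \<le> K3 * (1 + (1 / C1)\<^sup>2) * kk \<omega> ^ 3 * (nrm e + gn e)"
        unfolding lev(3,4)[OF \<omega>] by (rule order.trans)
    qed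
  qed
  obtain Ha where Ha: "Ha \<ge> 0" "\<And>\<omega> e. \<omega> \<in> \<Omega> \<Longrightarrow> \<bar>lattice.ip (torus (fst \<omega>)) (mesh (fst \<omega>)) (lattice.res4 (tsh (fst \<omega>)) (tsb (fst \<omega>)) (mesh (fst \<omega>)) (kk \<omega>) \<alpha> ?\<beta> (vl (fst \<omega>) f) (G 0 \<omega>) (G 1 \<omega>)) e\<bar>
      \<le> Ha * kk \<omega> ^ 3 * (lattice.nrm (torus (fst \<omega>)) (mesh (fst \<omega>)) e + lattice.gn (torus (fst \<omega>)) (tsh (fst \<omega>)) (mesh (fst \<omega>)) e)"
    using bd_hE[OF res4] by blast
  obtain Hb where Hb: "Hb \<ge> 0" "\<And>\<omega> e. \<omega> \<in> \<Omega> \<Longrightarrow> \<bar>lattice.ip (torus (fst \<omega>)) (mesh (fst \<omega>)) (lattice.res5 (tsh (fst \<omega>)) (tsb (fst \<omega>)) (mesh (fst \<omega>)) (kk \<omega>) \<alpha> ?\<beta> (vl (fst \<omega>) f) (G 0 \<omega>) (G 1 \<omega>) (G 2 \<omega>)) e\<bar>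
      \<le> Hb * kk \<omega> ^ 3 * (lattice.nrm (torus (fst \<omega>)) (mesh (fst \<omega>)) e + lattice.gn (torus (fst \<omega>)) (tsh (fst \<omega>)) (mesh (fst \<omega>)) e)"
    using bd_hE[OF res5(1)] by blast
  obtain K where K: "K \<ge> 0" "K \<ge> 1 + Ha + Hb"
    "\<forall>\<omega>\<in>\<Omega>. \<forall>q. norm (Yf \<omega> q - G 0 \<omega> q) \<le> K * kk \<omega> ^ 2"
    "\<forall>\<omega>\<in>\<Omega>. \<forall>q. norm (Yf1 \<omega> q - G 1 \<omega> q) \<le> K * kk \<omega> ^ 2"
    "\<forall>\<omega>\<in>\<Omega>. \<forall>q. norm (vl (fst \<omega>) f q) \<le> K * kk \<omega> ^ 0"
    "\<forall>\<omega>\<in>\<Omega>. \<forall>q. norm (w2 \<omega> q) \<le> K * kk \<omega> ^ 0"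
    "\<forall>\<omega>\<in>\<Omega>. \<forall>q. norm (w3 \<omega> q) \<le> K * kk \<omega> ^ 0"
    "\<forall>\<omega>\<in>\<Omega>. \<forall>q. norm (w4 \<omega> q) \<le> K * kk \<omega> ^ 0"
    "\<forall>\<omega>\<in>\<Omega>. \<forall>d q. norm (lattice.Ac (tsh (fst \<omega>)) (tsb (fst \<omega>)) (mesh (fst \<omega>)) d (w2 \<omega>) q) \<le> K * kk \<omega> ^ 0"
    "\<forall>\<omega>\<in>\<Omega>. \<forall>d q. norm (lattice.Ac (tsh (fst \<omega>)) (tsb (fst \<omega>)) (mesh (fst \<omega>)) d (w3 \<omega>) q) \<le> K * kk \<omega> ^ 0"
    "\<forall>\<omega>\<in>\<Omega>. \<forall>d q. norm (lattice.Ac (tsh (fst \<omega>)) (tsb (fst \<omega>)) (mesh (fst \<omega>)) d (w4 \<omega>) q) \<le> K * kk \<omega> ^ 0"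
    "\<forall>\<omega>\<in>\<Omega>. \<forall>i. lsem \<omega> (lattice.res5 (tsh (fst \<omega>)) (tsb (fst \<omega>)) (mesh (fst \<omega>)) (kk \<omega>) \<alpha> ?\<beta> (vl (fst \<omega>) f) (G 0 \<omega>) (G 1 \<omega>) (G 2 \<omega>)) i \<le> K * kk \<omega> ^ 3"
    using eventually_conj[OF eventually_ge_at_top[of "1 + Ha + Hb"] eventually_conj[OF
      bd_p_eventually[OF Yf_diff(1)] eventually_conj[OF bd_p_eventually[OF Yf_diff(2)] eventually_conj[OF
      bd_p_eventually[OF f_bd] eventually_conj[OF bd_p_eventually[OF stages_bounded(1)] eventually_conj[OF
      bd_p_eventually[OF stages_bounded(3)] eventually_conj[OF bd_p_eventually[OF stages_bounded(5)] eventually_conj[OF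
      bd_g_eventually[OF stages_bounded(2)] eventually_conj[OF bd_g_eventually[OF stages_bounded(4)] eventually_conj[OF
      bd_g_eventually[OF stages_bounded(6)] bd_eventually[OF res5(2)]]]]]]]]]]]
  proof (rule at_top_real_obtain, elim conjE, goal_cases)
    case (1 K)
    show thesis by (rule that[of K]) (fact 1)+
  qed
  show thesis
  proof (rule that[of K])
    show "1 \<le> K" using K(2) Ha(1) Hb(1) by linarith
    fix N n :: nat and k :: real assume "(N, k, n) \<in> family C1 C2"
    then have \<omega>: "(N, k, n) \<in> \<Omega>" by (simp add: \<Omega>_def)
    note B = bspec[OF _ \<omega>] and S = fst_conv snd_conv kk_def G_def add_0 plus_1_eq_Suc add_2_eq_Suc power_0 mult_1_right
    show "norm (rY N k n q - levels N k n q) \<le> K * k\<^sup>2" for q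
      using B[OF K(3)] by (simp only: S)
    show "norm (rY N k (Suc n) q - levels N k (Suc n) q) \<le> K * k\<^sup>2" for q
      using B[OF K(4)] by (simp only: S)
    show "norm (vl N f q) \<le> K" for q
      using B[OF K(5)] by (simp only: S)
    show "norm (r2 N k n q) \<le> K \<and> norm (r3 N k n q) \<le> K \<and> norm (r4 N k n q) \<le> K" for q
      using B[OF K(6)] B[OF K(7)] B[OF K(8)] by (simp only: S simp_thms)
    show "norm (lattice.Ac (tsh N) (tsb N) (mesh N) d (r2 N k n) q) \<le> K
      \<and> norm (lattice.Ac (tsh N) (tsb N) (mesh N) d (r3 N k n) q) \<le> K
      \<and> norm (lattice.Ac (tsh N) (tsb N) (mesh N) d (r4 N k n) q) \<le> K" for d q
      using B[OF K(9)] B[OF K(10)] B[OF K(11)] by (simp only: S simp_thms)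
    interpret lattice "torus N" "tsh N" "tsb N" "mesh N" k \<alpha> ?\<beta> F for F
      using lat[OF \<omega>] by (simp only: S)
    have K': "H * k ^ 3 * (nrm e + gn e) \<le> K * k ^ 3 * (nrm e + gn e)" if "H \<le> K" for H e
      using that k_pos by (intro mult_right_mono) auto
    show "\<bar>ip (d4 N k n) e\<bar> \<le> K * k ^ 3 * (nrm e + gn e)" for e
      using Ha(2)[OF \<omega>, of e] K'[of Ha e] K(2) Ha(1) Hb(1) by (simp only: S) linarith
    show "\<bar>ip (d5 N k n) e\<bar> \<le> K * k ^ 3 * (nrm e + gn e)" for e
      using Hb(2)[OF \<omega>, of e] K'[of Hb e] K(2) Ha(1) Hb(1) by (simp only: S) linarith
    show "sqrt k * nrm (d5 N k n) \<le> K * k ^ 3"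
      using B[OF K(12)] by (simp only: S lsem_def simp_thms)
  qed
qed

text \<open>Subtracting the lifted scheme from the equations of the reference stages gives exactly
  the error system of \<open>step_stability\<close>, with no residual in stages 2 and 3 and with
  \<open>res4\<close> and \<open>res5\<close> in the other two equations.\<close>

lemma error_step:
  assumes C: "C1 > 0" "C2 > 0"
  obtains K \<theta> M where "K \<ge> 1" "\<theta> > 0" "M > 0"
    "\<And>N k n q. (N, k, n) \<in> family C1 C2 \<Longrightarrow> norm (rY N k n q - levels N k n q) \<le> K * k\<^sup>2"
    "\<And>N k n q. (N, k, n) \<in> family C1 C2 \<Longrightarrow> norm (rY N k (Suc n) q - levels N k (Suc n) q) \<le> K * k\<^sup>2"
    "\<And>N k n m m'. (N, k, n) \<in> family C1 C2 \<Longrightarrow> scheme_step \<alpha> (\<alpha> * \<epsilon>) f N k m m' \<Longrightarrow> k \<le> \<theta> \<Longrightarrow>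
      mesh N powr (-3/2) * (lattice.nrm (torus N) (mesh N) (\<lambda>q. rY N k n q - lift N m q) + k\<^sup>2 * sqrt k) \<le> \<theta> \<Longrightarrow>
      (lattice.nrm (torus N) (mesh N) (\<lambda>q. rY N k (Suc n) q - lift N m' q))\<^sup>2
        \<le> (1 + M * k) * (lattice.nrm (torus N) (mesh N) (\<lambda>q. rY N k n q - lift N m q))\<^sup>2 + M * k ^ 5"
proof -
  let ?\<beta> = "\<alpha> * \<epsilon>"
  have b: "?\<beta> > 0" using ae by simp
  obtain K where K: "K \<ge> 1"
    "\<And>N k n q. (N, k, n) \<in> family C1 C2 \<Longrightarrow> norm (rY N k n q - levels N k n q) \<le> K * k\<^sup>2"
    "\<And>N k n q. (N, k, n) \<in> family C1 C2 \<Longrightarrow> norm (rY N k (Suc n) q - levels N k (Suc n) q) \<le> K * k\<^sup>2"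
    "\<And>N k n q. (N, k, n) \<in> family C1 C2 \<Longrightarrow> norm (vl N f q) \<le> K"
    "\<And>N k n q. (N, k, n) \<in> family C1 C2 \<Longrightarrow> norm (r2 N k n q) \<le> K \<and> norm (r3 N k n q) \<le> K \<and> norm (r4 N k n q) \<le> K"
    "\<And>N k n d q. (N, k, n) \<in> family C1 C2 \<Longrightarrow> norm (lattice.Ac (tsh N) (tsb N) (mesh N) d (r2 N k n) q) \<le> K
      \<and> norm (lattice.Ac (tsh N) (tsb N) (mesh N) d (r3 N k n) q) \<le> K
      \<and> norm (lattice.Ac (tsh N) (tsb N) (mesh N) d (r4 N k n) q) \<le> K"
    "\<And>N k n e. (N, k, n) \<in> family C1 C2 \<Longrightarrow> \<bar>lattice.ip (torus N) (mesh N) (d4 N k n) e\<bar>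
      \<le> K * k ^ 3 * (lattice.nrm (torus N) (mesh N) e + lattice.gn (torus N) (tsh N) (mesh N) e)"
    "\<And>N k n e. (N, k, n) \<in> family C1 C2 \<Longrightarrow> \<bar>lattice.ip (torus N) (mesh N) (d5 N k n) e\<bar>
      \<le> K * k ^ 3 * (lattice.nrm (torus N) (mesh N) e + lattice.gn (torus N) (tsh N) (mesh N) e)"
    "\<And>N k n. (N, k, n) \<in> family C1 C2 \<Longrightarrow> sqrt k * lattice.nrm (torus N) (mesh N) (d5 N k n) \<le> K * k ^ 3"
    by (rule reference_bounds[OF C], rule that)
  show thesis
  proof (rule step_stability[where 'a = tpoint, OF ae(1) b K(1)], goal_cases)
    case (1 \<theta> M)
    note stab = 1(3)
    show thesis
    proof (rule that[OF K(1) 1(1,2) K(2,3)])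
    fix N n :: nat and k :: real and m m' :: gridfun
    assume w: "(N, k, n) \<in> family C1 C2" and st: "scheme_step \<alpha> ?\<beta> f N k m m'" and small: "k \<le> \<theta>"
      "mesh N powr (-3/2) * (lattice.nrm (torus N) (mesh N) (\<lambda>q. rY N k n q - lift N m q) + k\<^sup>2 * sqrt k) \<le> \<theta>"
    have N: "N \<ge> 1" and k: "k > 0" using w by (auto simp: family_def)
    have lat: "lattice (torus N) (tsh N) (tsb N) (mesh N) k \<alpha> ?\<beta>"
      by (rule torus_lattice) (use N ae b k in auto)
    interpret lattice "torus N" "tsh N" "tsb N" "mesh N" k \<alpha> ?\<beta> "vl N f" by (rule lat)
    obtain M2 M3 M4 where M:
      "\<And>q. M2 q = lift N m q + (1/4) *\<^sub>R Z M2 q"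
      "\<And>q. M3 q = lift N m q + (k/2) *\<^sub>R NL M2 q + (1/4) *\<^sub>R Z M3 q"
      "\<And>q. M4 q = lift N m q + (k/2) *\<^sub>R (NL M2 q + NL M3 q) + (1/3) *\<^sub>R Z (\<lambda>q. M2 q + M3 q + M4 q) q"
      "\<And>q. lift N m' q = M4 q + (k/3) *\<^sub>R NL M4 q - (k/6) *\<^sub>R (NL M2 q + NL M3 q)"
      by (rule numerical_lift[OF N k ae(1) b st], rule that)
    define u v x where "u = levels N k n" and "v = levels N k (Suc n)" and "x = levels N k (Suc (Suc n))"
    note uvx = u_def[symmetric] v_def[symmetric] x_def[symmetric]
    have a: "(1/4::real) \<ge> 0" by simp
    have r: "ref2 u v q = refY u v q + (1/4) *\<^sub>R Z (ref2 u v) q"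
      "ref3 u v q = refY u v q + (k/2) *\<^sub>R NL (ref2 u v) q + (1/4) *\<^sub>R Z (ref3 u v) q"
      "ref4 u v q = refY u v q + (k/2) *\<^sub>R (NL (ref2 u v) q + NL (ref3 u v) q)
        + (1/3) *\<^sub>R Z (\<lambda>q. ref2 u v q + ref3 u v q + ref4 u v q) q + res4 u v q"
      "refY v x q = ref4 u v q + (k/3) *\<^sub>R NL (ref4 u v) q
        - (k/6) *\<^sub>R (NL (ref2 u v) q + NL (ref3 u v) q) + res5 u v x q" for q
    proof -
      show "ref2 u v q = refY u v q + (1/4) *\<^sub>R Z (ref2 u v) q"
        unfolding ref2_def by (rule J_eq[OF a])
      show "ref3 u v q = refY u v q + (k/2) *\<^sub>R NL (ref2 u v) q + (1/4) *\<^sub>R Z (ref3 u v) q"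
        unfolding ref3_def by (rule J_eq[OF a])
    qed (simp_all add: res4_def res5_def)
    have d: "(\<lambda>q. w q - (w q - y q)) = y" for w y :: "tpoint \<Rightarrow> real^3" by simp
    have "(nrm (\<lambda>q. refY v x q - lift N m' q))\<^sup>2 \<le> (1 + M * k) * (nrm (\<lambda>q. refY u v q - lift N m q))\<^sup>2 + M * k ^ 5"
    proof (rule stab[where f = "vl N f" and ?w2.0 = "ref2 u v" and ?w3.0 = "ref3 u v" and ?w4.0 = "ref4 u v"
          and ?e2.0 = "\<lambda>q. ref2 u v q - M2 q" and ?e3.0 = "\<lambda>q. ref3 u v q - M3 q" and ?e4.0 = "\<lambda>q. ref4 u v q - M4 q"
          and r = "res4 u v" and d = "res5 u v x" and sh = "tsh N" and sb = "tsb N", OF lat small(1) small(2)[unfolded uvx]], unfold d)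
      note K' = K(4-)[OF w, unfolded uvx]
      show "norm (vl N f p) \<le> K" "norm (ref2 u v p) \<le> K" "norm (ref3 u v p) \<le> K" "norm (ref4 u v p) \<le> K" for p
        using K'(1,2) by blast+
      show "norm (Ac d (ref2 u v) p) \<le> K" "norm (Ac d (ref3 u v) p) \<le> K" "norm (Ac d (ref4 u v) p) \<le> K" for d p
        using K'(3) by blast+
      show "ref2 u v p - M2 p = refY u v p - lift N m p + (1/4) *\<^sub>R Z (\<lambda>q. ref2 u v q - M2 q) p" for p
        unfolding Z_diff by (subst r(1), subst M(1)) (simp add: scaleR_diff_right)
      show "ref3 u v p - M3 p = refY u v p - lift N m p + (k/2) *\<^sub>R (NL (ref2 u v) p - NL M2 p)
          + (1/4) *\<^sub>R Z (\<lambda>q. ref3 u v q - M3 q) p" for p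
        unfolding Z_diff by (subst r(2), subst M(2)) (simp add: scaleR_diff_right)
      show "ref4 u v p - M4 p = refY u v p - lift N m p
          + (k/2) *\<^sub>R ((NL (ref2 u v) p - NL M2 p) + (NL (ref3 u v) p - NL M3 p))
          + (1/3) *\<^sub>R Z (\<lambda>p. (ref2 u v p - M2 p) + (ref3 u v p - M3 p) + (ref4 u v p - M4 p)) p + res4 u v p" for p
        unfolding Z_add Z_diff by (subst r(3), subst M(3)) (simp add: Z_add scaleR_diff_right scaleR_add_right)
      show "refY v x p - lift N m' p = (ref4 u v p - M4 p) + (k/3) *\<^sub>R (NL (ref4 u v) p - NL M4 p)
          - (k/6) *\<^sub>R ((NL (ref2 u v) p - NL M2 p) + (NL (ref3 u v) p - NL M3 p)) + res5 u v x p" for p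
        unfolding r(4) M(4) by (simp add: scaleR_diff_right scaleR_add_right)
      show "\<bar>ip (res4 u v) y\<bar> \<le> K * k ^ 3 * (nrm y + gn y)" "\<bar>ip (res5 u v x) y\<bar> \<le> K * k ^ 3 * (nrm y + gn y)" for y
        by (rule K'(4), rule K'(5))
      show "sqrt k * nrm (res5 u v x) \<le> K * k ^ 3" by (rule K'(6))
    qed
    then show "(nrm (\<lambda>q. rY N k (Suc n) q - lift N m' q))\<^sup>2
        \<le> (1 + M * k) * (nrm (\<lambda>q. rY N k n q - lift N m q))\<^sup>2 + M * k ^ 5"
      unfolding uvx .
  qed
  qed
qed

end

lemma refinement_eventually:
  assumes "\<kappa> > 0"
  shows "\<forall>\<^sub>F (N, k) in refinement C1 C2. N \<ge> 1 \<and> 0 < k \<and> k \<le> \<kappa> \<and> C1 * mesh N \<le> k \<and> k \<le> C2 * mesh N"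
proof -
  have "\<forall>\<^sub>F k in at_right 0. k \<in> {0<..<\<kappa>}" by (rule eventually_at_right_real[OF assms])
  from eventually_prodI[OF eventually_ge_at_top[of "1::nat"] this]
  have "\<forall>\<^sub>F x :: nat \<times> real in at_top \<times>\<^sub>F at_right 0. 1 \<le> fst x \<and> snd x \<in> {0<..<\<kappa>}" .
  then show ?thesis
    unfolding refinement_def eventually_inf_principal by eventually_elim auto
qed

lemma lift_restrict:
  "N \<ge> 1 \<Longrightarrow> lift N (\<lambda>p. grid_restrict N v p - g p) = (\<lambda>q. vl N v q - lift N g q)"
proof
  fix q assume N: "N \<ge> 1"
  have "(\<chi> d. max 1 (min N (p $ d))) = p" if "p \<in> grid N" for p
    using that by (auto simp: vec_eq_iff grid_def)
  then show "lift N (\<lambda>p. grid_restrict N v p - g p) q = vl N v q - lift N g q"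
    by (simp add: lift_def vl_def[OF N] grid_restrict_def)
qed

section \<open>The global error estimate\<close>

context exact
begin

lemma error_bound:
  assumes C: "C1 > 0" "C2 > 0" and c: "c \<ge> 0"
  obtains \<kappa> C where "\<kappa> > 0" "C > 0"
    "\<And>N k m n. N \<ge> 1 \<Longrightarrow> 0 < k \<Longrightarrow> k \<le> \<kappa> \<Longrightarrow> C1 * mesh N \<le> k \<Longrightarrow> k \<le> C2 * mesh N \<Longrightarrow>
      \<forall>i. scheme_step \<alpha> (\<alpha> * \<epsilon>) f N k (m i) (m (Suc i)) \<Longrightarrow>
      grid_norm N (\<lambda>p. grid_restrict N (\<Phi> 0) p - m 0 p) \<le> c * (mesh N)\<^sup>2 \<Longrightarrow> n \<ge> 1 \<Longrightarrow> real n * k \<le> T \<Longrightarrow>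
      grid_norm N (\<lambda>p. grid_restrict N (\<Phi> (real n * k)) p - m n p) \<le> C * k\<^sup>2"
proof -
  obtain K \<theta> M where K: "K \<ge> 1" and th: "\<theta> > 0" "M > 0" and near:
    "\<And>N k n q. (N, k, n) \<in> family C1 C2 \<Longrightarrow> norm (rY N k n q - levels N k n q) \<le> K * k\<^sup>2"
    "\<And>N k n q. (N, k, n) \<in> family C1 C2 \<Longrightarrow> norm (rY N k (Suc n) q - levels N k (Suc n) q) \<le> K * k\<^sup>2"
    and step: "\<And>N k n m m'. (N, k, n) \<in> family C1 C2 \<Longrightarrow> scheme_step \<alpha> (\<alpha> * \<epsilon>) f N k m m' \<Longrightarrow> k \<le> \<theta> \<Longrightarrow>
      mesh N powr (-3/2) * (lattice.nrm (torus N) (mesh N) (\<lambda>q. rY N k n q - lift N m q) + k\<^sup>2 * sqrt k) \<le> \<theta> \<Longrightarrow>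
      (lattice.nrm (torus N) (mesh N) (\<lambda>q. rY N k (Suc n) q - lift N m' q))\<^sup>2
        \<le> (1 + M * k) * (lattice.nrm (torus N) (mesh N) (\<lambda>q. rY N k n q - lift N m q))\<^sup>2 + M * k ^ 5"
    by (rule error_step[OF C], rule that)
  \<comment> \<open>\<open>c0\<close> bounds the initial distance to the reference: 3 K for the
    modification, sqrt 8 for the eight sheets, (1/C1)^2 for converting h^2 into k^2.
    \<open>c1\<close> is the constant after Gronwall, and \<kappa> contains the threshold of
    \<open>small_data\<close> for it.\<close>
  define c0 where "c0 = 3 * K + sqrt 8 * c * (1 / C1)\<^sup>2"
  define c1 where "c1 = sqrt (exp (M * T) * (c0\<^sup>2 + M * T))"
  define \<kappa> where "\<kappa> = min 1 (min \<theta> ((\<theta> / (C2 powr (3/2) * (c1 + 1)))\<^sup>2))"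
  have c0: "c0 \<ge> 0" using K c by (simp add: c0_def)
  have c1: "c1 \<ge> 0" "c1\<^sup>2 = exp (M * T) * (c0\<^sup>2 + M * T)" using th T by (simp_all add: c1_def)
  have \<kappa>: "\<kappa> > 0" using th C c1 by (simp add: \<kappa>_def)
  show thesis
  proof (rule that[OF \<kappa>, of "3 * K + c1"])
    show "0 < 3 * K + c1" using K c1 by simp
    fix N n :: nat and k :: real and m
    assume N: "N \<ge> 1" and k: "0 < k" "k \<le> \<kappa>" and hk: "C1 * mesh N \<le> k" "k \<le> C2 * mesh N"
      and m: "\<forall>i. scheme_step \<alpha> (\<alpha> * \<epsilon>) f N k (m i) (m (Suc i))"
      and init: "grid_norm N (\<lambda>p. grid_restrict N (\<Phi> 0) p - m 0 p) \<le> c * (mesh N)\<^sup>2"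
      and n: "n \<ge> 1" "real n * k \<le> T"
    have b: "\<alpha> * \<epsilon> > 0" using ae by simp
    interpret lattice "torus N" "tsh N" "tsb N" "mesh N" k \<alpha> "\<alpha> * \<epsilon>" F for F
      by (rule torus_lattice) (use N ae b k in auto)
    note nl = nrm_lift[OF N k(1) ae(1) b]
    have k1: "k \<le> 1" "k \<le> \<theta>" "k \<le> (\<theta> / (C2 powr (3/2) * (c1 + 1)))\<^sup>2" using k by (auto simp: \<kappa>_def)
    have fam: "(N, k, i) \<in> family C1 C2" if "i < n" for i
    proof -
      have "real (Suc i) * k \<le> real n * k" using that k by (intro mult_right_mono) auto
      then have "real (Suc i) * k \<le> T" using n(2) by (rule order.trans)
      then show ?thesis using N k k1 hk by (simp add: family_def)
    qed
    define e where "e i = nrm (\<lambda>q. rY N k i q - lift N (m i) q)" for i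
    have e0: "e 0 \<le> c0 * k\<^sup>2"
    proof -
      have L: "levels N k 0 = vl N (\<Phi> 0)" using T by (simp add: levels_def)
      have "e 0 \<le> nrm (\<lambda>q. rY N k 0 q - levels N k 0 q) + nrm (\<lambda>q. levels N k 0 q - lift N (m 0) q)"
        using nrm_add[of "\<lambda>q. rY N k 0 q - levels N k 0 q" "\<lambda>q. levels N k 0 q - lift N (m 0) q"] by (simp add: e_def)
      also have "nrm (\<lambda>q. rY N k 0 q - levels N k 0 q) \<le> 3 * (K * k\<^sup>2)"
        using near(1)[OF fam, of 0] n K by (intro nrm_le) auto
      also have "nrm (\<lambda>q. levels N k 0 q - lift N (m 0) q) = sqrt 8 * grid_norm N (\<lambda>p. grid_restrict N (\<Phi> 0) p - m 0 p)"
        unfolding L nl[symmetric] lift_restrict[OF N] ..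
      also have "sqrt 8 * grid_norm N (\<lambda>p. grid_restrict N (\<Phi> 0) p - m 0 p) \<le> sqrt 8 * (c * ((1 / C1)\<^sup>2 * k\<^sup>2))"
      proof (intro mult_left_mono order.trans[OF init])
        have "mesh N \<le> 1 / C1 * k" using hk(1) C by (simp add: field_simps)
        then show "(mesh N)\<^sup>2 \<le> (1 / C1)\<^sup>2 * k\<^sup>2"
          unfolding power_mult_distrib[symmetric] using h_pos by (intro power_mono) auto
      qed (use c in auto)
      finally show ?thesis by (simp add: c0_def algebra_simps)
    qed
    \<comment> \<open>At most T/k steps add M k^5 each, so the squared error stays of order k^4,
      with amplification at most exp (M T).\<close>
    have grow: "(1 + M * k) ^ i * ((e 0)\<^sup>2 + real i * (M * k ^ 5)) \<le> (c1 * k\<^sup>2)\<^sup>2" if i: "i \<le> n" for i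
    proof -
      have ik: "real i * k \<le> T"
        by (rule order.trans[OF mult_right_mono n(2)]) (use i k in auto)
      have "(1 + M * k) ^ i \<le> exp (M * k) ^ i"
        using th k by (intro power_mono exp_ge_add_one_self) (auto intro: add_nonneg_nonneg)
      also have "\<dots> = exp (M * (real i * k))" unfolding exp_of_nat_mult[symmetric] by (simp add: mult_ac)
      also have "\<dots> \<le> exp (M * T)" using th ik by simp
      finally have 1: "(1 + M * k) ^ i \<le> exp (M * T)" .
      have "(e 0)\<^sup>2 \<le> (c0 * k\<^sup>2)\<^sup>2" using e0 by (intro power_mono) (simp_all add: e_def)
      moreover have "real i * (M * k ^ 5) = M * (real i * k) * k ^ 4" by (simp add: eval_nat_numeral)
      moreover have "M * (real i * k) * k ^ 4 \<le> M * T * k ^ 4" using th ik by (intro mult_right_mono mult_left_mono) auto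
      moreover have "(c0 * k\<^sup>2)\<^sup>2 = c0\<^sup>2 * k ^ 4" by (simp add: power_mult_distrib)
      ultimately have 2: "(e 0)\<^sup>2 + real i * (M * k ^ 5) \<le> (c0\<^sup>2 + M * T) * k ^ 4"
        unfolding distrib_right by linarith
      have "(1 + M * k) ^ i * ((e 0)\<^sup>2 + real i * (M * k ^ 5)) \<le> exp (M * T) * ((c0\<^sup>2 + M * T) * k ^ 4)"
        using 1 2 th k by (intro mult_mono) auto
      also have "\<dots> = (c1 * k\<^sup>2)\<^sup>2" unfolding power_mult_distrib c1(2) by simp
      finally show ?thesis .
    qed
    have small: "e i \<le> c1 * k\<^sup>2" if "i \<le> n" "(e i)\<^sup>2 \<le> (1 + M * k) ^ i * ((e 0)\<^sup>2 + real i * (M * k ^ 5))" for i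
      using order.trans[OF that(2) grow[OF that(1)]] c1 by (intro power2_le_imp_le[of "e i"]) auto
    have "(e n)\<^sup>2 \<le> (1 + M * k) ^ n * ((e 0)\<^sup>2 + real n * (M * k ^ 5))"
    proof (rule discrete_gronwall[where a = "\<lambda>i. (e i)\<^sup>2" and n = n])
      fix i assume i: "i < n" and ind: "(e i)\<^sup>2 \<le> (1 + M * k) ^ i * ((e 0)\<^sup>2 + real i * (M * k ^ 5))"
      have "mesh N powr (-3/2) * (e i + k\<^sup>2 * sqrt k) \<le> \<theta>"
        using small[OF _ ind] i by (intro small_data[OF h_pos k(1) k1(1) hk(2) C(2) c1(1) k1(3) th(1)]) simp
      then show "(e (Suc i))\<^sup>2 \<le> (1 + M * k) * (e i)\<^sup>2 + M * k ^ 5"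
        unfolding e_def by (intro step[OF fam[OF i] m[rule_format] k1(2)])
    qed (use th k in auto)
    then have en: "e n \<le> c1 * k\<^sup>2" by (intro small) auto
    \<comment> \<open>The reference at level n is compared with the solution through the step that
      ends at n: n may be the last level before T, so no step of the family need start
      there.\<close>
    obtain j where j: "n = Suc j" using n(1) by (cases n) auto
    have L: "levels N k n = vl N (\<Phi> (real n * k))" using n(2) by (simp add: levels_def)
    let ?g = "grid_norm N (\<lambda>p. grid_restrict N (\<Phi> (real n * k)) p - m n p)"
    have g: "?g \<ge> 0" by (simp add: grid_norm_def mesh_def sum_nonneg)
    have "1 \<le> sqrt (8::real)" by simp
    then have "?g \<le> sqrt 8 * ?g" using g mult_right_mono[of 1 "sqrt 8" ?g] by simp
    also have "\<dots> = nrm (\<lambda>q. levels N k n q - lift N (m n) q)"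
      unfolding L nl[symmetric] lift_restrict[OF N] ..
    also have "\<dots> \<le> e n + nrm (\<lambda>q. rY N k n q - levels N k n q)"
      using nrm_diff[of "\<lambda>q. rY N k n q - lift N (m n) q" "\<lambda>q. rY N k n q - levels N k n q"] by (simp add: e_def)
    also have "nrm (\<lambda>q. rY N k n q - levels N k n q) \<le> 3 * (K * k\<^sup>2)"
      using near(2)[OF fam, of j] K unfolding j by (intro nrm_le) auto
    finally show "?g \<le> (3 * K + c1) * k\<^sup>2" using en by (simp add: algebra_simps)
  qed
qed

end

theorem theorem5p1:
  fixes \<alpha> \<epsilon> \<beta> T C1 C2 :: real
    and f :: "real^3 \<Rightarrow> real^3"
    and \<Phi> :: "real \<Rightarrow> real^3 \<Rightarrow> real^3"
    and m :: "nat \<Rightarrow> real \<Rightarrow> nat \<Rightarrow> gridfun"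
  assumes "\<alpha> > 0" and "\<epsilon> > 0" and "\<beta> = \<alpha> * \<epsilon>" and "T > 0"
    and "bounded (f ` cube)"
    and "exact_solution \<alpha> \<epsilon> f T \<Phi>"
    and "Cq_time 3 0 T \<Phi>" and "Cq_time 2 2 T \<Phi>" and "Linf_time 4 T \<Phi>"
    and "C1 > 0" and "C2 > 0"
    and "\<And>N k. N \<ge> 1 \<Longrightarrow> k > 0 \<Longrightarrow> numerical_solution \<alpha> \<beta> f N k (m N k)"
    and "(\<lambda>(N, k). grid_norm N (\<lambda>p. grid_restrict N (\<Phi> 0) p - m N k 0 p)
                  + grid_grad_norm N (\<lambda>p. grid_restrict N (\<Phi> 0) p - m N k 0 p))
          \<in> O[refinement C1 C2](\<lambda>(N, k). (mesh N)\<^sup>2)"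
  shows "\<exists>C>0. \<forall>\<^sub>F (N, k) in refinement C1 C2.
           \<forall>n::nat. 1 \<le> n \<and> int n \<le> \<lfloor>T / k\<rfloor> \<longrightarrow>
             grid_norm N (\<lambda>p. grid_restrict N (\<Phi> (real n * k)) p - m N k n p)
               \<le> C * (k\<^sup>2 + (mesh N)\<^sup>2)"
proof -
  interpret exact \<alpha> \<epsilon> T f \<Phi> by (rule exact.intro) fact+
  obtain c where c: "c > 0" and init: "\<forall>\<^sub>F (N, k) in refinement C1 C2.
      grid_norm N (\<lambda>p. grid_restrict N (\<Phi> 0) p - m N k 0 p)
        + grid_grad_norm N (\<lambda>p. grid_restrict N (\<Phi> 0) p - m N k 0 p) \<le> c * (mesh N)\<^sup>2"
  proof -
    obtain c where c: "c > 0" "\<forall>\<^sub>F x in refinement C1 C2.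
        norm ((\<lambda>(N, k). grid_norm N (\<lambda>p. grid_restrict N (\<Phi> 0) p - m N k 0 p)
          + grid_grad_norm N (\<lambda>p. grid_restrict N (\<Phi> 0) p - m N k 0 p)) x)
        \<le> c * norm ((\<lambda>(N, k). (mesh N)\<^sup>2) x)"
      using landau_o.bigE[OF assms(13)] by blast
    show thesis
      by (rule that[OF c(1)], rule eventually_mono[OF c(2)]) auto
  qed
  obtain \<kappa> C where kC: "\<kappa> > 0" "C > 0" and bound:
    "\<And>N k m n. N \<ge> 1 \<Longrightarrow> 0 < k \<Longrightarrow> k \<le> \<kappa> \<Longrightarrow> C1 * mesh N \<le> k \<Longrightarrow> k \<le> C2 * mesh N \<Longrightarrow>
      \<forall>i. scheme_step \<alpha> (\<alpha> * \<epsilon>) f N k (m i) (m (Suc i)) \<Longrightarrow>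
      grid_norm N (\<lambda>p. grid_restrict N (\<Phi> 0) p - m 0 p) \<le> c * (mesh N)\<^sup>2 \<Longrightarrow> n \<ge> 1 \<Longrightarrow> real n * k \<le> T \<Longrightarrow>
      grid_norm N (\<lambda>p. grid_restrict N (\<Phi> (real n * k)) p - m n p) \<le> C * k\<^sup>2"
    by (rule error_bound[OF assms(10,11) less_imp_le[OF c]], rule that)
  have "\<forall>\<^sub>F x in refinement C1 C2. case x of (N, k) \<Rightarrow> \<forall>n::nat. 1 \<le> n \<and> int n \<le> \<lfloor>T / k\<rfloor> \<longrightarrow>
      grid_norm N (\<lambda>p. grid_restrict N (\<Phi> (real n * k)) p - m N k n p) \<le> C * (k\<^sup>2 + (mesh N)\<^sup>2)"
    using eventually_conj[OF init refinement_eventually[OF kC(1)]]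
  proof (rule eventually_mono)
    fix x :: "nat \<times> real"
    obtain N k where x: "x = (N, k)" by (cases x)
    assume "(case x of (N, k) \<Rightarrow> grid_norm N (\<lambda>p. grid_restrict N (\<Phi> 0) p - m N k 0 p)
        + grid_grad_norm N (\<lambda>p. grid_restrict N (\<Phi> 0) p - m N k 0 p) \<le> c * (mesh N)\<^sup>2) \<and>
      (case x of (N, k) \<Rightarrow> N \<ge> 1 \<and> 0 < k \<and> k \<le> \<kappa> \<and> C1 * mesh N \<le> k \<and> k \<le> C2 * mesh N)"
    then have i: "grid_norm N (\<lambda>p. grid_restrict N (\<Phi> 0) p - m N k 0 p)
        + grid_grad_norm N (\<lambda>p. grid_restrict N (\<Phi> 0) p - m N k 0 p) \<le> c * (mesh N)\<^sup>2"
      and Nk: "N \<ge> 1" "0 < k" "k \<le> \<kappa>" "C1 * mesh N \<le> k" "k \<le> C2 * mesh N" by (simp_all add: x)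
    have "grid_grad_norm N (\<lambda>p. grid_restrict N (\<Phi> 0) p - m N k 0 p) \<ge> 0"
      by (auto simp: grid_grad_norm_def mesh_def intro!: sum_nonneg mult_nonneg_nonneg)
    with i have i': "grid_norm N (\<lambda>p. grid_restrict N (\<Phi> 0) p - m N k 0 p) \<le> c * (mesh N)\<^sup>2" by linarith
    have st: "\<forall>i. scheme_step \<alpha> (\<alpha> * \<epsilon>) f N k (m N k i) (m N k (Suc i))"
      using assms(12)[OF Nk(1,2)] unfolding numerical_solution_def assms(3) by blast
    have "grid_norm N (\<lambda>p. grid_restrict N (\<Phi> (real n * k)) p - m N k n p) \<le> C * (k\<^sup>2 + (mesh N)\<^sup>2)"
      if n: "1 \<le> n" "int n \<le> \<lfloor>T / k\<rfloor>" for n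
    proof -
      have "real n \<le> T / k" using n(2) by (simp add: le_floor_iff)
      then have "real n * k \<le> T" using Nk(2) by (simp add: pos_le_divide_eq)
      from bound[of N k "m N k", OF Nk st i' n(1) this]
      have "grid_norm N (\<lambda>p. grid_restrict N (\<Phi> (real n * k)) p - m N k n p) \<le> C * k\<^sup>2" .
      also have "\<dots> \<le> C * (k\<^sup>2 + (mesh N)\<^sup>2)" using kC(2) by simp
      finally show ?thesis .
    qed
    then show "case x of (N, k) \<Rightarrow> \<forall>n::nat. 1 \<le> n \<and> int n \<le> \<lfloor>T / k\<rfloor> \<longrightarrow>
      grid_norm N (\<lambda>p. grid_restrict N (\<Phi> (real n * k)) p - m N k n p) \<le> C * (k\<^sup>2 + (mesh N)\<^sup>2)"
      by (simp add: x)
  qed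
  then show ?thesis using kC(2) by blast
qed

end
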